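(* Suppose a quiver algebra $A=kQ/I$ with center $Z$ admits an impression $(\tau,B)$, $\tau:A\to\operatorname{End}_B(B^{|Q_0|})$, where $B$ is an integral domain, $\tau(e_i)=E_{ii}$ and $\bar{\tau}(e_iAe_i)=\bar{\tau}(e_jAe_j)\subset B$ for each $i,j\in Q_0$. Let $V$ be a large $A$-module, and set $\mathfrak{p}:=\operatorname{ann}_AV$, $\mathfrak{m}:=\mathfrak{p}\cap Z\in\operatorname{Max}Z$. Then $$\operatorname{pd}_A(V)=\operatorname{pd}_{A_{\mathfrak{m}}}(V_{\mathfrak{m}})=\operatorname{pd}_A(A/\mathfrak{p})=\operatorname{pd}_{A_{\mathfrak{m}}}(A_{\mathfrak{m}}/\mathfrak{p}_{\mathfrak{m}})=\operatorname{pd}_{Z_{\mathfrak{m}}}(Z_{\mathfrak{m}}/\mathfrak{m}_{\mathfrak{m}}).$$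
   Context: $k$ is an algebraically closed field of characteristic zero; all algebras are unital and finitely generated over $k$; modules are left modules. A quiver algebra $kQ/I$ is a quotient of the path algebra of a finite quiver $Q$ by an ideal $I$; $e_i$ is the idempotent at vertex $i\in Q_0$. A pre-impression of an algebra $A$ is a pair $(\tau,B)$ where $B$ is a commutative finitely-generated $k$-algebra and $\tau:A\to\operatorname{End}_B(B^d)\cong M_d(B)$, $d<\infty$, is an algebra monomorphism for which there is an open dense subset $U\subseteq\operatorname{Max}B$ such that, for each $\mathfrak{q}\in U$, the composition with evaluation $A\to\operatorname{End}_B(B^d)\to\operatorname{End}_B((B/\mathfrak{q})^d)\cong\operatorname{End}_k(k^d)$ is a simple representation of $A$. It is an impression if moreover $\operatorname{Max}B\to\operatorname{Max}R$, $\mathfrak{q}\mapsto\mathfrak{q}\cap R$, is surjective, where $R:=\{f\in B\mid f1_d\in\operatorname{im}\tau\}$. $E_{ji}$ is the matrix unit. When $d=|Q_0|$ and $\tau(e_i)=E_{ii}$, each $a\in e_jAe_i$ satisfies $\tau(a)=\bar{\tau}(a)E_{ji}$ for a unique $\bar{\tau}(a)\in B$. A large $A$-module is a simple $A$-module of maximal $k$-dimension. $A_{\mathfrak{m}}:=Z_{\mathfrak{m}}\otimes_ZA$, $\mathfrak{p}_{\mathfrak{m}}$ and $\mathfrak{m}_{\mathfrak{m}}$ are the localizations of $\mathfrak{p}$ and $\mathfrak{m}$, and $V_{\mathfrak{m}}:=Z_{\mathfrak{m}}/\mathfrak{m}_{\mathfrak{m}}\otimes_kV$ is the localization of $V$ (isomorphic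 to $V$ as an $A$-module via $v\mapsto1\otimes v$). *)

theory Defs
  imports
    "HOL-Algebra.Algebra"
    "HOL-Analysis.Abstract_Topology"
    "HOL-Library.Extended_Nat"
    "Graph_Theory.Arc_Walk"
begin

no_notation dominates (\<open>_ \<rightarrow>\<index> _\<close> [100,100] 40)


section \<open>Left modules and projective dimension\<close>

text \<open>
  The library locale \<^locale>\<open>module\<close> requires a commutative ring of scalars. A left module over an
  arbitrary ring is described by the same record type; its fields \<^const>\<open>monoid.mult\<close> and \<^const>\<open>one\<close> are
  never looked at when the record is used as a module. The library locale \<^locale>\<open>submodule\<close> does not
  use commutativity.
\<close>

locale left_module = R?: ring R + M?: abelian_group M
  for R :: "('r, 's) ring_scheme" (structure) and M :: "('r, 'm) module" (structure) +
  assumes smult_closed [simp, intro]: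
      "\<lbrakk>a \<in> carrier R; x \<in> carrier M\<rbrakk> \<Longrightarrow> a \<odot>\<^bsub>M\<^esub> x \<in> carrier M"
    and smult_l_distr:
      "\<lbrakk>a \<in> carrier R; b \<in> carrier R; x \<in> carrier M\<rbrakk> \<Longrightarrow>
        (a \<oplus> b) \<odot>\<^bsub>M\<^esub> x = a \<odot>\<^bsub>M\<^esub> x \<oplus>\<^bsub>M\<^esub> b \<odot>\<^bsub>M\<^esub> x"
    and smult_r_distr:
      "\<lbrakk>a \<in> carrier R; x \<in> carrier M; y \<in> carrier M\<rbrakk> \<Longrightarrow>
        a \<odot>\<^bsub>M\<^esub> (x \<oplus>\<^bsub>M\<^esub> y) = a \<odot>\<^bsub>M\<^esub> x \<oplus>\<^bsub>M\<^esub> a \<odot>\<^bsub>M\<^esub> y"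
    and smult_assoc:
      "\<lbrakk>a \<in> carrier R; b \<in> carrier R; x \<in> carrier M\<rbrakk> \<Longrightarrow>
        (a \<otimes> b) \<odot>\<^bsub>M\<^esub> x = a \<odot>\<^bsub>M\<^esub> (b \<odot>\<^bsub>M\<^esub> x)"
    and smult_one [simp]: "x \<in> carrier M \<Longrightarrow> \<one> \<odot>\<^bsub>M\<^esub> x = x"

definition lmod_hom ::
    "('r, 's) ring_scheme \<Rightarrow> ('r, 'm) module \<Rightarrow> ('r, 'n) module \<Rightarrow> ('m \<Rightarrow> 'n) set" where
  "lmod_hom R M N = {f \<in> carrier M \<rightarrow> carrier N.
     (\<forall>x\<in>carrier M. \<forall>y\<in>carrier M. f (x \<oplus>\<^bsub>M\<^esub> y) = f x \<oplus>\<^bsub>N\<^esub> f y) \<and>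
     (\<forall>r\<in>carrier R. \<forall>x\<in>carrier M. f (r \<odot>\<^bsub>M\<^esub> x) = r \<odot>\<^bsub>N\<^esub> f x)}"

definition simple_module :: "('r, 's) ring_scheme \<Rightarrow> ('r, 'm) module \<Rightarrow> bool" where
  "simple_module R M \<longleftrightarrow> left_module R M \<and> carrier M \<noteq> {\<zero>\<^bsub>M\<^esub>} \<and>
     (\<forall>H. submodule H R M \<longrightarrow> H = {\<zero>\<^bsub>M\<^esub>} \<or> H = carrier M)"

definition annihilator :: "('r, 's) ring_scheme \<Rightarrow> ('r, 'm) module \<Rightarrow> 'r set" where
  "annihilator R M = {r \<in> carrier R. \<forall>x\<in>carrier M. r \<odot>\<^bsub>M\<^esub> x = \<zero>\<^bsub>M\<^esub>}"

text \<open>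
  Projectivity is the lifting property. A quantifier cannot range over types, so the lifting problems
  are posed for modules with carriers in two fixed types. These are large enough: the free module on
  the set \<open>carrier P\<close> lives in \<open>'p \<Rightarrow> 'r\<close>. The lemma \<open>projective_module_lift\<close> below shows that the
  lifting property then holds for modules of arbitrary types.
\<close>

definition projective_module :: "('r, 's) ring_scheme \<Rightarrow> ('r, 'p) module \<Rightarrow> bool" where
  "projective_module R P \<longleftrightarrow> left_module R P \<and>
     (\<forall>(N :: ('r, 'p \<Rightarrow> 'r) module) (N' :: ('r, 'p) module) g h.
        left_module R N \<and> left_module R N' \<and> g \<in> lmod_hom R N N' \<and> g ` carrier N = carrier N' \<and>
        h \<in> lmod_hom R P N' \<longrightarrow>
        (\<exists>l \<in> lmod_hom R P N. \<forall>x\<in>carrier P. g (l x) = h x))"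

definition free_module :: "('r, 's) ring_scheme \<Rightarrow> 'p set \<Rightarrow> ('r, 'p \<Rightarrow> 'r) module" where
  "free_module R C =
    \<lparr>carrier = {f. (\<forall>x. f x \<in> carrier R) \<and> (\<forall>x. x \<notin> C \<longrightarrow> f x = \<zero>\<^bsub>R\<^esub>) \<and> finite {x. f x \<noteq> \<zero>\<^bsub>R\<^esub>}},
     monoid.mult = undefined, one = undefined,
     ring.zero = (\<lambda>_. \<zero>\<^bsub>R\<^esub>),
     add = (\<lambda>f g x. f x \<oplus>\<^bsub>R\<^esub> g x),
     smult = (\<lambda>r f x. r \<otimes>\<^bsub>R\<^esub> f x)\<rparr>"

lemma left_module_free_module:
  fixes R :: "('r, 's) ring_scheme" and C :: "'p set"
  assumes "ring R"
  shows "left_module R (free_module R C)"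
proof -
  interpret R: ring R by fact
  have fin_add: "finite {x. f x \<oplus>\<^bsub>R\<^esub> g x \<noteq> \<zero>\<^bsub>R\<^esub>}"
    if "finite {x. f x \<noteq> \<zero>\<^bsub>R\<^esub>}" "finite {x. g x \<noteq> \<zero>\<^bsub>R\<^esub>}" for f g :: "'p \<Rightarrow> 'r"
    by (rule finite_subset[OF _ finite_UnI[OF that]]) auto
  have fin_smult: "finite {x. r \<otimes>\<^bsub>R\<^esub> f x \<noteq> \<zero>\<^bsub>R\<^esub>}"
    if "finite {x. f x \<noteq> \<zero>\<^bsub>R\<^esub>}" "r \<in> carrier R" for f :: "'p \<Rightarrow> 'r" and r
    by (rule finite_subset[OF _ that(1)]) (use that(2) in auto)
  have fin_neg: "finite {x. \<ominus>\<^bsub>R\<^esub> f x \<noteq> \<zero>\<^bsub>R\<^esub>}"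
    if "finite {x. f x \<noteq> \<zero>\<^bsub>R\<^esub>}" for f :: "'p \<Rightarrow> 'r"
    by (rule finite_subset[OF _ that]) auto
  show ?thesis
  proof (intro left_module.intro left_module_axioms.intro abelian_groupI \<open>ring R\<close>)
    fix f assume "f \<in> carrier (free_module R C)"
    then show "\<exists>g\<in>carrier (free_module R C). g \<oplus>\<^bsub>free_module R C\<^esub> f = \<zero>\<^bsub>free_module R C\<^esub>"
      by (intro bexI[of _ "\<lambda>x. \<ominus>\<^bsub>R\<^esub> f x"]) (auto simp: free_module_def R.l_neg fin_neg)
  qed (auto simp: free_module_def fin_add fin_smult R.a_ac R.m_assoc R.l_distr R.r_distr)
qed

definition free_extend ::
    "('r, 's) ring_scheme \<Rightarrow> ('r, 'n) module \<Rightarrow> ('p \<Rightarrow> 'n) \<Rightarrow> ('p \<Rightarrow> 'r) \<Rightarrow> 'n" where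
  "free_extend R N n f = (\<Oplus>\<^bsub>N\<^esub>x\<in>{x. f x \<noteq> \<zero>\<^bsub>R\<^esub>}. f x \<odot>\<^bsub>N\<^esub> n x)"

lemma (in left_module) smult_zeros:
  "x \<in> carrier M \<Longrightarrow> \<zero> \<odot>\<^bsub>M\<^esub> x = \<zero>\<^bsub>M\<^esub>" "a \<in> carrier R \<Longrightarrow> a \<odot>\<^bsub>M\<^esub> \<zero>\<^bsub>M\<^esub> = \<zero>\<^bsub>M\<^esub>"
proof -
  show "\<zero> \<odot>\<^bsub>M\<^esub> x = \<zero>\<^bsub>M\<^esub>" if "x \<in> carrier M"
    using that smult_l_distr[of \<zero> \<zero> x] by (metis M.add.r_cancel_one' R.l_zero R.zero_closed smult_closed)
  show "a \<odot>\<^bsub>M\<^esub> \<zero>\<^bsub>M\<^esub> = \<zero>\<^bsub>M\<^esub>" if "a \<in> carrier R"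
    using that smult_r_distr[of a "\<zero>\<^bsub>M\<^esub>" "\<zero>\<^bsub>M\<^esub>"]
    by (metis M.add.r_cancel_one' M.l_zero M.zero_closed smult_closed)
qed

lemma (in left_module) smult_finsum:
  "\<lbrakk>finite S; a \<in> carrier R; f \<in> S \<rightarrow> carrier M\<rbrakk> \<Longrightarrow>
    a \<odot>\<^bsub>M\<^esub> (\<Oplus>\<^bsub>M\<^esub>i\<in>S. f i) = (\<Oplus>\<^bsub>M\<^esub>i\<in>S. a \<odot>\<^bsub>M\<^esub> f i)"
  by (induct rule: finite_induct) (auto simp: Pi_def smult_zeros smult_r_distr)

lemma lmod_hom_finsum:
  assumes "left_module R M" "left_module R N" "h \<in> lmod_hom R M N"
    and "finite S" "f \<in> S \<rightarrow> carrier M"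
  shows "h (\<Oplus>\<^bsub>M\<^esub>i\<in>S. f i) = (\<Oplus>\<^bsub>N\<^esub>i\<in>S. h (f i))"
proof -
  interpret M: left_module R M by fact
  interpret N: left_module R N by fact
  have h: "h x \<in> carrier N" if "x \<in> carrier M" for x
    using assms(3) that by (auto simp: lmod_hom_def)
  have "h (x \<oplus>\<^bsub>M\<^esub> y) = h x \<oplus>\<^bsub>N\<^esub> h y" if "x \<in> carrier M" "y \<in> carrier M" for x y
    using assms(3) that by (simp add: lmod_hom_def)
  from this[OF M.M.zero_closed M.M.zero_closed]
  have "h \<zero>\<^bsub>M\<^esub> \<oplus>\<^bsub>N\<^esub> h \<zero>\<^bsub>M\<^esub> = h \<zero>\<^bsub>M\<^esub>" by simp
  then have h0: "h \<zero>\<^bsub>M\<^esub> = \<zero>\<^bsub>N\<^esub>"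
    using h[of "\<zero>\<^bsub>M\<^esub>"] by simp
  show ?thesis
    using assms(4,5)
  proof (induct rule: finite_induct)
    case (insert x F)
    then have "h (f x \<oplus>\<^bsub>M\<^esub> (\<Oplus>\<^bsub>M\<^esub>i\<in>F. f i)) = h (f x) \<oplus>\<^bsub>N\<^esub> h (\<Oplus>\<^bsub>M\<^esub>i\<in>F. f i)"
      using assms(3) M.M.finsum_closed[of f F] unfolding lmod_hom_def by auto
    with insert show ?case
      by (simp add: Pi_def h)
  qed (simp add: h0)
qed

lemma free_extend_superset:
  assumes "left_module R N" "n \<in> C \<rightarrow> carrier N" "f \<in> carrier (free_module R C)"
    and "finite S" "S \<subseteq> C" "{x. f x \<noteq> \<zero>\<^bsub>R\<^esub>} \<subseteq> S"
  shows "free_extend R N n f = (\<Oplus>\<^bsub>N\<^esub>x\<in>S. f x \<odot>\<^bsub>N\<^esub> n x)"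
proof -
  interpret N: left_module R N by fact
  show ?thesis
    unfolding free_extend_def
    by (rule N.M.add.finprod_mono_neutral_cong_left)
      (use assms in \<open>auto simp: free_module_def N.smult_zeros Pi_def subset_iff\<close>)
qed

lemma free_extend_hom:
  assumes "left_module R N" "n \<in> C \<rightarrow> carrier N"
  shows "free_extend R N n \<in> lmod_hom R (free_module R C) N"
proof -
  interpret N: left_module R N by fact
  interpret F: left_module R "free_module R C"
    by (rule left_module_free_module) (rule N.R.ring_axioms)
  have supp: "{x. f x \<noteq> \<zero>\<^bsub>R\<^esub>} \<subseteq> C" "finite {x. f x \<noteq> \<zero>\<^bsub>R\<^esub>}" "\<And>x. f x \<in> carrier R"
    if "f \<in> carrier (free_module R C)" for f
    using that by (auto simp: free_module_def)
  note ext = free_extend_superset[OF assms]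
  have cl: "(\<lambda>x. f x \<odot>\<^bsub>N\<^esub> n x) \<in> S \<rightarrow> carrier N"
    if "f \<in> carrier (free_module R C)" "S \<subseteq> C" for f S
    using that supp(3)[OF that(1)] assms(2) by blast
  show ?thesis
    unfolding lmod_hom_def
  proof (intro CollectI conjI ballI)
    show "free_extend R N n \<in> carrier (free_module R C) \<rightarrow> carrier N"
    proof
      fix f assume f: "f \<in> carrier (free_module R C)"
      show "free_extend R N n f \<in> carrier N"
        unfolding free_extend_def by (rule N.M.finsum_closed[OF cl[OF f supp(1)[OF f]]])
    qed
  next
    fix f g assume f: "f \<in> carrier (free_module R C)" and g: "g \<in> carrier (free_module R C)"
    let ?S = "{x. f x \<noteq> \<zero>\<^bsub>R\<^esub>} \<union> {x. g x \<noteq> \<zero>\<^bsub>R\<^esub>}"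
    have S: "finite ?S" "?S \<subseteq> C"
      using supp[OF f] supp[OF g] by auto
    have fg: "f \<oplus>\<^bsub>free_module R C\<^esub> g \<in> carrier (free_module R C)"
      using f g by simp
    have fg': "(f \<oplus>\<^bsub>free_module R C\<^esub> g) x = f x \<oplus>\<^bsub>R\<^esub> g x" for x
      by (simp add: free_module_def)
    have "free_extend R N n (f \<oplus>\<^bsub>free_module R C\<^esub> g) =
        (\<Oplus>\<^bsub>N\<^esub>x\<in>?S. (f \<oplus>\<^bsub>free_module R C\<^esub> g) x \<odot>\<^bsub>N\<^esub> n x)"
      by (rule ext[OF fg S]) (auto simp: fg')
    also have "\<dots> = (\<Oplus>\<^bsub>N\<^esub>x\<in>?S. f x \<odot>\<^bsub>N\<^esub> n x \<oplus>\<^bsub>N\<^esub> g x \<odot>\<^bsub>N\<^esub> n x)"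
    proof (rule N.M.finsum_cong'[OF HOL.refl])
      show "(\<lambda>x. f x \<odot>\<^bsub>N\<^esub> n x \<oplus>\<^bsub>N\<^esub> g x \<odot>\<^bsub>N\<^esub> n x) \<in> ?S \<rightarrow> carrier N"
        using cl[OF f S(2)] cl[OF g S(2)] by (auto simp: Pi_def)
      fix x assume "x \<in> ?S"
      then have "n x \<in> carrier N" using S(2) assms(2) by blast
      then show "(f \<oplus>\<^bsub>free_module R C\<^esub> g) x \<odot>\<^bsub>N\<^esub> n x = f x \<odot>\<^bsub>N\<^esub> n x \<oplus>\<^bsub>N\<^esub> g x \<odot>\<^bsub>N\<^esub> n x"
        by (simp add: fg' N.smult_l_distr supp(3)[OF f] supp(3)[OF g])
    qed
    also have "\<dots> = (\<Oplus>\<^bsub>N\<^esub>x\<in>?S. f x \<odot>\<^bsub>N\<^esub> n x) \<oplus>\<^bsub>N\<^esub> (\<Oplus>\<^bsub>N\<^esub>x\<in>?S. g x \<odot>\<^bsub>N\<^esub> n x)"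
      by (rule N.M.finsum_addf[OF cl[OF f S(2)] cl[OF g S(2)]])
    also have "\<dots> = free_extend R N n f \<oplus>\<^bsub>N\<^esub> free_extend R N n g"
      using ext[OF f S] ext[OF g S] by auto
    finally show "free_extend R N n (f \<oplus>\<^bsub>free_module R C\<^esub> g) =
        free_extend R N n f \<oplus>\<^bsub>N\<^esub> free_extend R N n g" .
  next
    fix r f assume r: "r \<in> carrier R" and f: "f \<in> carrier (free_module R C)"
    let ?S = "{x. f x \<noteq> \<zero>\<^bsub>R\<^esub>}"
    have rf: "r \<odot>\<^bsub>free_module R C\<^esub> f \<in> carrier (free_module R C)"
      using r f by simp
    have rf': "(r \<odot>\<^bsub>free_module R C\<^esub> f) x = r \<otimes>\<^bsub>R\<^esub> f x" for x
      by (simp add: free_module_def)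
    have "free_extend R N n (r \<odot>\<^bsub>free_module R C\<^esub> f) =
        (\<Oplus>\<^bsub>N\<^esub>x\<in>?S. (r \<odot>\<^bsub>free_module R C\<^esub> f) x \<odot>\<^bsub>N\<^esub> n x)"
      by (rule ext[OF rf supp(2,1)[OF f]]) (use r in \<open>auto simp: rf'\<close>)
    also have "\<dots> = (\<Oplus>\<^bsub>N\<^esub>x\<in>?S. r \<odot>\<^bsub>N\<^esub> (f x \<odot>\<^bsub>N\<^esub> n x))"
    proof (rule N.M.finsum_cong'[OF HOL.refl])
      show "(\<lambda>x. r \<odot>\<^bsub>N\<^esub> (f x \<odot>\<^bsub>N\<^esub> n x)) \<in> ?S \<rightarrow> carrier N"
        using cl[OF f supp(1)[OF f]] r by (auto simp: Pi_def)
      fix x assume "x \<in> ?S"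
      then have "n x \<in> carrier N" using supp(1)[OF f] assms(2) by blast
      then show "(r \<odot>\<^bsub>free_module R C\<^esub> f) x \<odot>\<^bsub>N\<^esub> n x = r \<odot>\<^bsub>N\<^esub> (f x \<odot>\<^bsub>N\<^esub> n x)"
        by (simp add: rf' N.smult_assoc supp(3)[OF f] r)
    qed
    also have "\<dots> = r \<odot>\<^bsub>N\<^esub> free_extend R N n f"
      unfolding free_extend_def
      by (rule N.smult_finsum[OF supp(2)[OF f] r cl[OF f supp(1)[OF f]], symmetric])
    finally show "free_extend R N n (r \<odot>\<^bsub>free_module R C\<^esub> f) = r \<odot>\<^bsub>N\<^esub> free_extend R N n f" .
  qed
qed

lemma projective_module_lift:
  fixes N :: "('r, 'n) module" and N' :: "('r, 'm) module" and P :: "('r, 'p) module"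
  assumes P: "projective_module R P" and N: "left_module R N" and N': "left_module R N'"
    and g: "g \<in> lmod_hom R N N'" "g ` carrier N = carrier N'" and h: "h \<in> lmod_hom R P N'"
  shows "\<exists>l\<in>lmod_hom R P N. \<forall>x\<in>carrier P. g (l x) = h x"
proof -
  have lP: "left_module R P" using P by (simp add: projective_module_def)
  interpret P: left_module R P by (rule lP)
  interpret N: left_module R N by fact
  interpret N': left_module R N' by fact
  let ?F = "free_module R (carrier P)"
  let ?\<pi> = "free_extend R P (\<lambda>x. x)"
  have F: "left_module R ?F" by (rule left_module_free_module) (rule P.R.ring_axioms)
  have \<pi>: "?\<pi> \<in> lmod_hom R ?F P" by (rule free_extend_hom[OF lP]) simp
  have "x \<in> ?\<pi> ` carrier ?F" if x: "x \<in> carrier P" for x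
  proof -
    let ?f = "\<lambda>y. if y = x then \<one>\<^bsub>R\<^esub> else \<zero>\<^bsub>R\<^esub>"
    have f: "?f \<in> carrier ?F" using x by (auto simp: free_module_def)
    have "?\<pi> ?f = (\<Oplus>\<^bsub>P\<^esub>y\<in>{x}. ?f y \<odot>\<^bsub>P\<^esub> y)"
      by (rule free_extend_superset[OF lP _ f]) (use x in auto)
    also have "\<dots> = x" using x by simp
    finally show ?thesis using f by (metis image_eqI)
  qed
  then have \<pi>_onto: "?\<pi> ` carrier ?F = carrier P"
    using \<pi> unfolding lmod_hom_def by blast
  have "(\<lambda>x. x) \<in> lmod_hom R P P" by (simp add: lmod_hom_def)
  then obtain s where s: "s \<in> lmod_hom R P ?F" "\<And>x. x \<in> carrier P \<Longrightarrow> ?\<pi> (s x) = x"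
    using P F lP \<pi> \<pi>_onto unfolding projective_module_def by blast
  define n where "n x = (SOME y. y \<in> carrier N \<and> g y = h x)" for x
  have n: "n x \<in> carrier N \<and> g (n x) = h x" if "x \<in> carrier P" for x
  proof -
    have "h x \<in> g ` carrier N" using h that g(2) by (auto simp: lmod_hom_def)
    then have "\<exists>y. y \<in> carrier N \<and> g y = h x" by (metis image_iff)
    then show ?thesis unfolding n_def by (rule someI_ex)
  qed
  then have n': "n \<in> carrier P \<rightarrow> carrier N" by blast
  let ?\<phi> = "free_extend R N n"
  have \<phi>: "?\<phi> \<in> lmod_hom R ?F N" by (rule free_extend_hom[OF N n'])
  have comm: "g (?\<phi> f) = h (?\<pi> f)" if f: "f \<in> carrier ?F" for f
  proof -
    let ?S = "{x. f x \<noteq> \<zero>\<^bsub>R\<^esub>}"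
    have S: "finite ?S" "?S \<subseteq> carrier P" "\<And>x. f x \<in> carrier R"
      using f by (auto simp: free_module_def)
    have "g (?\<phi> f) = (\<Oplus>\<^bsub>N'\<^esub>x\<in>?S. g (f x \<odot>\<^bsub>N\<^esub> n x))"
      unfolding free_extend_def
      by (rule lmod_hom_finsum[OF N N' g(1) S(1)]) (use S n in auto)
    also have "\<dots> = (\<Oplus>\<^bsub>N'\<^esub>x\<in>?S. h (f x \<odot>\<^bsub>P\<^esub> x))"
    proof (rule N'.M.finsum_cong'[OF HOL.refl])
      show "(\<lambda>x. h (f x \<odot>\<^bsub>P\<^esub> x)) \<in> ?S \<rightarrow> carrier N'"
        using S h by (auto simp: lmod_hom_def Pi_def)
      fix x assume "x \<in> ?S"
      then have x: "x \<in> carrier P" using S by blast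
      then show "g (f x \<odot>\<^bsub>N\<^esub> n x) = h (f x \<odot>\<^bsub>P\<^esub> x)"
        using S(3) g(1) h n[OF x] by (simp add: lmod_hom_def)
    qed
    also have "\<dots> = h (?\<pi> f)"
      unfolding free_extend_def
      by (rule lmod_hom_finsum[OF lP N' h S(1), symmetric]) (use S in auto)
    finally show ?thesis .
  qed
  show ?thesis
  proof (intro bexI ballI)
    show "g ((?\<phi> \<circ> s) x) = h x" if "x \<in> carrier P" for x
      using comm[of "s x"] s that by (auto simp: lmod_hom_def)
    show "?\<phi> \<circ> s \<in> lmod_hom R P N"
      using s(1) \<phi> by (auto simp: lmod_hom_def Pi_def)
  qed
qed

definition lmod_ker :: "('r, 'm) module \<Rightarrow> ('r, 'n) module \<Rightarrow> ('m \<Rightarrow> 'n) \<Rightarrow> 'm set" where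
  "lmod_ker M N f = {x \<in> carrier M. f x = \<zero>\<^bsub>N\<^esub>}"

text \<open>
  An exact sequence \<open>\<dots> \<rightarrow> P 1 \<rightarrow> P 0 \<rightarrow> M \<rightarrow> 0\<close> with all \<open>P i\<close> projective and \<open>P i = 0\<close> for \<open>i > n\<close>;
  \<open>d i\<close> is the map \<open>P (Suc i) \<rightarrow> P i\<close> and \<open>\<epsilon>\<close> is the augmentation.
\<close>

definition projective_resolution ::
    "('r, 's) ring_scheme \<Rightarrow> ('r, 'm) module \<Rightarrow> nat \<Rightarrow>
      (nat \<Rightarrow> ('r, 'u) module) \<Rightarrow> (nat \<Rightarrow> 'u \<Rightarrow> 'u) \<Rightarrow> ('u \<Rightarrow> 'm) \<Rightarrow> bool" where
  "projective_resolution R M n P d \<epsilon> \<longleftrightarrow>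
     (\<forall>i. projective_module R (P i)) \<and>
     (\<forall>i. d i \<in> lmod_hom R (P (Suc i)) (P i)) \<and>
     \<epsilon> \<in> lmod_hom R (P 0) M \<and>
     \<epsilon> ` carrier (P 0) = carrier M \<and>
     lmod_ker (P 0) M \<epsilon> = d 0 ` carrier (P (Suc 0)) \<and>
     (\<forall>i. lmod_ker (P (Suc i)) (P i) (d i) = d (Suc i) ` carrier (P (Suc (Suc i)))) \<and>
     (\<forall>i>n. carrier (P i) = {\<zero>\<^bsub>P i\<^esub>})"

text \<open>
  The modules of a resolution are taken with carriers in the type \<open>('r + 'm + nat) list\<close>. This loses
  nothing: its cardinality is an infinite upper bound of those of \<open>R\<close> and \<open>M\<close>, so there is a free
  resolution of \<open>M\<close>, with all its syzygies, in this type. If \<open>M\<close> has a projective resolution of length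
  \<open>n\<close> by modules of any kind, then the \<open>n\<close>-th syzygy of that free resolution is projective by
  Schanuel's lemma, and truncating there gives a resolution of length \<open>n\<close> in this type.
  The infimum of the empty set is \<open>\<infinity>\<close>.
\<close>

definition pd :: "('r, 's) ring_scheme \<Rightarrow> ('r, 'm) module \<Rightarrow> enat" where
  "pd R M = Inf {enat n | n. \<exists>(P :: nat \<Rightarrow> ('r, ('r + 'm + nat) list) module) d \<epsilon>.
     projective_resolution R M n P d \<epsilon>}"


section \<open>Scalars along a ring homomorphism, quotients\<close>

definition restrict_scalars :: "('r \<Rightarrow> 's) \<Rightarrow> ('s, 'm) module \<Rightarrow> ('r, 'm) module" where
  "restrict_scalars \<phi> M = \<lparr>carrier = carrier M, monoid.mult = monoid.mult M, one = one M, ring.zero = ring.zero M,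
     add = add M, smult = (\<lambda>r x. \<phi> r \<odot>\<^bsub>M\<^esub> x)\<rparr>"

definition ring_as_module :: "('r \<Rightarrow> 'a) \<Rightarrow> ('a, 's) ring_scheme \<Rightarrow> ('r, 'a) module" where
  "ring_as_module \<phi> C = \<lparr>carrier = carrier C, monoid.mult = monoid.mult C, one = one C, ring.zero = ring.zero C,
     add = add C, smult = (\<lambda>r x. \<phi> r \<otimes>\<^bsub>C\<^esub> x)\<rparr>"

text \<open>For a two-sided ideal \<open>J\<close>: \<open>R/J\<close> as a left \<open>R\<close>-module.\<close>

definition quot_module :: "('a, 's) ring_scheme \<Rightarrow> 'a set \<Rightarrow> ('a, 'a set) module" where
  "quot_module R J = ring_as_module (\<lambda>r. J +>\<^bsub>R\<^esub> r) (R Quot J)"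

text \<open>For a two-sided ideal \<open>J\<close> of a \<open>k\<close>-algebra \<open>C\<close>: \<open>C/J\<close> as a \<open>k\<close>-algebra.\<close>

definition quot_algebra :: "('k, 'a) module \<Rightarrow> 'a set \<Rightarrow> ('k, 'a set) module" where
  "quot_algebra C J = ring_as_module (\<lambda>c. J +>\<^bsub>C\<^esub> (c \<odot>\<^bsub>C\<^esub> \<one>\<^bsub>C\<^esub>)) (C Quot J)"

definition algebra_hom ::
    "('k, 's) ring_scheme \<Rightarrow> ('k, 'a) module \<Rightarrow> ('k, 'c) module \<Rightarrow> ('a \<Rightarrow> 'c) set" where
  "algebra_hom k A C = {f \<in> ring_hom A C.
     \<forall>c\<in>carrier k. \<forall>a\<in>carrier A. f (c \<odot>\<^bsub>A\<^esub> a) = c \<odot>\<^bsub>C\<^esub> f a}"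

definition fin_gen_algebra :: "('k, 's) ring_scheme \<Rightarrow> ('k, 'a) module \<Rightarrow> bool" where
  "fin_gen_algebra k C \<longleftrightarrow> (\<exists>S. finite S \<and> S \<subseteq> carrier C \<and>
     generate_ring C (S \<union> (\<lambda>c. c \<odot>\<^bsub>C\<^esub> \<one>\<^bsub>C\<^esub>) ` carrier k) = carrier C)"

definition center_algebra :: "('k, 'a) module \<Rightarrow> ('k, 'a) module" where
  "center_algebra A = A\<lparr>carrier := {z \<in> carrier A. \<forall>a\<in>carrier A. z \<otimes>\<^bsub>A\<^esub> a = a \<otimes>\<^bsub>A\<^esub> z}\<rparr>"


section \<open>Quiver algebras\<close>

text \<open>
  A quiver is a finite directed multigraph (\<^locale>\<open>fin_digraph\<close>). A path is a pair of its starting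
  vertex and its list of arrows in the order in which they are traversed, so that \<open>(i, [])\<close> is the
  path of length zero at \<open>i\<close>.
\<close>

definition quiver_paths :: "('v, 'e) pre_digraph \<Rightarrow> ('v \<times> 'e list) set" where
  "quiver_paths Q = {(u, p). \<exists>v. pre_digraph.awalk Q u p v}"

text \<open>
  Elements of \<open>kQ\<close> are finitely supported functions on paths. Paths are composed from right to left:
  a product \<open>b a\<close> of paths is non-zero only if \<open>b\<close> starts where \<open>a\<close> ends, and it is then the path
  that first traverses \<open>a\<close>. So \<open>e\<^sub>j A e\<^sub>i\<close> is spanned by the paths from \<open>i\<close> to \<open>j\<close>.
\<close>

definition path_algebra ::
    "('k, 's) ring_scheme \<Rightarrow> ('v, 'e) pre_digraph \<Rightarrow> ('k, 'v \<times> 'e list \<Rightarrow> 'k) module" where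
  "path_algebra k Q =
    \<lparr>carrier = {f. (\<forall>x. f x \<in> carrier k) \<and> (\<forall>x. x \<notin> quiver_paths Q \<longrightarrow> f x = \<zero>\<^bsub>k\<^esub>) \<and>
                   finite {x. f x \<noteq> \<zero>\<^bsub>k\<^esub>}},
     monoid.mult = (\<lambda>f g (u, p). \<Oplus>\<^bsub>k\<^esub>i\<in>{..length p}.
               f (last (pre_digraph.awalk_verts Q u (take i p)), drop i p) \<otimes>\<^bsub>k\<^esub> g (u, take i p)),
     one = (\<lambda>(u, p). if u \<in> verts Q \<and> p = [] then \<one>\<^bsub>k\<^esub> else \<zero>\<^bsub>k\<^esub>),
     ring.zero = (\<lambda>_. \<zero>\<^bsub>k\<^esub>),
     add = (\<lambda>f g x. f x \<oplus>\<^bsub>k\<^esub> g x),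
     smult = (\<lambda>c f x. c \<otimes>\<^bsub>k\<^esub> f x)\<rparr>"

definition path_elem :: "('k, 's) ring_scheme \<Rightarrow> 'v \<times> 'e list \<Rightarrow> ('v \<times> 'e list \<Rightarrow> 'k)" where
  "path_elem k x = (\<lambda>y. if y = x then \<one>\<^bsub>k\<^esub> else \<zero>\<^bsub>k\<^esub>)"

definition quiver_algebra ::
    "('k, 's) ring_scheme \<Rightarrow> ('v, 'e) pre_digraph \<Rightarrow> ('v \<times> 'e list \<Rightarrow> 'k) set \<Rightarrow>
      ('k, ('v \<times> 'e list \<Rightarrow> 'k) set) module" where
  "quiver_algebra k Q I = quot_algebra (path_algebra k Q) I"

definition vertex_idem ::
    "('k, 's) ring_scheme \<Rightarrow> ('v, 'e) pre_digraph \<Rightarrow> ('v \<times> 'e list \<Rightarrow> 'k) set \<Rightarrow> 'v \<Rightarrow>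
      ('v \<times> 'e list \<Rightarrow> 'k) set" where
  "vertex_idem k Q I i = I +>\<^bsub>path_algebra k Q\<^esub> path_elem k (i, [])"

text \<open>\<open>e A f\<close> for elements \<open>e\<close>, \<open>f\<close> of \<open>A\<close>.\<close>

definition corner :: "('a, 's) ring_scheme \<Rightarrow> 'a \<Rightarrow> 'a \<Rightarrow> 'a set" where
  "corner A e f = {e \<otimes>\<^bsub>A\<^esub> a \<otimes>\<^bsub>A\<^esub> f | a. a \<in> carrier A}"


section \<open>Matrices, maximal spectra and impressions\<close>

text \<open>
  \<open>End\<^sub>B(B\<^sup>d) = M\<^sub>d(B)\<close> with rows and columns indexed by a finite set \<open>D\<close> of \<open>d\<close> elements.
\<close>

definition mat_algebra :: "('k, 'b) module \<Rightarrow> 'v set \<Rightarrow> ('k, 'v \<times> 'v \<Rightarrow> 'b) module" where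
  "mat_algebra B D =
    \<lparr>carrier = D \<times> D \<rightarrow>\<^sub>E carrier B,
     monoid.mult = (\<lambda>M N. \<lambda>(i, j)\<in>D \<times> D. \<Oplus>\<^bsub>B\<^esub>l\<in>D. M (i, l) \<otimes>\<^bsub>B\<^esub> N (l, j)),
     one = (\<lambda>(i, j)\<in>D \<times> D. if i = j then \<one>\<^bsub>B\<^esub> else \<zero>\<^bsub>B\<^esub>),
     ring.zero = (\<lambda>_\<in>D \<times> D. \<zero>\<^bsub>B\<^esub>),
     add = (\<lambda>M N. \<lambda>x\<in>D \<times> D. M x \<oplus>\<^bsub>B\<^esub> N x),
     smult = (\<lambda>c M. \<lambda>x\<in>D \<times> D. c \<odot>\<^bsub>B\<^esub> M x)\<rparr>"

text \<open>\<open>b E\<^sub>j\<^sub>i\<close>, with entry \<open>b\<close> in row \<open>j\<close> and column \<open>i\<close>, and \<open>b 1\<^sub>d\<close>.\<close>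

definition mat_entry :: "('b, 's) ring_scheme \<Rightarrow> 'v set \<Rightarrow> 'v \<Rightarrow> 'v \<Rightarrow> 'b \<Rightarrow> ('v \<times> 'v \<Rightarrow> 'b)" where
  "mat_entry B D j i b = (\<lambda>x\<in>D \<times> D. if x = (j, i) then b else \<zero>\<^bsub>B\<^esub>)"

definition mat_scalar :: "('b, 's) ring_scheme \<Rightarrow> 'v set \<Rightarrow> 'b \<Rightarrow> ('v \<times> 'v \<Rightarrow> 'b)" where
  "mat_scalar B D b = (\<lambda>(i, j)\<in>D \<times> D. if i = j then b else \<zero>\<^bsub>B\<^esub>)"

definition Max_spec :: "('b, 's) ring_scheme \<Rightarrow> 'b set set" where
  "Max_spec B = {\<qq>. maximalideal \<qq> B}"

text \<open>The Zariski topology: the open sets are the complements of the sets \<open>{\<qq>. S \<subseteq> \<qq>}\<close>.\<close>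

definition zariski :: "('b, 's) ring_scheme \<Rightarrow> 'b set topology" where
  "zariski B = topology (\<lambda>U. \<exists>S \<subseteq> carrier B. U = {\<qq> \<in> Max_spec B. \<not> S \<subseteq> \<qq>})"

lemma openin_zariski:
  assumes "cring B"
  shows "openin (zariski B) U \<longleftrightarrow> (\<exists>S \<subseteq> carrier B. U = {\<qq> \<in> Max_spec B. \<not> S \<subseteq> \<qq>})"
proof -
  interpret B: cring B by fact
  let ?D = "\<lambda>S. {\<qq> \<in> Max_spec B. \<not> S \<subseteq> \<qq>}"
  have inter: "?D S \<inter> ?D S' = ?D {s \<otimes>\<^bsub>B\<^esub> t | s t. s \<in> S \<and> t \<in> S'}"
    if S: "S \<subseteq> carrier B" and S': "S' \<subseteq> carrier B" for S S'
  proof -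
    let ?T = "{s \<otimes>\<^bsub>B\<^esub> t | s t. s \<in> S \<and> t \<in> S'}"
    have iff: "\<not> ?T \<subseteq> \<qq> \<longleftrightarrow> \<not> S \<subseteq> \<qq> \<and> \<not> S' \<subseteq> \<qq>" if "\<qq> \<in> Max_spec B" for \<qq>
    proof -
      interpret q: primeideal \<qq> B
        using that B.maximalideal_prime by (simp add: Max_spec_def)
      have "s \<otimes>\<^bsub>B\<^esub> t \<in> \<qq> \<longleftrightarrow> s \<in> \<qq> \<or> t \<in> \<qq>" if "s \<in> S" "t \<in> S'" for s t
        using that S S' q.I_prime q.I_l_closed q.I_r_closed by blast
      then show ?thesis by blast
    qed
    have "?D S \<inter> ?D S' = {\<qq> \<in> Max_spec B. \<not> S \<subseteq> \<qq> \<and> \<not> S' \<subseteq> \<qq>}" by blast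
    also have "\<dots> = ?D ?T"
      by (intro Collect_cong conj_cong HOL.refl) (simp only: iff)
    finally show ?thesis .
  qed
  have "istopology (\<lambda>U. \<exists>S \<subseteq> carrier B. U = ?D S)"
    unfolding istopology_def
  proof (intro conjI allI impI)
    fix U U' assume "\<exists>S \<subseteq> carrier B. U = ?D S" "\<exists>S \<subseteq> carrier B. U' = ?D S"
    then obtain S S' where S: "S \<subseteq> carrier B" "U = ?D S" and S': "S' \<subseteq> carrier B" "U' = ?D S'"
      by auto
    have "{s \<otimes>\<^bsub>B\<^esub> t | s t. s \<in> S \<and> t \<in> S'} \<subseteq> carrier B"
      using S(1) S'(1) by auto
    moreover have "U \<inter> U' = ?D {s \<otimes>\<^bsub>B\<^esub> t | s t. s \<in> S \<and> t \<in> S'}"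
      unfolding S(2) S'(2) by (rule inter[OF S(1) S'(1)])
    ultimately show "\<exists>S \<subseteq> carrier B. U \<inter> U' = ?D S"
      by (intro exI conjI)
  next
    fix K assume "\<forall>U\<in>K. \<exists>S \<subseteq> carrier B. U = ?D S"
    then obtain f where f: "\<And>U. U \<in> K \<Longrightarrow> f U \<subseteq> carrier B \<and> U = ?D (f U)"
      by metis
    have "\<Union>K = ?D (\<Union>(f ` K))"
    proof
      show "\<Union>K \<subseteq> ?D (\<Union>(f ` K))"
      proof
        fix \<qq> assume "\<qq> \<in> \<Union>K"
        then obtain U where U: "U \<in> K" "\<qq> \<in> U" by blast
        then have "\<qq> \<in> ?D (f U)" using f by blast
        with U(1) show "\<qq> \<in> ?D (\<Union>(f ` K))" by blast
      qed
      show "?D (\<Union>(f ` K)) \<subseteq> \<Union>K"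
      proof
        fix \<qq> assume "\<qq> \<in> ?D (\<Union>(f ` K))"
        then obtain U where U: "U \<in> K" "\<qq> \<in> ?D (f U)" by blast
        then have "\<qq> \<in> U" using f by blast
        with U(1) show "\<qq> \<in> \<Union>K" by blast
      qed
    qed
    moreover have "\<Union>(f ` K) \<subseteq> carrier B" using f by blast
    ultimately show "\<exists>S \<subseteq> carrier B. \<Union>K = ?D S" by blast
  qed
  then show ?thesis by (simp add: zariski_def)
qed

text \<open>
  The \<open>A\<close>-module \<open>(B/\<qq>)\<^sup>d\<close> given by \<open>\<tau>\<close> followed by evaluation at \<open>\<qq>\<close>. (For a finitely generated
  algebra \<open>B\<close> over an algebraically closed field \<open>k\<close>, \<open>B/\<qq>\<close> is \<open>k\<close>.)
\<close>

definition fiber_module ::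
    "('k, 'b) module \<Rightarrow> 'v set \<Rightarrow> ('a \<Rightarrow> 'v \<times> 'v \<Rightarrow> 'b) \<Rightarrow> 'b set \<Rightarrow> ('a, 'v \<Rightarrow> 'b set) module" where
  "fiber_module B D \<tau> \<qq> =
    \<lparr>carrier = D \<rightarrow>\<^sub>E carrier (B Quot \<qq>),
     monoid.mult = undefined, one = undefined,
     ring.zero = (\<lambda>_\<in>D. \<zero>\<^bsub>B Quot \<qq>\<^esub>),
     add = (\<lambda>v w. \<lambda>i\<in>D. v i \<oplus>\<^bsub>B Quot \<qq>\<^esub> w i),
     smult = (\<lambda>a v. \<lambda>i\<in>D. \<Oplus>\<^bsub>B Quot \<qq>\<^esub>j\<in>D. (\<qq> +>\<^bsub>B\<^esub> \<tau> a (i, j)) \<otimes>\<^bsub>B Quot \<qq>\<^esub> v j)\<rparr>"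

text \<open>The locale \<^locale>\<open>algebra\<close> is the library's notion of a commutative algebra.\<close>

definition pre_impression ::
    "('k, 's) ring_scheme \<Rightarrow> ('k, 'a) module \<Rightarrow> 'v set \<Rightarrow> ('a \<Rightarrow> 'v \<times> 'v \<Rightarrow> 'b) \<Rightarrow>
      ('k, 'b) module \<Rightarrow> bool" where
  "pre_impression k A D \<tau> B \<longleftrightarrow>
     algebra k B \<and> fin_gen_algebra k B \<and> finite D \<and>
     \<tau> \<in> algebra_hom k A (mat_algebra B D) \<and> inj_on \<tau> (carrier A) \<and>
     (\<exists>U. openin (zariski B) U \<and> zariski B closure_of U = Max_spec B \<and>
          (\<forall>\<qq>\<in>U. simple_module A (fiber_module B D \<tau> \<qq>)))"

definition scalar_subring ::
    "('k, 'a) module \<Rightarrow> 'v set \<Rightarrow> ('a \<Rightarrow> 'v \<times> 'v \<Rightarrow> 'b) \<Rightarrow> ('k, 'b) module \<Rightarrow> ('k, 'b) module" where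
  "scalar_subring A D \<tau> B = B\<lparr>carrier := {f \<in> carrier B. mat_scalar B D f \<in> \<tau> ` carrier A}\<rparr>"

definition impression ::
    "('k, 's) ring_scheme \<Rightarrow> ('k, 'a) module \<Rightarrow> 'v set \<Rightarrow> ('a \<Rightarrow> 'v \<times> 'v \<Rightarrow> 'b) \<Rightarrow>
      ('k, 'b) module \<Rightarrow> bool" where
  "impression k A D \<tau> B \<longleftrightarrow> pre_impression k A D \<tau> B \<and>
     (\<lambda>\<qq>. \<qq> \<inter> carrier (scalar_subring A D \<tau> B)) ` Max_spec B = Max_spec (scalar_subring A D \<tau> B)"

text \<open>\<open>\<tau>\<close>-bar of an element \<open>a\<close> of \<open>e\<^sub>j A e\<^sub>i\<close>.\<close>

definition tau_bar ::
    "('b, 's) ring_scheme \<Rightarrow> 'v set \<Rightarrow> ('a \<Rightarrow> 'v \<times> 'v \<Rightarrow> 'b) \<Rightarrow> 'v \<Rightarrow> 'v \<Rightarrow> 'a \<Rightarrow> 'b" where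
  "tau_bar B D \<tau> j i a = (THE b. b \<in> carrier B \<and> \<tau> a = mat_entry B D j i b)"


section \<open>Large modules\<close>

definition finite_basis :: "('k, 's) ring_scheme \<Rightarrow> ('k, 'm) module \<Rightarrow> 'm set \<Rightarrow> bool" where
  "finite_basis k W S \<longleftrightarrow> finite S \<and> S \<subseteq> carrier W \<and>
     (\<forall>w\<in>carrier W. \<exists>!c. c \<in> S \<rightarrow>\<^sub>E carrier k \<and> w = (\<Oplus>\<^bsub>W\<^esub>s\<in>S. c s \<odot>\<^bsub>W\<^esub> s))"

text \<open>All bases have the same size; the infimum makes the dimension \<open>\<infinity>\<close> if there is no finite basis.\<close>

definition kdim :: "('k, 's) ring_scheme \<Rightarrow> ('k, 'm) module \<Rightarrow> enat" where
  "kdim k W = Inf {enat (card S) | S. finite_basis k W S}"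

text \<open>An \<open>A\<close>-module as a vector space over \<open>k\<close>.\<close>

definition base_space :: "('k, 'a) module \<Rightarrow> ('a, 'm) module \<Rightarrow> ('k, 'm) module" where
  "base_space A V = restrict_scalars (\<lambda>c. c \<odot>\<^bsub>A\<^esub> \<one>\<^bsub>A\<^esub>) V"

text \<open>
  It suffices to compare with simple modules that have subsets of \<open>A\<close> as elements, because a simple
  module is isomorphic to \<open>A/L\<close> for a maximal left ideal \<open>L\<close>; see the lemma \<open>large_module_max\<close> below.
  A simple module over a finitely generated algebra has countable dimension, so nothing is lost by
  not distinguishing infinite cardinals.
\<close>

definition large_module :: "('k, 's) ring_scheme \<Rightarrow> ('k, 'a) module \<Rightarrow> ('a, 'm) module \<Rightarrow> bool" where
  "large_module k A V \<longleftrightarrow> simple_module A V \<and>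
     (\<forall>W :: ('a, 'a set) module. simple_module A W \<longrightarrow>
        kdim k (base_space A W) \<le> kdim k (base_space A V))"

text \<open>
  Transport along an injective map \<open>\<phi>\<close>, and its invariance properties.
\<close>

definition transport_module :: "('m \<Rightarrow> 'n) \<Rightarrow> ('r, 'm) module \<Rightarrow> ('r, 'n) module" where
  "transport_module \<phi> M = (let \<psi> = inv_into (carrier M) \<phi> in
    \<lparr>carrier = \<phi> ` carrier M, monoid.mult = undefined, one = undefined,
     ring.zero = \<phi> \<zero>\<^bsub>M\<^esub>, add = (\<lambda>x y. \<phi> (\<psi> x \<oplus>\<^bsub>M\<^esub> \<psi> y)),
     smult = (\<lambda>r x. \<phi> (r \<odot>\<^bsub>M\<^esub> \<psi> x))\<rparr>)"

lemma simple_transport_module: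
  fixes M :: "('r, 'm) module" and \<phi> :: "'m \<Rightarrow> 'n"
  assumes M: "simple_module R M" and \<phi>: "inj_on \<phi> (carrier M)"
  shows "simple_module R (transport_module \<phi> M)"
    and "inv_into (carrier M) \<phi> \<in> lmod_hom R (transport_module \<phi> M) M"
proof -
  let ?N = "transport_module \<phi> M"
  let ?\<psi> = "inv_into (carrier M) \<phi>"
  interpret M: left_module R M using M by (simp add: simple_module_def)
  have psi: "?\<psi> (\<phi> x) = x" if "x \<in> carrier M" for x
    using that \<phi> by simp
  have sim: "carrier ?N = \<phi> ` carrier M" "\<zero>\<^bsub>?N\<^esub> = \<phi> \<zero>\<^bsub>M\<^esub>"
    "x \<oplus>\<^bsub>?N\<^esub> y = \<phi> (?\<psi> x \<oplus>\<^bsub>M\<^esub> ?\<psi> y)" "r \<odot>\<^bsub>?N\<^esub> x = \<phi> (r \<odot>\<^bsub>M\<^esub> ?\<psi> x)" for x y r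
    by (simp_all add: transport_module_def Let_def)
  have N: "left_module R ?N"
  proof (intro left_module.intro left_module_axioms.intro abelian_groupI M.R.ring_axioms)
    fix x assume "x \<in> carrier ?N"
    then obtain x' where "x' \<in> carrier M" "x = \<phi> x'" by (auto simp: sim)
    then show "\<exists>y\<in>carrier ?N. y \<oplus>\<^bsub>?N\<^esub> x = \<zero>\<^bsub>?N\<^esub>"
      by (intro bexI[of _ "\<phi> (\<ominus>\<^bsub>M\<^esub> x')"]) (auto simp: sim psi M.M.l_neg)
  qed (auto simp: sim psi M.M.a_ac M.smult_l_distr M.smult_r_distr M.smult_assoc)
  interpret N: left_module R ?N by (rule N)
  show hom: "?\<psi> \<in> lmod_hom R ?N M"
    by (auto simp: lmod_hom_def sim psi)
  have "carrier M \<noteq> {\<zero>\<^bsub>M\<^esub>}" using M by (simp add: simple_module_def)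
  then have nz: "carrier ?N \<noteq> {\<zero>\<^bsub>?N\<^esub>}"
    using \<phi> M.M.zero_closed by (auto simp: sim inj_on_def)
  have "H = {\<zero>\<^bsub>?N\<^esub>} \<or> H = carrier ?N" if H: "submodule H R ?N" for H
  proof -
    interpret H: submodule H R ?N by (rule H)
    have sub: "H \<subseteq> \<phi> ` carrier M" using H.subset by (simp add: sim)
    have add: "x \<oplus>\<^bsub>?N\<^esub> y \<in> H" if "x \<in> H" "y \<in> H" for x y
      using H.m_closed[OF that] by simp
    have "submodule (?\<psi> ` H) R M"
    proof (intro submodule.intro subgroup.intro submodule_axioms.intro)
      show "?\<psi> ` H \<subseteq> carrier (add_monoid M)" using sub psi by auto
      show "\<one>\<^bsub>add_monoid M\<^esub> \<in> ?\<psi> ` H"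
        using H.one_closed psi[of "\<zero>\<^bsub>M\<^esub>"] by (force simp: sim)
      show smc: "a \<odot>\<^bsub>M\<^esub> x \<in> ?\<psi> ` H" if "a \<in> carrier R" "x \<in> ?\<psi> ` H" for a x
      proof -
        obtain y where y: "y \<in> H" "x = ?\<psi> y" using \<open>x \<in> ?\<psi> ` H\<close> by blast
        have ay: "a \<odot>\<^bsub>?N\<^esub> y \<in> H" by (rule H.smult_closed[OF that(1) y(1)])
        obtain z where z: "z \<in> carrier M" "y = \<phi> z" using y(1) sub by blast
        have eq: "?\<psi> (a \<odot>\<^bsub>?N\<^esub> y) = a \<odot>\<^bsub>M\<^esub> x"
          unfolding sim y(2) z(2) psi[OF z(1)] by (rule psi[OF M.smult_closed[OF that(1) z(1)]])
        show ?thesis by (rule image_eqI[where f = ?\<psi>, OF eq[symmetric] ay])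
      qed
      show "x \<otimes>\<^bsub>add_monoid M\<^esub> y \<in> ?\<psi> ` H" if x: "x \<in> ?\<psi> ` H" and y: "y \<in> ?\<psi> ` H" for x y
      proof -
        obtain x' where x': "x' \<in> H" "x = ?\<psi> x'" using x by blast
        obtain y' where y': "y' \<in> H" "y = ?\<psi> y'" using y by blast
        obtain x'' where x'': "x'' \<in> carrier M" "x' = \<phi> x''" using x'(1) sub by blast
        obtain y'' where y'': "y'' \<in> carrier M" "y' = \<phi> y''" using y'(1) sub by blast
        have eq: "?\<psi> (x' \<oplus>\<^bsub>?N\<^esub> y') = x \<oplus>\<^bsub>M\<^esub> y"
          unfolding sim x'(2) y'(2) x''(2) y''(2) psi[OF x''(1)] psi[OF y''(1)]
          by (rule psi[OF M.M.a_closed[OF x''(1) y''(1)]])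
        show ?thesis
          using image_eqI[where f = ?\<psi>, OF eq[symmetric] add[OF x'(1) y'(1)]] by simp
      qed
      show "inv\<^bsub>add_monoid M\<^esub> x \<in> ?\<psi> ` H" if "x \<in> ?\<psi> ` H" for x
      proof -
        have x: "x \<in> carrier M" using that sub psi by auto
        have "\<ominus>\<^bsub>M\<^esub> x = (\<ominus>\<^bsub>R\<^esub> \<one>\<^bsub>R\<^esub>) \<odot>\<^bsub>M\<^esub> x"
        proof (rule M.M.minus_equality)
          show "(\<ominus>\<^bsub>R\<^esub> \<one>\<^bsub>R\<^esub>) \<odot>\<^bsub>M\<^esub> x \<oplus>\<^bsub>M\<^esub> x = \<zero>\<^bsub>M\<^esub>"
            using M.smult_l_distr[of "\<ominus>\<^bsub>R\<^esub> \<one>\<^bsub>R\<^esub>" "\<one>\<^bsub>R\<^esub>" x] x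
            by (simp add: M.R.l_neg M.smult_zeros)
        qed (use x in auto)
        then show ?thesis using smc[OF _ that] by (simp add: a_inv_def)
      qed
    qed
    then have "?\<psi> ` H = {\<zero>\<^bsub>M\<^esub>} \<or> ?\<psi> ` H = carrier M"
      using M by (simp add: simple_module_def)
    moreover have "\<phi> ` (?\<psi> ` H) = H"
      using sub by (force simp: image_image f_inv_into_f subset_iff)
    ultimately show ?thesis by (metis image_empty image_insert sim(1,2))
  qed
  with N nz show "simple_module R ?N" by (simp add: simple_module_def)
qed

lemma kdim_iso_le:
  fixes A :: "('k, 'a) module" and M :: "('a, 'm) module" and N :: "('a, 'n) module"
  assumes "left_module A M" "left_module A N" "f \<in> lmod_hom A M N"
    and bij: "bij_betw f (carrier M) (carrier N)"
    and scal: "\<And>c. c \<in> carrier k \<Longrightarrow> c \<odot>\<^bsub>A\<^esub> \<one>\<^bsub>A\<^esub> \<in> carrier A"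
  shows "kdim k (base_space A N) \<le> kdim k (base_space A M)"
  unfolding kdim_def
proof (rule Inf_greatest)
  interpret M: left_module A M by fact
  interpret N: left_module A N by fact
  have sums: "finsum (base_space A K) = finsum K" for K :: "('a, 'e) module"
    by (intro HOL.ext) (simp add: finsum_def finprod_def base_space_def restrict_scalars_def)
  fix e assume "e \<in> {enat (card S) | S. finite_basis k (base_space A M) S}"
  then obtain S where S: "finite_basis k (base_space A M) S" "e = enat (card S)" by blast
  then have S': "finite S" "S \<subseteq> carrier M"
    by (auto simp: finite_basis_def base_space_def restrict_scalars_def)
  have inj: "inj_on f S" "inj_on f (carrier M)"
    using bij S'(2) by (auto simp: bij_betw_def inj_on_subset)
  let ?g = "inv_into S f"
  have g: "?g (f s) = s" if "s \<in> S" for s using inj(1) that by simp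
  have fS: "f s \<in> carrier N" if "s \<in> S" for s
    using assms(3) that S'(2) by (auto simp: lmod_hom_def)
  have sumf: "f (\<Oplus>\<^bsub>M\<^esub>s\<in>S. (c s \<odot>\<^bsub>A\<^esub> \<one>\<^bsub>A\<^esub>) \<odot>\<^bsub>M\<^esub> s) =
      (\<Oplus>\<^bsub>N\<^esub>t\<in>f ` S. (c (?g t) \<odot>\<^bsub>A\<^esub> \<one>\<^bsub>A\<^esub>) \<odot>\<^bsub>N\<^esub> t)" if c: "\<And>s. s \<in> S \<Longrightarrow> c s \<in> carrier k" for c
  proof -
    have cl: "(c s \<odot>\<^bsub>A\<^esub> \<one>\<^bsub>A\<^esub>) \<odot>\<^bsub>M\<^esub> s \<in> carrier M" if "s \<in> S" for s
      using that c scal S'(2) by blast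
    have "f (\<Oplus>\<^bsub>M\<^esub>s\<in>S. (c s \<odot>\<^bsub>A\<^esub> \<one>\<^bsub>A\<^esub>) \<odot>\<^bsub>M\<^esub> s) = (\<Oplus>\<^bsub>N\<^esub>s\<in>S. f ((c s \<odot>\<^bsub>A\<^esub> \<one>\<^bsub>A\<^esub>) \<odot>\<^bsub>M\<^esub> s))"
      by (rule lmod_hom_finsum[OF assms(1-3) S'(1)]) (use cl in auto)
    also have "\<dots> = (\<Oplus>\<^bsub>N\<^esub>s\<in>S. (c (?g (f s)) \<odot>\<^bsub>A\<^esub> \<one>\<^bsub>A\<^esub>) \<odot>\<^bsub>N\<^esub> f s)"
    proof (rule N.M.finsum_cong'[OF HOL.refl])
      show "(\<lambda>s. (c (?g (f s)) \<odot>\<^bsub>A\<^esub> \<one>\<^bsub>A\<^esub>) \<odot>\<^bsub>N\<^esub> f s) \<in> S \<rightarrow> carrier N"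
        using c scal fS by (auto simp: g)
      fix s assume s: "s \<in> S"
      then have "s \<in> carrier M" using S'(2) by blast
      with s show "f ((c s \<odot>\<^bsub>A\<^esub> \<one>\<^bsub>A\<^esub>) \<odot>\<^bsub>M\<^esub> s) = (c (?g (f s)) \<odot>\<^bsub>A\<^esub> \<one>\<^bsub>A\<^esub>) \<odot>\<^bsub>N\<^esub> f s"
        using assms(3) scal[OF c[OF s]] by (simp add: lmod_hom_def g)
    qed
    also have "\<dots> = (\<Oplus>\<^bsub>N\<^esub>t\<in>f ` S. (c (?g t) \<odot>\<^bsub>A\<^esub> \<one>\<^bsub>A\<^esub>) \<odot>\<^bsub>N\<^esub> t)"
      by (rule N.M.finsum_reindex[symmetric, OF _ inj(1)]) (use c scal fS in \<open>auto simp: g\<close>)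
    finally show ?thesis .
  qed
  have "finite_basis k (base_space A N) (f ` S)"
    unfolding finite_basis_def
  proof (intro conjI ballI)
    show "finite (f ` S)" using S' by simp
    show "f ` S \<subseteq> carrier (base_space A N)"
      using S'(2) bij by (auto simp: bij_betw_def base_space_def restrict_scalars_def)
    fix w assume "w \<in> carrier (base_space A N)"
    then have "w \<in> f ` carrier M"
      using bij by (simp add: bij_betw_def base_space_def restrict_scalars_def)
    then obtain v where v: "v \<in> carrier M" "w = f v" by blast
    have ex1: "\<exists>!c. c \<in> S \<rightarrow>\<^sub>E carrier k \<and> v = (\<Oplus>\<^bsub>M\<^esub>s\<in>S. (c s \<odot>\<^bsub>A\<^esub> \<one>\<^bsub>A\<^esub>) \<odot>\<^bsub>M\<^esub> s)"
      using S(1) v(1) by (simp add: finite_basis_def sums) (simp add: base_space_def restrict_scalars_def)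
    then obtain c where c: "c \<in> S \<rightarrow>\<^sub>E carrier k" "v = (\<Oplus>\<^bsub>M\<^esub>s\<in>S. (c s \<odot>\<^bsub>A\<^esub> \<one>\<^bsub>A\<^esub>) \<odot>\<^bsub>M\<^esub> s)"
      by blast
    have "\<exists>!d. d \<in> f ` S \<rightarrow>\<^sub>E carrier k \<and> w = (\<Oplus>\<^bsub>N\<^esub>t\<in>f ` S. (d t \<odot>\<^bsub>A\<^esub> \<one>\<^bsub>A\<^esub>) \<odot>\<^bsub>N\<^esub> t)"
    proof (rule ex1I)
      let ?d = "restrict (c \<circ> ?g) (f ` S)"
      have "w = (\<Oplus>\<^bsub>N\<^esub>t\<in>f ` S. (c (?g t) \<odot>\<^bsub>A\<^esub> \<one>\<^bsub>A\<^esub>) \<odot>\<^bsub>N\<^esub> t)"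
        using sumf[of c] c v(2) by auto
      also have "\<dots> = (\<Oplus>\<^bsub>N\<^esub>t\<in>f ` S. (?d t \<odot>\<^bsub>A\<^esub> \<one>\<^bsub>A\<^esub>) \<odot>\<^bsub>N\<^esub> t)"
        by (rule N.M.finsum_cong'[OF HOL.refl])
          (auto simp: g intro!: N.smult_closed scal fS PiE_mem[OF c(1)])
      finally show "?d \<in> f ` S \<rightarrow>\<^sub>E carrier k \<and> w = (\<Oplus>\<^bsub>N\<^esub>t\<in>f ` S. (?d t \<odot>\<^bsub>A\<^esub> \<one>\<^bsub>A\<^esub>) \<odot>\<^bsub>N\<^esub> t)"
        using c(1) by (auto simp: g)
    next
      fix d assume d: "d \<in> f ` S \<rightarrow>\<^sub>E carrier k \<and> w = (\<Oplus>\<^bsub>N\<^esub>t\<in>f ` S. (d t \<odot>\<^bsub>A\<^esub> \<one>\<^bsub>A\<^esub>) \<odot>\<^bsub>N\<^esub> t)"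
      let ?c = "restrict (d \<circ> f) S"
      have c': "?c s \<in> carrier k" if "s \<in> S" for s using d that by auto
      have "w = (\<Oplus>\<^bsub>N\<^esub>t\<in>f ` S. (?c (?g t) \<odot>\<^bsub>A\<^esub> \<one>\<^bsub>A\<^esub>) \<odot>\<^bsub>N\<^esub> t)"
        unfolding conjunct2[OF d]
        by (rule N.M.finsum_cong'[OF HOL.refl])
          (auto simp: g intro!: N.smult_closed scal fS PiE_mem[OF conjunct1[OF d]])
      also have "\<dots> = f (\<Oplus>\<^bsub>M\<^esub>s\<in>S. (?c s \<odot>\<^bsub>A\<^esub> \<one>\<^bsub>A\<^esub>) \<odot>\<^bsub>M\<^esub> s)"
        by (rule sumf[OF c', symmetric])
      finally have "f v = f (\<Oplus>\<^bsub>M\<^esub>s\<in>S. (?c s \<odot>\<^bsub>A\<^esub> \<one>\<^bsub>A\<^esub>) \<odot>\<^bsub>M\<^esub> s)" using v(2) by simp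
      moreover have "(\<Oplus>\<^bsub>M\<^esub>s\<in>S. (?c s \<odot>\<^bsub>A\<^esub> \<one>\<^bsub>A\<^esub>) \<odot>\<^bsub>M\<^esub> s) \<in> carrier M"
        by (rule M.M.finsum_closed) (use c' scal S'(2) in blast)
      ultimately have "v = (\<Oplus>\<^bsub>M\<^esub>s\<in>S. (?c s \<odot>\<^bsub>A\<^esub> \<one>\<^bsub>A\<^esub>) \<odot>\<^bsub>M\<^esub> s)"
        using inj(2) v(1) by (meson inj_onD)
      moreover have "?c \<in> S \<rightarrow>\<^sub>E carrier k" using c' by auto
      ultimately have "?c = c" using ex1 c by blast
      then show "d = restrict (c \<circ> ?g) (f ` S)"
        using d by (intro extensionalityI[of _ "f ` S"]) (auto simp: g PiE_def)
    qed
    then show "\<exists>!d. d \<in> f ` S \<rightarrow>\<^sub>E carrier k \<and> w = (\<Oplus>\<^bsub>base_space A N\<^esub>t\<in>f ` S. d t \<odot>\<^bsub>base_space A N\<^esub> t)"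
      by (simp add: sums) (simp add: base_space_def restrict_scalars_def)
  qed
  moreover have "card (f ` S) = card S" using inj(1) by (rule card_image)
  ultimately show "Inf {enat (card S) | S. finite_basis k (base_space A N) S} \<le> e"
    using S(2) by (intro Inf_lower) force
qed

lemma large_module_max:
  fixes W :: "('a, 'w) module" and V :: "('a, 'm) module"
  assumes V: "large_module k A V" and W: "simple_module A W"
    and scal: "\<And>c. c \<in> carrier k \<Longrightarrow> c \<odot>\<^bsub>A\<^esub> \<one>\<^bsub>A\<^esub> \<in> carrier A"
  shows "kdim k (base_space A W) \<le> kdim k (base_space A V)"
proof -
  interpret W: left_module A W using W by (simp add: simple_module_def)
  obtain w where w: "w \<in> carrier W" "w \<noteq> \<zero>\<^bsub>W\<^esub>"
    using W W.M.zero_closed by (auto simp: simple_module_def)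
  let ?H = "(\<lambda>a. a \<odot>\<^bsub>W\<^esub> w) ` carrier A"
  have "submodule ?H A W"
  proof (intro submodule.intro subgroup.intro submodule_axioms.intro)
    show "?H \<subseteq> carrier (add_monoid W)" using w by auto
    show "x \<otimes>\<^bsub>add_monoid W\<^esub> y \<in> ?H" if "x \<in> ?H" "y \<in> ?H" for x y
      using that w by (auto simp: W.smult_l_distr[symmetric])
    show "\<one>\<^bsub>add_monoid W\<^esub> \<in> ?H"
      using W.smult_zeros(1)[OF w(1)] W.R.zero_closed by (force simp: image_iff)
    show "a \<odot>\<^bsub>W\<^esub> x \<in> ?H" if "a \<in> carrier A" "x \<in> ?H" for a x
      using that w by (auto simp: W.smult_assoc[symmetric])
    show "inv\<^bsub>add_monoid W\<^esub> x \<in> ?H" if x: "x \<in> ?H" for x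
    proof -
      obtain a where a: "a \<in> carrier A" "x = a \<odot>\<^bsub>W\<^esub> w" using x by blast
      have "\<ominus>\<^bsub>W\<^esub> x = (\<ominus>\<^bsub>A\<^esub> a) \<odot>\<^bsub>W\<^esub> w"
        by (rule W.M.minus_equality)
          (use W.smult_l_distr[of "\<ominus>\<^bsub>A\<^esub> a" a w] a w in \<open>simp_all add: W.R.l_neg W.smult_zeros\<close>)
      then show ?thesis using a by (auto simp: a_inv_def)
    qed
  qed
  moreover have "w \<in> ?H"
    using W.smult_one[OF w(1)] W.R.one_closed by (metis image_eqI)
  ultimately have H: "?H = carrier W"
    using W w(2) unfolding simple_module_def by blast
  let ?\<phi> = "\<lambda>x. {a \<in> carrier A. a \<odot>\<^bsub>W\<^esub> w = x}"
  have inj: "inj_on ?\<phi> (carrier W)"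
  proof (rule inj_onI)
    fix x y assume "x \<in> carrier W" "?\<phi> x = ?\<phi> y"
    moreover obtain a where "a \<in> carrier A" "x = a \<odot>\<^bsub>W\<^esub> w" using H \<open>x \<in> carrier W\<close> by blast
    ultimately show "x = y" by blast
  qed
  note W' = simple_transport_module[OF W inj]
  have "kdim k (base_space A W) \<le> kdim k (base_space A (transport_module ?\<phi> W))"
  proof (rule kdim_iso_le[OF _ _ W'(2) _ scal])
    show "left_module A (transport_module ?\<phi> W)" "left_module A W"
      using W'(1) W by (simp_all add: simple_module_def)
    show "bij_betw (inv_into (carrier W) ?\<phi>) (carrier (transport_module ?\<phi> W)) (carrier W)"
      using bij_betw_inv_into[OF inj_on_imp_bij_betw[OF inj]]
      by (simp add: transport_module_def Let_def)
  qed
  also have "\<dots> \<le> kdim k (base_space A V)"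
    using V W'(1) by (simp add: large_module_def)
  finally show ?thesis .
qed


section \<open>Tensor products\<close>

text \<open>
  For modules \<open>M\<close>, \<open>N\<close> over a commutative ring \<open>R\<close>, an element of the tensor product is a class of
  formal sums \<open>m\<^sub>1 \<otimes> n\<^sub>1 + \<dots> + m\<^sub>r \<otimes> n\<^sub>r\<close>, written as lists of pairs.
\<close>

inductive_set tensor_rel ::
    "('r, 's) ring_scheme \<Rightarrow> ('r, 'm) module \<Rightarrow> ('r, 'n) module \<Rightarrow>
      (('m \<times> 'n) list \<times> ('m \<times> 'n) list) set"
  for R and M and N where
    refl: "set xs \<subseteq> carrier M \<times> carrier N \<Longrightarrow> (xs, xs) \<in> tensor_rel R M N"
  | sym: "(xs, ys) \<in> tensor_rel R M N \<Longrightarrow> (ys, xs) \<in> tensor_rel R M N"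
  | trans: "\<lbrakk>(xs, ys) \<in> tensor_rel R M N; (ys, zs) \<in> tensor_rel R M N\<rbrakk> \<Longrightarrow>
      (xs, zs) \<in> tensor_rel R M N"
  | append: "\<lbrakk>(xs, ys) \<in> tensor_rel R M N; (us, vs) \<in> tensor_rel R M N\<rbrakk> \<Longrightarrow>
      (xs @ us, ys @ vs) \<in> tensor_rel R M N"
  | comm: "\<lbrakk>set xs \<subseteq> carrier M \<times> carrier N; set ys \<subseteq> carrier M \<times> carrier N\<rbrakk> \<Longrightarrow>
      (xs @ ys, ys @ xs) \<in> tensor_rel R M N"
  | zero: "n \<in> carrier N \<Longrightarrow> ([(\<zero>\<^bsub>M\<^esub>, n)], []) \<in> tensor_rel R M N"
  | add_left: "\<lbrakk>m \<in> carrier M; m' \<in> carrier M; n \<in> carrier N\<rbrakk> \<Longrightarrow>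
      ([(m \<oplus>\<^bsub>M\<^esub> m', n)], [(m, n), (m', n)]) \<in> tensor_rel R M N"
  | add_right: "\<lbrakk>m \<in> carrier M; n \<in> carrier N; n' \<in> carrier N\<rbrakk> \<Longrightarrow>
      ([(m, n \<oplus>\<^bsub>N\<^esub> n')], [(m, n), (m, n')]) \<in> tensor_rel R M N"
  | balanced: "\<lbrakk>r \<in> carrier R; m \<in> carrier M; n \<in> carrier N\<rbrakk> \<Longrightarrow>
      ([(r \<odot>\<^bsub>M\<^esub> m, n)], [(m, r \<odot>\<^bsub>N\<^esub> n)]) \<in> tensor_rel R M N"

definition tensor_class ::
    "('r, 's) ring_scheme \<Rightarrow> ('r, 'm) module \<Rightarrow> ('r, 'n) module \<Rightarrow> ('m \<times> 'n) list \<Rightarrow>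
      ('m \<times> 'n) list set" where
  "tensor_class R M N xs = tensor_rel R M N `` {xs}"

definition tensor_carrier ::
    "('r, 's) ring_scheme \<Rightarrow> ('r, 'm) module \<Rightarrow> ('r, 'n) module \<Rightarrow> ('m \<times> 'n) list set set" where
  "tensor_carrier R M N = {xs. set xs \<subseteq> carrier M \<times> carrier N} // tensor_rel R M N"

definition tensor_add ::
    "('r, 's) ring_scheme \<Rightarrow> ('r, 'm) module \<Rightarrow> ('r, 'n) module \<Rightarrow>
      ('m \<times> 'n) list set \<Rightarrow> ('m \<times> 'n) list set \<Rightarrow> ('m \<times> 'n) list set" where
  "tensor_add R M N S T = (\<Union>xs\<in>S. \<Union>ys\<in>T. tensor_class R M N (xs @ ys))"

text \<open>
  The bi-additive extension of \<open>(m \<otimes> n) \<cdot> (m' \<otimes> n') = f m m' \<otimes> g n n'\<close>, where the products lie in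
  \<open>M \<otimes>\<^sub>R N\<close>.
\<close>

definition tensor_lift2 ::
    "('r, 's) ring_scheme \<Rightarrow> ('r, 'm) module \<Rightarrow> ('r, 'n) module \<Rightarrow>
      ('a \<Rightarrow> 'b \<Rightarrow> 'm) \<Rightarrow> ('c \<Rightarrow> 'd \<Rightarrow> 'n) \<Rightarrow>
      ('a \<times> 'c) list set \<Rightarrow> ('b \<times> 'd) list set \<Rightarrow> ('m \<times> 'n) list set" where
  "tensor_lift2 R M N f g S T = (\<Union>xs\<in>S. \<Union>ys\<in>T.
     tensor_class R M N [(f m m', g n n'). (m, n) \<leftarrow> xs, (m', n') \<leftarrow> ys])"

text \<open>\<open>M \<otimes>\<^sub>R N\<close> as a ring, for two \<open>R\<close>-algebras.\<close>

definition tensor_ring ::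
    "('r, 's) ring_scheme \<Rightarrow> ('r, 'm) module \<Rightarrow> ('r, 'n) module \<Rightarrow> ('m \<times> 'n) list set ring" where
  "tensor_ring R M N =
    \<lparr>carrier = tensor_carrier R M N,
     monoid.mult = tensor_lift2 R M N (monoid.mult M) (monoid.mult N),
     one = tensor_class R M N [(\<one>\<^bsub>M\<^esub>, \<one>\<^bsub>N\<^esub>)],
     ring.zero = tensor_class R M N [],
     add = tensor_add R M N\<rparr>"


section \<open>Localization at a maximal ideal of the center\<close>

text \<open>Fractions \<open>a/s\<close> over a commutative algebra \<open>Z\<close>, with denominators in a multiplicative set \<open>S\<close>.\<close>

definition loc_rel :: "('a, 's) ring_scheme \<Rightarrow> 'a set \<Rightarrow> (('a \<times> 'a) \<times> ('a \<times> 'a)) set" where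
  "loc_rel Z S = {((a, s), (b, t)). a \<in> carrier Z \<and> b \<in> carrier Z \<and> s \<in> S \<and> t \<in> S \<and>
     (\<exists>u\<in>S. u \<otimes>\<^bsub>Z\<^esub> (t \<otimes>\<^bsub>Z\<^esub> a) = u \<otimes>\<^bsub>Z\<^esub> (s \<otimes>\<^bsub>Z\<^esub> b))}"

definition loc_frac :: "('a, 's) ring_scheme \<Rightarrow> 'a set \<Rightarrow> 'a \<Rightarrow> 'a \<Rightarrow> ('a \<times> 'a) set" where
  "loc_frac Z S a s = loc_rel Z S `` {(a, s)}"

definition localization :: "('k, 'a) module \<Rightarrow> 'a set \<Rightarrow> ('k, ('a \<times> 'a) set) module" where
  "localization Z S =
    \<lparr>carrier = (carrier Z \<times> S) // loc_rel Z S,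
     monoid.mult = (\<lambda>x y. \<Union>(a, s)\<in>x. \<Union>(b, t)\<in>y. loc_frac Z S (a \<otimes>\<^bsub>Z\<^esub> b) (s \<otimes>\<^bsub>Z\<^esub> t)),
     one = loc_frac Z S \<one>\<^bsub>Z\<^esub> \<one>\<^bsub>Z\<^esub>,
     ring.zero = loc_frac Z S \<zero>\<^bsub>Z\<^esub> \<one>\<^bsub>Z\<^esub>,
     add = (\<lambda>x y. \<Union>(a, s)\<in>x. \<Union>(b, t)\<in>y.
              loc_frac Z S ((t \<otimes>\<^bsub>Z\<^esub> a) \<oplus>\<^bsub>Z\<^esub> (s \<otimes>\<^bsub>Z\<^esub> b)) (s \<otimes>\<^bsub>Z\<^esub> t)),
     smult = (\<lambda>c x. \<Union>(a, s)\<in>x. loc_frac Z S (c \<odot>\<^bsub>Z\<^esub> a) s)\<rparr>"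

text \<open>
  Below, \<open>A\<close> is a \<open>k\<close>-algebra with center \<open>Z\<close> and \<open>\<mm>\<close> is a maximal ideal of \<open>Z\<close>.
  First \<open>Z\<^sub>\<mm>\<close> and its maximal ideal \<open>\<mm>\<^sub>\<mm>\<close>.
\<close>

definition center_loc :: "('k, 'a) module \<Rightarrow> 'a set \<Rightarrow> ('k, ('a \<times> 'a) set) module" where
  "center_loc A \<mm> = localization (center_algebra A) (carrier (center_algebra A) - \<mm>)"

definition center_loc_ideal :: "('k, 'a) module \<Rightarrow> 'a set \<Rightarrow> ('a \<times> 'a) set set" where
  "center_loc_ideal A \<mm> = {loc_frac (center_algebra A) (carrier (center_algebra A) - \<mm>) a s | a s.
     a \<in> \<mm> \<and> s \<in> carrier (center_algebra A) - \<mm>}"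

text \<open>\<open>Z\<^sub>\<mm>\<close> and \<open>A\<close> as \<open>Z\<close>-algebras, and \<open>A\<^sub>\<mm> = Z\<^sub>\<mm> \<otimes>\<^sub>Z A\<close>.\<close>

definition center_loc_Z :: "('k, 'a) module \<Rightarrow> 'a set \<Rightarrow> ('a, ('a \<times> 'a) set) module" where
  "center_loc_Z A \<mm> = ring_as_module
     (\<lambda>z. loc_frac (center_algebra A) (carrier (center_algebra A) - \<mm>) z \<one>\<^bsub>A\<^esub>) (center_loc A \<mm>)"

definition algebra_Z :: "('k, 'a) module \<Rightarrow> ('a, 'a) module" where
  "algebra_Z A = ring_as_module (\<lambda>z. z) A"

definition algebra_loc :: "('k, 'a) module \<Rightarrow> 'a set \<Rightarrow> (('a \<times> 'a) set \<times> 'a) list set ring" where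
  "algebra_loc A \<mm> = tensor_ring (center_algebra A) (center_loc_Z A \<mm>) (algebra_Z A)"

text \<open>The localization \<open>J\<^sub>\<mm>\<close> of an ideal \<open>J\<close> of \<open>A\<close>: the image of \<open>Z\<^sub>\<mm> \<otimes>\<^sub>Z J\<close> in \<open>A\<^sub>\<mm>\<close>.\<close>

definition ideal_loc ::
    "('k, 'a) module \<Rightarrow> 'a set \<Rightarrow> 'a set \<Rightarrow> (('a \<times> 'a) set \<times> 'a) list set set" where
  "ideal_loc A \<mm> J = tensor_class (center_algebra A) (center_loc_Z A \<mm>) (algebra_Z A) `
     {xs. set xs \<subseteq> carrier (center_loc A \<mm>) \<times> J}"

text \<open>
  \<open>V\<^sub>\<mm> = Z\<^sub>\<mm>/\<mm>\<^sub>\<mm> \<otimes>\<^sub>k V\<close> as a module over \<open>A\<^sub>\<mm> = Z\<^sub>\<mm> \<otimes>\<^sub>Z A\<close>, with \<open>(z \<otimes> a) (w \<otimes> v) = z w \<otimes> a v\<close>.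
\<close>

definition module_loc ::
    "('k, 's) ring_scheme \<Rightarrow> ('k, 'a) module \<Rightarrow> 'a set \<Rightarrow> ('a, 'm) module \<Rightarrow>
      ((('a \<times> 'a) set \<times> 'a) list set, (('a \<times> 'a) set set \<times> 'm) list set) module" where
  "module_loc k A \<mm> V =
    (let F = quot_algebra (center_loc A \<mm>) (center_loc_ideal A \<mm>);
         F' = quot_module (center_loc A \<mm>) (center_loc_ideal A \<mm>);
         W = base_space A V
     in \<lparr>carrier = tensor_carrier k F W,
         monoid.mult = undefined, one = undefined,
         ring.zero = tensor_class k F W [],
         add = tensor_add k F W,
         smult = tensor_lift2 k F W (smult F') (smult V)\<rparr>)"

end

theory Submission imports Defs
begin

text \<open>
  Why the five projective dimensions agree. The impression embeds \<open>A\<close> in matrices over a domain \<open>B\<close>. All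
  diagonal corners have the same image in \<open>B\<close>, so each element \<open>f\<close> of this image is the scalar of a matrix
  \<open>f 1\<close> in the image of \<open>A\<close>, and such elements of \<open>A\<close> are central. Every corner \<open>e\<^sub>i A e\<^sub>i\<close> therefore
  consists of multiples of \<open>e\<^sub>i\<close> by central elements.

  Let \<open>V\<close> be a simple module. Each non-zero \<open>e\<^sub>i V\<close> is simple over this commutative ring \<open>R\<close>, so it is \<open>R\<close>
  modulo a maximal ideal. That ideal is the trace of a maximal ideal of \<open>B\<close>, because the map on maximal
  spectra is onto, and the Nullstellensatz for \<open>B\<close> makes the residue field \<open>k\<close>. Hence \<open>e\<^sub>i V\<close> is zero or a
  line, and the dimension of \<open>V\<close> counts the vertices with \<open>e\<^sub>i V \<noteq> 0\<close>. A simple fibre of the impression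
  has the full support, so a large module has it too. Then there are elements \<open>a\<^sub>i\<close> from a base vertex \<open>r\<close>
  to \<open>i\<close> and \<open>b\<^sub>i\<close> back, with \<open>b\<^sub>i a\<^sub>i = t\<^sub>i e\<^sub>r\<close> and \<open>a\<^sub>i b\<^sub>i = t\<^sub>i e\<^sub>i\<close> for central \<open>t\<^sub>i\<close> outside \<open>\<mm>\<close>. Over \<open>Z\<^sub>\<mm>\<close> they
  become invertible, and \<open>A\<^sub>\<mm>\<close> is a matrix algebra over \<open>Z\<^sub>\<mm>\<close> with \<open>V\<^sub>\<mm>\<close> as the column module of its residue
  algebra.

  For all comparisons, \<open>pd \<le> n\<close> is expressed by a fixed projective resolution: the image of the \<open>n\<close>-th
  differential is a direct summand (\<open>pd_le_iff_boundary_retract\<close>).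

  \<^item> \<open>A/\<pp>\<close> is, as a left module, a direct sum of copies of \<open>V\<close>, one for each vertex; likewise over \<open>A\<^sub>\<mm>\<close>
    (\<open>pd_eq_pd_quotient_annihilator\<close>).
  \<^item> \<open>A\<close> is noetherian, so \<open>V\<close> has a resolution by free modules of finite rank. A splitting after localization
    needs one common denominator, which is invertible modulo the annihilator of \<open>V\<close>; so it gives a
    splitting over \<open>A\<close> (\<open>pd_localization\<close>).
  \<^item> The functor \<open>M \<mapsto> e\<^sub>r M\<close> is a Morita equivalence from \<open>A\<^sub>\<mm>\<close> to \<open>Z\<^sub>\<mm>\<close> that takes \<open>V\<^sub>\<mm>\<close> to \<open>Z\<^sub>\<mm>/\<mm>\<^sub>\<mm>\<close>
    (\<open>pd_corner\<close>).

  That \<open>A\<close> is noetherian holds because a long path contains a cycle, and cycles can be pulled out as central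
  factors (\<open>noetherian_quiver_algebra\<close>).
\<close>

text \<open>
  An index on the operations of a ring or module is written after a dollar sign, as in \<open>x \<otimes>$A y\<close> or
  \<open>\<zero>$(P n)\<close>, and \<open>x :. M\<close> is membership in the carrier.
\<close>

syntax
 "_index_id" :: "id => index" ("$_")
 "_index_term" :: "logic => index" ("$'(_')")
translations
 "_index_id x" => "_index x"
 "_index_term x" => "_index x"

abbreviation carrier_mem (infix ":." 50) where
 "x :. M \<equiv> x \<in> carrier M"

section \<open>Homomorphisms and submodules of left modules\<close>

lemma lmod_homI:
 assumes "!!x. x :. M ==> f x :. N"
  and "!!x y. [|x :. M; y :. M|] ==> f (x \<oplus>$M y) = f x \<oplus>$N f y"
  and "!!r x. [|r :. R; x :. M|] ==> f (r \<odot>$M x) = r \<odot>$N f x"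
 shows "f \<in> lmod_hom R M N"
 using assms by (auto simp: lmod_hom_def)

lemma lmod_hom_closed: "f \<in> lmod_hom R M N ==> x :. M ==> f x :. N"
 by (auto simp: lmod_hom_def)

lemma lmod_hom_add:
 "f \<in> lmod_hom R M N ==> x :. M ==> y :. M ==> f (x \<oplus>$M y) = f x \<oplus>$N f y"
 by (auto simp: lmod_hom_def)

lemma lmod_hom_smult:
 "f \<in> lmod_hom R M N ==> r :. R ==> x :. M ==> f (r \<odot>$M x) = r \<odot>$N f x"
 by (auto simp: lmod_hom_def)

lemma lmod_hom_zero:
 assumes "left_module R M" "left_module R N" "f \<in> lmod_hom R M N"
 shows "f \<zero>$M = \<zero>$N"
 using lmod_hom_finsum[OF assms, of "{}" "%_. \<zero>$M"]
 by (simp add: abelian_monoid.finsum_empty abelian_group.axioms(1) left_module.axioms(2)[OF assms(1)]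
   left_module.axioms(2)[OF assms(2)])

lemma (in left_module) smult_neg_one: "x :. M ==> (\<ominus>$R \<one>$R) \<odot>$M x = \<ominus>$M x"
 using smult_l_distr[of "\<ominus>$R \<one>$R" "\<one>$R" x]
 by (intro M.minus_equality[symmetric]) (simp_all add: R.l_neg smult_zeros)

lemma (in left_module) smult_r_neg:
 assumes "a :. R" "x :. M" shows "a \<odot>$M (\<ominus>$M x) = \<ominus>$M (a \<odot>$M x)"
 using assms smult_r_distr[of a "\<ominus>$M x" x]
 by (intro M.minus_equality[symmetric]) (simp_all add: M.l_neg smult_zeros)

lemma (in left_module) smult_r_minus:
 "[|a :. R; x :. M; y :. M|] ==>
  a \<odot>$M (x \<ominus>$M y) = a \<odot>$M x \<ominus>$M a \<odot>$M y"
 by (simp add: a_minus_def smult_r_distr smult_r_neg)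

lemma lmod_hom_neg:
 assumes "left_module R M" "left_module R N" "f \<in> lmod_hom R M N" "x :. M"
 shows "f (\<ominus>$M x) = \<ominus>$N f x"
proof -
 interpret M: left_module R M by fact
 interpret N: left_module R N by fact
 show ?thesis
  using assms(4) lmod_hom_smult[OF assms(3), of "\<ominus>$R \<one>$R" x] lmod_hom_closed[OF assms(3,4)]
  by (simp add: M.smult_neg_one N.smult_neg_one)
qed

lemma lmod_hom_minus:
 assumes "left_module R M" "left_module R N" "f \<in> lmod_hom R M N" "x :. M" "y :. M"
 shows "f (x \<ominus>$M y) = f x \<ominus>$N f y"
proof -
 interpret M: left_module R M by fact
 show ?thesis
  using assms(4,5) by (simp add: a_minus_def lmod_hom_add[OF assms(3)] lmod_hom_neg[OF assms(1-3)])
qed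

lemma lmod_hom_id: "(%x. x) \<in> lmod_hom R M M"
 by (simp add: lmod_hom_def)

lemma lmod_hom_comp:
 "f \<in> lmod_hom R M N ==> g \<in> lmod_hom R N L ==> (%x. g (f x)) \<in> lmod_hom R M L"
 by (auto simp: lmod_hom_def Pi_def)

lemma lmod_hom_add_fun:
 assumes "left_module R M" "left_module R N" "f \<in> lmod_hom R M N" "g \<in> lmod_hom R M N"
 shows "(%x. f x \<oplus>$N g x) \<in> lmod_hom R M N"
proof -
 interpret N: left_module R N by fact
 note cl = lmod_hom_closed[OF assms(3)] lmod_hom_closed[OF assms(4)]
 show ?thesis
  by (rule lmod_homI)
   (simp_all add: cl lmod_hom_add[OF assms(3)] lmod_hom_add[OF assms(4)] N.M.a_ac N.smult_r_distr
    lmod_hom_smult[OF assms(3)] lmod_hom_smult[OF assms(4)])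
qed

lemma lmod_hom_minus_fun:
 assumes "left_module R M" "left_module R N" "f \<in> lmod_hom R M N" "g \<in> lmod_hom R M N"
 shows "(%x. f x \<ominus>$N g x) \<in> lmod_hom R M N"
proof -
 interpret N: left_module R N by fact
 note cl = lmod_hom_closed[OF assms(3)] lmod_hom_closed[OF assms(4)]
 show ?thesis
  by (rule lmod_homI)
   (simp_all add: cl lmod_hom_add[OF assms(3)] lmod_hom_add[OF assms(4)] N.M.a_ac N.smult_r_minus
    N.smult_r_distr lmod_hom_smult[OF assms(3)] lmod_hom_smult[OF assms(4)] a_minus_def N.M.minus_add
    N.smult_r_neg)
qed

lemma lmod_hom_finsum_fun:
 assumes "left_module R M" "left_module R N" "finite J" "!!j. j \<in> J ==> f j \<in> lmod_hom R M N"
 shows "(%x. \<Oplus>$N j\<in>J. f j x) \<in> lmod_hom R M N"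
 using assms(3,4)
proof (induct rule: finite_induct)
 case empty
 interpret N: left_module R N by fact
 show ?case by (rule lmod_homI) (simp_all add: N.smult_zeros)
next
 case (insert j J)
 interpret N: left_module R N by fact
 interpret M: left_module R M by fact
 have cl: "f i x :. N" if "i \<in> insert j J" "x :. M" for i x
  using insert(4)[OF that(1)] that(2) by (rule lmod_hom_closed)
 have "(%x. f j x \<oplus>$N (\<Oplus>$N j\<in>J. f j x)) \<in> lmod_hom R M N"
  using insert by (intro lmod_hom_add_fun[OF assms(1,2)]) auto
 moreover have "(\<Oplus>$N i\<in>insert j J. f i x) = f j x \<oplus>$N (\<Oplus>$N j\<in>J. f j x)" if "x :. M" for x
  using cl that insert(1,2) by (intro N.M.finsum_insert) auto
 ultimately show ?case
  by (auto simp: lmod_hom_def)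
qed

lemma left_module_submodule:
 assumes "left_module R M" "H \<subseteq> carrier M" "\<zero>$M \<in> H"
  and "!!x y. [|x \<in> H; y \<in> H|] ==> x \<oplus>$M y \<in> H"
  and "!!r x. [|r :. R; x \<in> H|] ==> r \<odot>$M x \<in> H"
 shows "left_module R (M\<lparr>carrier := H\<rparr>)"
proof -
 interpret M: left_module R M by fact
 have sub: "x \<in> H ==> x :. M" for x using assms(2) by blast
 show ?thesis
 proof (intro left_module.intro left_module_axioms.intro abelian_groupI M.R.ring_axioms)
  fix x assume "x :. (M\<lparr>carrier := H\<rparr>)"
  then have x: "x \<in> H" by simp
  have "(\<ominus>$R \<one>$R) \<odot>$M x \<in> H" using assms(5)[OF _ x] by simp
  then show "\<exists>y\<in>carrier (M\<lparr>carrier := H\<rparr>). y \<oplus>$(M\<lparr>carrier := H\<rparr>) x = \<zero>$(M\<lparr>carrier := H\<rparr>)"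
   using x by (intro bexI[of _ "\<ominus>$M x"]) (simp_all add: M.smult_neg_one sub M.M.l_neg)
 qed (auto simp: assms(3-5) sub M.M.a_ac M.smult_l_distr M.smult_r_distr M.smult_assoc)
qed

lemma submoduleI:
 assumes "left_module R M" "H \<subseteq> carrier M" "\<zero>$M \<in> H"
  and "!!x y. [|x \<in> H; y \<in> H|] ==> x \<oplus>$M y \<in> H"
  and "!!r x. [|r :. R; x \<in> H|] ==> r \<odot>$M x \<in> H"
 shows "submodule H R M"
proof (intro submodule.intro subgroup.intro submodule_axioms.intro)
 interpret M: left_module R M by fact
 fix x assume x: "x \<in> H"
 then show "inv\<^bsub>add_monoid M\<^esub> x \<in> H"
  using assms(5)[OF _ x, of "\<ominus>$R \<one>$R"] assms(2) by (auto simp: M.smult_neg_one a_inv_def[symmetric])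
qed (use assms in auto)

lemma image_module:
 assumes "left_module R M" "left_module R N" "f \<in> lmod_hom R M N"
 shows "left_module R (N\<lparr>carrier := f ` carrier M\<rparr>)"
proof (rule left_module_submodule[OF assms(2)])
 interpret M: left_module R M by fact
 show "f ` carrier M \<subseteq> carrier N" using lmod_hom_closed[OF assms(3)] by blast
 show "\<zero>$N \<in> f ` carrier M" using lmod_hom_zero[OF assms] M.M.zero_closed by (metis image_eqI)
 show "x \<oplus>$N y \<in> f ` carrier M" if "x \<in> f ` carrier M" "y \<in> f ` carrier M" for x y
  using that by (auto simp: lmod_hom_add[OF assms(3), symmetric])
 show "r \<odot>$N x \<in> f ` carrier M" if "r :. R" "x \<in> f ` carrier M" for r x
  using that by (auto simp: lmod_hom_smult[OF assms(3), symmetric])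
qed

lemma kernel_module:
 assumes "left_module R M" "left_module R N" "f \<in> lmod_hom R M N"
 shows "left_module R (M\<lparr>carrier := lmod_ker M N f\<rparr>)"
proof (rule left_module_submodule[OF assms(1)])
 interpret M: left_module R M by fact
 interpret N: left_module R N by fact
 show "\<zero>$M \<in> lmod_ker M N f" using lmod_hom_zero[OF assms] by (simp add: lmod_ker_def)
 show "x \<oplus>$M y \<in> lmod_ker M N f" if "x \<in> lmod_ker M N f" "y \<in> lmod_ker M N f" for x y
  using that by (simp add: lmod_ker_def lmod_hom_add[OF assms(3)])
 show "r \<odot>$M x \<in> lmod_ker M N f" if "r :. R" "x \<in> lmod_ker M N f" for r x
  using that by (simp add: lmod_ker_def lmod_hom_smult[OF assms(3)] N.smult_zeros)
qed (auto simp: lmod_ker_def)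

lemma projective_imp_left_module: "projective_module R P ==> left_module R P"
 by (simp add: projective_module_def)

text \<open>
  The lifting problem is posed for the submodule \<open>g ` carrier N\<close>, so \<open>g\<close> need not be onto.
\<close>

lemma projective_lift_into_image:
 assumes "projective_module R P" "left_module R N" "left_module R N'" "g \<in> lmod_hom R N N'"
  and "h \<in> lmod_hom R P N'" "h ` carrier P \<subseteq> g ` carrier N"
 shows "\<exists>l\<in>lmod_hom R P N. \<forall>x\<in>carrier P. g (l x) = h x"
proof -
 let ?I = "N'\<lparr>carrier := g ` carrier N\<rparr>"
 have "g \<in> lmod_hom R N ?I" "h \<in> lmod_hom R P ?I"
  using assms(4-6) by (auto simp: lmod_hom_def)
 then show ?thesis
  by (intro projective_module_lift[OF assms(1,2) image_module[OF assms(2,3,4)]]) auto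
qed

lemma free_extend_zero_one:
 assumes "left_module R N" "n \<in> C \<rightarrow> carrier N" "c \<in> C"
 shows "(%x. if x = c then \<one>$R else \<zero>$R) :. (free_module R C)"
  and "free_extend R N n (%x. if x = c then \<one>$R else \<zero>$R) = n c"
proof -
 interpret N: left_module R N by fact
 show u: "(%x. if x = c then \<one>$R else \<zero>$R) :. (free_module R C)"
  using assms(3) by (auto simp: free_module_def)
 have "n c :. N" using assms(2,3) by blast
 then show "free_extend R N n (%x. if x = c then \<one>$R else \<zero>$R) = n c"
  by (subst free_extend_superset[OF assms(1,2) u, of "{c}"]) (use assms(3) in auto)
qed

lemma free_module_generates:
 assumes "left_module R N" "left_module R N'" "n \<in> C \<rightarrow> carrier N" "g \<in> lmod_hom R N N'"
  and "f :. (free_module R C)"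
 shows "g (free_extend R N n f) = free_extend R N' (%c. g (n c)) f"
proof -
 interpret N: left_module R N by fact
 interpret N': left_module R N' by fact
 let ?S = "{x. f x ~= \<zero>$R}"
 have S: "finite ?S" "?S \<subseteq> C" "!!x. f x :. R"
  using assms(5) by (auto simp: free_module_def)
 have n: "n x :. N" if "x \<in> ?S" for x using assms(3) S(2) that by blast
 have "g (free_extend R N n f) = (\<Oplus>$N' x\<in>?S. g (f x \<odot>$N n x))"
  unfolding free_extend_def
  by (rule lmod_hom_finsum[OF assms(1,2,4) S(1)]) (use S n in auto)
 also have "... = free_extend R N' (%c. g (n c)) f"
  unfolding free_extend_def
  by (rule N'.M.finsum_cong'[OF HOL.refl])
   (use n S in \<open>auto simp: lmod_hom_smult[OF assms(4)] intro!: N'.smult_closed lmod_hom_closed[OF assms(4)]\<close>)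
 finally show ?thesis .
qed

lemma free_module_expand:
 assumes "ring R" "f :. (free_module R C)"
 shows "free_extend R (free_module R C) (%c x. if x = c then \<one>$R else \<zero>$R) f = f"
proof -
 interpret R: ring R by fact
 let ?F = "free_module R C"
 interpret F: left_module R ?F by (rule left_module_free_module[OF assms(1)])
 let ?u = "%c x. if x = c then \<one>$R else \<zero>$R"
 let ?S = "{x. f x ~= \<zero>$R}"
 have S: "finite ?S" "?S \<subseteq> C" "!!x. f x :. R"
  using assms(2) by (auto simp: free_module_def)
 have u: "?u c :. ?F" if "c \<in> C" for c
  using that by (auto simp: free_module_def)
 have "(\<Oplus>$(?F)c\<in>T. f c \<odot>$(?F) ?u c) = (%x. if x \<in> T then f x else \<zero>$R)"
  if "finite T" "T \<subseteq> C" for T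
  using that
 proof (induct rule: finite_induct)
  case empty
  have "\<zero>$(?F) = (%_. \<zero>$R)" by (simp add: free_module_def)
  then show ?case by simp
 next
  case (insert c T)
  have "(\<Oplus>$(?F)c\<in>insert c T. f c \<odot>$(?F) ?u c) =
    f c \<odot>$(?F) ?u c \<oplus>$(?F) (\<Oplus>$(?F)c\<in>T. f c \<odot>$(?F) ?u c)"
   using insert(1,2,4) by (intro F.M.finsum_insert) (auto intro!: F.smult_closed u S(3))
  also have "... = (%x. if x \<in> insert c T then f x else \<zero>$R)"
   using insert(2,3,4) S(3) by (auto simp: free_module_def)
  finally show ?case .
 qed
 from this[OF S(1,2)] show ?thesis by (auto simp: free_extend_def)
qed

lemma free_extend_unique:
 assumes "left_module R N" "h \<in> lmod_hom R (free_module R C) N" "f :. (free_module R C)"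
 shows "h f = free_extend R N (%c. h (%x. if x = c then \<one>$R else \<zero>$R)) f"
proof -
 interpret N: left_module R N by fact
 have "(%c x. if x = c then \<one>$R else \<zero>$R) \<in> C \<rightarrow> carrier (free_module R C)"
  by (auto simp: free_module_def)
 from free_module_generates[OF left_module_free_module[OF N.R.ring_axioms] assms(1) this assms(2,3)]
 show ?thesis by (simp add: free_module_expand[OF N.R.ring_axioms assms(3)])
qed

text \<open>
  On the free module a lift is prescribed by choosing preimages on the basis; composed with the section \<open>s\<close>
  it lifts maps out of \<open>P\<close>.
\<close>

lemma projective_retract_of_free:
 fixes R :: "('r, 's) ring_scheme" and P :: "('r, 'p) module" and C :: "'c set"
 assumes P: "left_module R P" and s: "s \<in> lmod_hom R P (free_module R C)"
  and p: "p \<in> lmod_hom R (free_module R C) P" and ps: "!!x. x :. P ==> p (s x) = x"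
 shows "projective_module R P"
 unfolding projective_module_def
proof (intro conjI P allI impI)
 fix N :: "('r, 'p => 'r) module" and N' :: "('r, 'p) module" and g h
 assume "left_module R N & left_module R N' & g \<in> lmod_hom R N N' & g ` carrier N = carrier N' &
  h \<in> lmod_hom R P N'"
 then have N: "left_module R N" and N': "left_module R N'" and g: "g \<in> lmod_hom R N N'"
  and gs: "g ` carrier N = carrier N'" and h: "h \<in> lmod_hom R P N'" by auto
 interpret P: left_module R P by fact
 let ?u = "\<lambda>(c::'c) x. if x = c then \<one>$R else \<zero>$R"
 have u: "?u c :. (free_module R C)" if "c \<in> C" for c
  using that by (auto simp: free_module_def)
 define n where "n c = (SOME y. y :. N & g y = h (p (?u c)))" for c
 have n: "n c :. N & g (n c) = h (p (?u c))" if "c \<in> C" for c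
 proof -
  have "h (p (?u c)) \<in> g ` carrier N"
   using lmod_hom_closed[OF h lmod_hom_closed[OF p u[OF that]]] gs by simp
  then obtain y where "h (p (?u c)) = g y" "y :. N" by (rule imageE)
  then have "\<exists>y. y :. N & g y = h (p (?u c))" by (intro exI[of _ y]) simp
  then show ?thesis unfolding n_def by (rule someI_ex)
 qed
 then have n': "n \<in> C \<rightarrow> carrier N" by blast
 have eq: "g (free_extend R N n f) = h (p f)" if f: "f :. (free_module R C)" for f
 proof -
  interpret N': left_module R N' by fact
  have "h (p f) = free_extend R N' (%c. h (p (?u c))) f"
   by (rule free_extend_unique[OF N' lmod_hom_comp[OF p h] f])
  also have "... = free_extend R N' (%c. g (n c)) f"
   unfolding free_extend_def
  proof (rule N'.M.finsum_cong'[OF HOL.refl])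
   have fc: "f i :. R" "f i ~= \<zero>$R ==> i \<in> C" for i
    using f by (auto simp: free_module_def)
   show "(%i. f i \<odot>$N' g (n i)) \<in> {x. f x ~= \<zero>$R} \<rightarrow> carrier N'"
    using fc n by (auto intro!: lmod_hom_closed[OF g])
   show "f i \<odot>$N' h (p (?u i)) = f i \<odot>$N' g (n i)" if "i \<in> {x. f x ~= \<zero>$R}" for i
    using fc(2) n that by simp
  qed
  also have "... = g (free_extend R N n f)"
   by (rule free_module_generates[OF N N' n' g f, symmetric])
  finally show ?thesis by simp
 qed
 show "\<exists>l\<in>lmod_hom R P N. \<forall>x\<in>carrier P. g (l x) = h x"
 proof (intro bexI ballI)
  show "(%x. free_extend R N n (s x)) \<in> lmod_hom R P N"
   by (rule lmod_hom_comp[OF s free_extend_hom[OF N n']])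
  show "g (free_extend R N n (s x)) = h x" if "x :. P" for x
   using eq[OF lmod_hom_closed[OF s that]] ps[OF that] by simp
 qed
qed

lemma projective_free_module: "ring R ==> projective_module R (free_module R C)"
 by (rule projective_retract_of_free[OF left_module_free_module lmod_hom_id lmod_hom_id]) simp_all

lemma free_cover:
 assumes "left_module R P"
 shows "free_extend R P (%x. x) \<in> lmod_hom R (free_module R (carrier P)) P"
  and "free_extend R P (%x. x) ` carrier (free_module R (carrier P)) = carrier P"
proof -
 have id: "(%x. x) \<in> carrier P \<rightarrow> carrier P" by simp
 show h: "free_extend R P (%x. x) \<in> lmod_hom R (free_module R (carrier P)) P"
  by (rule free_extend_hom[OF assms id])
 show "free_extend R P (%x. x) ` carrier (free_module R (carrier P)) = carrier P"
  using free_extend_zero_one[OF assms id] lmod_hom_closed[OF h] by (force simp: image_iff)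
qed

lemma projective_free_retract:
 assumes "projective_module R P"
 obtains s p where "s \<in> lmod_hom R P (free_module R (carrier P))"
  "p \<in> lmod_hom R (free_module R (carrier P)) P" "!!x. x :. P ==> p (s x) = x"
proof -
 have P: "left_module R P" using assms by (rule projective_imp_left_module)
 interpret P: left_module R P by fact
 show ?thesis
  using projective_module_lift[OF assms left_module_free_module[OF P.R.ring_axioms] P free_cover[OF P]
    lmod_hom_id] that free_cover(1)[OF P] by blast
qed

text \<open>
  A lift for \<open>P\<close> is a lift for \<open>Q\<close> precomposed with the section \<open>s\<close>.
\<close>

lemma projective_retract:
 assumes "left_module R P" "projective_module R Q" "s \<in> lmod_hom R P Q" "p \<in> lmod_hom R Q P"
  and "!!x. x :. P ==> p (s x) = x"
 shows "projective_module R P"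
proof -
 obtain s' p' where sp: "s' \<in> lmod_hom R Q (free_module R (carrier Q))"
  "p' \<in> lmod_hom R (free_module R (carrier Q)) Q" "!!x. x :. Q ==> p' (s' x) = x"
  using projective_free_retract[OF assms(2)] by blast
 show ?thesis
  by (rule projective_retract_of_free[OF assms(1) lmod_hom_comp[OF assms(3) sp(1)]
     lmod_hom_comp[OF sp(2) assms(4)]])
   (simp add: sp(3) lmod_hom_closed[OF assms(3)] assms(5))
qed

section \<open>Projective resolutions and projective dimension\<close>

definition resolution ::
  "('r, 's) ring_scheme => ('r, 'm) module =>
   (nat => ('r, 'u) module) => (nat => 'u => 'u) => ('u => 'm) => bool" where
 "resolution R M P d \<epsilon> \<longleftrightarrow>
   left_module R M &
   (\<forall>i. projective_module R (P i)) &
   (\<forall>i. d i \<in> lmod_hom R (P (Suc i)) (P i)) &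
   \<epsilon> \<in> lmod_hom R (P 0) M &
   \<epsilon> ` carrier (P 0) = carrier M &
   lmod_ker (P 0) M \<epsilon> = d 0 ` carrier (P (Suc 0)) &
   (\<forall>i. lmod_ker (P (Suc i)) (P i) (d i) = d (Suc i) ` carrier (P (Suc (Suc i))))"

text \<open>
  The image of \<open>d n\<close> is a direct summand of \<open>P n\<close>. This is the form in which \<open>pd \<le> n\<close> is
  carried from one ring to another: it mentions a single map between two given modules.
\<close>

definition boundary_retract ::
  "('r, 's) ring_scheme => (nat => ('r, 'u) module) => (nat => 'u => 'u) => nat => bool" where
 "boundary_retract R P d n \<longleftrightarrow> (\<exists>r\<in>lmod_hom R (P n) (P n).
   r ` carrier (P n) \<subseteq> d n ` carrier (P (Suc n)) & (\<forall>x\<in>carrier (P (Suc n)). r (d n x) = d n x))"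

lemma resolutionD:
 assumes "resolution R M P d \<epsilon>"
 shows "left_module R M" "projective_module R (P i)" "left_module R (P i)"
  "d i \<in> lmod_hom R (P (Suc i)) (P i)" "\<epsilon> \<in> lmod_hom R (P 0) M"
  "m :. M ==> \<exists>x\<in>carrier (P 0). m = \<epsilon> x"
  "x :. (P (Suc 0)) ==> \<epsilon> (d 0 x) = \<zero>$M"
  "y :. (P 0) ==> \<epsilon> y = \<zero>$M ==> \<exists>x\<in>carrier (P (Suc 0)). y = d 0 x"
  "z :. (P (Suc (Suc i))) ==> d i (d (Suc i) z) = \<zero>$(P i)"
  "w :. (P (Suc i)) ==> d i w = \<zero>$(P i) ==> \<exists>x\<in>carrier (P (Suc (Suc i))). w = d (Suc i) x"
proof -
 have ker0: "lmod_ker (P 0) M \<epsilon> = d 0 ` carrier (P (Suc 0))" and onto: "\<epsilon> ` carrier (P 0) = carrier M"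
  and kerS: "lmod_ker (P (Suc i)) (P i) (d i) = d (Suc i) ` carrier (P (Suc (Suc i)))"
  using assms by (simp_all add: resolution_def)
 show "left_module R M" "projective_module R (P i)" "left_module R (P i)"
  "d i \<in> lmod_hom R (P (Suc i)) (P i)" "\<epsilon> \<in> lmod_hom R (P 0) M"
  using assms by (simp_all add: resolution_def projective_imp_left_module)
 show "m :. M ==> \<exists>x\<in>carrier (P 0). m = \<epsilon> x"
  using onto by blast
 show "x :. (P (Suc 0)) ==> \<epsilon> (d 0 x) = \<zero>$M"
  using ker0 by (auto simp: lmod_ker_def)
 show "y :. (P 0) ==> \<epsilon> y = \<zero>$M ==> \<exists>x\<in>carrier (P (Suc 0)). y = d 0 x"
  using ker0 by (auto simp: lmod_ker_def set_eq_iff image_iff)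
 show "z :. (P (Suc (Suc i))) ==> d i (d (Suc i) z) = \<zero>$(P i)"
  using kerS by (auto simp: lmod_ker_def)
 show "w :. (P (Suc i)) ==> d i w = \<zero>$(P i) ==> \<exists>x\<in>carrier (P (Suc (Suc i))). w = d (Suc i) x"
  using kerS by (auto simp: lmod_ker_def set_eq_iff image_iff)
qed

definition lift_chain_map ::
  "('r, 's) ring_scheme => (nat => ('r, 'u) module) => (nat => 'u => 'u) => ('u => 'm) =>
   (nat => ('r, 'w) module) => (nat => 'w => 'w) => ('w => 'n) => ('m => 'n) => (nat => 'u => 'w) => bool" where
 "lift_chain_map R P d \<epsilon> Q \<delta> \<eta> \<phi> f \<longleftrightarrow>
   (\<forall>i. f i \<in> lmod_hom R (P i) (Q i)) &
   (\<forall>x\<in>carrier (P 0). \<eta> (f 0 x) = \<phi> (\<epsilon> x)) &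
   (\<forall>i. \<forall>x\<in>carrier (P (Suc i)). \<delta> i (f (Suc i) x) = f i (d i x))"

text \<open>
  The comparison theorem: each \<open>P i\<close> is projective and each cycle of \<open>Q\<close> is a boundary, so the
  lift is built degree by degree.
\<close>

lemma chain_map_lift_exists:
 assumes P: "resolution R M P d \<epsilon>" and Q: "resolution R N Q \<delta> \<eta>" and \<phi>: "\<phi> \<in> lmod_hom R M N"
 shows "\<exists>f. lift_chain_map R P d \<epsilon> Q \<delta> \<eta> \<phi> f"
proof -
 note PD = resolutionD[OF P] note QD = resolutionD[OF Q]
 let ?G = "%n f. f \<in> lmod_hom R (P n) (Q n) &
  (\<forall>x\<in>carrier (P (Suc n)). f (d n x) \<in> \<delta> n ` carrier (Q (Suc n))) &
  (n = 0 \<longrightarrow> (\<forall>x\<in>carrier (P 0). \<eta> (f x) = \<phi> (\<epsilon> x)))"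
 have "\<exists>f. \<forall>n. ?G n (f n) & (\<forall>x\<in>carrier (P (Suc n)). \<delta> n (f (Suc n) x) = f n (d n x))"
 proof (rule dependent_nat_choice)
  have "(%x. \<phi> (\<epsilon> x)) ` carrier (P 0) \<subseteq> \<eta> ` carrier (Q 0)"
   using QD(6) lmod_hom_closed[OF lmod_hom_comp[OF PD(5) \<phi>]] by blast
  then obtain l where l: "l \<in> lmod_hom R (P 0) (Q 0)" "!!x. x :. (P 0) ==> \<eta> (l x) = \<phi> (\<epsilon> x)"
   using projective_lift_into_image[OF PD(2) QD(3) QD(1) QD(5) lmod_hom_comp[OF PD(5) \<phi>]] by blast
  have "l (d 0 x) \<in> \<delta> 0 ` carrier (Q (Suc 0))" if x: "x :. (P (Suc 0))" for x
  proof -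
   have dx: "d 0 x :. (P 0)" using lmod_hom_closed[OF PD(4) x] .
   have "\<eta> (l (d 0 x)) = \<zero>$N"
    using l(2)[OF dx] PD(7)[OF x] lmod_hom_zero[OF PD(1) QD(1) \<phi>] by simp
   then show ?thesis using QD(8)[OF lmod_hom_closed[OF l(1) dx]] by blast
  qed
  with l show "\<exists>f. ?G 0 f" by blast
 next
  fix f n assume f: "?G n f"
  then have fh: "f \<in> lmod_hom R (P n) (Q n)"
   and fi: "(%x. f (d n x)) ` carrier (P (Suc n)) \<subseteq> \<delta> n ` carrier (Q (Suc n))" by blast+
  obtain l where l: "l \<in> lmod_hom R (P (Suc n)) (Q (Suc n))"
    "!!x. x :. (P (Suc n)) ==> \<delta> n (l x) = f (d n x)"
   using projective_lift_into_image[OF PD(2) QD(3) QD(3) QD(4) lmod_hom_comp[OF PD(4) fh] fi] by blast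
  have "l (d (Suc n) x) \<in> \<delta> (Suc n) ` carrier (Q (Suc (Suc n)))" if x: "x :. (P (Suc (Suc n)))" for x
  proof -
   have dx: "d (Suc n) x :. (P (Suc n))" using lmod_hom_closed[OF PD(4) x] .
   have "\<delta> n (l (d (Suc n) x)) = \<zero>$(Q n)"
    using l(2)[OF dx] PD(9)[OF x] lmod_hom_zero[OF PD(3) QD(3) fh] by simp
   then show ?thesis using QD(10)[OF lmod_hom_closed[OF l(1) dx]] by blast
  qed
  with l show "\<exists>g. ?G (Suc n) g & (\<forall>x\<in>carrier (P (Suc n)). \<delta> n (g x) = f (d n x))" by blast
 qed
 then obtain f where f: "!!n. ?G n (f n)"
  "!!n. \<forall>x\<in>carrier (P (Suc n)). \<delta> n (f (Suc n) x) = f n (d n x)" by blast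
 show ?thesis
  unfolding lift_chain_map_def using f by (intro exI[of _ f]) blast
qed

text \<open>
  A chain map over the zero map is null-homotopic, \<open>u = \<delta> h + h' d\<close>; on boundaries the second
  summand vanishes.
\<close>

lemma null_homotopy_on_boundaries:
 assumes P: "resolution R M P d \<epsilon>" and Q: "resolution R N Q \<delta> \<eta>"
  and u: "!!i. u i \<in> lmod_hom R (P i) (Q i)"
  and u0: "!!x. x :. (P 0) ==> \<eta> (u 0 x) = \<zero>$N"
  and ud: "!!i x. x :. (P (Suc i)) ==> \<delta> i (u (Suc i) x) = u i (d i x)"
 shows "\<exists>h\<in>lmod_hom R (P n) (Q (Suc n)). \<forall>x\<in>carrier (P (Suc n)). u n (d n x) = \<delta> n (h (d n x))"
proof (induct n)
 note PD = resolutionD[OF P] note QD = resolutionD[OF Q]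
 case 0
 have "u 0 ` carrier (P 0) \<subseteq> \<delta> 0 ` carrier (Q (Suc 0))"
  using QD(8)[OF lmod_hom_closed[OF u] u0] by blast
 then obtain h where "h \<in> lmod_hom R (P 0) (Q (Suc 0))" "!!x. x :. (P 0) ==> \<delta> 0 (h x) = u 0 x"
  using projective_lift_into_image[OF PD(2) QD(3) QD(3) QD(4) u] by blast
 then show ?case using lmod_hom_closed[OF PD(4)] by (intro bexI[of _ h]) auto
next
 note PD = resolutionD[OF P] note QD = resolutionD[OF Q]
 case (Suc n)
 then obtain h where h: "h \<in> lmod_hom R (P n) (Q (Suc n))"
  "!!x. x :. (P (Suc n)) ==> u n (d n x) = \<delta> n (h (d n x))" by blast
 interpret Qn: left_module R "Q n" by (rule QD(3))
 interpret QS: left_module R "Q (Suc n)" by (rule QD(3))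
 let ?v = "%x. u (Suc n) x \<ominus>$(Q (Suc n)) h (d n x)"
 have hd: "(%x. h (d n x)) \<in> lmod_hom R (P (Suc n)) (Q (Suc n))" by (rule lmod_hom_comp[OF PD(4) h(1)])
 have v: "?v \<in> lmod_hom R (P (Suc n)) (Q (Suc n))"
  by (rule lmod_hom_minus_fun[OF PD(3) QD(3) u hd])
 have "?v x \<in> \<delta> (Suc n) ` carrier (Q (Suc (Suc n)))" if x: "x :. (P (Suc n))" for x
 proof -
  have "\<delta> n (?v x) = \<delta> n (u (Suc n) x) \<ominus>$(Q n) \<delta> n (h (d n x))"
   by (rule lmod_hom_minus[OF QD(3) QD(3) QD(4) lmod_hom_closed[OF u x] lmod_hom_closed[OF hd x]])
  also have "... = \<zero>$(Q n)"
   unfolding ud[OF x] h(2)[OF x] a_minus_def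
   by (rule Qn.M.r_neg) (rule lmod_hom_closed[OF QD(4) lmod_hom_closed[OF hd x]])
  finally show ?thesis using QD(10)[OF lmod_hom_closed[OF v x]] by blast
 qed
 then have "?v ` carrier (P (Suc n)) \<subseteq> \<delta> (Suc n) ` carrier (Q (Suc (Suc n)))" by blast
 then obtain k where k: "k \<in> lmod_hom R (P (Suc n)) (Q (Suc (Suc n)))"
  "!!x. x :. (P (Suc n)) ==> \<delta> (Suc n) (k x) = ?v x"
  using projective_lift_into_image[OF PD(2) QD(3) QD(3) QD(4) v] by blast
 show ?case
 proof (intro bexI[OF _ k(1)] ballI)
  fix x assume x: "x :. (P (Suc (Suc n)))"
  then have dx: "d (Suc n) x :. (P (Suc n))" by (rule lmod_hom_closed[OF PD(4)])
  have "h (d n (d (Suc n) x)) = \<zero>$(Q (Suc n))"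
   using PD(9)[OF x] lmod_hom_zero[OF PD(3) QD(3) h(1)] by simp
  then show "u (Suc n) (d (Suc n) x) = \<delta> (Suc n) (k (d (Suc n) x))"
   using k(2)[OF dx] lmod_hom_closed[OF u dx] by (simp add: a_minus_def)
 qed
qed

text \<open>
  The hypotheses make \<open>M\<close> a direct summand of a finite power of \<open>N\<close>. Lifting \<open>i j\<close> and \<open>p j\<close> to
  chain maps, \<open>\<Sum>\<^sub>j p j r (i j)\<close> is a retraction for \<open>P\<close> up to a chain map over zero, which is
  corrected by a null-homotopy. With \<open>J\<close> a singleton and identities this compares two resolutions of
  the same module.
\<close>

lemma boundary_retract_transfer:
 assumes P: "resolution R M P d \<epsilon>" and Q: "resolution R N Q \<delta> \<eta>" and J: "finite J"
  and i: "!!j. j \<in> J ==> i j \<in> lmod_hom R M N" and p: "!!j. j \<in> J ==> p j \<in> lmod_hom R N M"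
  and id: "!!x. x :. M ==> (\<Oplus>$M j\<in>J. p j (i j x)) = x"
  and Qn: "boundary_retract R Q \<delta> n"
 shows "boundary_retract R P d n"
proof -
 note PD = resolutionD[OF P] note QD = resolutionD[OF Q]
 interpret M: left_module R M by (rule PD(1))
 have "\<forall>j. \<exists>f. j \<in> J \<longrightarrow> lift_chain_map R P d \<epsilon> Q \<delta> \<eta> (i j) f"
  using chain_map_lift_exists[OF P Q i] by blast
 then obtain f where f: "!!j. j \<in> J ==> lift_chain_map R P d \<epsilon> Q \<delta> \<eta> (i j) (f j)" by metis
 have "\<forall>j. \<exists>f. j \<in> J \<longrightarrow> lift_chain_map R Q \<delta> \<eta> P d \<epsilon> (p j) f"
  using chain_map_lift_exists[OF Q P p] by blast
 then obtain g where g: "!!j. j \<in> J ==> lift_chain_map R Q \<delta> \<eta> P d \<epsilon> (p j) (g j)" by metis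
 note fD = f[unfolded lift_chain_map_def] note gD = g[unfolded lift_chain_map_def]
 have fh: "f j m \<in> lmod_hom R (P m) (Q m)" if "j \<in> J" for j m using fD[OF that] by blast
 have gh: "g j m \<in> lmod_hom R (Q m) (P m)" if "j \<in> J" for j m using gD[OF that] by blast
 have gf: "(%x. g j m (f j m x)) \<in> lmod_hom R (P m) (P m)" if "j \<in> J" for j m
  by (rule lmod_hom_comp[OF fh gh]) (rule that)+
 let ?s = "%m x. \<Oplus>$(P m)j\<in>J. g j m (f j m x)"
 have s: "?s m \<in> lmod_hom R (P m) (P m)" for m
  by (rule lmod_hom_finsum_fun[OF PD(3) PD(3) J gf])
 define u where "u m x = x \<ominus>$(P m) ?s m x" for m x
 have uh: "u m \<in> lmod_hom R (P m) (P m)" for m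
  using lmod_hom_minus_fun[OF PD(3) PD(3) lmod_hom_id s] unfolding u_def .
 have "\<epsilon> (?s 0 x) = \<epsilon> x" if x: "x :. (P 0)" for x
 proof -
  have "\<epsilon> (?s 0 x) = (\<Oplus>$M j\<in>J. \<epsilon> (g j 0 (f j 0 x)))"
   by (rule lmod_hom_finsum[OF PD(3) PD(1) PD(5) J]) (use lmod_hom_closed[OF gf x] in blast)
  also have "... = (\<Oplus>$M j\<in>J. p j (i j (\<epsilon> x)))"
  proof (rule M.M.finsum_cong'[OF HOL.refl])
   note ex = lmod_hom_closed[OF PD(5) x]
   show "(%j. p j (i j (\<epsilon> x))) \<in> J \<rightarrow> carrier M"
    using lmod_hom_closed[OF p] lmod_hom_closed[OF i] ex by blast
   fix j assume j: "j \<in> J"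
   have "\<epsilon> (g j 0 (f j 0 x)) = p j (\<eta> (f j 0 x))"
    using gD[OF j] lmod_hom_closed[OF fh[OF j] x] by blast
   also have "\<eta> (f j 0 x) = i j (\<epsilon> x)" using fD[OF j] x by blast
   finally show "\<epsilon> (g j 0 (f j 0 x)) = p j (i j (\<epsilon> x))" .
  qed
  also have "... = \<epsilon> x" by (rule id[OF lmod_hom_closed[OF PD(5) x]])
  finally show ?thesis .
 qed
 then have u0: "\<epsilon> (u 0 x) = \<zero>$M" if x: "x :. (P 0)" for x
  using lmod_hom_minus[OF PD(3) PD(1) PD(5) x lmod_hom_closed[OF s x]] lmod_hom_closed[OF PD(5) x] x
  by (simp add: u_def a_minus_def M.M.r_neg)
 have ud: "d m (u (Suc m) x) = u m (d m x)" if x: "x :. (P (Suc m))" for m x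
 proof -
  interpret Pm: left_module R "P m" by (rule PD(3))
  have dx: "d m x :. (P m)" using lmod_hom_closed[OF PD(4) x] .
  have "d m (?s (Suc m) x) = (\<Oplus>$(P m)j\<in>J. d m (g j (Suc m) (f j (Suc m) x)))"
   by (rule lmod_hom_finsum[OF PD(3) PD(3) PD(4) J]) (use lmod_hom_closed[OF gf x] in blast)
  also have "... = ?s m (d m x)"
  proof (rule Pm.M.finsum_cong'[OF HOL.refl])
   show "(%j. g j m (f j m (d m x))) \<in> J \<rightarrow> carrier (P m)" using lmod_hom_closed[OF gf dx] by blast
   fix j assume j: "j \<in> J"
   have "d m (g j (Suc m) (f j (Suc m) x)) = g j m (\<delta> m (f j (Suc m) x))"
    using gD[OF j] lmod_hom_closed[OF fh[OF j] x] by blast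
   also have "\<delta> m (f j (Suc m) x) = f j m (d m x)" using fD[OF j] x by blast
   finally show "d m (g j (Suc m) (f j (Suc m) x)) = g j m (f j m (d m x))" .
  qed
  finally show ?thesis
   unfolding u_def by (simp add: lmod_hom_minus[OF PD(3) PD(3) PD(4) x lmod_hom_closed[OF s x]])
 qed
 obtain h where h: "h \<in> lmod_hom R (P n) (P (Suc n))"
  and uh': "!!x. x :. (P (Suc n)) ==> u n (d n x) = d n (h (d n x))"
  using null_homotopy_on_boundaries[OF P P uh u0 ud] by blast
 obtain r where r: "r \<in> lmod_hom R (Q n) (Q n)" "r ` carrier (Q n) \<subseteq> \<delta> n ` carrier (Q (Suc n))"
  "!!x. x :. (Q (Suc n)) ==> r (\<delta> n x) = \<delta> n x"
  using Qn unfolding boundary_retract_def by blast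
 interpret Pn: left_module R "P n" by (rule PD(3))
 interpret PS: left_module R "P (Suc n)" by (rule PD(3))
 let ?t = "%x. \<Oplus>$(P n)j\<in>J. g j n (r (f j n x))"
 have grf: "(%x. g j n (r (f j n x))) \<in> lmod_hom R (P n) (P n)" if "j \<in> J" for j
  by (rule lmod_hom_comp[OF lmod_hom_comp[OF fh r(1)] gh]) (rule that)+
 have t: "?t \<in> lmod_hom R (P n) (P n)"
  by (rule lmod_hom_finsum_fun[OF PD(3) PD(3) J grf])
 have dh: "(%x. d n (h x)) \<in> lmod_hom R (P n) (P n)" by (rule lmod_hom_comp[OF h PD(4)])
 have tB: "?t x \<in> d n ` carrier (P (Suc n))" if x: "x :. (P n)" for x
 proof -
  have "\<exists>y\<in>carrier (P (Suc n)). g j n (r (f j n x)) = d n y" if j: "j \<in> J" for j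
  proof -
   obtain z where z: "z :. (Q (Suc n))" "r (f j n x) = \<delta> n z"
    using r(2) lmod_hom_closed[OF fh[OF j] x] by blast
   have "g j n (\<delta> n z) = d n (g j (Suc n) z)" using gD[OF j] z(1) by metis
   then show ?thesis using z lmod_hom_closed[OF gh[OF j] z(1)] by auto
  qed
  then obtain y where y: "!!j. j \<in> J ==> y j :. (P (Suc n))"
   "!!j. j \<in> J ==> g j n (r (f j n x)) = d n (y j)" by metis
  have "?t x = (\<Oplus>$(P n)j\<in>J. d n (y j))"
   by (rule Pn.M.finsum_cong'[OF HOL.refl]) (use y lmod_hom_closed[OF PD(4)] in auto)
  also have "... = d n (\<Oplus>$(P (Suc n))j\<in>J. y j)"
   by (rule lmod_hom_finsum[OF PD(3) PD(3) PD(4) J, symmetric]) (use y in auto)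
  finally show ?thesis using y(1) by auto
 qed
 show ?thesis
  unfolding boundary_retract_def
 proof (intro bexI conjI ballI)
  show "(%x. ?t x \<oplus>$(P n) d n (h x)) \<in> lmod_hom R (P n) (P n)"
   by (rule lmod_hom_add_fun[OF PD(3) PD(3) t dh])
  show "(%x. ?t x \<oplus>$(P n) d n (h x)) ` carrier (P n) \<subseteq> d n ` carrier (P (Suc n))"
  proof
   fix y assume "y \<in> (%x. ?t x \<oplus>$(P n) d n (h x)) ` carrier (P n)"
   then obtain x where x: "x :. (P n)" "y = ?t x \<oplus>$(P n) d n (h x)" by blast
   obtain w where w: "w :. (P (Suc n))" "?t x = d n w" using tB[OF x(1)] by blast
   have "y = d n (w \<oplus>$(P (Suc n)) h x)"
    using x w by (simp add: lmod_hom_add[OF PD(4)] lmod_hom_closed[OF h])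
   then show "y \<in> d n ` carrier (P (Suc n))" using w x lmod_hom_closed[OF h] by auto
  qed
  fix x assume x: "x :. (P (Suc n))"
  have dx: "d n x :. (P n)" using lmod_hom_closed[OF PD(4) x] .
  have "?t (d n x) = ?s n (d n x)"
  proof (rule Pn.M.finsum_cong'[OF HOL.refl])
   show "(%j. g j n (f j n (d n x))) \<in> J \<rightarrow> carrier (P n)" using lmod_hom_closed[OF gf dx] by blast
   fix j assume j: "j \<in> J"
   have "f j n (d n x) = \<delta> n (f j (Suc n) x)" using fD[OF j] x by metis
   then show "g j n (r (f j n (d n x))) = g j n (f j n (d n x))"
    using r(3)[OF lmod_hom_closed[OF fh[OF j] x]] by simp
  qed
  moreover have "d n (h (d n x)) = d n x \<ominus>$(P n) ?s n (d n x)"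
   using uh'[OF x] by (simp add: u_def)
  moreover have "?s n (d n x) \<oplus>$(P n) (d n x \<ominus>$(P n) ?s n (d n x)) = d n x"
   using dx lmod_hom_closed[OF s dx] by (simp add: a_minus_def Pn.M.a_lcomm Pn.M.r_neg)
  ultimately show "?t (d n x) \<oplus>$(P n) d n (h (d n x)) = d n x" by simp
 qed
qed

lemma transport_left_module:
 fixes M :: "('r, 'm) module" and \<phi> :: "'m => 'n"
 assumes "left_module R M" and \<phi>: "inj_on \<phi> (carrier M)"
 shows "left_module R (transport_module \<phi> M)"
  and "\<phi> \<in> lmod_hom R M (transport_module \<phi> M)"
  and "inv_into (carrier M) \<phi> \<in> lmod_hom R (transport_module \<phi> M) M"
  and "carrier (transport_module \<phi> M) = \<phi> ` carrier M"
proof -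
 let ?N = "transport_module \<phi> M" and ?\<psi> = "inv_into (carrier M) \<phi>"
 interpret M: left_module R M by fact
 have psi: "?\<psi> (\<phi> x) = x" if "x :. M" for x
  using that \<phi> by simp
 have sim: "carrier ?N = \<phi> ` carrier M" "\<zero>$(?N) = \<phi> \<zero>$M"
  "x \<oplus>$(?N) y = \<phi> (?\<psi> x \<oplus>$M ?\<psi> y)" "r \<odot>$(?N) x = \<phi> (r \<odot>$M ?\<psi> x)" for x y r
  by (simp_all add: transport_module_def Let_def)
 show "left_module R ?N"
 proof (intro left_module.intro left_module_axioms.intro abelian_groupI M.R.ring_axioms)
  fix x assume "x :. ?N"
  then obtain x' where "x' :. M" "x = \<phi> x'" by (auto simp: sim)
  then show "\<exists>y\<in>carrier ?N. y \<oplus>$(?N) x = \<zero>$(?N)"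
   by (intro bexI[of _ "\<phi> (\<ominus>$M x')"]) (auto simp: sim psi M.M.l_neg)
 qed (auto simp: sim psi M.M.a_ac M.smult_l_distr M.smult_r_distr M.smult_assoc)
 show "\<phi> \<in> lmod_hom R M ?N" "?\<psi> \<in> lmod_hom R ?N M" "carrier ?N = \<phi> ` carrier M"
  by (auto simp: lmod_hom_def sim psi)
qed

text \<open>
  Projective dimension is defined by resolutions with carriers in one fixed type of lists. A finitely
  supported function is coded there as the concatenation of blocks, one for each pair of a basis
  element, itself a list, and its coefficient. The leading length makes the concatenation decodable.
\<close>

definition coeff_block :: "('r + 'm + nat) list => 'r => ('r + 'm + nat) list" where
 "coeff_block x r = Inr (Inr (length x)) # x @ [Inl r]"

lemma coeff_blocks_inject:
 "concat (map (\<lambda>(x, r). coeff_block x r) ps) = concat (map (\<lambda>(x, r). coeff_block x r) qs) ==> ps = qs"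
proof (induct ps arbitrary: qs)
 case Nil
 then show ?case by (cases qs) (auto simp: coeff_block_def)
next
 case (Cons a ps)
 obtain x r where a: "a = (x, r)" by (cases a)
 with Cons(2) obtain b qs' where qs: "qs = b # qs'" by (cases qs) (auto simp: coeff_block_def)
 obtain y s where b: "b = (y, s)" by (cases b)
 have len: "length x = length y" and
  eq: "x @ Inl r # concat (map (\<lambda>(x, r). coeff_block x r) ps) =
   y @ Inl s # concat (map (\<lambda>(x, r). coeff_block x r) qs')"
  using Cons(2) by (simp_all add: a b qs coeff_block_def)
 then have "x = y" "r = s" "concat (map (\<lambda>(x, r). coeff_block x r) ps) =
   concat (map (\<lambda>(x, r). coeff_block x r) qs')"
  using append_eq_append_conv[of x y] by auto
 with Cons(1) show ?case by (simp add: a b qs)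
qed

text \<open>
  The free module on \<open>carrier Y\<close> is transported into the type of lists along the code, so the
  construction can be repeated for its kernel without leaving the type.
\<close>

lemma projective_cover_in_lists:
 fixes Y :: "('r, ('r + 'm + nat) list) module"
 assumes Y: "left_module R Y"
 shows "\<exists>(P :: ('r, ('r + 'm + nat) list) module) d.
  projective_module R P & d \<in> lmod_hom R P Y & d ` carrier P = carrier Y"
proof -
 interpret Y: left_module R Y by (rule Y)
 let ?F = "free_module R (carrier Y)"
 have F: "left_module R ?F" by (rule left_module_free_module) (rule Y.R.ring_axioms)
 let ?L = "%f ps. set ps = {(x, f x) | x. f x ~= \<zero>$R}"
 have ex: "\<exists>ps. ?L f ps" if "f :. ?F" for f
 proof -
  have "finite ((%x. (x, f x)) ` {x. f x ~= \<zero>$R})" using that by (simp add: free_module_def)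
  moreover have "(%x. (x, f x)) ` {x. f x ~= \<zero>$R} = {(x, f x) | x. f x ~= \<zero>$R}" by blast
  ultimately show ?thesis using finite_list by metis
 qed
 have "\<forall>f\<in>carrier ?F. \<exists>ps. ?L f ps" using ex by blast
 from bchoice[OF this] obtain L where L: "!!f. f :. ?F ==> ?L f (L f)" by blast
 define code :: "(('r + 'm + nat) list => 'r) => ('r + 'm + nat) list"
  where "code f = concat (map (\<lambda>(x, r). coeff_block x r) (L f))" for f
 have inj: "inj_on code (carrier ?F)"
 proof (rule inj_onI)
  fix f g assume fg: "f :. ?F" "g :. ?F" "code f = code g"
  have "L f = L g"
   using fg(3) unfolding code_def by (intro coeff_blocks_inject)
  have mem: "(x, y) \<in> set (L h) \<longleftrightarrow> h x ~= \<zero>$R & y = h x" if "h :. ?F" for h x y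
   unfolding L[OF that] by blast
  show "f = g"
  proof
   fix x
   have "f x ~= \<zero>$R & y = f x \<longleftrightarrow> g x ~= \<zero>$R & y = g x" for y
    using mem[OF fg(1), of x y] mem[OF fg(2), of x y] \<open>L f = L g\<close> by simp
   from this[of "f x"] this[of "g x"] show "f x = g x" by auto
  qed
 qed
 let ?P = "transport_module code ?F"
 note T = transport_left_module[OF F inj]
 let ?d = "%p. free_extend R Y (%x. x) (inv_into (carrier ?F) code p)"
 have "projective_module R ?P"
  by (rule projective_retract_of_free[OF T(1,3,2)]) (use T(4) in \<open>auto simp: f_inv_into_f\<close>)
 moreover have "?d \<in> lmod_hom R ?P Y" by (rule lmod_hom_comp[OF T(3) free_cover(1)[OF Y]])
 moreover have "?d ` carrier ?P = carrier Y"
  using inj free_cover(2)[OF Y] by (simp add: T(4) image_image)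
 ultimately show ?thesis by blast
qed

lemma projective_resolution_in_lists:
 fixes M :: "('r, 'm) module"
 assumes M: "left_module R M"
 shows "\<exists>(P :: nat => ('r, ('r + 'm + nat) list) module) d \<epsilon>. resolution R M P d \<epsilon>"
proof -
 let ?\<phi> = "%m. [Inr (Inl m)] :: ('r + 'm + nat) list"
 have inj: "inj_on ?\<phi> (carrier M)" by (rule inj_onI) simp
 let ?M = "transport_module ?\<phi> M" and ?\<psi> = "inv_into (carrier M) ?\<phi>"
 note T = transport_left_module[OF M inj]
 let ?G = "\<lambda>(n::nat) (Y, P :: ('r, ('r + 'm + nat) list) module, d). left_module R Y & projective_module R P & d \<in> lmod_hom R P Y &
  (n = 0 \<longrightarrow> Y = ?M & d ` carrier P = carrier Y)"
 let ?H = "\<lambda>(Y :: ('r, ('r + 'm + nat) list) module, P :: ('r, ('r + 'm + nat) list) module, d) (Y', P' :: ('r, ('r + 'm + nat) list) module, d'). Y' = P & d' ` carrier P' = lmod_ker P Y d"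
 have "\<exists>s. \<forall>n. ?G n (s n) & ?H (s n) (s (Suc n))"
 proof (rule dependent_nat_choice)
  obtain P d where "projective_module R (P :: ('r, ('r + 'm + nat) list) module)" "d \<in> lmod_hom R P ?M"
   "d ` carrier P = carrier ?M"
   using projective_cover_in_lists[OF T(1)] by blast
  then show "\<exists>s. ?G 0 s" using T(1) by (intro exI[of _ "(?M, P, d)"]) simp
 next
  fix s n assume s: "?G n s"
  obtain Y P d where s': "s = (Y, P, d)" by (cases s)
  have XPd: "left_module R Y" "projective_module R P" "d \<in> lmod_hom R P Y"
   using s by (simp_all add: s')
  have P: "left_module R P" using XPd(2) by (rule projective_imp_left_module)
  obtain P' d' where d': "projective_module R (P' :: ('r, ('r + 'm + nat) list) module)" "d' \<in> lmod_hom R P' (P\<lparr>carrier := lmod_ker P Y d\<rparr>)"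
   "d' ` carrier P' = lmod_ker P Y d"
   using projective_cover_in_lists[OF kernel_module[OF P XPd(1,3)]] by auto
  have "d' \<in> lmod_hom R P' P" using d'(2) by (auto simp: lmod_hom_def lmod_ker_def)
  then show "\<exists>s'. ?G (Suc n) s' & ?H s s'"
   using d' P by (intro exI[of _ "(P, P', d')"]) (simp add: s')
 qed
 then obtain s where s': "\<forall>n. ?G n (s n) & ?H (s n) (s (Suc n))" by (rule exE)
 note s = s'[THEN spec, THEN conjunct1] s'[THEN spec, THEN conjunct2]
 define Y P d where "Y n = fst (s n)" and "P n = fst (snd (s n))" and "d n = snd (snd (s n))" for n
 have sn: "s n = (Y n, P n, d n)" for n by (simp add: Y_def P_def d_def)
 have G: "left_module R (Y n)" "projective_module R (P n)" "d n \<in> lmod_hom R (P n) (Y n)" for n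
  using s(1)[of n] by (simp_all add: sn)
 have G0: "Y 0 = ?M" "d 0 ` carrier (P 0) = carrier ?M"
  using s(1)[of 0] by (simp_all add: sn)
 have H: "Y (Suc n) = P n" "d (Suc n) ` carrier (P (Suc n)) = lmod_ker (P n) (Y n) (d n)" for n
  using s(2)[of n] by (simp_all add: sn)
 have d0: "d 0 \<in> lmod_hom R (P 0) ?M" using G(3)[of 0] by (simp add: G0)
 have "resolution R M P (%i. d (Suc i)) (%x. ?\<psi> (d 0 x))"
  unfolding resolution_def
 proof (intro conjI allI M G(2))
  show "d (Suc i) \<in> lmod_hom R (P (Suc i)) (P i)" for i using G(3)[of "Suc i"] by (simp add: H(1))
  show "(%x. ?\<psi> (d 0 x)) \<in> lmod_hom R (P 0) M" by (rule lmod_hom_comp[OF d0 T(3)])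
  have "(%x. ?\<psi> (d 0 x)) ` carrier (P 0) = ?\<psi> ` d 0 ` carrier (P 0)" by (simp add: image_image)
  also have "... = carrier M" unfolding G0(2) T(4) by (rule inv_into_image_cancel[OF inj subset_refl])
  finally show "(%x. ?\<psi> (d 0 x)) ` carrier (P 0) = carrier M" .
  have "?\<psi> y = \<zero>$M \<longleftrightarrow> y = \<zero>$(?M)" if "y :. ?M" for y
   using that lmod_hom_zero[OF T(1) M T(3)] lmod_hom_zero[OF M T(1,2)] unfolding T(4)
   by (metis f_inv_into_f)
  then have "lmod_ker (P 0) M (%x. ?\<psi> (d 0 x)) = lmod_ker (P 0) (Y 0) (d 0)"
   using lmod_hom_closed[OF d0] by (auto simp: lmod_ker_def G0)
  then show "lmod_ker (P 0) M (%x. ?\<psi> (d 0 x)) = d (Suc 0) ` carrier (P (Suc 0))"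
   by (simp add: H(2))
  show "lmod_ker (P (Suc i)) (P i) (d (Suc i)) = d (Suc (Suc i)) ` carrier (P (Suc (Suc i)))" for i
   using H(2)[of "Suc i"] by (simp add: H(1))
 qed
 then show ?thesis by blast
qed

lemma projective_resolution_iff:
 assumes "left_module R M"
 shows "projective_resolution R M n P d \<epsilon> \<longleftrightarrow>
  resolution R M P d \<epsilon> & (\<forall>i>n. carrier (P i) = {\<zero>$(P i)})"
 using assms by (simp add: projective_resolution_def resolution_def)

text \<open>
  A retraction \<open>r\<close> onto the image of \<open>\<delta> n\<close> splits \<open>Q n\<close>; the complementary summand is projective and
  can replace \<open>Q n\<close> as the last module.
\<close>

lemma truncate_resolution:
 assumes Q: "resolution R M Q \<delta> \<eta>" and r: "boundary_retract R Q \<delta> n"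
 shows "\<exists>P d. projective_resolution R M n P d \<eta>"
proof -
 note QD = resolutionD[OF Q]
 interpret Qn: left_module R "Q n" by (rule QD(3))
 obtain r where r: "r \<in> lmod_hom R (Q n) (Q n)" "r ` carrier (Q n) \<subseteq> \<delta> n ` carrier (Q (Suc n))"
  "!!x. x :. (Q (Suc n)) ==> r (\<delta> n x) = \<delta> n x"
  using r unfolding boundary_retract_def by blast
 let ?K = "lmod_ker (Q n) (Q n) r" and ?z = "\<zero>$(Q n)"
 let ?QK = "Q n\<lparr>carrier := ?K\<rparr>" and ?O = "Q n\<lparr>carrier := {?z}\<rparr>"
 have QK: "left_module R ?QK" by (rule kernel_module[OF QD(3) QD(3) r(1)])
 have O: "left_module R ?O"
  by (rule left_module_submodule[OF QD(3)]) (auto simp: Qn.smult_zeros)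
 let ?p = "%x. x \<ominus>$(Q n) r x"
 have p: "?p \<in> lmod_hom R (Q n) (Q n)" by (rule lmod_hom_minus_fun[OF QD(3) QD(3) lmod_hom_id r(1)])
 have rr: "r (r x) = r x" if "x :. (Q n)" for x
  using r(2,3) that by force
 have pK: "?p x \<in> ?K" if "x :. (Q n)" for x
  using that lmod_hom_minus[OF QD(3) QD(3) r(1) that lmod_hom_closed[OF r(1) that]]
   lmod_hom_closed[OF p that] lmod_hom_closed[OF r(1) that]
  by (simp add: lmod_ker_def rr a_minus_def Qn.M.r_neg)
 have Kp: "?p x = x" if "x \<in> ?K" for x
  using that by (simp add: lmod_ker_def a_minus_def)
 have projK: "projective_module R ?QK"
 proof (rule projective_retract[OF QK QD(2)])
  show "(%x. x) \<in> lmod_hom R ?QK (Q n)" by (auto simp: lmod_hom_def lmod_ker_def)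
  show "?p \<in> lmod_hom R (Q n) ?QK" using p pK by (simp add: lmod_hom_def)
  show "?p x = x" if "x :. ?QK" for x using that Kp by simp
 qed
 have projO: "projective_module R ?O"
 proof (rule projective_retract[OF O QD(2)])
  show "(%x. x) \<in> lmod_hom R ?O (Q n)" by (auto simp: lmod_hom_def)
  show "(%x. ?z) \<in> lmod_hom R (Q n) ?O" by (auto simp: lmod_hom_def Qn.smult_zeros)
 qed simp
 have split: "x = ?p x \<oplus>$(Q n) r x" if "x :. (Q n)" for x
  using that lmod_hom_closed[OF r(1) that] by (simp add: a_minus_def Qn.M.a_assoc Qn.M.l_neg)
 define P where "P i = (if i < n then Q i else if i = n then ?QK else ?O)" for i
 define d where "d i = (if i < n then \<delta> i else (%_. ?z))" for i
 have PQ: "carrier (P i) \<subseteq> carrier (Q i)" "add (P i) = add (Q i)" "smult (P i) = smult (Q i)"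
  "\<zero>$(P i) = \<zero>$(Q i)" if "i \<le> n" for i
  using that by (auto simp: P_def lmod_ker_def)
 have disj: "x = ?z" if "x \<in> ?K" "x \<in> \<delta> n ` carrier (Q (Suc n))" for x
  using that r(3) by (auto simp: lmod_ker_def)
 have "resolution R M P d \<eta> & (\<forall>i>n. carrier (P i) = {\<zero>$(P i)})"
  unfolding resolution_def
 proof (intro conjI allI impI QD(1))
  show "projective_module R (P i)" for i using QD(2) projK projO by (simp add: P_def)
  show "d i \<in> lmod_hom R (P (Suc i)) (P i)" for i
  proof (cases "i < n")
   case True
   have "\<delta> i \<in> lmod_hom R (P (Suc i)) (Q i)"
    using lmod_hom_closed[OF QD(4)] lmod_hom_add[OF QD(4)] lmod_hom_smult[OF QD(4)] PQ[of "Suc i"] True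
    by (intro lmod_homI) (simp_all add: subset_iff)
   then show ?thesis using True by (simp add: d_def P_def)
  next
   case False
   then show ?thesis
    by (auto simp: d_def P_def lmod_hom_def Qn.smult_zeros lmod_ker_def lmod_hom_zero[OF QD(3) QD(3) r(1)])
  qed
  show "\<eta> \<in> lmod_hom R (P 0) M"
   using lmod_hom_closed[OF QD(5)] lmod_hom_add[OF QD(5)] lmod_hom_smult[OF QD(5)] PQ[of 0]
   by (intro lmod_homI) (simp_all add: subset_iff)
  have n0: "\<eta> (?p x) = \<eta> x" if "n = 0" "x :. (Q n)" for x
  proof -
   interpret M: left_module R M by (rule QD(1))
   have "\<eta> (r x) = \<zero>$M" using r(2) that QD(7) by force
   then have "\<eta> x = \<eta> (?p x) \<oplus>$M \<zero>$M"
    using arg_cong[OF split[OF that(2)], of \<eta>] that lmod_hom_add[OF QD(5)]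
     lmod_hom_closed[OF p that(2)] lmod_hom_closed[OF r(1) that(2)] by simp
   then show ?thesis using that lmod_hom_closed[OF QD(5)] lmod_hom_closed[OF p that(2)] by simp
  qed
  show "\<eta> ` carrier (P 0) = carrier M"
  proof
   show "\<eta> ` carrier (P 0) \<subseteq> carrier M" using PQ(1)[of 0] lmod_hom_closed[OF QD(5)] by auto
   show "carrier M \<subseteq> \<eta> ` carrier (P 0)"
   proof
    fix m assume "m :. M"
    then obtain x where x: "x :. (Q 0)" "m = \<eta> x" using QD(6) by blast
    show "m \<in> \<eta> ` carrier (P 0)"
    proof (cases "n = 0")
     case True
     then have "m = \<eta> (?p x)" using n0 x by simp
     then show ?thesis using pK x True by (auto simp: P_def)
    qed (use x in \<open>auto simp: P_def\<close>)
   qed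
  qed
  have np: "\<delta> i (?p x) = \<delta> i x" if "n = Suc i" "x :. (Q n)" for i x
  proof -
   interpret Qi: left_module R "Q i" by (rule QD(3))
   have "\<delta> i (r x) = \<zero>$(Q i)" using r(2) that QD(9) by force
   then have "\<delta> i x = \<delta> i (?p x) \<oplus>$(Q i) \<zero>$(Q i)"
    using arg_cong[OF split[OF that(2)], of "\<delta> i"] that lmod_hom_add[OF QD(4)]
     lmod_hom_closed[OF p that(2)] lmod_hom_closed[OF r(1) that(2)] by simp
   then show ?thesis using that lmod_hom_closed[OF QD(4)] lmod_hom_closed[OF p that(2)] by simp
  qed
  have img: "d i ` carrier (P (Suc i)) = \<delta> i ` carrier (Q (Suc i))" if "i < n" for i
  proof (cases "n = Suc i")
   case True
   have "\<delta> i x \<in> \<delta> i ` ?K" if "x :. (Q n)" for x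
    using np[OF True that] pK[OF that] by (metis image_eqI)
   then show ?thesis using True by (auto simp: d_def P_def lmod_ker_def)
  qed (use that in \<open>auto simp: d_def P_def\<close>)
  have zK: "?z \<in> ?K" by (simp add: lmod_ker_def lmod_hom_zero[OF QD(3) QD(3) r(1)])
  show "lmod_ker (P 0) M \<eta> = d 0 ` carrier (P (Suc 0))"
  proof (cases "n = 0")
   case True
   have "lmod_ker (P 0) M \<eta> = {?z}"
    using True disj QD(8) zK lmod_hom_zero[OF QD(3) QD(1) QD(5)]
    by (force simp: P_def lmod_ker_def)
   then show ?thesis using True by (simp add: P_def d_def)
  next
   case False
   then have "lmod_ker (P 0) M \<eta> = lmod_ker (Q 0) M \<eta>" by (simp add: P_def)
   also have "... = \<delta> 0 ` carrier (Q (Suc 0))" using Q by (simp add: resolution_def)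
   finally show ?thesis using img[of 0] False by simp
  qed
  show "lmod_ker (P (Suc i)) (P i) (d i) = d (Suc i) ` carrier (P (Suc (Suc i)))" for i
  proof (cases "Suc i < n")
   case True
   then have "lmod_ker (P (Suc i)) (P i) (d i) = lmod_ker (Q (Suc i)) (Q i) (\<delta> i)"
    by (simp add: P_def d_def)
   also have "... = \<delta> (Suc i) ` carrier (Q (Suc (Suc i)))" using Q by (simp add: resolution_def)
   finally show ?thesis using img[OF True] by simp
  next
   case False
   then consider "n = Suc i" | "n \<le> i" by linarith
   then show ?thesis
   proof cases
    case 1
    have "lmod_ker (P (Suc i)) (P i) (d i) = {?z}"
    proof
     show "lmod_ker (P (Suc i)) (P i) (d i) \<subseteq> {?z}"
      using 1 disj QD(10) by (force simp: P_def d_def lmod_ker_def)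
     show "{?z} \<subseteq> lmod_ker (P (Suc i)) (P i) (d i)"
      using 1 zK lmod_hom_zero[OF QD(3) QD(3) QD(4)] by (simp add: P_def d_def lmod_ker_def)
    qed
    then show ?thesis using 1 by (simp add: P_def d_def)
   next
    case 2
    then show ?thesis by (auto simp: P_def d_def lmod_ker_def)
   qed
  qed
 next
  show "carrier (P i) = {\<zero>$(P i)}" if "i > n" for i using that by (simp add: P_def)
 qed
 then show ?thesis using projective_resolution_iff[OF QD(1)] by blast
qed

lemma pd_le_iff_projective_resolution:
 fixes M :: "('r, 'm) module"
 shows "pd R M \<le> enat n \<longleftrightarrow> (\<exists>(P :: nat => ('r, ('r + 'm + nat) list) module) d \<epsilon>.
  projective_resolution R M n P d \<epsilon>)" (is "_ \<longleftrightarrow> ?E n")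
proof
 let ?S = "{enat m | m. ?E m}"
 assume le: "pd R M \<le> enat n"
 have ne: "?S ~= {}"
 proof
  assume "?S = {}"
  then have "pd R M = \<infinity>" unfolding pd_def Inf_enat_def by (rule if_P)
  with le show False by simp
 qed
 then have "Inf ?S \<in> ?S"
  unfolding Inf_enat_def using LeastI_ex[of "%x. x \<in> ?S"] by auto
 then obtain m where m: "pd R M = enat m" "?E m" by (auto simp: pd_def)
 then have "m \<le> n" using le by simp
 then have "projective_resolution R M m P d \<epsilon> ==> projective_resolution R M n P d \<epsilon>" for P d \<epsilon>
  by (auto simp: projective_resolution_def)
 with m(2) show "?E n" by blast
next
 assume "?E n"
 then show "pd R M \<le> enat n" unfolding pd_def by (intro Inf_lower) blast
qed

text \<open>
  If \<open>pd R M \<le> n\<close>, then some resolution of length \<open>n\<close> has the zero map as its retraction in degree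
  \<open>n\<close>, and the transfer lemma moves it to \<open>P\<close>; the converse is the truncation of \<open>P\<close>.
\<close>

theorem pd_le_iff_boundary_retract:
 assumes P: "resolution R M P d \<epsilon>"
 shows "pd R M \<le> enat n \<longleftrightarrow> boundary_retract R P d n"
proof -
 note M = resolutionD(1)[OF P]
 interpret M: left_module R M by (rule M)
 have transfer: "boundary_retract R P' d' n"
  if "resolution R M P' d' \<epsilon>'" "resolution R M Q \<delta> \<eta>" "boundary_retract R Q \<delta> n" for P' d' \<epsilon>' Q \<delta> \<eta>
  by (rule boundary_retract_transfer[OF that(1,2) finite.insertI[OF finite.emptyI] _ _ _ that(3),
     of "{()}" "%_ x. x" "%_ x. x"])
   (simp_all add: lmod_hom_id)
 show ?thesis
 proof
  assume "pd R M \<le> enat n"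
  then obtain Q :: "nat => ('a, ('a + 'c + nat) list) module" and \<delta> \<eta>
   where "projective_resolution R M n Q \<delta> \<eta>"
   unfolding pd_le_iff_projective_resolution by blast
  then have Q: "resolution R M Q \<delta> \<eta>" "!!i. i > n ==> carrier (Q i) = {\<zero>$(Q i)}"
   by (simp_all add: projective_resolution_iff[OF M])
  note QD = resolutionD[OF Q(1)]
  interpret Qn: left_module R "Q n" by (rule QD(3))
  have dz: "\<delta> n \<zero>$(Q (Suc n)) = \<zero>$(Q n)" by (rule lmod_hom_zero[OF QD(3) QD(3) QD(4)])
  have "boundary_retract R Q \<delta> n"
   unfolding boundary_retract_def
   by (rule bexI[of _ "%_. \<zero>$(Q n)"]) (auto simp: Q(2) dz lmod_hom_def Qn.smult_zeros)
  then show "boundary_retract R P d n" by (rule transfer[OF P Q(1)])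
 next
  assume r: "boundary_retract R P d n"
  obtain Q :: "nat => ('a, ('a + 'c + nat) list) module" and \<delta> \<eta> where Q: "resolution R M Q \<delta> \<eta>"
   using projective_resolution_in_lists[OF M] by blast
  have "boundary_retract R Q \<delta> n" by (rule transfer[OF Q P r])
  then show "pd R M \<le> enat n"
   unfolding pd_le_iff_projective_resolution using truncate_resolution[OF Q] by blast
 qed
qed

lemma enat_le_by_nat_bounds:
 fixes a b :: enat
 assumes "!!n. b \<le> enat n ==> a \<le> enat n"
 shows "a \<le> b"
 using assms by (cases b) auto

lemma pd_le_of_finite_retract:
 assumes M: "left_module R M" and N: "left_module R N" and J: "finite J"
  and "!!j. j \<in> J ==> i j \<in> lmod_hom R M N" and "!!j. j \<in> J ==> p j \<in> lmod_hom R N M"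
  and "!!x. x :. M ==> (\<Oplus>$M j\<in>J. p j (i j x)) = x"
 shows "pd R M \<le> pd R N"
proof (rule enat_le_by_nat_bounds)
 fix n assume n: "pd R N \<le> enat n"
 obtain P d \<epsilon> where P: "resolution R M (P :: nat => ('a, ('a + 'c + nat) list) module) d \<epsilon>"
  using projective_resolution_in_lists[OF M] by blast
 obtain Q \<delta> \<eta> where Q: "resolution R N (Q :: nat => ('a, ('a + 'd + nat) list) module) \<delta> \<eta>"
  using projective_resolution_in_lists[OF N] by blast
 show "pd R M \<le> enat n"
  unfolding pd_le_iff_boundary_retract[OF P]
  by (rule boundary_retract_transfer[OF P Q assms(3-6)]) (use n in \<open>simp_all add: pd_le_iff_boundary_retract[OF Q]\<close>)
qed

lemma finitely_generated_free_cover: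
 assumes M: "left_module R M" and H: "H \<subseteq> carrier M" and G: "finite G" "G \<subseteq> H"
  and sub: "submodule H R M" and gen: "\<And>H'. submodule H' R M ==> G \<subseteq> H' ==> H \<subseteq> H'"
 shows "\<exists>m f. f \<in> lmod_hom R (free_module R {..<m::nat}) M & f ` carrier (free_module R {..<m}) = H"
proof -
 interpret M: left_module R M by (rule M)
 obtain g and m :: nat where g: "G = g ` {..<m}"
  using finite_imp_nat_seg_image_inj_on[OF G(1)] unfolding lessThan_def by metis
 let ?F = "free_module R {..<m}"
 have F: "left_module R ?F" by (rule left_module_free_module) (rule M.R.ring_axioms)
 have gM: "g \<in> {..<m} \<rightarrow> carrier M" using g G H by blast
 let ?f = "free_extend R M g"
 have f: "?f \<in> lmod_hom R ?F M" by (rule free_extend_hom[OF M gM])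
 interpret I: left_module R "M\<lparr>carrier := ?f ` carrier ?F\<rparr>" by (rule image_module[OF F M f])
 have "submodule (?f ` carrier ?F) R M"
  using I.M.add.m_closed I.M.add.one_closed I.smult_closed lmod_hom_closed[OF f]
  by (intro submoduleI[OF M]) auto
 moreover have "G \<subseteq> ?f ` carrier ?F"
  unfolding g
 proof (rule image_subsetI)
  fix c assume c: "c \<in> {..<m}"
  show "g c \<in> ?f ` carrier ?F"
   by (rule image_eqI[where f = ?f, OF free_extend_zero_one(2)[OF M gM c, symmetric]
      free_extend_zero_one(1)[OF M gM c]])
 qed
 ultimately have "H \<subseteq> ?f ` carrier ?F" by (rule gen)
 moreover have "?f ` carrier ?F \<subseteq> H"
 proof
  interpret H: submodule H R M by (rule sub)
  fix y assume "y \<in> ?f ` carrier ?F"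
  then obtain x where x: "x :. ?F" "y = ?f x" by blast
  have xc: "x i :. R" "x i ~= \<zero>$R ==> i < m" for i
   using x(1) by (auto simp: free_module_def)
  have add: "a \<oplus>$M b \<in> H" if "a \<in> H" "b \<in> H" for a b using H.m_closed[OF that] by simp
  have "(\<Oplus>$M i\<in>T. x i \<odot>$M g i) \<in> H" if "finite T" "T \<subseteq> {..<m}" for T
   using that
  proof (induct rule: finite_induct)
   case empty then show ?case using H.one_closed by simp
  next
   case (insert i T)
   then have "x i \<odot>$M g i \<in> H" using H.smult_closed[OF xc(1)] g G(2) by blast
   moreover have "(\<Oplus>$M i\<in>insert i T. x i \<odot>$M g i) = x i \<odot>$M g i \<oplus>$M (\<Oplus>$M i\<in>T. x i \<odot>$M g i)"
    using insert(1,2,4) gM by (intro M.M.finsum_insert) (auto intro!: M.smult_closed xc(1))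
   ultimately show ?case using insert add by simp
  qed
  moreover have "{i. x i ~= \<zero>$R} \<subseteq> {..<m}" using xc(2) by auto
  ultimately show "y \<in> H" using finite_subset unfolding x(2) free_extend_def by blast
 qed
 ultimately show ?thesis using f by blast
qed

definition noetherian_free_modules :: "('r, 's) ring_scheme => bool" where
 "noetherian_free_modules R \<longleftrightarrow> (\<forall>m::nat. \<forall>H. submodule H R (free_module R {..<m}) \<longrightarrow>
   (\<exists>G. finite G & G \<subseteq> H & (\<forall>H'. submodule H' R (free_module R {..<m}) \<longrightarrow> G \<subseteq> H' \<longrightarrow> H \<subseteq> H')))"

text \<open>
  Over a ring whose free modules of finite rank are noetherian, each kernel is again finitely
  generated.
\<close>

lemma finite_free_resolution_exists:
 assumes "ring R" and noeth: "noetherian_free_modules R" and M: "left_module R M"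
  and \<epsilon>: "\<epsilon> \<in> lmod_hom R (free_module R {..<m::nat}) M" "\<epsilon> ` carrier (free_module R {..<m}) = carrier M"
 shows "\<exists>(k :: nat => nat) d. resolution R M (%i. free_module R {..<k i}) d \<epsilon>"
proof -
 let ?F = "\<lambda>m::nat. free_module R {..<m}"
 have F: "left_module R (?F m)" for m by (rule left_module_free_module[OF assms(1)])
 have cover: "\<exists>m' f'. f' \<in> lmod_hom R (?F m') (?F m) & f' ` carrier (?F m') = lmod_ker (?F m) Y f"
  if f: "f \<in> lmod_hom R (?F m) Y" and Y: "left_module R Y" for f m and Y :: "('a, 'd) module"
 proof -
  interpret K: left_module R "?F m\<lparr>carrier := lmod_ker (?F m) Y f\<rparr>" by (rule kernel_module[OF F Y f])
  have K: "lmod_ker (?F m) Y f \<subseteq> carrier (?F m)" by (auto simp: lmod_ker_def)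
  have sub: "submodule (lmod_ker (?F m) Y f) R (?F m)"
   using K.M.add.m_closed K.M.add.one_closed K.smult_closed
   by (intro submoduleI[OF F K]) auto
  have "\<exists>G. finite G & G \<subseteq> lmod_ker (?F m) Y f &
    (\<forall>H'. submodule H' R (?F m) \<longrightarrow> G \<subseteq> H' \<longrightarrow> lmod_ker (?F m) Y f \<subseteq> H')"
   by (rule noeth[unfolded noetherian_free_modules_def, THEN spec, THEN spec, THEN mp, OF sub])
  then obtain G where G: "finite G" "G \<subseteq> lmod_ker (?F m) Y f"
   "\<And>H'. submodule H' R (?F m) ==> G \<subseteq> H' ==> lmod_ker (?F m) Y f \<subseteq> H'"
   by metis
  show ?thesis by (rule finitely_generated_free_cover[OF F K G(1,2) sub G(3)])
 qed
 let ?G = "\<lambda>(n::nat) (a, b, f). f \<in> lmod_hom R (?F b) (?F a) &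
  (n = 0 \<longrightarrow> a = m & f ` carrier (?F b) = lmod_ker (?F m) M \<epsilon>)"
 let ?H = "\<lambda>(a, b, f) (a', b', f'). a' = b & f' ` carrier (?F b') = lmod_ker (?F b) (?F a) f"
 have "\<exists>s. \<forall>n. ?G n (s n) & ?H (s n) (s (Suc n))"
 proof (rule dependent_nat_choice)
  obtain b f where "f \<in> lmod_hom R (?F b) (?F m)" "f ` carrier (?F b) = lmod_ker (?F m) M \<epsilon>"
   using cover[OF \<epsilon>(1) M] by blast
  then show "\<exists>s. ?G 0 s" by (intro exI[of _ "(m, b, f)"]) simp
 next
  fix s n assume s: "?G n s"
  obtain a b f where s': "s = (a, b, f)" by (cases s)
  then have "f \<in> lmod_hom R (?F b) (?F a)" using s by simp
  from cover[OF this F] obtain b' f' where "f' \<in> lmod_hom R (?F b') (?F b)"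
   "f' ` carrier (?F b') = lmod_ker (?F b) (?F a) f" by blast
  then show "\<exists>s'. ?G (Suc n) s' & ?H s s'"
   by (intro exI[of _ "(b, b', f')"]) (simp add: s')
 qed
 then obtain s where s': "\<forall>n. ?G n (s n) & ?H (s n) (s (Suc n))" by (rule exE)
 note s = s'[THEN spec, THEN conjunct1] s'[THEN spec, THEN conjunct2]
 define k l d where "k n = fst (s n)" and "l n = fst (snd (s n))" and "d n = snd (snd (s n))" for n
 have sn: "s n = (k n, l n, d n)" for n by (simp add: k_def l_def d_def)
 have kl: "k (Suc n) = l n" for n using s(2)[of n] by (simp add: sn)
 have "resolution R M (%i. ?F (k i)) d \<epsilon>"
  unfolding resolution_def
 proof (intro conjI allI M projective_free_module assms(1))
  have k0: "k 0 = m" using s(1)[of 0] by (simp add: sn)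
  show "d i \<in> lmod_hom R (?F (k (Suc i))) (?F (k i))" for i using s(1)[of i] by (simp add: sn kl)
  show "\<epsilon> \<in> lmod_hom R (?F (k 0)) M" "\<epsilon> ` carrier (?F (k 0)) = carrier M" using \<epsilon> by (simp_all add: k0)
  show "lmod_ker (?F (k 0)) M \<epsilon> = d 0 ` carrier (?F (k (Suc 0)))"
   using s(1)[of 0] by (simp add: sn kl)
  show "lmod_ker (?F (k (Suc i))) (?F (k i)) (d i) = d (Suc i) ` carrier (?F (k (Suc (Suc i))))" for i
   using s(2)[of i] by (simp add: sn kl)
 qed
 then show ?thesis by blast
qed

section \<open>Restriction of scalars and quotient modules\<close>

lemma left_module_restrict_scalars:
 assumes "ring R" "left_module S M" "\<phi> \<in> ring_hom R S"
 shows "left_module R (restrict_scalars \<phi> M)"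
proof -
 interpret M: left_module S M by fact
 interpret R: ring R by fact
 note h = ring_hom_closed[OF assms(3)] ring_hom_add[OF assms(3)] ring_hom_mult[OF assms(3)]
  ring_hom_one[OF assms(3)]
 show ?thesis
 proof (intro left_module.intro left_module_axioms.intro abelian_groupI assms(1))
  fix x assume "x :. (restrict_scalars \<phi> M)"
  then show "\<exists>y\<in>carrier (restrict_scalars \<phi> M). y \<oplus>$(restrict_scalars \<phi> M) x = \<zero>$(restrict_scalars \<phi> M)"
   by (intro bexI[of _ "\<ominus>$M x"]) (simp_all add: restrict_scalars_def M.M.l_neg)
 qed (simp_all add: restrict_scalars_def h M.M.a_ac M.smult_l_distr M.smult_r_distr M.smult_assoc)
qed

lemma finsum_same_addition:
 assumes "carrier M = carrier N" "add M = add N" "\<zero>$M = \<zero>$N"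
 shows "finsum M = finsum N"
 using assms by (intro HOL.ext) (simp add: finsum_def finprod_def)

lemma left_module_ring_as_module:
 assumes "ring R" "ring C" "\<phi> \<in> ring_hom R C"
 shows "left_module R (ring_as_module \<phi> C)"
proof -
 interpret C: ring C by fact
 note h = ring_hom_closed[OF assms(3)] ring_hom_add[OF assms(3)] ring_hom_mult[OF assms(3)]
  ring_hom_one[OF assms(3)]
 show ?thesis
 proof (intro left_module.intro left_module_axioms.intro abelian_groupI assms(1))
  fix x assume "x :. (ring_as_module \<phi> C)"
  then show "\<exists>y\<in>carrier (ring_as_module \<phi> C). y \<oplus>$(ring_as_module \<phi> C) x = \<zero>$(ring_as_module \<phi> C)"
   by (intro bexI[of _ "\<ominus>$C x"]) (simp_all add: ring_as_module_def C.l_neg)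
 qed (simp_all add: ring_as_module_def h C.a_ac C.l_distr C.r_distr C.m_assoc)
qed

lemma left_module_quot_module:
 assumes "ideal J R"
 shows "left_module R (quot_module R J)"
 unfolding quot_module_def
 by (rule left_module_ring_as_module[OF _ ideal.quotient_is_ring[OF assms] ideal.rcos_ring_hom[OF assms]])
  (rule ideal.axioms(2)[OF assms])

lemma quot_module_simps:
 "carrier (quot_module R J) = a_rcosets\<^bsub>R\<^esub> J" "add (quot_module R J) = (<+>$R)" "\<zero>$(quot_module R J) = J"
 "smult (quot_module R J) r x = rcoset_mult R J (J +>$R r) x"
 by (simp_all add: quot_module_def ring_as_module_def FactRing_def)

lemma quot_module_coset:
 assumes "ideal J R"
 shows "x :. (quot_module R J) ==> \<exists>r\<in>carrier R. x = J +>$R r"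
  and "r :. R ==> J +>$R r :. (quot_module R J)"
  and "[|r :. R; s :. R|] ==>
   (J +>$R r) \<oplus>$(quot_module R J) (J +>$R s) = J +>$R (r \<oplus>$R s)"
  and "[|r :. R; s :. R|] ==>
   r \<odot>$(quot_module R J) (J +>$R s) = J +>$R (r \<otimes>$R s)"
  and "[|r :. R; s :. R|] ==> J +>$R r = J +>$R s \<longleftrightarrow> r \<ominus>$R s \<in> J"
proof -
 interpret ideal J R by fact
 show "x :. (quot_module R J) ==> \<exists>r\<in>carrier R. x = J +>$R r"
  by (auto simp: quot_module_simps A_RCOSETS_def')
 show "r :. R ==> J +>$R r :. (quot_module R J)"
  by (auto simp: quot_module_simps A_RCOSETS_def')
 show "[|r :. R; s :. R|] ==>
   (J +>$R r) \<oplus>$(quot_module R J) (J +>$R s) = J +>$R (r \<oplus>$R s)"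
  by (simp add: quot_module_simps a_rcos_sum)
 show "[|r :. R; s :. R|] ==>
   r \<odot>$(quot_module R J) (J +>$R s) = J +>$R (r \<otimes>$R s)"
  by (simp add: quot_module_simps rcoset_mult_add)
 show "[|r :. R; s :. R|] ==> J +>$R r = J +>$R s \<longleftrightarrow> r \<ominus>$R s \<in> J"
  using quotient_eq_iff_same_a_r_cos[OF ideal_axioms] by simp
qed

lemma ideal_annihilator:
 assumes "left_module R V"
 shows "ideal (annihilator R V) R"
proof -
 interpret V: left_module R V by fact
 show ?thesis
 proof (intro idealI V.R.ring_axioms subgroup.intro)
  show "inv\<^bsub>add_monoid R\<^esub> x \<in> annihilator R V" if "x \<in> annihilator R V" for x
  proof -
   have x: "x :. R" "!!v. v :. V ==> x \<odot>$V v = \<zero>$V" using that by (auto simp: annihilator_def)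
   have "(\<ominus>$R x) \<odot>$V v = \<zero>$V" if "v :. V" for v
    using that V.smult_l_distr[of "\<ominus>$R x" x v] x by (simp add: V.R.l_neg V.smult_zeros)
   then show ?thesis using x(1) by (simp add: annihilator_def a_inv_def[symmetric])
  qed
 qed (auto simp: annihilator_def V.smult_zeros V.smult_l_distr V.smult_assoc)
qed

text \<open>
  Write \<open>J\<close> for the annihilator. Evaluation at \<open>v j\<close> is a map \<open>R/J \<rightarrow> V\<close>, and \<open>a v\<^sub>j \<mapsto> a e\<^sub>j + J\<close> is well
  defined by the hypothesis \<open>kill\<close>. So \<open>V\<close> is a summand of \<open>R/J\<close>, and since the \<open>e j\<close> add up to 1,
  \<open>R/J\<close> is a summand of a finite power of \<open>V\<close>: as a left module a matrix algebra is a sum of copies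
  of its column module.
\<close>

theorem pd_eq_pd_quotient_annihilator:
 assumes V: "left_module R V" and D: "finite D" "D ~= {}"
  and e: "!!j. j \<in> D ==> e j :. R" and e1: "(\<Oplus>$R j\<in>D. e j) = \<one>$R"
  and v: "!!j. j \<in> D ==> v j :. V" and ev: "!!j. j \<in> D ==> e j \<odot>$V v j = v j"
  and gen: "!!j w. j \<in> D ==> w :. V ==> \<exists>a\<in>carrier R. w = a \<odot>$V v j"
  and kill: "!!j a. j \<in> D ==> a :. R ==> a \<odot>$V v j = \<zero>$V ==> a \<otimes>$R e j \<in> annihilator R V"
 shows "pd R V = pd R (quot_module R (annihilator R V))"
proof -
 interpret V: left_module R V by (rule V)
 let ?J = "annihilator R V"
 let ?Q = "quot_module R ?J"
 have J: "ideal ?J R" by (rule ideal_annihilator[OF V])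
 note Q = left_module_quot_module[OF J] note cos = quot_module_coset[OF J]
 interpret Q: left_module R ?Q by (rule Q)
 define i where "i j x = (SOME r. r :. R & x = ?J +>$R r) \<odot>$V v j" for j x
 define p where "p j w = ?J +>$R ((SOME a. a :. R & w = a \<odot>$V v j) \<otimes>$R e j)" for j w
 have i: "i j (?J +>$R r) = r \<odot>$V v j" if "j \<in> D" "r :. R" for j r
 proof -
  define s where "s = (SOME s. s :. R & ?J +>$R r = ?J +>$R s)"
  have "s :. R & ?J +>$R r = ?J +>$R s"
   unfolding s_def
   by (rule someI[of "%s. s :. R & ?J +>$R r = ?J +>$R s" r]) (simp add: that)
  then have s: "s :. R" "r \<ominus>$R s \<in> ?J" using cos(5)[OF that(2)] by blast+
  then have "(r \<ominus>$R s) \<odot>$V v j = \<zero>$V" using v[OF that(1)] by (simp add: annihilator_def)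
  moreover have "r = (r \<ominus>$R s) \<oplus>$R s"
   using s that by (simp add: a_minus_def V.R.a_assoc V.R.l_neg)
  ultimately have "r \<odot>$V v j = s \<odot>$V v j"
   using V.smult_l_distr[of "r \<ominus>$R s" s "v j"] s that v by simp
  then show ?thesis by (simp add: i_def s_def)
 qed
 have p: "p j (a \<odot>$V v j) = ?J +>$R (a \<otimes>$R e j)" if "j \<in> D" "a :. R" for j a
 proof -
  let ?b = "SOME b. b :. R & a \<odot>$V v j = b \<odot>$V v j"
  have b: "?b :. R & a \<odot>$V v j = ?b \<odot>$V v j"
   by (rule someI[of "%b. b :. R & a \<odot>$V v j = b \<odot>$V v j" a]) (simp add: that)
  have "(?b \<ominus>$R a) \<odot>$V v j \<oplus>$V a \<odot>$V v j = ?b \<odot>$V v j"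
   using V.smult_l_distr[of "?b \<ominus>$R a" a "v j"] b that v
   by (simp add: a_minus_def V.R.a_assoc V.R.l_neg)
  moreover have "(?b \<ominus>$R a) \<odot>$V v j :. V" using b that v by simp
  ultimately have "(?b \<ominus>$R a) \<odot>$V v j = \<zero>$V"
   using b v that by (metis V.M.add.r_cancel_one V.smult_closed)
  then have "(?b \<ominus>$R a) \<otimes>$R e j \<in> ?J" using kill that b by simp
  then have "?b \<otimes>$R e j \<ominus>$R a \<otimes>$R e j \<in> ?J"
   using b that e by (simp add: a_minus_def V.R.l_distr V.R.l_minus)
  then show ?thesis
   unfolding p_def using cos(5)[of "?b \<otimes>$R e j" "a \<otimes>$R e j"] b that e by simp
 qed
 have ih: "i j \<in> lmod_hom R ?Q V" if j: "j \<in> D" for j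
 proof (rule lmod_homI)
  fix x y assume "x :. ?Q" "y :. ?Q"
  then obtain r s where r: "r :. R" "x = ?J +>$R r" and s: "s :. R" "y = ?J +>$R s"
   using cos(1) by metis
  show "i j x :. V" using r v j by (simp add: i)
  show "i j (x \<oplus>$(?Q) y) = i j x \<oplus>$V i j y"
   using r s v j by (simp add: cos(3) i V.smult_l_distr)
  show "i j (a \<odot>$(?Q) x) = a \<odot>$V i j x" if "a :. R" for a
   using r that v j by (simp add: cos(4) i V.smult_assoc)
 qed
 have ph: "p j \<in> lmod_hom R V ?Q" if j: "j \<in> D" for j
 proof (rule lmod_homI)
  fix x y assume "x :. V" "y :. V"
  then obtain r s where r: "r :. R" "x = r \<odot>$V v j" and s: "s :. R" "y = s \<odot>$V v j"
   using gen[OF j] by metis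
  show "p j x :. ?Q" using r e j by (simp add: p cos(2))
  show "p j (x \<oplus>$V y) = p j x \<oplus>$(?Q) p j y"
   using r s v e j V.smult_l_distr[of r s "v j", symmetric] by (simp add: p cos(3) V.R.l_distr)
  show "p j (a \<odot>$V x) = a \<odot>$(?Q) p j x" if "a :. R" for a
   using r that v e j V.smult_assoc[of a r "v j", symmetric] by (simp add: p cos(4) V.R.m_assoc)
 qed
 obtain l where l: "l \<in> D" using D by blast
 have "pd R V \<le> pd R ?Q"
 proof (rule pd_le_of_finite_retract[OF V Q, of "{l}" "p" "i"])
  fix w assume "w :. V"
  then obtain a where a: "a :. R" "w = a \<odot>$V v l" using gen[OF l] by blast
  have "i l (p l w) = w"
   using a l e v by (simp add: p i V.smult_assoc ev)
  then show "(\<Oplus>$V j\<in>{l}. i j (p j w)) = w" using a v l by simp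
 qed (use l ih ph in auto)
 moreover have "pd R ?Q \<le> pd R V"
 proof (rule pd_le_of_finite_retract[OF Q V D(1) ih ph])
  fix x assume "x :. ?Q"
  then obtain r where r: "r :. R" "x = ?J +>$R r" using cos(1) by blast
  let ?A = "ring_as_module (%x. x) R"
  have A: "left_module R ?A"
   by (rule left_module_ring_as_module[OF V.R.ring_axioms V.R.ring_axioms]) (simp add: ring_hom_def)
  have q: "(%s. ?J +>$R s) \<in> lmod_hom R ?A ?Q"
   by (rule lmod_homI) (simp_all add: ring_as_module_def cos)
  have "(\<Oplus>$(?Q)j\<in>D. p j (i j x)) = (\<Oplus>$(?Q)j\<in>D. ?J +>$R (r \<otimes>$R e j))"
   by (rule Q.M.finsum_cong'[OF HOL.refl]) (use r e in \<open>auto simp: i p intro!: cos(2)\<close>)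
  also have "... = ?J +>$R (\<Oplus>$(?A)j\<in>D. r \<otimes>$R e j)"
   by (rule lmod_hom_finsum[OF A Q q D(1), symmetric]) (use r e in \<open>auto simp: ring_as_module_def\<close>)
  also have "finsum ?A = finsum R" by (rule finsum_same_addition) (simp_all add: ring_as_module_def)
  also have "(\<Oplus>$R j\<in>D. r \<otimes>$R e j) = r \<otimes>$R (\<Oplus>$R j\<in>D. e j)"
   by (rule V.R.finsum_rdistr[symmetric]) (use D r e in auto)
  finally show "(\<Oplus>$(?Q)j\<in>D. p j (i j x)) = x" using r by (simp add: e1)
 qed
 ultimately show ?thesis by (rule antisym)
qed

lemma enat_eq_by_nat_bounds:
 fixes a b :: enat
 assumes "!!n. a \<le> enat n \<longleftrightarrow> b \<le> enat n"
 shows "a = b"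
proof (rule antisym)
 show "a \<le> b" by (rule enat_le_by_nat_bounds) (simp add: assms)
 show "b \<le> a" by (rule enat_le_by_nat_bounds) (simp add: assms)
qed

section \<open>Corners\<close>

lemma (in left_module) finsum_swap_module:
 assumes "finite S" "finite T" "!!i j. i \<in> S ==> j \<in> T ==> f i j :. M"
 shows "(\<Oplus>$M i\<in>S. \<Oplus>$M j\<in>T. f i j) = (\<Oplus>$M j\<in>T. \<Oplus>$M i\<in>S. f i j)"
 using assms(1,3)
proof (induct rule: finite_induct)
 case (insert i S)
 then have "(\<Oplus>$M i\<in>insert i S. \<Oplus>$M j\<in>T. f i j) = (\<Oplus>$M j\<in>T. f i j) \<oplus>$M (\<Oplus>$M j\<in>T. \<Oplus>$M i\<in>S. f i j)"
  by (subst M.finsum_insert) auto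
 also have "... = (\<Oplus>$M j\<in>T. f i j \<oplus>$M (\<Oplus>$M i\<in>S. f i j))"
  by (rule M.finsum_addf[symmetric]) (use insert in auto)
 also have "... = (\<Oplus>$M j\<in>T. \<Oplus>$M i\<in>insert i S. f i j)"
  by (rule M.finsum_cong'[OF HOL.refl]) (use insert in \<open>auto intro!: M.finsum_insert[symmetric]\<close>)
 finally show ?case .
qed simp

definition corner_module :: "('z => 'a) => 'a => ('a, 'm) module => ('z, 'm) module" where
 "corner_module \<mu> e M = (restrict_scalars \<mu> M)\<lparr>carrier := {x \<in> carrier M. e \<odot>$M x = x}\<rparr>"

lemma corner_module_simps:
 "carrier (corner_module \<mu> e M) = {x \<in> carrier M. e \<odot>$M x = x}" "add (corner_module \<mu> e M) = add M"
 "\<zero>$(corner_module \<mu> e M) = \<zero>$M" "smult (corner_module \<mu> e M) z x = \<mu> z \<odot>$M x"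
 by (simp_all add: corner_module_def restrict_scalars_def)

text \<open>
  The idempotent \<open>e\<close> is full, because 1 is a sum of products \<open>a i b i\<close> through \<open>e\<close>, and its corner
  \<open>e R e\<close> is the central ring \<open>Z\<close>. This is the situation of Morita equivalence, in which
  \<open>M \<mapsto> e M\<close> identifies left \<open>R\<close>-modules with \<open>Z\<close>-modules.
\<close>

locale full_corner =
 R: ring R + Z: ring Z
 for R :: "('a, 's) ring_scheme" and Z :: "('z, 't) ring_scheme" +
 fixes \<mu> :: "'z => 'a" and e :: 'a and D :: "'v set" and a b :: "'v => 'a"
 assumes hom: "\<mu> \<in> ring_hom Z R"
  and central: "!!z r. [|z :. Z; r :. R|] ==> \<mu> z \<otimes>$R r = r \<otimes>$R \<mu> z"
  and e: "e :. R" "e \<otimes>$R e = e"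
  and D: "finite D"
  and a: "!!i. i \<in> D ==> a i :. R" "!!i. i \<in> D ==> a i \<otimes>$R e = a i"
  and b: "!!i. i \<in> D ==> b i :. R" "!!i. i \<in> D ==> e \<otimes>$R b i = b i"
  and full: "(\<Oplus>$R i\<in>D. a i \<otimes>$R b i) = \<one>$R"
  and scalar: "!!r. r :. R ==> e \<otimes>$R r \<otimes>$R e = r ==> \<exists>z\<in>carrier Z. r = \<mu> z \<otimes>$R e"
  and faithful: "!!z. z :. Z ==> \<mu> z \<otimes>$R e = \<zero>$R ==> z = \<zero>$Z"
begin

lemmas mu = ring_hom_closed[OF hom] ring_hom_add[OF hom] ring_hom_mult[OF hom] ring_hom_one[OF hom]

lemma corner_left_module:
 assumes "left_module R M"
 shows "left_module Z (corner_module \<mu> e M)"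
 unfolding corner_module_def
proof (rule left_module_submodule[OF left_module_restrict_scalars[OF Z.ring_axioms assms hom]])
 interpret M: left_module R M by fact
 show "r \<odot>$(restrict_scalars \<mu> M) x \<in> {x \<in> carrier M. e \<odot>$M x = x}"
  if "r :. Z" "x \<in> {x \<in> carrier M. e \<odot>$M x = x}" for r x
  using that e mu central[of r e] M.smult_assoc[of e "\<mu> r" x] M.smult_assoc[of "\<mu> r" e x]
  by (simp add: restrict_scalars_def)
qed (use assms in \<open>auto simp: restrict_scalars_def left_module.smult_zeros left_module.smult_r_distr e
   left_module.axioms(2) abelian_group.axioms(1) abelian_monoid.zero_closed abelian_monoid.a_closed\<close>)

lemma corner_hom:
 assumes "left_module R M" "left_module R N" "f \<in> lmod_hom R M N"
 shows "f \<in> lmod_hom Z (corner_module \<mu> e M) (corner_module \<mu> e N)"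
proof (rule lmod_homI)
 show "f x :. (corner_module \<mu> e N)" if "x :. (corner_module \<mu> e M)" for x
  using that lmod_hom_closed[OF assms(3)] lmod_hom_smult[OF assms(3) e(1), of x]
  by (auto simp: corner_module_simps)
qed (auto simp: corner_module_simps lmod_hom_add[OF assms(3)] lmod_hom_smult[OF assms(3)] mu)

lemma corner_mem:
 assumes "left_module R M" "x :. M"
 shows "e \<odot>$M x :. (corner_module \<mu> e M)"
proof -
 interpret M: left_module R M by fact
 show ?thesis using assms(2) e M.smult_assoc[of e e x] by (simp add: corner_module_simps)
qed

text \<open>
  For \<open>x\<close> in \<open>e R\<close> we have \<open>x = \<Sum>\<^sub>i (x a\<^sub>i) b\<^sub>i\<close> with \<open>x a\<^sub>i\<close> in \<open>e R e = Z\<close>. So \<open>e R\<close> is a summand of a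
  finite power of \<open>Z\<close>, and the corner of a free module is a summand of a free \<open>Z\<close>-module.
\<close>

lemma corner_free_projective:
 fixes C :: "'c set"
 shows "projective_module Z (corner_module \<mu> e (free_module R C))"
proof -
 let ?F = "free_module R C" and ?E = "corner_module \<mu> e (free_module R C)"
 let ?G = "free_module Z (C \<times> D)"
 have F: "left_module R ?F" by (rule left_module_free_module[OF R.ring_axioms])
 have E: "left_module Z ?E" by (rule corner_left_module[OF F])
 have memE: "x :. ?E \<longleftrightarrow> x :. ?F & (\<forall>c. e \<otimes>$R x c = x c)" for x
  by (auto simp: corner_module_simps free_module_def fun_eq_iff)
 define s where "s x = (\<lambda>(c, i). if c \<in> C & i \<in> D then (THE z. z :. Z & \<mu> z \<otimes>$R e = x c \<otimes>$R a i) else \<zero>$Z)"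
  for x :: "'c => 'a"
 define p where "p f = (%c. \<Oplus>$R i\<in>D. \<mu> (f (c, i)) \<otimes>$R b i)" for f :: "'c \<times> 'v => 'z"
 have unique: "z = z'" if "z :. Z" "z' :. Z" "\<mu> z \<otimes>$R e = \<mu> z' \<otimes>$R e" for z z'
 proof -
  have "\<mu> (z \<ominus>$Z z') \<otimes>$R e \<oplus>$R \<mu> z' \<otimes>$R e = \<mu> z \<otimes>$R e"
   using that mu e by (simp add: R.l_distr[symmetric] mu(2)[symmetric] a_minus_def Z.a_assoc Z.l_neg)
  then have "\<mu> (z \<ominus>$Z z') \<otimes>$R e = \<zero>$R"
   using that mu e by (metis R.add.r_cancel_one R.m_closed Z.minus_closed)
  then have "z \<ominus>$Z z' = \<zero>$Z" using faithful that by simp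
  then show ?thesis using that by simp
 qed
 have coeff: "s x (c, i) :. Z & \<mu> (s x (c, i)) \<otimes>$R e = x c \<otimes>$R a i"
  if xE: "x :. ?E" and cC: "c \<in> C" and iD: "i \<in> D" for x c i
 proof -
  have xc: "x c :. R" "e \<otimes>$R x c = x c" using that(1) memE by (auto simp: free_module_def)
  have "e \<otimes>$R (x c \<otimes>$R a i) \<otimes>$R e = (e \<otimes>$R x c) \<otimes>$R (a i \<otimes>$R e)"
   using xc(1) a(1)[OF iD] e(1) by (simp add: R.m_assoc)
  then have "e \<otimes>$R (x c \<otimes>$R a i) \<otimes>$R e = x c \<otimes>$R a i"
   by (simp add: xc(2) a(2)[OF iD])
  then obtain z where z: "z :. Z" "x c \<otimes>$R a i = \<mu> z \<otimes>$R e"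
   using scalar[of "x c \<otimes>$R a i"] xc(1) a(1)[OF iD] by auto
  have "s x (c, i) = z"
   unfolding s_def using cC iD z unique by (auto intro!: the_equality)
  with z show ?thesis by simp
 qed
 have scl: "s x ci :. Z" if "x :. ?E" for x ci
 proof (cases ci)
  case (Pair c i)
  then show ?thesis
   using coeff[OF that, of c i] by (cases "c \<in> C & i \<in> D") (auto simp: s_def)
 qed
 have szero: "s x (c, i) = \<zero>$Z" if "x :. ?E" "x c = \<zero>$R" for x c i
 proof (cases "c \<in> C & i \<in> D")
  case True
  then show ?thesis using coeff[OF that(1), of c i] that(2) a faithful by simp
 qed (auto simp: s_def)
 have sG: "s x :. ?G" if x: "x :. ?E" for x
 proof -
  have fin: "finite {c. x c ~= \<zero>$R}" using x memE by (simp add: free_module_def)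
  have "{ci. s x ci ~= \<zero>$Z} \<subseteq> {c. x c ~= \<zero>$R} \<times> D"
   using szero[OF x] by (auto simp: s_def split: if_splits)
  then have "finite {ci. s x ci ~= \<zero>$Z}" using fin D finite_subset by blast
  moreover have "s x ci = \<zero>$Z" if "ci \<notin> C \<times> D" for ci using that by (cases ci) (auto simp: s_def)
  ultimately show ?thesis using scl[OF x] by (simp add: free_module_def)
 qed
 have s: "s \<in> lmod_hom Z ?E ?G"
 proof (rule lmod_homI)
  show "s x :. ?G" if "x :. ?E" for x using sG[OF that] .
  interpret E: left_module Z ?E by (rule E)
  show "s (x \<oplus>$(?E) y) = s x \<oplus>$(?G) s y" if "x :. ?E" "y :. ?E" for x y
  proof
   fix ci :: "'c \<times> 'v" obtain c i where ci: "ci = (c, i)" by (cases ci)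
   have xy: "x c :. R" "y c :. R" using that memE by (auto simp: free_module_def)
   show "s (x \<oplus>$(?E) y) ci = (s x \<oplus>$(?G) s y) ci"
   proof (cases "c \<in> C & i \<in> D")
    case True
    note cs = coeff[OF that(1), of c i] coeff[OF that(2), of c i] coeff[OF E.M.a_closed[OF that], of c i]
    have "\<mu> (s x (c, i) \<oplus>$Z s y (c, i)) \<otimes>$R e = (x c \<oplus>$R y c) \<otimes>$R a i"
     using True cs mu e a xy by (simp add: R.l_distr)
    then have "s (x \<oplus>$(?E) y) (c, i) = s x (c, i) \<oplus>$Z s y (c, i)"
     using True cs by (intro unique) (auto simp: corner_module_simps free_module_def)
    then show ?thesis by (simp add: ci free_module_def)
   qed (auto simp: ci s_def free_module_def)
  qed
  show "s (z \<odot>$(?E) x) = z \<odot>$(?G) s x" if "z :. Z" "x :. ?E" for z x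
  proof
   fix ci :: "'c \<times> 'v" obtain c i where ci: "ci = (c, i)" by (cases ci)
   have xc: "x c :. R" using that memE by (auto simp: free_module_def)
   show "s (z \<odot>$(?E) x) ci = (z \<odot>$(?G) s x) ci"
   proof (cases "c \<in> C & i \<in> D")
    case True
    note cs = coeff[OF that(2), of c i] coeff[OF E.smult_closed[OF that], of c i]
    have "\<mu> (z \<otimes>$Z s x (c, i)) \<otimes>$R e = (\<mu> z \<otimes>$R x c) \<otimes>$R a i"
     using True cs mu e a xc that(1) by (simp add: R.m_assoc)
    then have "s (z \<odot>$(?E) x) (c, i) = z \<otimes>$Z s x (c, i)"
     using True cs that(1) by (intro unique) (auto simp: corner_module_simps free_module_def)
    then show ?thesis by (simp add: ci free_module_def)
   qed (use that(1) in \<open>auto simp: ci s_def free_module_def\<close>)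
  qed
 qed
 have fcl: "f ci :. Z" if "f :. ?G" for f ci
  using that by (cases ci) (auto simp: free_module_def)
 have pcl: "\<mu> (f (c, i)) \<otimes>$R b i :. R" if "f :. ?G" "i \<in> D" for f c i
  using fcl[OF that(1)] mu b that by simp
 have mu0: "\<mu> \<zero>$Z = \<zero>$R" using ring_hom_zero[OF hom Z.ring_axioms R.ring_axioms] .
 have p: "p \<in> lmod_hom Z ?G ?E"
 proof (rule lmod_homI)
  show "p f :. ?E" if f: "f :. ?G" for f
  proof -
   have "{c. p f c ~= \<zero>$R} \<subseteq> fst ` {ci. f ci ~= \<zero>$Z}"
   proof
    fix c assume c: "c \<in> {c. p f c ~= \<zero>$R}"
    have "\<exists>i. f (c, i) ~= \<zero>$Z"
    proof (rule ccontr)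
     assume "\<not> ?thesis"
     then have "p f c = (\<Oplus>$R i\<in>D. \<zero>$R)"
      unfolding p_def by (intro R.finsum_cong'[OF HOL.refl]) (auto simp: mu0 b)
     with c show False by simp
    qed
    then show "c \<in> fst ` {ci. f ci ~= \<zero>$Z}" by force
   qed
   then have "finite {c. p f c ~= \<zero>$R}"
    using f finite_subset by (fastforce simp: free_module_def)
   moreover have "p f c = \<zero>$R" if "c \<notin> C" for c
   proof -
    have "f (c, i) = \<zero>$Z" for i using f that by (auto simp: free_module_def)
    then have "p f c = (\<Oplus>$R i\<in>D. \<zero>$R)"
     unfolding p_def by (intro R.finsum_cong'[OF HOL.refl]) (auto simp: mu0 b)
    then show ?thesis by simp
   qed
   moreover have "p f c :. R" for c unfolding p_def using pcl[OF f] by auto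
   moreover have "e \<otimes>$R p f c = p f c" for c
   proof -
    have "e \<otimes>$R p f c = (\<Oplus>$R i\<in>D. e \<otimes>$R (\<mu> (f (c, i)) \<otimes>$R b i))"
     unfolding p_def by (rule R.finsum_rdistr) (use D e pcl[OF f] in auto)
    also have "... = p f c"
     unfolding p_def
    proof (rule R.finsum_cong'[OF HOL.refl])
     show "(%i. \<mu> (f (c, i)) \<otimes>$R b i) \<in> D \<rightarrow> carrier R" using pcl[OF f] by blast
     fix i assume i: "i \<in> D"
     have "e \<otimes>$R (\<mu> (f (c, i)) \<otimes>$R b i) = \<mu> (f (c, i)) \<otimes>$R (e \<otimes>$R b i)"
      using central[OF fcl[OF f] e(1), of "(c, i)"] mu(1)[OF fcl[OF f, of "(c, i)"]] e(1) b(1)[OF i]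
      by (simp add: R.m_assoc[symmetric])
     then show "e \<otimes>$R (\<mu> (f (c, i)) \<otimes>$R b i) = \<mu> (f (c, i)) \<otimes>$R b i" by (simp add: b(2)[OF i])
    qed
    finally show ?thesis .
   qed
   ultimately show ?thesis unfolding memE by (auto simp: free_module_def)
  qed
  show "p (f \<oplus>$(?G) g) = p f \<oplus>$(?E) p g" if f: "f :. ?G" and g: "g :. ?G" for f g
  proof
   fix c
   have "p (f \<oplus>$(?G) g) c = (\<Oplus>$R i\<in>D. \<mu> (f (c, i)) \<otimes>$R b i \<oplus>$R \<mu> (g (c, i)) \<otimes>$R b i)"
    unfolding p_def
    by (rule R.finsum_cong'[OF HOL.refl])
     (use fcl[OF f] fcl[OF g] mu b pcl[OF f] pcl[OF g] in \<open>auto simp: free_module_def R.l_distr\<close>)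
   also have "... = p f c \<oplus>$R p g c"
    unfolding p_def by (rule R.finsum_addf) (use pcl[OF f] pcl[OF g] in auto)
   finally show "p (f \<oplus>$(?G) g) c = (p f \<oplus>$(?E) p g) c" by (simp add: corner_module_simps free_module_def)
  qed
  show "p (z \<odot>$(?G) f) = z \<odot>$(?E) p f" if z: "z :. Z" and f: "f :. ?G" for z f
  proof
   fix c
   have "p (z \<odot>$(?G) f) c = (\<Oplus>$R i\<in>D. \<mu> z \<otimes>$R (\<mu> (f (c, i)) \<otimes>$R b i))"
    unfolding p_def
    by (rule R.finsum_cong'[OF HOL.refl])
     (use fcl[OF f] mu b z in \<open>auto simp: free_module_def R.m_assoc\<close>)
   also have "... = \<mu> z \<otimes>$R p f c"
    unfolding p_def by (rule R.finsum_rdistr[symmetric]) (use D mu z pcl[OF f] in auto)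
   finally show "p (z \<odot>$(?G) f) c = (z \<odot>$(?E) p f) c" by (simp add: corner_module_simps free_module_def)
  qed
 qed
 have ps: "p (s x) = x" if x: "x :. ?E" for x
 proof
  fix c
  have xc: "x c :. R" using x memE by (auto simp: free_module_def)
  show "p (s x) c = x c"
  proof (cases "c \<in> C")
   case True
   have "p (s x) c = (\<Oplus>$R i\<in>D. x c \<otimes>$R (a i \<otimes>$R b i))"
    unfolding p_def
   proof (rule R.finsum_cong'[OF HOL.refl])
    show "(%i. x c \<otimes>$R (a i \<otimes>$R b i)) \<in> D \<rightarrow> carrier R" using xc a b by auto
    fix i assume i: "i \<in> D"
    have "\<mu> (s x (c, i)) \<otimes>$R b i = \<mu> (s x (c, i)) \<otimes>$R e \<otimes>$R b i"
     using mu(1)[OF scl[OF x]] e b[OF i] by (simp add: R.m_assoc)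
    also have "... = x c \<otimes>$R (a i \<otimes>$R b i)"
     using coeff[OF x True i] xc a(1)[OF i] b(1)[OF i] by (simp add: R.m_assoc)
    finally show "\<mu> (s x (c, i)) \<otimes>$R b i = x c \<otimes>$R (a i \<otimes>$R b i)" .
   qed
   also have "... = x c \<otimes>$R (\<Oplus>$R i\<in>D. a i \<otimes>$R b i)"
    by (rule R.finsum_rdistr[symmetric]) (use D xc a b in auto)
   finally show ?thesis using xc by (simp add: full)
  next
   case False
   then have "p (s x) c = (\<Oplus>$R i\<in>D. \<zero>$R)"
    unfolding p_def by (intro R.finsum_cong'[OF HOL.refl]) (auto simp: s_def mu0 b)
   then show ?thesis using False x memE by (simp add: free_module_def)
  qed
 qed
 show ?thesis by (rule projective_retract_of_free[OF E s p ps])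
qed

lemma corner_projective:
 assumes "projective_module R P"
 shows "projective_module Z (corner_module \<mu> e P)"
proof -
 have P: "left_module R P" using assms by (rule projective_imp_left_module)
 obtain s p where sp: "s \<in> lmod_hom R P (free_module R (carrier P))"
  "p \<in> lmod_hom R (free_module R (carrier P)) P" "!!x. x :. P ==> p (s x) = x"
  using projective_free_retract[OF assms] by blast
 note F = left_module_free_module[OF R.ring_axioms]
 show ?thesis
  by (rule projective_retract[OF corner_left_module[OF P] corner_free_projective
     corner_hom[OF P F sp(1)] corner_hom[OF F P sp(2)]])
   (simp add: sp(3) corner_module_simps)
qed

lemma corner_resolution:
 assumes P: "resolution R V P d \<epsilon>" and N: "left_module Z N"
  and \<chi>: "\<chi> \<in> lmod_hom Z (corner_module \<mu> e V) N" "bij_betw \<chi> (carrier (corner_module \<mu> e V)) (carrier N)"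
 shows "resolution Z N (%i. corner_module \<mu> e (P i)) d (%x. \<chi> (\<epsilon> x))"
proof -
 note PD = resolutionD[OF P]
 let ?E = "corner_module \<mu> e"
 note eh = corner_hom[OF PD(3) PD(1) PD(5)]
 have E: "left_module Z (?E V)" by (rule corner_left_module[OF PD(1)])
 have mem: "x :. (?E M) \<longleftrightarrow> x :. M & e \<odot>$M x = x" for x M
  by (auto simp: corner_module_simps)
 have d_pull: "\<exists>y\<in>carrier (?E (P (Suc i))). d i z = d i y"
  if "z :. (P (Suc i))" "e \<odot>$(P i) d i z = d i z" for i z
  using corner_mem[OF PD(3) that(1)] lmod_hom_smult[OF PD(4) e(1) that(1)] that(2)
  by (intro bexI[of _ "e \<odot>$(P (Suc i)) z"]) simp_all
 show ?thesis
  unfolding resolution_def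
 proof (intro conjI allI N)
  show "projective_module Z (?E (P i))" for i by (rule corner_projective[OF PD(2)])
  show "d i \<in> lmod_hom Z (?E (P (Suc i))) (?E (P i))" for i by (rule corner_hom[OF PD(3) PD(3) PD(4)])
  show "(%x. \<chi> (\<epsilon> x)) \<in> lmod_hom Z (?E (P 0)) N" by (rule lmod_hom_comp[OF eh \<chi>(1)])
  have "\<epsilon> ` carrier (?E (P 0)) = carrier (?E V)"
  proof
   show "\<epsilon> ` carrier (?E (P 0)) \<subseteq> carrier (?E V)" using lmod_hom_closed[OF eh] by blast
   show "carrier (?E V) \<subseteq> \<epsilon> ` carrier (?E (P 0))"
   proof
    fix v assume v: "v :. (?E V)"
    then have "v :. V" by (simp add: mem)
    then obtain x where x: "x :. (P 0)" "v = \<epsilon> x" using PD(6) by blast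
    then have "v = \<epsilon> (e \<odot>$(P 0) x)" using v lmod_hom_smult[OF PD(5) e(1) x(1)] by (simp add: mem)
    then show "v \<in> \<epsilon> ` carrier (?E (P 0))" using corner_mem[OF PD(3) x(1)] by blast
   qed
  qed
  then show "(%x. \<chi> (\<epsilon> x)) ` carrier (?E (P 0)) = carrier N"
   using \<chi>(2) by (metis bij_betw_imp_surj_on image_image)
  have "\<chi> v = \<zero>$N \<longleftrightarrow> v = \<zero>$V" if "v :. (?E V)" for v
  proof -
   have "\<zero>$V :. (?E V)"
    using left_module.axioms(2)[OF E, THEN abelian_group.axioms(1), THEN abelian_monoid.zero_closed]
    by (simp add: corner_module_simps)
   moreover have "\<chi> \<zero>$V = \<zero>$N" using lmod_hom_zero[OF E N \<chi>(1)] by (simp add: corner_module_simps)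
   ultimately show ?thesis using \<chi>(2) that by (metis bij_betw_imp_inj_on inj_on_eq_iff)
  qed
  then have ker: "\<chi> (\<epsilon> x) = \<zero>$N \<longleftrightarrow> \<epsilon> x = \<zero>$V" if "x :. (?E (P 0))" for x
   using lmod_hom_closed[OF eh that] by blast
  show "lmod_ker (?E (P 0)) N (%x. \<chi> (\<epsilon> x)) = d 0 ` carrier (?E (P (Suc 0)))"
  proof
   show "lmod_ker (?E (P 0)) N (%x. \<chi> (\<epsilon> x)) \<subseteq> d 0 ` carrier (?E (P (Suc 0)))"
   proof
    fix x assume "x \<in> lmod_ker (?E (P 0)) N (%x. \<chi> (\<epsilon> x))"
    then have x: "x :. (P 0)" "e \<odot>$(P 0) x = x" "\<epsilon> x = \<zero>$V" using ker by (auto simp: lmod_ker_def mem)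
    then show "x \<in> d 0 ` carrier (?E (P (Suc 0)))" using PD(8)[OF x(1,3)] d_pull[of _ 0] by auto
   qed
   show "d 0 ` carrier (?E (P (Suc 0))) \<subseteq> lmod_ker (?E (P 0)) N (%x. \<chi> (\<epsilon> x))"
   proof
    fix y assume "y \<in> d 0 ` carrier (?E (P (Suc 0)))"
    then obtain x where x: "x :. (?E (P (Suc 0)))" "y = d 0 x" by blast
    have "y :. (?E (P 0))" unfolding x(2) by (rule lmod_hom_closed[OF corner_hom[OF PD(3) PD(3) PD(4)] x(1)])
    moreover have "\<epsilon> y = \<zero>$V" using x PD(7) by (simp add: mem)
    ultimately show "y \<in> lmod_ker (?E (P 0)) N (%x. \<chi> (\<epsilon> x))"
     using ker[THEN iffD2] unfolding lmod_ker_def by blast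
   qed
  qed
  show "lmod_ker (?E (P (Suc i))) (?E (P i)) (d i) = d (Suc i) ` carrier (?E (P (Suc (Suc i))))" for i
  proof
   show "lmod_ker (?E (P (Suc i))) (?E (P i)) (d i) \<subseteq> d (Suc i) ` carrier (?E (P (Suc (Suc i))))"
   proof
    fix x assume "x \<in> lmod_ker (?E (P (Suc i))) (?E (P i)) (d i)"
    then have x: "x :. (P (Suc i))" "e \<odot>$(P (Suc i)) x = x" "d i x = \<zero>$(P i)"
     by (auto simp: lmod_ker_def corner_module_simps)
    then show "x \<in> d (Suc i) ` carrier (?E (P (Suc (Suc i))))" using PD(10)[OF x(1,3)] d_pull[of _ "Suc i"] by auto
   qed
   show "d (Suc i) ` carrier (?E (P (Suc (Suc i)))) \<subseteq> lmod_ker (?E (P (Suc i))) (?E (P i)) (d i)"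
    using lmod_hom_closed[OF corner_hom[OF PD(3) PD(3) PD(4)]] PD(9)
    by (auto simp: lmod_ker_def corner_module_simps)
  qed
 qed
qed

text \<open>
  A retraction of \<open>P n\<close> restricts to the corner. Conversely a \<open>Z\<close>-linear retraction \<open>r\<close> of the corner
  extends to \<open>x \<mapsto> \<Sum>\<^sub>i a\<^sub>i r (b\<^sub>i x)\<close>, which is \<open>R\<close>-linear since each \<open>b\<^sub>i c a\<^sub>j\<close> lies in \<open>e R e = Z\<close>.
\<close>

lemma corner_boundary_retract:
 assumes P: "resolution R V P d \<epsilon>"
 shows "boundary_retract Z (%i. corner_module \<mu> e (P i)) d n \<longleftrightarrow> boundary_retract R P d n"
proof
 note PD = resolutionD[OF P]
 let ?E = "corner_module \<mu> e"
 interpret P: left_module R "P n" by (rule PD(3))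
 interpret PS: left_module R "P (Suc n)" by (rule PD(3))
 have mem: "x :. (?E M) \<longleftrightarrow> x :. M & e \<odot>$M x = x" for x M
  by (auto simp: corner_module_simps)
 {
  assume "boundary_retract R P d n"
  then obtain r where r: "r \<in> lmod_hom R (P n) (P n)" "r ` carrier (P n) \<subseteq> d n ` carrier (P (Suc n))"
   "!!x. x :. (P (Suc n)) ==> r (d n x) = d n x"
   unfolding boundary_retract_def by blast
  have "r x \<in> d n ` carrier (?E (P (Suc n)))" if "x :. (?E (P n))" for x
  proof -
   have xP: "x :. (P n)" using that by (simp add: mem)
   then obtain y where y: "y :. (P (Suc n))" "r x = d n y" using r(2) by blast
   have "r x = r (e \<odot>$(P n) x)" using that by (simp add: mem)
   also have "... = e \<odot>$(P n) r x" by (rule lmod_hom_smult[OF r(1) e(1) xP])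
   also have "... = d n (e \<odot>$(P (Suc n)) y)"
    unfolding y(2) by (rule lmod_hom_smult[OF PD(4) e(1) y(1), symmetric])
   finally show ?thesis using corner_mem[OF PD(3) y(1)] by blast
  qed
  then show "boundary_retract Z (%i. ?E (P i)) d n"
   unfolding boundary_retract_def
   by (intro bexI[OF _ corner_hom[OF PD(3) PD(3) r(1)]]) (auto simp: mem r(3))
 next
  assume "boundary_retract Z (%i. ?E (P i)) d n"
  then obtain r where r: "r \<in> lmod_hom Z (?E (P n)) (?E (P n))"
   "r ` carrier (?E (P n)) \<subseteq> d n ` carrier (?E (P (Suc n)))"
   "!!x. x :. (?E (P (Suc n))) ==> r (d n x) = d n x"
   unfolding boundary_retract_def by blast
  have rE: "r x :. (P n)" "e \<odot>$(P n) r x = r x" if "x :. (?E (P n))" for x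
   using lmod_hom_closed[OF r(1) that] by (simp_all add: mem)
  have bE: "b i \<odot>$M x :. (?E M)" if "left_module R M" "i \<in> D" "x :. M" for i M x
  proof -
   interpret M: left_module R M by (rule that(1))
   show ?thesis using that e(1) b M.smult_assoc[of e "b i" x] by (simp add: mem)
  qed
  note bP = bE[OF PD(3)]
  have sum_ab: "(\<Oplus>$(P n)i\<in>D. (c \<otimes>$R a i \<otimes>$R b i) \<odot>$(P n) x) = c \<odot>$(P n) x"
   if "c :. R" "x :. (P n)" for c x
  proof -
   let ?A = "ring_as_module (%x. x) R"
   have A: "left_module R ?A"
    by (rule left_module_ring_as_module[OF R.ring_axioms R.ring_axioms]) (simp add: ring_hom_def)
   have h: "(%r. r \<odot>$(P n) x) \<in> lmod_hom R ?A (P n)"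
    by (rule lmod_homI) (use that in \<open>simp_all add: ring_as_module_def P.smult_l_distr P.smult_assoc\<close>)
   have "(\<Oplus>$(P n)i\<in>D. (c \<otimes>$R a i \<otimes>$R b i) \<odot>$(P n) x) = (\<Oplus>$(?A)i\<in>D. c \<otimes>$R a i \<otimes>$R b i) \<odot>$(P n) x"
    by (rule lmod_hom_finsum[OF A PD(3) h D, symmetric]) (use that a b in \<open>auto simp: ring_as_module_def\<close>)
   also have "finsum ?A = finsum R" by (rule finsum_same_addition) (simp_all add: ring_as_module_def)
   also have "(\<Oplus>$R i\<in>D. c \<otimes>$R a i \<otimes>$R b i) = (\<Oplus>$R i\<in>D. c \<otimes>$R (a i \<otimes>$R b i))"
    by (rule R.finsum_cong'[OF HOL.refl]) (use that a b in \<open>auto simp: R.m_assoc\<close>)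
   also have "... = c \<otimes>$R (\<Oplus>$R i\<in>D. a i \<otimes>$R b i)"
    by (rule R.finsum_rdistr[symmetric]) (use D that a b in auto)
   finally show ?thesis using that by (simp add: full)
  qed
  let ?t = "%x. \<Oplus>$(P n)i\<in>D. a i \<odot>$(P n) r (b i \<odot>$(P n) x)"
  have tcl: "a i \<odot>$(P n) r (b i \<odot>$(P n) x) :. (P n)" if "i \<in> D" "x :. (P n)" for i x
   using rE(1)[OF bP] that a by simp
  have key: "r (b i \<odot>$(P n) (c \<odot>$(P n) x)) =
    (\<Oplus>$(P n)j\<in>D. (b i \<otimes>$R c \<otimes>$R a j) \<odot>$(P n) r (b j \<odot>$(P n) x))"
   if i: "i \<in> D" and c: "c :. R" and x: "x :. (P n)" for i c x
  proof -
   have "\<exists>z\<in>carrier Z. b i \<otimes>$R c \<otimes>$R a j = \<mu> z \<otimes>$R e" if j: "j \<in> D" for j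
   proof (rule scalar)
    show "b i \<otimes>$R c \<otimes>$R a j :. R" using a b c i j by simp
    have "e \<otimes>$R (b i \<otimes>$R c \<otimes>$R a j) \<otimes>$R e = (e \<otimes>$R b i) \<otimes>$R c \<otimes>$R (a j \<otimes>$R e)"
     using a(1)[OF j] b(1)[OF i] c e(1) by (simp add: R.m_assoc)
    then show "e \<otimes>$R (b i \<otimes>$R c \<otimes>$R a j) \<otimes>$R e = b i \<otimes>$R c \<otimes>$R a j"
     by (simp add: a(2)[OF j] b(2)[OF i])
   qed
   then obtain z where z: "!!j. j \<in> D ==> z j :. Z"
    "!!j. j \<in> D ==> b i \<otimes>$R c \<otimes>$R a j = \<mu> (z j) \<otimes>$R e" by metis
   have act: "(b i \<otimes>$R c \<otimes>$R a j) \<odot>$(P n) w = \<mu> (z j) \<odot>$(P n) w" if "j \<in> D" "w :. (?E (P n))" for j w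
    using that z mu e by (simp add: mem P.smult_assoc)
   have fs: "finsum (?E (P n)) f D = finsum (P n) f D" if f: "f \<in> D \<rightarrow> carrier (?E (P n))" for f
    using D f
   proof (induct rule: finite_induct)
    interpret E: left_module Z "?E (P n)" by (rule corner_left_module[OF PD(3)])
    case empty then show ?case by (simp add: corner_module_simps)
   next
    interpret E: left_module Z "?E (P n)" by (rule corner_left_module[OF PD(3)])
    case (insert x S)
    then have "f \<in> S \<rightarrow> carrier (P n)" "f x :. (P n)" by (auto simp: corner_module_simps)
    with insert show ?case by (simp add: E.M.finsum_insert P.M.finsum_insert) (simp add: corner_module_simps)
   qed
   have "b i \<odot>$(P n) (c \<odot>$(P n) x) = (b i \<otimes>$R c) \<odot>$(P n) x"
    using b i c x by (simp add: P.smult_assoc)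
   also have "... = (\<Oplus>$(P n)j\<in>D. (b i \<otimes>$R c \<otimes>$R a j \<otimes>$R b j) \<odot>$(P n) x)"
    by (rule sum_ab[symmetric]) (use b i c x in simp_all)
   also have "... = (\<Oplus>$(P n)j\<in>D. \<mu> (z j) \<odot>$(P n) (b j \<odot>$(P n) x))"
   proof (rule P.M.finsum_cong'[OF HOL.refl])
    show "(%j. \<mu> (z j) \<odot>$(P n) (b j \<odot>$(P n) x)) \<in> D \<rightarrow> carrier (P n)" using z mu b x by auto
    fix j assume j: "j \<in> D"
    have "(b i \<otimes>$R c \<otimes>$R a j \<otimes>$R b j) \<odot>$(P n) x = (b i \<otimes>$R c \<otimes>$R a j) \<odot>$(P n) (b j \<odot>$(P n) x)"
     using a b c i j x by (simp add: P.smult_assoc)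
    then show "(b i \<otimes>$R c \<otimes>$R a j \<otimes>$R b j) \<odot>$(P n) x = \<mu> (z j) \<odot>$(P n) (b j \<odot>$(P n) x)"
     using act[OF j bP[OF j x]] by simp
   qed
   finally have "b i \<odot>$(P n) (c \<odot>$(P n) x) = (\<Oplus>$(P n)j\<in>D. \<mu> (z j) \<odot>$(P n) (b j \<odot>$(P n) x))" .
   moreover have zb: "(%j. \<mu> (z j) \<odot>$(P n) (b j \<odot>$(P n) x)) \<in> D \<rightarrow> carrier (?E (P n))"
    using left_module.smult_closed[OF corner_left_module[OF PD(3)] z(1) bP[OF _ x]]
    by (auto simp: corner_module_simps)
   ultimately have "r (b i \<odot>$(P n) (c \<odot>$(P n) x)) = r (\<Oplus>$(?E (P n))j\<in>D. \<mu> (z j) \<odot>$(P n) (b j \<odot>$(P n) x))"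
    by (simp add: fs)
   also have "... = (\<Oplus>$(?E (P n))j\<in>D. r (\<mu> (z j) \<odot>$(P n) (b j \<odot>$(P n) x)))"
    by (rule lmod_hom_finsum[OF corner_left_module[OF PD(3)] corner_left_module[OF PD(3)] r(1) D zb])
   also have "... = (\<Oplus>$(P n)j\<in>D. r (\<mu> (z j) \<odot>$(P n) (b j \<odot>$(P n) x)))"
    using lmod_hom_closed[OF r(1)] zb by (intro fs) blast
   also have "... = (\<Oplus>$(P n)j\<in>D. (b i \<otimes>$R c \<otimes>$R a j) \<odot>$(P n) r (b j \<odot>$(P n) x))"
   proof (rule P.M.finsum_cong'[OF HOL.refl])
    show "(%j. (b i \<otimes>$R c \<otimes>$R a j) \<odot>$(P n) r (b j \<odot>$(P n) x)) \<in> D \<rightarrow> carrier (P n)"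
     using a b i c x rE(1)[OF bP] by auto
    fix j assume j: "j \<in> D"
    have "r (\<mu> (z j) \<odot>$(P n) (b j \<odot>$(P n) x)) = \<mu> (z j) \<odot>$(P n) r (b j \<odot>$(P n) x)"
     using lmod_hom_smult[OF r(1) z(1)[OF j] bP[OF j x]] by (simp add: corner_module_simps)
    then show "r (\<mu> (z j) \<odot>$(P n) (b j \<odot>$(P n) x)) = (b i \<otimes>$R c \<otimes>$R a j) \<odot>$(P n) r (b j \<odot>$(P n) x)"
     using act[OF j lmod_hom_closed[OF r(1) bP[OF j x]]] by simp
   qed
   finally show ?thesis .
  qed
  have t: "?t \<in> lmod_hom R (P n) (P n)"
  proof (rule lmod_homI)
   show "?t x :. (P n)" if "x :. (P n)" for x using tcl that by auto
   show "?t (x \<oplus>$(P n) y) = ?t x \<oplus>$(P n) ?t y" if x: "x :. (P n)" and y: "y :. (P n)" for x y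
   proof -
    have "?t (x \<oplus>$(P n) y) = (\<Oplus>$(P n)i\<in>D. a i \<odot>$(P n) r (b i \<odot>$(P n) x) \<oplus>$(P n) a i \<odot>$(P n) r (b i \<odot>$(P n) y))"
    proof (rule P.M.finsum_cong'[OF HOL.refl])
     show "(%i. a i \<odot>$(P n) r (b i \<odot>$(P n) x) \<oplus>$(P n) a i \<odot>$(P n) r (b i \<odot>$(P n) y)) \<in> D \<rightarrow> carrier (P n)"
      using tcl x y by auto
     fix i assume i: "i \<in> D"
     have "r (b i \<odot>$(P n) (x \<oplus>$(P n) y)) = r (b i \<odot>$(P n) x) \<oplus>$(P n) r (b i \<odot>$(P n) y)"
      using lmod_hom_add[OF r(1) bP[OF i x] bP[OF i y]] b(1)[OF i] x y
      by (simp add: P.smult_r_distr corner_module_simps)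
     then show "a i \<odot>$(P n) r (b i \<odot>$(P n) (x \<oplus>$(P n) y)) =
       a i \<odot>$(P n) r (b i \<odot>$(P n) x) \<oplus>$(P n) a i \<odot>$(P n) r (b i \<odot>$(P n) y)"
      using a(1)[OF i] rE(1)[OF bP[OF i x]] rE(1)[OF bP[OF i y]] by (simp add: P.smult_r_distr)
    qed
    also have "... = ?t x \<oplus>$(P n) ?t y" by (rule P.M.finsum_addf) (use tcl x y in auto)
    finally show ?thesis .
   qed
   show "?t (c \<odot>$(P n) x) = c \<odot>$(P n) ?t x" if c: "c :. R" and x: "x :. (P n)" for c x
   proof -
    let ?w = "%j. r (b j \<odot>$(P n) x)"
    have w: "?w j :. (P n)" if "j \<in> D" for j using rE(1)[OF bP[OF that x]] .
    let ?m = "%i j. (a i \<otimes>$R b i \<otimes>$R (c \<otimes>$R a j)) \<odot>$(P n) ?w j"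
    have m: "?m i j :. (P n)" if "i \<in> D" "j \<in> D" for i j using that a b c w by simp
    have "?t (c \<odot>$(P n) x) = (\<Oplus>$(P n)i\<in>D. \<Oplus>$(P n)j\<in>D. ?m i j)"
    proof (rule P.M.finsum_cong'[OF HOL.refl])
     show "(%i. \<Oplus>$(P n)j\<in>D. ?m i j) \<in> D \<rightarrow> carrier (P n)" using m by auto
     fix i assume i: "i \<in> D"
     have "a i \<odot>$(P n) r (b i \<odot>$(P n) (c \<odot>$(P n) x)) =
       (\<Oplus>$(P n)j\<in>D. a i \<odot>$(P n) ((b i \<otimes>$R c \<otimes>$R a j) \<odot>$(P n) ?w j))"
      unfolding key[OF i c x] by (rule P.smult_finsum[OF D]) (use a b c i w in auto)
     also have "... = (\<Oplus>$(P n)j\<in>D. ?m i j)"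
      by (rule P.M.finsum_cong'[OF HOL.refl])
       (use a b c i w m in \<open>auto simp: P.smult_assoc[symmetric] R.m_assoc\<close>)
     finally show "a i \<odot>$(P n) r (b i \<odot>$(P n) (c \<odot>$(P n) x)) = (\<Oplus>$(P n)j\<in>D. ?m i j)" .
    qed
    also have "... = (\<Oplus>$(P n)j\<in>D. \<Oplus>$(P n)i\<in>D. ?m i j)"
     by (rule P.finsum_swap_module) (use D m in auto)
    also have "... = (\<Oplus>$(P n)j\<in>D. c \<odot>$(P n) (a j \<odot>$(P n) ?w j))"
    proof (rule P.M.finsum_cong'[OF HOL.refl])
     show "(%j. c \<odot>$(P n) (a j \<odot>$(P n) ?w j)) \<in> D \<rightarrow> carrier (P n)" using c a w by auto
     fix j assume j: "j \<in> D"
     let ?y = "(c \<otimes>$R a j) \<odot>$(P n) ?w j"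
     have y: "?y :. (P n)" using c a j w by simp
     have "(\<Oplus>$(P n)i\<in>D. ?m i j) = (\<Oplus>$(P n)i\<in>D. (\<one>$R \<otimes>$R a i \<otimes>$R b i) \<odot>$(P n) ?y)"
      by (rule P.M.finsum_cong'[OF HOL.refl])
       (use a b c j w y in \<open>auto simp: P.smult_assoc\<close>)
     also have "... = ?y" using sum_ab[OF R.one_closed y] y by simp
     finally show "(\<Oplus>$(P n)i\<in>D. ?m i j) = c \<odot>$(P n) (a j \<odot>$(P n) ?w j)"
      using c a(1)[OF j] w[OF j] by (simp add: P.smult_assoc)
    qed
    also have "... = c \<odot>$(P n) ?t x"
     by (rule P.smult_finsum[OF D c, symmetric]) (use a w in auto)
    finally show ?thesis .
   qed
  qed
  show "boundary_retract R P d n"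
   unfolding boundary_retract_def
  proof (intro bexI[OF _ t] conjI ballI)
   show "?t ` carrier (P n) \<subseteq> d n ` carrier (P (Suc n))"
   proof
    fix y assume "y \<in> ?t ` carrier (P n)"
    then obtain x where x: "x :. (P n)" "y = ?t x" by blast
    have "\<exists>u. u :. (P (Suc n)) & r (b i \<odot>$(P n) x) = d n u" if "i \<in> D" for i
    proof -
     have "r (b i \<odot>$(P n) x) \<in> d n ` carrier (?E (P (Suc n)))" using r(2) bP[OF that x(1)] by blast
     then show ?thesis by (auto simp: mem)
    qed
    then obtain u where u: "!!i. i \<in> D ==> u i :. (P (Suc n))"
     "!!i. i \<in> D ==> r (b i \<odot>$(P n) x) = d n (u i)" by metis
    have "y = (\<Oplus>$(P n)i\<in>D. d n (a i \<odot>$(P (Suc n)) u i))"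
     unfolding x(2)
     by (rule P.M.finsum_cong'[OF HOL.refl])
      (use u a in \<open>auto simp: lmod_hom_smult[OF PD(4)] intro!: P.smult_closed lmod_hom_closed[OF PD(4)]\<close>)
    also have "... = d n (\<Oplus>$(P (Suc n))i\<in>D. a i \<odot>$(P (Suc n)) u i)"
     by (rule lmod_hom_finsum[OF PD(3) PD(3) PD(4) D, symmetric]) (use u a in auto)
    finally show "y \<in> d n ` carrier (P (Suc n))" using u a by auto
   qed
   fix x assume x: "x :. (P (Suc n))"
   have dx: "d n x :. (P n)" using lmod_hom_closed[OF PD(4) x] .
   have "?t (d n x) = (\<Oplus>$(P n)i\<in>D. (\<one>$R \<otimes>$R a i \<otimes>$R b i) \<odot>$(P n) d n x)"
   proof (rule P.M.finsum_cong'[OF HOL.refl])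
    show "(%i. (\<one>$R \<otimes>$R a i \<otimes>$R b i) \<odot>$(P n) d n x) \<in> D \<rightarrow> carrier (P n)" using a b dx by auto
    fix i assume i: "i \<in> D"
    have "b i \<odot>$(P n) d n x = d n (b i \<odot>$(P (Suc n)) x)"
     using lmod_hom_smult[OF PD(4) b(1)[OF i] x] by simp
    then have "r (b i \<odot>$(P n) d n x) = b i \<odot>$(P n) d n x" using r(3)[OF bE[OF PD(3) i x]] by simp
    then show "a i \<odot>$(P n) r (b i \<odot>$(P n) d n x) = (\<one>$R \<otimes>$R a i \<otimes>$R b i) \<odot>$(P n) d n x"
     using a(1)[OF i] b(1)[OF i] dx by (simp add: P.smult_assoc)
   qed
   also have "... = d n x" using sum_ab[OF R.one_closed dx] dx by simp
   finally show "?t (d n x) = d n x" .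
  qed
 }
qed

theorem pd_corner:
 assumes V: "left_module R V" and N: "left_module Z N"
  and \<chi>: "\<chi> \<in> lmod_hom Z (corner_module \<mu> e V) N" "bij_betw \<chi> (carrier (corner_module \<mu> e V)) (carrier N)"
 shows "pd R V = pd Z N"
proof -
 obtain P d \<epsilon> where P: "resolution R V (P :: nat => ('a, ('a + 'b + nat) list) module) d \<epsilon>"
  using projective_resolution_in_lists[OF V] by blast
 have "pd R V \<le> enat n \<longleftrightarrow> pd Z N \<le> enat n" for n
  by (simp add: pd_le_iff_boundary_retract[OF P] corner_boundary_retract[OF P]
    pd_le_iff_boundary_retract[OF corner_resolution[OF P N \<chi>]])
 then show ?thesis by (rule enat_eq_by_nat_bounds)
qed

end

section \<open>Central localization\<close>

text \<open>
  An abstract localization \<open>L\<close> of \<open>R\<close> at central denominators, without zero divisors among them.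
  Resolutions are localized through free modules, as functions into \<open>L\<close>.
\<close>

locale central_localization =
 R: ring R + L: ring L
 for R :: "('a, 's) ring_scheme" and L :: "('b, 't) ring_scheme" +
 fixes loc :: "'a => 'b" and T :: "'a set"
 assumes hom: "loc \<in> ring_hom R L" and inj: "inj_on loc (carrier R)"
  and T: "T \<subseteq> carrier R" "\<one>$R \<in> T" "!!s t. [|s \<in> T; t \<in> T|] ==> s \<otimes>$R t \<in> T"
  and central: "!!t a. [|t \<in> T; a :. R|] ==> t \<otimes>$R a = a \<otimes>$R t"
  and unit: "!!t. t \<in> T ==> \<exists>u\<in>carrier L. u \<otimes>$L loc t = \<one>$L & loc t \<otimes>$L u = \<one>$L"
  and frac: "!!x. x :. L ==> \<exists>t\<in>T. \<exists>a\<in>carrier R. loc t \<otimes>$L x = loc a"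
begin

lemmas loc_hom = ring_hom_closed[OF hom] ring_hom_add[OF hom] ring_hom_mult[OF hom] ring_hom_one[OF hom]

lemma loc_zero_iff: "a :. R ==> loc a = \<zero>$L \<longleftrightarrow> a = \<zero>$R"
 using inj_onD[OF inj, of a "\<zero>$R"] ring_hom_zero[OF hom R.ring_axioms L.ring_axioms] by auto

lemma Tc: "t \<in> T ==> t :. R"
 using T(1) by blast

lemma loc_central:
 assumes t: "t \<in> T" and x: "x :. L"
 shows "loc t \<otimes>$L x = x \<otimes>$L loc t"
proof -
 obtain s a where s: "s \<in> T" "a :. R" "loc s \<otimes>$L x = loc a" using frac[OF x] by blast
 obtain u where u: "u :. L" "u \<otimes>$L loc s = \<one>$L" using unit[OF s(1)] by blast
 have ls: "loc s :. L" and lt: "loc t :. L" using loc_hom(1) Tc s t by auto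
 have "loc s \<otimes>$L (loc t \<otimes>$L x) = loc (s \<otimes>$R t) \<otimes>$L x"
  using ls lt x by (simp add: loc_hom(3) Tc s t L.m_assoc)
 also have "s \<otimes>$R t = t \<otimes>$R s" by (rule central[OF s(1) Tc[OF t]])
 also have "loc (t \<otimes>$R s) \<otimes>$L x = loc t \<otimes>$L loc a"
  using ls lt x by (simp add: loc_hom(3) Tc s t L.m_assoc)
 also have "... = loc a \<otimes>$L loc t"
  using central[OF t s(2)] by (simp add: loc_hom(3)[symmetric] Tc s t)
 also have "... = loc s \<otimes>$L (x \<otimes>$L loc t)"
  using ls lt x by (simp add: s(3)[symmetric] L.m_assoc)
 finally have "u \<otimes>$L (loc s \<otimes>$L (loc t \<otimes>$L x)) = u \<otimes>$L (loc s \<otimes>$L (x \<otimes>$L loc t))" by simp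
 then show ?thesis using u ls lt x by (simp add: L.m_assoc[symmetric])
qed

lemma smult_cancel:
 assumes "left_module L M" "t \<in> T" "y :. M" "loc t \<odot>$M y = \<zero>$M"
 shows "y = \<zero>$M"
proof -
 interpret M: left_module L M by fact
 obtain u where u: "u :. L" "u \<otimes>$L loc t = \<one>$L" using unit[OF assms(2)] by blast
 have "y = (u \<otimes>$L loc t) \<odot>$M y" using u assms(3) by simp
 also have "... = \<zero>$M"
  using M.smult_assoc[OF u(1) loc_hom(1)[OF Tc[OF assms(2)]] assms(3)] assms(4) u(1) by (simp add: M.smult_zeros)
 finally show ?thesis .
qed

abbreviation push :: "('c => 'a) => 'c => 'b" where "push f \<equiv> %i. loc (f i)"

lemma push_supp: "f :. (free_module R C) ==> {i. push f i ~= \<zero>$L} = {i. f i ~= \<zero>$R}"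
 by (auto simp: free_module_def loc_zero_iff)

lemma push_hom: "push \<in> lmod_hom R (free_module R C) (restrict_scalars loc (free_module L C))"
proof (rule lmod_homI)
 show "push f :. (restrict_scalars loc (free_module L C))" if "f :. (free_module R C)" for f
  using that push_supp[OF that] ring_hom_zero[OF hom R.ring_axioms L.ring_axioms]
  by (simp add: restrict_scalars_def free_module_def loc_hom)
qed (auto simp: restrict_scalars_def free_module_def loc_hom)

lemma push_closed: "f :. (free_module R C) ==> push f :. (free_module L C)"
 using lmod_hom_closed[OF push_hom] by (auto simp: restrict_scalars_def)

lemma push_inj:
 assumes "f :. (free_module R C)" "g :. (free_module R C)" "push f = push g"
 shows "f = g"
proof
 fix i
 have "f i :. R" "g i :. R" "loc (f i) = loc (g i)"
  using assms by (auto simp: free_module_def dest: fun_cong)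
 then show "f i = g i" using inj by (simp add: inj_on_eq_iff)
qed

lemma common_denominator:
 assumes "finite C" "!!i. i \<in> C ==> x i :. L"
 shows "\<exists>t\<in>T. \<forall>i\<in>C. \<exists>a\<in>carrier R. loc t \<otimes>$L x i = loc a"
 using assms
proof (induct rule: finite_induct)
 case empty then show ?case using T(2) by blast
next
 case (insert j C)
 then obtain t where t: "t \<in> T" "!!i. i \<in> C ==> \<exists>a\<in>carrier R. loc t \<otimes>$L x i = loc a" by auto
 obtain s b where s: "s \<in> T" "b :. R" "loc s \<otimes>$L x j = loc b" using frac[of "x j"] insert(4) by auto
 have st: "loc (s \<otimes>$R t) \<otimes>$L y = loc s \<otimes>$L (loc t \<otimes>$L y)"
  "loc (s \<otimes>$R t) \<otimes>$L y = loc t \<otimes>$L (loc s \<otimes>$L y)" if "y :. L" for y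
  using that s t loc_central[OF t(1), of "loc s"] by (simp_all add: loc_hom Tc L.m_assoc[symmetric])
 show ?case
 proof (intro bexI[OF _ T(3)[OF s(1) t(1)]] ballI)
  fix i assume i: "i \<in> insert j C"
  show "\<exists>a\<in>carrier R. loc (s \<otimes>$R t) \<otimes>$L x i = loc a"
  proof (cases "i = j")
   case True
   then have "loc (s \<otimes>$R t) \<otimes>$L x i = loc (t \<otimes>$R b)"
    using st(2)[of "x j"] insert(4) s t by (simp add: loc_hom Tc)
   then show ?thesis using s t Tc by blast
  next
   case False
   then obtain a where a: "a :. R" "loc t \<otimes>$L x i = loc a" using t(2) i by blast
   then have "loc (s \<otimes>$R t) \<otimes>$L x i = loc (s \<otimes>$R a)"
    using st(1)[of "x i"] insert(4) s t i by (simp add: loc_hom Tc)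
   then show ?thesis using s a Tc by blast
  qed
 qed
qed

text \<open>
  Free modules of finite rank over \<open>L\<close> consist of fractions of elements of the free module over \<open>R\<close>.
\<close>

lemma push_frac:
 assumes C: "finite C" and x: "x :. (free_module L C)"
 shows "\<exists>t\<in>T. \<exists>y\<in>carrier (free_module R C). loc t \<odot>$(free_module L C) x = push y"
proof -
 have xc: "x i :. L" "i \<notin> C ==> x i = \<zero>$L" for i using x by (auto simp: free_module_def)
 obtain t where t: "t \<in> T" "\<forall>i\<in>C. \<exists>a\<in>carrier R. loc t \<otimes>$L x i = loc a"
  using common_denominator[OF C, of x] xc(1) by blast
 then obtain a where a: "!!i. i \<in> C ==> a i :. R" "!!i. i \<in> C ==> loc t \<otimes>$L x i = loc (a i)" by metis
 let ?y = "%i. if i \<in> C then a i else \<zero>$R"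
 have "{i. ?y i ~= \<zero>$R} \<subseteq> C" by auto
 then have "?y :. (free_module R C)"
  using finite_subset[OF _ C] a by (simp add: free_module_def)
 moreover have "loc t \<odot>$(free_module L C) x = push ?y"
  using a(2) xc t Tc by (auto simp: free_module_def loc_hom ring_hom_zero[OF hom R.ring_axioms L.ring_axioms])
 ultimately show ?thesis by (intro bexI[OF _ t(1)] bexI[of _ ?y])
qed

text \<open>
  Extension of scalars of a map out of a free module, determined by the images of the basis.
\<close>

definition ext :: "('b, 'n) module => ('m => 'n) => (('c => 'a) => 'm) => ('c => 'b) => 'n" where
 "ext M' \<iota> h = free_extend L M' (%c. \<iota> (h (%x. if x = c then \<one>$R else \<zero>$R)))"

lemma ext_props:
 fixes C :: "'c set"
 assumes M: "left_module R M" and M': "left_module L M'" and \<iota>: "\<iota> \<in> lmod_hom R M (restrict_scalars loc M')"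
  and h: "h \<in> lmod_hom R (free_module R C) M"
 shows "ext M' \<iota> h \<in> lmod_hom L (free_module L C) M'"
  and "!!x. x :. (free_module R C) ==> ext M' \<iota> h (push x) = \<iota> (h x)"
proof -
 let ?u = "%c x. if x = c then \<one>$R else \<zero>$R"
 let ?N = "restrict_scalars loc M'"
 have N: "left_module R ?N" by (rule left_module_restrict_scalars[OF R.ring_axioms M' hom])
 interpret N: left_module R ?N by (rule N)
 interpret M': left_module L M' by (rule M')
 have u: "?u \<in> C \<rightarrow> carrier (free_module R C)" by (auto simp: free_module_def)
 have ih: "(%x. \<iota> (h x)) \<in> lmod_hom R (free_module R C) ?N" by (rule lmod_hom_comp[OF h \<iota>])
 have cl: "(%c. \<iota> (h (?u c))) \<in> C \<rightarrow> carrier M'"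
  using lmod_hom_closed[OF ih] u by (auto simp: restrict_scalars_def)
 show "ext M' \<iota> h \<in> lmod_hom L (free_module L C) M'"
  unfolding ext_def by (rule free_extend_hom[OF M' cl])
 fix x assume x: "x :. (free_module R C)"
 have "\<iota> (h x) = free_extend R ?N (%c. \<iota> (h (?u c))) x"
  by (rule free_extend_unique[OF N ih x])
 also have "... = (\<Oplus>$(?N)c\<in>{c. x c ~= \<zero>$R}. loc (x c) \<odot>$M' \<iota> (h (?u c)))"
  by (simp add: free_extend_def restrict_scalars_def)
 also have "finsum ?N = finsum M'"
  by (rule finsum_same_addition) (simp_all add: restrict_scalars_def)
 also have "(\<Oplus>$M' c\<in>{c. x c ~= \<zero>$R}. loc (x c) \<odot>$M' \<iota> (h (?u c))) = ext M' \<iota> h (push x)"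
  by (simp add: ext_def free_extend_def push_supp[OF x])
 finally show "ext M' \<iota> h (push x) = \<iota> (h x)" by simp
qed

text \<open>
  Localization is exact: clearing denominators reduces a kernel element over \<open>L\<close> to one over \<open>R\<close>.
\<close>

lemma ext_exact:
 assumes M: "left_module R M" and M': "left_module L M'" and \<iota>: "\<iota> \<in> lmod_hom R M (restrict_scalars loc M')"
  and \<iota>0: "!!m. m :. M ==> \<iota> m = \<zero>$M' ==> m = \<zero>$M"
  and C: "finite C" "finite C'"
  and g: "g \<in> lmod_hom R (free_module R C) M" and f: "f \<in> lmod_hom R (free_module R C') (free_module R C)"
  and exact: "lmod_ker (free_module R C) M g = f ` carrier (free_module R C')"
 shows "lmod_ker (free_module L C) M' (ext M' \<iota> g) =
  ext (free_module L C) push f ` carrier (free_module L C')"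
proof -
 let ?F = "free_module R" and ?F' = "free_module L"
 let ?g = "ext M' \<iota> g" and ?f = "ext (?F' C) push f"
 have F: "left_module R (?F C)" and F': "left_module L (?F' C)" and F'': "left_module L (?F' C')"
  by (rule left_module_free_module[OF R.ring_axioms] left_module_free_module[OF L.ring_axioms])+
 note g' = ext_props[OF M M' \<iota> g] and f' = ext_props[OF F F' push_hom f]
 interpret M': left_module L M' by (rule M')
 interpret F': left_module L "?F' C" by (rule F')
 interpret M: left_module R M by (rule M)
 have \<iota>z: "\<iota> \<zero>$M = \<zero>$M'"
  using lmod_hom_zero[OF M left_module_restrict_scalars[OF R.ring_axioms M' hom] \<iota>]
  by (simp add: restrict_scalars_def)
 show ?thesis
 proof
  show "?f ` carrier (?F' C') \<subseteq> lmod_ker (?F' C) M' ?g"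
  proof
   fix y assume "y \<in> ?f ` carrier (?F' C')"
   then obtain x where x: "x :. (?F' C')" "y = ?f x" by blast
   obtain t w where t: "t \<in> T" and w: "w :. (?F C')" "loc t \<odot>$(?F' C') x = push w"
    using push_frac[OF C(2) x(1)] by blast
   have lt: "loc t :. L" using loc_hom(1) Tc t by blast
   have fx: "?f x :. (?F' C)" by (rule lmod_hom_closed[OF f'(1) x(1)])
   have "loc t \<odot>$M' ?g (?f x) = ?g (?f (push w))"
    unfolding w(2)[symmetric] lmod_hom_smult[OF f'(1) lt x(1)] lmod_hom_smult[OF g'(1) lt fx] ..
   also have "... = \<iota> (g (f w))"
    using f'(2)[OF w(1)] g'(2)[OF lmod_hom_closed[OF f w(1)]] by simp
   also have "g (f w) = \<zero>$M" using exact w(1) by (auto simp: lmod_ker_def)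
   finally have "?g (?f x) = \<zero>$M'"
    using smult_cancel[OF M' t lmod_hom_closed[OF g'(1) fx]] \<iota>z by simp
   then show "y \<in> lmod_ker (?F' C) M' ?g" using fx x(2) by (simp add: lmod_ker_def)
  qed
  show "lmod_ker (?F' C) M' ?g \<subseteq> ?f ` carrier (?F' C')"
  proof
   fix x assume "x \<in> lmod_ker (?F' C) M' ?g"
   then have x: "x :. (?F' C)" "?g x = \<zero>$M'" by (auto simp: lmod_ker_def)
   obtain t y where t: "t \<in> T" and y: "y :. (?F C)" "loc t \<odot>$(?F' C) x = push y"
    using push_frac[OF C(1) x(1)] by blast
   have lt: "loc t :. L" using loc_hom(1) Tc t by blast
   have "\<iota> (g y) = loc t \<odot>$M' ?g x"
    using g'(2)[OF y(1)] lmod_hom_smult[OF g'(1) lt x(1)] by (simp add: y(2))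
   then have "g y = \<zero>$M" using \<iota>0[OF lmod_hom_closed[OF g y(1)]] x(2) lt by (simp add: M'.smult_zeros)
   then obtain w where w: "w :. (?F C')" "y = f w" using exact y(1) by (auto simp: lmod_ker_def)
   obtain u where u: "u :. L" "u \<otimes>$L loc t = \<one>$L" using unit[OF t] by blast
   have "x = (u \<otimes>$L loc t) \<odot>$(?F' C) x" using u x(1) by simp
   also have "... = u \<odot>$(?F' C) push y" unfolding F'.smult_assoc[OF u(1) lt x(1)] y(2) ..
   also have "... = ?f (u \<odot>$(?F' C') push w)"
    unfolding lmod_hom_smult[OF f'(1) u(1) push_closed[OF w(1)]] f'(2)[OF w(1)] w(2) ..
   finally show "x \<in> ?f ` carrier (?F' C')"
    using left_module.smult_closed[OF F'' u(1) push_closed[OF w(1)]] by blast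
  qed
 qed
qed

text \<open>
  A retraction over \<open>R\<close> localizes. Given one over \<open>L\<close>, a common denominator \<open>t\<close> of its finitely many
  matrix entries produces a map over \<open>R\<close> into the image of \<open>d n\<close> that acts there as multiplication by
  \<open>t\<close>. Choose central \<open>z\<close> and \<open>c\<close> with \<open>z t + c = 1\<close> and \<open>c V = 0\<close>. Multiplication by \<open>c\<close> is a chain map
  over zero, hence on boundaries it factors through a map into the image of \<open>d n\<close>, and the two maps
  together give a retraction over \<open>R\<close>.
\<close>

theorem pd_localization:
 assumes noeth: "noetherian_free_modules R" and V: "left_module R V" and V': "left_module L V'"
  and \<iota>: "\<iota> \<in> lmod_hom R V (restrict_scalars loc V')" "bij_betw \<iota> (carrier V) (carrier V')"
  and fg: "\<epsilon> \<in> lmod_hom R (free_module R {..<m::nat}) V" "\<epsilon> ` carrier (free_module R {..<m}) = carrier V"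
  and comax: "!!t. t \<in> T ==> \<exists>z\<in>carrier R. \<exists>c\<in>annihilator R V. z \<otimes>$R t \<oplus>$R c = \<one>$R &
   (\<forall>a\<in>carrier R. z \<otimes>$R a = a \<otimes>$R z & c \<otimes>$R a = a \<otimes>$R c)"
 shows "pd R V = pd L V'"
proof -
 let ?F = "\<lambda>n::nat. free_module R {..<n}" and ?F' = "\<lambda>n::nat. free_module L {..<n}"
 have F: "left_module R (?F n)" for n by (rule left_module_free_module[OF R.ring_axioms])
 have F': "left_module L (?F' n)" for n by (rule left_module_free_module[OF L.ring_axioms])
 obtain k d where P: "resolution R V (%i. ?F (k i)) d \<epsilon>"
  using finite_free_resolution_exists[OF R.ring_axioms noeth V fg] by blast
 note PD = resolutionD[OF P]
 define d' where "d' i = ext (?F' (k i)) push (d i)" for i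
 define \<epsilon>' where "\<epsilon>' = ext V' \<iota> \<epsilon>"
 note d' = ext_props[OF F F' push_hom PD(4), folded d'_def]
 note \<epsilon>' = ext_props[OF V V' \<iota>(1) PD(5), folded \<epsilon>'_def]
 interpret V: left_module R V by (rule V)
 have \<iota>0: "m = \<zero>$V" if "m :. V" "\<iota> m = \<zero>$V'" for m
  using that \<iota>(2) lmod_hom_zero[OF V left_module_restrict_scalars[OF R.ring_axioms V' hom] \<iota>(1)]
  by (auto simp: bij_betw_def inj_on_def restrict_scalars_def)
 have push0: "y = \<zero>$(?F n)" if "y :. (?F n)" "push y = \<zero>$(?F' n)" for y n
  using push_inj[OF that(1) abelian_monoid.zero_closed] that F[of n]
   lmod_hom_zero[OF F left_module_restrict_scalars[OF R.ring_axioms F' hom] push_hom, of n]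
  by (auto simp: restrict_scalars_def left_module_def abelian_group_def)
 have P': "resolution L V' (%i. ?F' (k i)) d' \<epsilon>'"
  unfolding resolution_def
 proof (intro conjI allI V' projective_free_module L.ring_axioms)
  show "d' i \<in> lmod_hom L (?F' (k (Suc i))) (?F' (k i))" for i by (rule d'(1))
  show "\<epsilon>' \<in> lmod_hom L (?F' (k 0)) V'" by (rule \<epsilon>'(1))
  show "\<epsilon>' ` carrier (?F' (k 0)) = carrier V'"
  proof
   show "\<epsilon>' ` carrier (?F' (k 0)) \<subseteq> carrier V'" using lmod_hom_closed[OF \<epsilon>'(1)] by blast
   show "carrier V' \<subseteq> \<epsilon>' ` carrier (?F' (k 0))"
   proof
    fix v' assume "v' :. V'"
    then obtain v where v: "v :. V" "v' = \<iota> v" using \<iota>(2) by (auto simp: bij_betw_def)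
    obtain x where x: "x :. (?F (k 0))" "v = \<epsilon> x" using PD(6)[OF v(1)] by blast
    have "v' = \<epsilon>' (push x)" using \<epsilon>'(2)[OF x(1)] v x by simp
    then show "v' \<in> \<epsilon>' ` carrier (?F' (k 0))" using push_closed[OF x(1)] by blast
   qed
  qed
  show "lmod_ker (?F' (k 0)) V' \<epsilon>' = d' 0 ` carrier (?F' (k (Suc 0)))"
   unfolding \<epsilon>'_def d'_def
   by (rule ext_exact[OF V V' \<iota>(1) \<iota>0 _ _ PD(5) PD(4)]) (use P in \<open>simp_all add: resolution_def\<close>)
  show "lmod_ker (?F' (k (Suc i))) (?F' (k i)) (d' i) = d' (Suc i) ` carrier (?F' (k (Suc (Suc i))))" for i
   unfolding d'_def
   by (rule ext_exact[OF F F' push_hom push0 _ _ PD(4) PD(4)]) (use P in \<open>simp_all add: resolution_def\<close>)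
 qed
 have "boundary_retract R (%i. ?F (k i)) d n \<longleftrightarrow> boundary_retract L (%i. ?F' (k i)) d' n" for n
 proof
  interpret Fn: left_module R "?F (k n)" by (rule F)
  interpret F'n: left_module L "?F' (k n)" by (rule F')
  interpret F'S: left_module L "?F' (k (Suc n))" by (rule F')
  assume "boundary_retract R (%i. ?F (k i)) d n"
  then obtain r where r: "r \<in> lmod_hom R (?F (k n)) (?F (k n))"
   "r ` carrier (?F (k n)) \<subseteq> d n ` carrier (?F (k (Suc n)))"
   "!!x. x :. (?F (k (Suc n))) ==> r (d n x) = d n x"
   unfolding boundary_retract_def by blast
  let ?r = "ext (?F' (k n)) push r"
  note r' = ext_props[OF F F' push_hom r(1)]
  show "boundary_retract L (%i. ?F' (k i)) d' n"
   unfolding boundary_retract_def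
  proof (intro bexI[OF _ r'(1)] conjI ballI)
   show "?r ` carrier (?F' (k n)) \<subseteq> d' n ` carrier (?F' (k (Suc n)))"
   proof
    fix y assume "y \<in> ?r ` carrier (?F' (k n))"
    then obtain x where x: "x :. (?F' (k n))" "y = ?r x" by blast
    obtain t w where t: "t \<in> T" and w: "w :. (?F (k n))" "loc t \<odot>$(?F' (k n)) x = push w"
     using push_frac[OF _ x(1)] by auto
    obtain u where u: "u :. L" "u \<otimes>$L loc t = \<one>$L" using unit[OF t] by blast
    have lt: "loc t :. L" using loc_hom(1) Tc t by blast
    obtain v where v: "v :. (?F (k (Suc n)))" "r w = d n v" using r(2) w(1) by blast
    have "y = (u \<otimes>$L loc t) \<odot>$(?F' (k n)) ?r x" using u x lmod_hom_closed[OF r'(1) x(1)] by simp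
    also have "... = u \<odot>$(?F' (k n)) ?r (push w)"
     unfolding F'n.smult_assoc[OF u(1) lt lmod_hom_closed[OF r'(1) x(1)]]
      lmod_hom_smult[OF r'(1) lt x(1), symmetric] w(2) ..
    also have "... = d' n (u \<odot>$(?F' (k (Suc n))) push v)"
     unfolding lmod_hom_smult[OF d'(1) u(1) push_closed[OF v(1)]] d'(2)[OF v(1)] r'(2)[OF w(1)] v(2) ..
    finally show "y \<in> d' n ` carrier (?F' (k (Suc n)))"
     using F'S.smult_closed[OF u(1) push_closed[OF v(1)]] by blast
   qed
   fix x assume x: "x :. (?F' (k (Suc n)))"
   obtain t w where t: "t \<in> T" and w: "w :. (?F (k (Suc n)))" "loc t \<odot>$(?F' (k (Suc n))) x = push w"
    using push_frac[OF _ x(1)] by auto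
   obtain u where u: "u :. L" "u \<otimes>$L loc t = \<one>$L" using unit[OF t] by blast
   have lt: "loc t :. L" using loc_hom(1) Tc t by blast
   have eq: "x = u \<odot>$(?F' (k (Suc n))) push w"
    using F'S.smult_assoc[OF u(1) lt x] u x by (simp add: w(2))
   have "?r (d' n (push w)) = d' n (push w)"
    using d'(2)[OF w(1)] r'(2)[OF lmod_hom_closed[OF PD(4) w(1)]] r(3)[OF w(1)] by simp
   then show "?r (d' n x) = d' n x"
    using push_closed[OF w(1)] u(1) lmod_hom_closed[OF d'(1)]
    by (simp add: eq lmod_hom_smult[OF d'(1)] lmod_hom_smult[OF r'(1)])
  qed
 next
  interpret Fn: left_module R "?F (k n)" by (rule F)
  interpret FS: left_module R "?F (k (Suc n))" by (rule F)
  interpret F'n: left_module L "?F' (k n)" by (rule F')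
  assume "boundary_retract L (%i. ?F' (k i)) d' n"
  then obtain r where r: "r \<in> lmod_hom L (?F' (k n)) (?F' (k n))"
   "r ` carrier (?F' (k n)) \<subseteq> d' n ` carrier (?F' (k (Suc n)))"
   "!!x. x :. (?F' (k (Suc n))) ==> r (d' n x) = d' n x"
   unfolding boundary_retract_def by blast
  let ?u = "\<lambda>c x::nat. if x = c then \<one>$R else \<zero>$R"
  have u: "?u c :. (?F (k n))" if "c < k n" for c using that by (auto simp: free_module_def)
  have "\<forall>c\<in>{..<k n}. \<exists>y\<in>carrier (?F' (k (Suc n))). r (push (?u c)) = d' n y"
   using r(2) push_closed[OF u] by blast
  then obtain y where y: "!!c. c < k n ==> y c :. (?F' (k (Suc n)))"
   "!!c. c < k n ==> r (push (?u c)) = d' n (y c)"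
   by (metis lessThan_iff)
  have "\<exists>t\<in>T. \<forall>ci\<in>{..<k n} \<times> {..<k (Suc n)}. \<exists>a\<in>carrier R. loc t \<otimes>$L y (fst ci) (snd ci) = loc a"
   by (rule common_denominator) (use y(1) in \<open>auto simp: free_module_def\<close>)
  then obtain t where t: "t \<in> T"
   "!!c i. c < k n ==> i < k (Suc n) ==> \<exists>a\<in>carrier R. loc t \<otimes>$L y c i = loc a" by auto
  have lt: "loc t :. L" using loc_hom(1) Tc t(1) by blast
  have "\<exists>w\<in>carrier (?F (k (Suc n))). loc t \<odot>$(?F' (k (Suc n))) y c = push w" if c: "c < k n" for c
  proof -
   obtain a where a: "!!i. i < k (Suc n) ==> a i :. R"
    "!!i. i < k (Suc n) ==> loc t \<otimes>$L y c i = loc (a i)" using t(2)[OF c] by metis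
   let ?w = "%i. if i < k (Suc n) then a i else \<zero>$R"
   have "{i. ?w i ~= \<zero>$R} \<subseteq> {..<k (Suc n)}" by auto
   then have "?w :. (?F (k (Suc n)))"
    using finite_subset[OF _ finite_lessThan] a by (simp add: free_module_def)
   moreover have "loc t \<odot>$(?F' (k (Suc n))) y c = push ?w"
    using a(2) y(1)[OF c] lt
    by (auto simp: free_module_def ring_hom_zero[OF hom R.ring_axioms L.ring_axioms])
   ultimately show ?thesis by (intro bexI[of _ ?w])
  qed
  then obtain w where w: "!!c. c < k n ==> w c :. (?F (k (Suc n)))"
   "!!c. c < k n ==> loc t \<odot>$(?F' (k (Suc n))) y c = push (w c)" by metis
  have dw: "(%c. d n (w c)) \<in> {..<k n} \<rightarrow> carrier (?F (k n))" using lmod_hom_closed[OF PD(4) w(1)] by auto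
  have wc: "w \<in> {..<k n} \<rightarrow> carrier (?F (k (Suc n)))" using w(1) by auto
  define s where "s = free_extend R (?F (k n)) (%c. d n (w c))"
  have s: "s \<in> lmod_hom R (?F (k n)) (?F (k n))" unfolding s_def by (rule free_extend_hom[OF F dw])
  have sB: "s x \<in> d n ` carrier (?F (k (Suc n)))" if x: "x :. (?F (k n))" for x
  proof -
   have "s x = d n (free_extend R (?F (k (Suc n))) w x)"
    unfolding s_def by (rule free_module_generates[OF F F wc PD(4) x, symmetric])
   then show ?thesis using lmod_hom_closed[OF free_extend_hom[OF F wc] x] by blast
  qed
  let ?N = "restrict_scalars loc (?F' (k n))"
  have N: "left_module R ?N" by (rule left_module_restrict_scalars[OF R.ring_axioms F' hom])
  interpret N: left_module R ?N by (rule N)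
  have push_s: "push (s x) = loc t \<odot>$(?F' (k n)) r (push x)" if x: "x :. (?F (k n))" for x
  proof -
   have h1: "(%x. push (s x)) \<in> lmod_hom R (?F (k n)) ?N" by (rule lmod_hom_comp[OF s push_hom])
   have rN: "r \<in> lmod_hom R ?N ?N"
    by (rule lmod_homI) (simp_all add: restrict_scalars_def lmod_hom_closed[OF r(1)] lmod_hom_add[OF r(1)]
      lmod_hom_smult[OF r(1)] loc_hom)
   have tN: "(%x. loc t \<odot>$(?F' (k n)) x) \<in> lmod_hom R ?N ?N"
    by (rule lmod_homI)
     (use lt in \<open>simp_all add: restrict_scalars_def F'n.smult_r_distr loc_hom F'n.smult_assoc[symmetric]
      loc_central[OF t(1)]\<close>)
   have h2: "(%x. loc t \<odot>$(?F' (k n)) r (push x)) \<in> lmod_hom R (?F (k n)) ?N"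
    by (rule lmod_hom_comp[OF lmod_hom_comp[OF push_hom rN] tN])
   have eq: "push (s (?u c)) = loc t \<odot>$(?F' (k n)) r (push (?u c))" if c: "c \<in> {..<k n}" for c
   proof -
    have c': "c < k n" using c by simp
    have "s (?u c) = d n (w c)" unfolding s_def by (rule free_extend_zero_one(2)[OF F dw c])
    then have "push (s (?u c)) = d' n (push (w c))" using d'(2)[OF w(1)[OF c']] by simp
    also have "... = loc t \<odot>$(?F' (k n)) d' n (y c)"
     unfolding w(2)[OF c', symmetric] by (rule lmod_hom_smult[OF d'(1) lt y(1)[OF c']])
    finally show ?thesis by (simp add: y(2)[OF c'])
   qed
   have "push (s x) = free_extend R ?N (%c. push (s (?u c))) x" by (rule free_extend_unique[OF N h1 x])
   also have "... = free_extend R ?N (%c. loc t \<odot>$(?F' (k n)) r (push (?u c))) x"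
    unfolding free_extend_def
   proof (rule N.M.finsum_cong'[OF HOL.refl])
    have supp: "c \<in> {..<k n}" if "c \<in> {c. x c ~= \<zero>$R}" for c using that x by (auto simp: free_module_def)
    have xc: "x c :. R" for c using x by (auto simp: free_module_def)
    show "(%c. x c \<odot>$(?N) (loc t \<odot>$(?F' (k n)) r (push (?u c)))) \<in> {c. x c ~= \<zero>$R} \<rightarrow> carrier ?N"
    proof
     fix c assume "c \<in> {c. x c ~= \<zero>$R}"
     then have "c < k n" using supp by auto
     then show "x c \<odot>$(?N) (loc t \<odot>$(?F' (k n)) r (push (?u c))) :. ?N"
      using lmod_hom_closed[OF h2 u] xc by (intro N.smult_closed) auto
    qed
    show "x c \<odot>$(?N) push (s (?u c)) = x c \<odot>$(?N) (loc t \<odot>$(?F' (k n)) r (push (?u c)))"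
     if "c \<in> {c. x c ~= \<zero>$R}" for c using eq[OF supp[OF that]] by simp
   qed
   also have "... = loc t \<odot>$(?F' (k n)) r (push x)" by (rule free_extend_unique[OF N h2 x, symmetric])
   finally show ?thesis .
  qed
  have s_t: "s (d n x) = t \<odot>$(?F (k n)) d n x" if x: "x :. (?F (k (Suc n)))" for x
  proof (rule push_inj)
   have dx: "d n x :. (?F (k n))" by (rule lmod_hom_closed[OF PD(4) x])
   show "s (d n x) :. (?F (k n))" by (rule lmod_hom_closed[OF s dx])
   show "t \<odot>$(?F (k n)) d n x :. (?F (k n))" using Tc[OF t(1)] dx by simp
   have "push (s (d n x)) = loc t \<odot>$(?F' (k n)) r (d' n (push x))"
    using push_s[OF dx] d'(2)[OF x] by simp
   also have "... = loc t \<odot>$(?F' (k n)) push (d n x)"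
    using r(3)[OF push_closed[OF x]] d'(2)[OF x] by simp
   also have "... = push (t \<odot>$(?F (k n)) d n x)"
    using lmod_hom_smult[OF push_hom Tc[OF t(1)] dx] by (simp add: restrict_scalars_def)
   finally show "push (s (d n x)) = push (t \<odot>$(?F (k n)) d n x)" .
  qed
  obtain z c where z: "z :. R" and c: "c \<in> annihilator R V" and one: "z \<otimes>$R t \<oplus>$R c = \<one>$R"
   and zc: "!!a. a :. R ==> z \<otimes>$R a = a \<otimes>$R z" and cc: "!!a. a :. R ==> c \<otimes>$R a = a \<otimes>$R c"
   using comax[OF t(1)] by blast
  have cR: "c :. R" using c by (simp add: annihilator_def)
  have central_hom: "(%x. q \<odot>$(?F j) x) \<in> lmod_hom R (?F j) (?F j)"
   if "q :. R" "!!a. a :. R ==> q \<otimes>$R a = a \<otimes>$R q" for q j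
  proof -
   interpret Fj: left_module R "?F j" by (rule F)
   show ?thesis
    by (rule lmod_homI) (use that in \<open>simp_all add: Fj.smult_r_distr Fj.smult_assoc[symmetric]\<close>)
  qed
  obtain h where h: "h \<in> lmod_hom R (?F (k n)) (?F (k (Suc n)))"
   "!!x. x :. (?F (k (Suc n))) ==> c \<odot>$(?F (k n)) d n x = d n (h (d n x))"
  proof -
   have "\<exists>h\<in>lmod_hom R (?F (k n)) (?F (k (Suc n))). \<forall>x\<in>carrier (?F (k (Suc n))).
     c \<odot>$(?F (k n)) d n x = d n (h (d n x))"
   proof (rule null_homotopy_on_boundaries[OF P P])
    show "(%x. c \<odot>$(?F (k i)) x) \<in> lmod_hom R (?F (k i)) (?F (k i))" for i by (rule central_hom[OF cR cc])
    show "\<epsilon> (c \<odot>$(?F (k 0)) x) = \<zero>$V" if "x :. (?F (k 0))" for x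
     using lmod_hom_smult[OF PD(5) cR that] lmod_hom_closed[OF PD(5) that] c by (simp add: annihilator_def)
    show "d i (c \<odot>$(?F (k (Suc i))) x) = c \<odot>$(?F (k i)) d i x" if "x :. (?F (k (Suc i)))" for i x
     by (rule lmod_hom_smult[OF PD(4) cR that])
   qed
   then show ?thesis using that by blast
  qed
  show "boundary_retract R (%i. ?F (k i)) d n"
   unfolding boundary_retract_def
  proof (intro bexI conjI ballI)
   let ?q = "%x. z \<odot>$(?F (k n)) s x \<oplus>$(?F (k n)) d n (h x)"
   show "?q \<in> lmod_hom R (?F (k n)) (?F (k n))"
    by (rule lmod_hom_add_fun[OF F F lmod_hom_comp[OF s central_hom[OF z zc]] lmod_hom_comp[OF h(1) PD(4)]])
   show "?q ` carrier (?F (k n)) \<subseteq> d n ` carrier (?F (k (Suc n)))"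
   proof
    fix y assume "y \<in> ?q ` carrier (?F (k n))"
    then obtain x where x: "x :. (?F (k n))" "y = ?q x" by blast
    obtain v where v: "v :. (?F (k (Suc n)))" "s x = d n v" using sB[OF x(1)] by blast
    have hx: "h x :. (?F (k (Suc n)))" by (rule lmod_hom_closed[OF h(1) x(1)])
    have "y = d n (z \<odot>$(?F (k (Suc n))) v \<oplus>$(?F (k (Suc n))) h x)"
     unfolding x(2) v(2) lmod_hom_add[OF PD(4) FS.smult_closed[OF z v(1)] hx]
      lmod_hom_smult[OF PD(4) z v(1)] ..
    then show "y \<in> d n ` carrier (?F (k (Suc n)))" using FS.M.a_closed[OF FS.smult_closed[OF z v(1)] hx] by blast
   qed
   fix x assume x: "x :. (?F (k (Suc n)))"
   have dx: "d n x :. (?F (k n))" by (rule lmod_hom_closed[OF PD(4) x])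
   have "?q (d n x) = (z \<otimes>$R t \<oplus>$R c) \<odot>$(?F (k n)) d n x"
    using z cR Tc[OF t(1)] dx
    by (simp add: s_t[OF x] h(2)[OF x, symmetric] Fn.smult_l_distr Fn.smult_assoc)
   then show "?q (d n x) = d n x" using dx by (simp add: one)
  qed
 qed
 then have "pd R V \<le> enat n \<longleftrightarrow> pd L V' \<le> enat n" for n
  by (simp add: pd_le_iff_boundary_retract[OF P] pd_le_iff_boundary_retract[OF P'])
 then show ?thesis by (rule enat_eq_by_nat_bounds)
qed

end

section \<open>A basis theorem for modules with commuting operators\<close>

text \<open>
  For a set \<open>\<Omega>\<close> of ring elements acting on \<open>M\<close>: subgroups stable under \<open>\<Omega>\<close>, the stable subgroup
  generated by a set, and the ascending chain condition below \<open>K\<close> in the form of finite generation.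
  Arbitrary sets of operators make it possible to adjoin one generator of a ring at a time.
\<close>

definition op_closed :: "'r set => ('r, 'm) module => 'm set => bool" where
 "op_closed \<Omega> M N \<longleftrightarrow> N \<subseteq> carrier M & \<zero>$M \<in> N & (\<forall>x\<in>N. \<forall>y\<in>N. x \<ominus>$M y \<in> N) &
   (\<forall>\<omega>\<in>\<Omega>. \<forall>x\<in>N. \<omega> \<odot>$M x \<in> N)"

definition op_span :: "'r set => ('r, 'm) module => 'm set => 'm set" where
 "op_span \<Omega> M G = \<Inter>{N. op_closed \<Omega> M N & G \<subseteq> N}"

definition op_noetherian :: "'r set => ('r, 'm) module => 'm set => bool" where
 "op_noetherian \<Omega> M K \<longleftrightarrow> (\<forall>N. op_closed \<Omega> M N \<longrightarrow> N \<subseteq> K \<longrightarrow>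
   (\<exists>G. finite G & G \<subseteq> N & N \<subseteq> op_span \<Omega> M G))"

lemma op_closedD:
 assumes "op_closed \<Omega> M N"
 shows "x \<in> N ==> x :. M" "\<zero>$M \<in> N" "[|x \<in> N; y \<in> N|] ==> x \<ominus>$M y \<in> N"
  "[|\<omega> \<in> \<Omega>; x \<in> N|] ==> \<omega> \<odot>$M x \<in> N"
 using assms by (auto simp: op_closed_def)

lemma op_closed_add:
 assumes "abelian_group M" "op_closed \<Omega> M N" "x \<in> N" "y \<in> N"
 shows "x \<oplus>$M y \<in> N"
proof -
 interpret M: abelian_group M by fact
 note N = op_closedD[OF assms(2)]
 have "x \<ominus>$M (\<zero>$M \<ominus>$M y) \<in> N" by (rule N(3)[OF assms(3) N(3)[OF N(2) assms(4)]])
 moreover have "x \<ominus>$M (\<zero>$M \<ominus>$M y) = x \<oplus>$M y"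
  using N(1) assms(3,4) by (simp add: a_minus_def)
 ultimately show ?thesis by simp
qed

lemma op_span_superset: "G \<subseteq> op_span \<Omega> M G"
 by (auto simp: op_span_def)

lemma op_span_least: "op_closed \<Omega> M N ==> G \<subseteq> N ==> op_span \<Omega> M G \<subseteq> N"
 by (auto simp: op_span_def)

lemma (in left_module) op_closed_carrier: "\<Omega> \<subseteq> carrier R ==> op_closed \<Omega> M (carrier M)"
 by (auto simp: op_closed_def)

lemma (in left_module) op_closed_span:
 assumes "\<Omega> \<subseteq> carrier R" "G \<subseteq> carrier M"
 shows "op_closed \<Omega> M (op_span \<Omega> M G)"
 unfolding op_closed_def
proof (intro conjI ballI)
 show "op_span \<Omega> M G \<subseteq> carrier M" by (rule op_span_least[OF op_closed_carrier[OF assms(1)] assms(2)])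
 show "\<zero>$M \<in> op_span \<Omega> M G" by (auto simp: op_span_def op_closed_def)
 show "x \<ominus>$M y \<in> op_span \<Omega> M G" if "x \<in> op_span \<Omega> M G" "y \<in> op_span \<Omega> M G" for x y
  using that by (auto simp: op_span_def op_closed_def)
 show "\<omega> \<odot>$M x \<in> op_span \<Omega> M G" if "\<omega> \<in> \<Omega>" "x \<in> op_span \<Omega> M G" for \<omega> x
  using that by (auto simp: op_span_def op_closed_def)
qed

lemma (in left_module) minus_eq_swap:
 "[|a :. M; b :. M; c :. M; d :. M|] ==>
  (a \<oplus>$M b) \<ominus>$M (c \<oplus>$M d) = (a \<ominus>$M c) \<oplus>$M (b \<ominus>$M d)"
 by (simp add: a_minus_def M.minus_add M.a_ac)

text \<open>
  Hilbert's basis theorem. A stable subgroup \<open>N\<close> of \<open>K + t K + t\<^sup>2 K + \<dots>\<close> is filtered by degree in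
  \<open>t\<close>. The leading coefficients in degree \<open>n\<close> form stable subgroups of \<open>K\<close> that increase with \<open>n\<close>;
  their union is finitely generated, so they stabilize, and lifts of finitely many generators in
  the finitely many degrees before that generate \<open>N\<close>.
\<close>

lemma (in left_module) op_noetherian_adjoin:
 assumes \<Omega>: "\<Omega> \<subseteq> carrier R" and t: "t :. R" and comm: "\<And>\<omega>. \<omega> \<in> \<Omega> ==> \<omega> \<otimes> t = t \<otimes> \<omega>"
  and K: "op_closed \<Omega> M K" and noeth: "op_noetherian \<Omega> M K"
 shows "op_noetherian (insert t \<Omega>) M (op_span (insert t \<Omega>) M K)"
proof -
 let ?\<Omega>' = "insert t \<Omega>"
 have \<Omega>': "?\<Omega>' \<subseteq> carrier R" using \<Omega> t by simp
 note KD = op_closedD[OF K]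
 define tp where "tp n x = ((%y. t \<odot>$M y) ^^ n) x" for n x
 have tp_Suc: "tp (Suc n) x = t \<odot>$M tp n x" and tp_0: "tp 0 x = x" for n x by (simp_all add: tp_def)
 have tp_cl [simp]: "tp n x :. M" if "x :. M" for n x
  using that t by (induct n) (simp_all add: tp_def)
 have tp_minus: "tp n (x \<ominus>$M y) = tp n x \<ominus>$M tp n y" if "x :. M" "y :. M" for n x y
  using that t by (induct n) (simp_all add: tp_Suc tp_0 smult_r_minus)
 have tp_add: "tp n (x \<oplus>$M y) = tp n x \<oplus>$M tp n y" if "x :. M" "y :. M" for n x y
  using that t by (induct n) (simp_all add: tp_Suc tp_0 smult_r_distr)
 have tp_\<omega>: "tp n (\<omega> \<odot>$M x) = \<omega> \<odot>$M tp n x" if "x :. M" "\<omega> \<in> \<Omega>" for n x \<omega>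
 proof (induct n)
  case (Suc n)
  have \<omega>: "\<omega> :. R" using that \<Omega> by blast
  then show ?case
   using that t comm[OF that(2)] by (simp add: tp_Suc Suc smult_assoc[symmetric])
 qed (simp add: tp_0)
 have tp_z: "tp n \<zero>$M = \<zero>$M" for n by (induct n) (simp_all add: tp_Suc tp_0 smult_zeros t)
 have tp_tp: "tp a (tp b x) = tp (a + b) x" for a b x by (induct a) (simp_all add: tp_Suc tp_0)
 define W where "W = rec_nat {\<zero>$M} (%n W. {tp n m \<oplus>$M w | m w. m \<in> K & w \<in> W})"
 have W0: "W 0 = {\<zero>$M}" and WS: "W (Suc n) = {tp n m \<oplus>$M w | m w. m \<in> K & w \<in> W n}" for n
  by (simp_all add: W_def)
 have Wcl: "op_closed \<Omega> M (W n)" for n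
 proof (induct n)
  case 0 then show ?case using \<Omega> by (auto simp: W0 op_closed_def smult_zeros a_minus_def)
 next
  case (Suc n)
  note IH = op_closedD[OF Suc]
  show ?case
   unfolding op_closed_def
  proof (intro conjI ballI)
   show "W (Suc n) \<subseteq> carrier M" using KD(1) IH(1) by (auto simp: WS)
   have "\<zero>$M = tp n \<zero>$M \<oplus>$M \<zero>$M" by (simp add: tp_z)
   then show "\<zero>$M \<in> W (Suc n)" unfolding WS using KD(2) IH(2) by blast
   show "x \<ominus>$M y \<in> W (Suc n)" if xy: "x \<in> W (Suc n)" "y \<in> W (Suc n)" for x y
   proof -
    obtain m w where m: "m \<in> K" "w \<in> W n" "x = tp n m \<oplus>$M w" using xy(1) by (auto simp: WS)
    obtain m' w' where m': "m' \<in> K" "w' \<in> W n" "y = tp n m' \<oplus>$M w'" using xy(2) by (auto simp: WS)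
    have "x \<ominus>$M y = tp n (m \<ominus>$M m') \<oplus>$M (w \<ominus>$M w')"
     using m m' KD(1) IH(1) by (simp add: minus_eq_swap tp_minus)
    then show ?thesis unfolding WS using KD(3)[OF m(1) m'(1)] IH(3)[OF m(2) m'(2)] by blast
   qed
   show "\<omega> \<odot>$M x \<in> W (Suc n)" if \<omega>x: "\<omega> \<in> \<Omega>" "x \<in> W (Suc n)" for \<omega> x
   proof -
    obtain m w where m: "m \<in> K" "w \<in> W n" "x = tp n m \<oplus>$M w" using \<omega>x(2) by (auto simp: WS)
    have "\<omega> \<odot>$M x = tp n (\<omega> \<odot>$M m) \<oplus>$M \<omega> \<odot>$M w"
     using m \<omega>x(1) \<Omega> KD(1) IH(1) by (simp add: subset_iff smult_r_distr tp_\<omega>)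
    then show ?thesis unfolding WS using KD(4)[OF \<omega>x(1) m(1)] IH(4)[OF \<omega>x(1) m(2)] by blast
   qed
  qed
 qed
 have Wc: "w \<in> W n ==> w :. M" for w n using op_closedD(1)[OF Wcl] .
 have Kc: "m \<in> K ==> m :. M" for m by (rule KD(1))
 have Wadd: "x \<in> W n ==> y \<in> W n ==> x \<oplus>$M y \<in> W n" for x y n
  by (rule op_closed_add[OF M.abelian_group_axioms Wcl])
 have WSuc: "W n \<subseteq> W (Suc n)" for n
 proof
  fix w assume w: "w \<in> W n"
  then have "w = tp n \<zero>$M \<oplus>$M w" using Wc by (simp add: tp_z)
  then show "w \<in> W (Suc n)" unfolding WS using KD(2) w by blast
 qed
 have Wmono: "W m \<subseteq> W n" if "m \<le> n" for m n
  using that by (induct rule: dec_induct) (use WSuc in auto)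
 have tW: "t \<odot>$M w \<in> W (Suc n)" if "w \<in> W n" for w n
  using that
 proof (induct n arbitrary: w)
  case 0
  then have "t \<odot>$M w = \<zero>$M" by (simp add: W0 smult_zeros t)
  then show ?case using op_closedD(2)[OF Wcl] by simp
 next
  case (Suc n)
  then obtain m v where m: "m \<in> K" "v \<in> W n" "w = tp n m \<oplus>$M v" by (auto simp: WS)
  have "t \<odot>$M w = tp (Suc n) m \<oplus>$M t \<odot>$M v" using m t Kc Wc by (simp add: smult_r_distr tp_Suc)
  then show ?case using Suc(1)[OF m(2)] m(1) unfolding WS[of "Suc n"] by blast
 qed
 have tpW: "tp a w \<in> W (a + n)" if "w \<in> W n" for a w n
  using that by (induct a) (simp_all add: tp_0 tp_Suc tW)
 let ?U = "\<Union>n. W n"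
 have U: "op_closed ?\<Omega>' M ?U"
  unfolding op_closed_def
 proof (intro conjI ballI)
  show "?U \<subseteq> carrier M" using Wc by blast
  show "\<zero>$M \<in> ?U" using W0 by blast
  fix x y assume "x \<in> ?U" "y \<in> ?U"
  then obtain a b where ab: "x \<in> W a" "y \<in> W b" by blast
  then have "x \<in> W (max a b)" "y \<in> W (max a b)" using Wmono by (meson max.cobounded1 max.cobounded2 subsetD)+
  then show "x \<ominus>$M y \<in> ?U" using op_closedD(3)[OF Wcl] by blast
 next
  fix \<omega> x assume "\<omega> \<in> ?\<Omega>'" "x \<in> ?U"
  then show "\<omega> \<odot>$M x \<in> ?U" using tW op_closedD(4)[OF Wcl] by blast
 qed
 have "K \<subseteq> W (Suc 0)"
 proof
  fix m assume m: "m \<in> K"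
  then have "m = tp 0 m \<oplus>$M \<zero>$M" using Kc by (simp add: tp_0)
  then show "m \<in> W (Suc 0)" unfolding WS W0 using m by blast
 qed
 then have KU: "op_span ?\<Omega>' M K \<subseteq> ?U" by (intro op_span_least[OF U]) blast
 show ?thesis
  unfolding op_noetherian_def
 proof (intro allI impI)
  fix N assume N: "op_closed ?\<Omega>' M N" and "N \<subseteq> op_span ?\<Omega>' M K"
  then have NU: "N \<subseteq> ?U" using KU by blast
  note ND = op_closedD[OF N]
  have N\<Omega>: "op_closed \<Omega> M N" using N by (auto simp: op_closed_def)
  \<comment> \<open>leading coefficients\<close>
  define Ld where "Ld n = {m \<in> K. \<exists>w\<in>W n. tp n m \<oplus>$M w \<in> N}" for n
  have Ldcl: "op_closed \<Omega> M (Ld n)" for n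
   unfolding op_closed_def
  proof (intro conjI ballI)
   show "Ld n \<subseteq> carrier M" using Kc by (auto simp: Ld_def)
   have "tp n \<zero>$M \<oplus>$M \<zero>$M \<in> N" using ND(2) by (simp add: tp_z)
   then show "\<zero>$M \<in> Ld n" unfolding Ld_def using KD(2) op_closedD(2)[OF Wcl, of n] by blast
   show "x \<ominus>$M y \<in> Ld n" if prem: "x \<in> Ld n" "y \<in> Ld n" for x y
   proof -
    obtain w v where w: "w \<in> W n" "tp n x \<oplus>$M w \<in> N" and v: "v \<in> W n" "tp n y \<oplus>$M v \<in> N"
     and K: "x \<in> K" "y \<in> K" using prem by (auto simp: Ld_def)
    have "tp n (x \<ominus>$M y) \<oplus>$M (w \<ominus>$M v) \<in> N"
     using ND(3)[OF w(2) v(2)] K Kc Wc w v by (simp add: minus_eq_swap tp_minus)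
    then show ?thesis using KD(3)[OF K] op_closedD(3)[OF Wcl w(1) v(1)] by (auto simp: Ld_def)
   qed
   show "\<omega> \<odot>$M x \<in> Ld n" if prem: "\<omega> \<in> \<Omega>" "x \<in> Ld n" for \<omega> x
   proof -
    obtain w where w: "w \<in> W n" "tp n x \<oplus>$M w \<in> N" and K: "x \<in> K" using prem by (auto simp: Ld_def)
    have "tp n (\<omega> \<odot>$M x) \<oplus>$M \<omega> \<odot>$M w \<in> N"
     using op_closedD(4)[OF N\<Omega> that(1) w(2)] that(1) K Kc Wc w \<Omega>
     by (simp add: smult_r_distr tp_\<omega> subset_iff)
    then show ?thesis using KD(4)[OF that(1) K] op_closedD(4)[OF Wcl that(1) w(1)] by (auto simp: Ld_def)
   qed
  qed
  have LdK: "Ld n \<subseteq> K" for n by (auto simp: Ld_def)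
  have LdSuc: "Ld n \<subseteq> Ld (Suc n)" for n
  proof
   fix m assume "m \<in> Ld n"
   then obtain w where w: "w \<in> W n" "tp n m \<oplus>$M w \<in> N" and m: "m \<in> K" by (auto simp: Ld_def)
   have "t \<odot>$M (tp n m \<oplus>$M w) \<in> N" using ND(4) w(2) by blast
   then have "tp (Suc n) m \<oplus>$M t \<odot>$M w \<in> N" using m w(1) Kc Wc t by (simp add: smult_r_distr tp_Suc)
   then show "m \<in> Ld (Suc n)" using m tW[OF w(1)] by (auto simp: Ld_def)
  qed
  have Ldmono: "Ld a \<subseteq> Ld b" if "a \<le> b" for a b
   using that by (induct rule: dec_induct) (use LdSuc in auto)
  let ?L = "\<Union>n. Ld n"
  have "op_closed \<Omega> M ?L"
   unfolding op_closed_def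
  proof (intro conjI ballI)
   show "?L \<subseteq> carrier M" using op_closedD(1)[OF Ldcl] by blast
   show "\<zero>$M \<in> ?L" using op_closedD(2)[OF Ldcl] by blast
   fix x y assume "x \<in> ?L" "y \<in> ?L"
   then obtain a b where ab: "x \<in> Ld a" "y \<in> Ld b" by blast
   then have "x \<in> Ld (max a b)" "y \<in> Ld (max a b)" using Ldmono by (meson max.cobounded1 max.cobounded2 subsetD)+
   then show "x \<ominus>$M y \<in> ?L" using op_closedD(3)[OF Ldcl] by blast
  next
   fix \<omega> x assume "\<omega> \<in> \<Omega>" "x \<in> ?L"
   then show "\<omega> \<odot>$M x \<in> ?L" using op_closedD(4)[OF Ldcl] by blast
  qed
  moreover have "?L \<subseteq> K" using LdK by blast
  ultimately obtain G where G: "finite G" "G \<subseteq> ?L" "?L \<subseteq> op_span \<Omega> M G"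
   using noeth unfolding op_noetherian_def by metis
  have "\<exists>q. G \<subseteq> Ld q"
   using G(1,2)
  proof (induct rule: finite_induct)
   case (insert g G)
   then obtain q a where "G \<subseteq> Ld q" "g \<in> Ld a" by auto
   then have "insert g G \<subseteq> Ld (max q a)" using Ldmono[of q "max q a"] Ldmono[of a "max q a"] by auto
   then show ?case by blast
  qed simp
  then obtain q where q: "G \<subseteq> Ld q" by blast
  have Lstab: "Ld n \<subseteq> Ld q" for n
   using G(3) op_span_least[OF Ldcl q] by blast
  have "\<exists>G. finite G & G \<subseteq> Ld n & Ld n \<subseteq> op_span \<Omega> M G" for n
   using noeth[unfolded op_noetherian_def, rule_format, OF Ldcl LdK] .
  then obtain Gn where Gn: "!!n. finite (Gn n)" "!!n. Gn n \<subseteq> Ld n" "!!n. Ld n \<subseteq> op_span \<Omega> M (Gn n)"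
   by metis
  define \<nu> where "\<nu> n g = (SOME w. w \<in> W n & tp n g \<oplus>$M w \<in> N)" for n g
  have \<nu>: "\<nu> n g \<in> W n & tp n g \<oplus>$M \<nu> n g \<in> N" if "g \<in> Ld n" for n g
  proof -
   have "\<exists>w. w \<in> W n & tp n g \<oplus>$M w \<in> N" using that by (auto simp: Ld_def)
   then show ?thesis unfolding \<nu>_def by (rule someI_ex)
  qed
  define H where "H = (\<Union>n\<in>{..q}. (%g. tp n g \<oplus>$M \<nu> n g) ` Gn n)"
  have H: "finite H" "H \<subseteq> N"
  proof -
   show "finite H" using Gn(1) unfolding H_def by auto
   show "H \<subseteq> N" unfolding H_def using \<nu>[OF subsetD[OF Gn(2)]] by blast
  qed
  let ?S = "op_span ?\<Omega>' M H"
  have S: "op_closed ?\<Omega>' M ?S" by (rule op_closed_span[OF \<Omega>']) (use H(2) ND(1) in blast)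
  note SD = op_closedD[OF S]
  have SN: "?S \<subseteq> N" by (rule op_span_least[OF N H(2)])
  have lead: "\<exists>h\<in>?S. \<exists>w\<in>W n. h = tp n m \<oplus>$M w" if n: "n \<le> q" and m: "m \<in> Ld n" for n m
  proof -
   let ?T = "{m \<in> K. \<exists>h\<in>?S. \<exists>w\<in>W n. h = tp n m \<oplus>$M w}"
   have "op_closed \<Omega> M ?T"
    unfolding op_closed_def
   proof (intro conjI ballI)
    show "?T \<subseteq> carrier M" using Kc by auto
    have "\<zero>$M = tp n \<zero>$M \<oplus>$M \<zero>$M" by (simp add: tp_z)
    then show "\<zero>$M \<in> ?T" using KD(2) SD(2) op_closedD(2)[OF Wcl] by blast
    show "x \<ominus>$M y \<in> ?T" if prem: "x \<in> ?T" "y \<in> ?T" for x y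
    proof -
     obtain w v where w: "w \<in> W n" "tp n x \<oplus>$M w \<in> ?S" and v: "v \<in> W n" "tp n y \<oplus>$M v \<in> ?S"
      and K: "x \<in> K" "y \<in> K" using prem by auto
     have "tp n (x \<ominus>$M y) \<oplus>$M (w \<ominus>$M v) \<in> ?S"
      using SD(3)[OF w(2) v(2)] K Kc Wc w v by (simp add: minus_eq_swap tp_minus)
     then show ?thesis using KD(3)[OF K] op_closedD(3)[OF Wcl w(1) v(1)] by auto
    qed
    show "\<omega> \<odot>$M x \<in> ?T" if prem: "\<omega> \<in> \<Omega>" "x \<in> ?T" for \<omega> x
    proof -
     obtain w where w: "w \<in> W n" "tp n x \<oplus>$M w \<in> ?S" and K: "x \<in> K" using prem by auto
     have "\<omega> \<odot>$M (tp n x \<oplus>$M w) \<in> ?S" using SD(4) that(1) w(2) by blast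
     then have "tp n (\<omega> \<odot>$M x) \<oplus>$M \<omega> \<odot>$M w \<in> ?S"
      using that(1) K Kc Wc w \<Omega> by (simp add: smult_r_distr tp_\<omega> subset_iff)
     then show ?thesis using KD(4)[OF that(1) K] op_closedD(4)[OF Wcl that(1) w(1)] by auto
    qed
   qed
   moreover have "Gn n \<subseteq> ?T"
   proof
    fix g assume g: "g \<in> Gn n"
    then have "tp n g \<oplus>$M \<nu> n g \<in> H" using n by (auto simp: H_def)
    then have "tp n g \<oplus>$M \<nu> n g \<in> ?S" by (rule subsetD[OF op_span_superset])
    then show "g \<in> ?T" using \<nu>[of g n] g Gn(2)[of n] LdK[of n] by auto
   qed
   ultimately have "op_span \<Omega> M (Gn n) \<subseteq> ?T" by (rule op_span_least)
   then show ?thesis using Gn(3)[of n] m by auto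
  qed
  have lead': "\<exists>h\<in>?S. \<exists>w\<in>W n. h = tp n m \<oplus>$M w" if m: "m \<in> Ld n" for n m
  proof (cases "n \<le> q")
   case True then show ?thesis using lead m by blast
  next
   case False
   then have nq: "n - q + q = n" by simp
   obtain h w where h: "h \<in> ?S" "w \<in> W q" "h = tp q m \<oplus>$M w" using lead[OF order_refl, of m] Lstab m by blast
   have mc: "m :. M" using m LdK Kc by blast
   have "tp (n - q) h = tp n m \<oplus>$M tp (n - q) w"
    using h(2,3) mc Wc by (simp add: tp_add tp_tp nq)
   moreover have "tp a h \<in> ?S" for a by (induct a) (use h(1) SD(4) in \<open>auto simp: tp_0 tp_Suc\<close>)
   moreover have "tp (n - q) w \<in> W n" using tpW[OF h(2), of "n - q"] nq by simp
   ultimately show ?thesis by blast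
  qed
  have "y \<in> ?S" if "y \<in> N" "y \<in> W n" for y n
   using that
  proof (induct n arbitrary: y)
   case 0 then show ?case using SD(2) by (simp add: W0)
  next
   case (Suc n)
   then obtain m w where m: "m \<in> K" "w \<in> W n" "y = tp n m \<oplus>$M w" by (auto simp: WS)
   then have "m \<in> Ld n" using Suc(2) by (auto simp: Ld_def)
   then obtain h v where h: "h \<in> ?S" "v \<in> W n" "h = tp n m \<oplus>$M v" using lead' by blast
   have "y \<ominus>$M h = w \<ominus>$M v"
    using m h(2,3) Kc Wc by (simp add: minus_eq_swap) (simp add: a_minus_def M.r_neg)
   then have "y \<ominus>$M h \<in> W n" using op_closedD(3)[OF Wcl m(2) h(2)] by simp
   moreover have "y \<ominus>$M h \<in> N" using ND(3) Suc(2) h(1) SN by blast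
   ultimately have "y \<ominus>$M h \<in> ?S" by (intro Suc(1))
   then have "(y \<ominus>$M h) \<oplus>$M h \<in> ?S" by (rule op_closed_add[OF M.abelian_group_axioms S _ h(1)])
   moreover have "(y \<ominus>$M h) \<oplus>$M h = y"
    using SD(1)[OF h(1)] ND(1)[OF Suc(2)] by (simp add: a_minus_def M.a_assoc M.l_neg)
   ultimately show ?case by simp
  qed
  then have "N \<subseteq> ?S" using NU by blast
  then show "\<exists>G. finite G & G \<subseteq> N & N \<subseteq> op_span ?\<Omega>' M G" using H by blast
 qed
qed

lemma op_noetherian_subset: "op_noetherian \<Omega> M K ==> K' \<subseteq> K ==> op_noetherian \<Omega> M K'"
 unfolding op_noetherian_def by (meson order_trans)

text \<open>
  Here \<open>\<Omega>\<close> is a field of scalars, and induction on the number of generators is linear algebra: modulo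
  the earlier generators, the coefficients of the last one that occur in \<open>N\<close> are all of \<open>\<Omega>\<close> or zero.
\<close>

lemma (in left_module) op_noetherian_finite_dim:
 assumes \<Omega>: "\<Omega> \<subseteq> carrier R" and one: "\<one> \<in> \<Omega>" and neg: "!!c d. c \<in> \<Omega> ==> d \<in> \<Omega> ==> c \<ominus> d \<in> \<Omega>"
  and mult: "!!c d. c \<in> \<Omega> ==> d \<in> \<Omega> ==> c \<otimes> d \<in> \<Omega>"
  and inv: "!!c. c \<in> \<Omega> ==> c = \<zero> \<or> (\<exists>d\<in>\<Omega>. d \<otimes> c = \<one>)"
  and G: "finite G" "G \<subseteq> carrier M"
 shows "op_noetherian \<Omega> M (op_span \<Omega> M G)"
 using G
proof (induct rule: finite_induct)
 case empty
 have "op_closed \<Omega> M {\<zero>$M}" using \<Omega> by (auto simp: op_closed_def smult_zeros a_minus_def)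
 then have z: "op_span \<Omega> M {} \<subseteq> {\<zero>$M}" by (rule op_span_least) simp
 show ?case
  unfolding op_noetherian_def
 proof (intro allI impI exI[of _ "{}"])
  fix N assume "op_closed \<Omega> M N" "N \<subseteq> op_span \<Omega> M {}"
  then show "finite {} & {} \<subseteq> N & N \<subseteq> op_span \<Omega> M {}" by simp
 qed
next
 case (insert g G)
 then have g: "g :. M" and Gc: "G \<subseteq> carrier M" by auto
 let ?K = "op_span \<Omega> M G"
 have K: "op_closed \<Omega> M ?K" by (rule op_closed_span[OF \<Omega> Gc])
 note KD = op_closedD[OF K]
 let ?E = "{m \<oplus>$M c \<odot>$M g | m c. m \<in> ?K & c \<in> \<Omega>}"
 have c\<Omega>: "c \<in> \<Omega> ==> c :. R" for c using \<Omega> by blast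
 have zero: "\<zero> \<in> \<Omega>" using neg[OF one one] by (simp add: a_minus_def R.r_neg)
 have sub: "(c \<ominus> d) \<odot>$M x = c \<odot>$M x \<ominus>$M d \<odot>$M x" if "c \<in> \<Omega>" "d \<in> \<Omega>" "x :. M" for c d x
 proof -
  have "(\<ominus> d) \<odot>$M x \<oplus>$M d \<odot>$M x = \<zero>$M"
   using smult_l_distr[of "\<ominus> d" d x] that c\<Omega> by (simp add: R.l_neg smult_zeros)
  then have "\<ominus>$M (d \<odot>$M x) = (\<ominus> d) \<odot>$M x"
   using that c\<Omega> by (intro M.minus_equality) simp_all
  then show ?thesis using that c\<Omega> by (simp add: a_minus_def smult_l_distr)
 qed
 have "op_closed \<Omega> M ?E"
  unfolding op_closed_def
 proof (intro conjI ballI)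
  show "?E \<subseteq> carrier M" using KD(1) g c\<Omega> by auto
  have "\<zero>$M = \<zero>$M \<oplus>$M \<zero> \<odot>$M g" using g by (simp add: smult_zeros)
  then show "\<zero>$M \<in> ?E" using KD(2) zero by blast
  show "x \<ominus>$M y \<in> ?E" if prem: "x \<in> ?E" "y \<in> ?E" for x y
  proof -
   obtain m c m' c' where m: "m \<in> ?K" "c \<in> \<Omega>" "x = m \<oplus>$M c \<odot>$M g"
    and m': "m' \<in> ?K" "c' \<in> \<Omega>" "y = m' \<oplus>$M c' \<odot>$M g" using prem by blast
   have "x \<ominus>$M y = (m \<ominus>$M m') \<oplus>$M (c \<ominus> c') \<odot>$M g"
    using m m' KD(1) g c\<Omega> by (simp add: minus_eq_swap sub)
   then show ?thesis using KD(3)[OF m(1) m'(1)] neg[OF m(2) m'(2)] by blast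
  qed
  show "d \<odot>$M x \<in> ?E" if prem: "d \<in> \<Omega>" "x \<in> ?E" for d x
  proof -
   obtain m c where m: "m \<in> ?K" "c \<in> \<Omega>" "x = m \<oplus>$M c \<odot>$M g" using prem by blast
   have "d \<odot>$M x = d \<odot>$M m \<oplus>$M (d \<otimes> c) \<odot>$M g"
    using m KD(1) g c\<Omega> that(1) by (simp add: smult_r_distr smult_assoc)
   then show ?thesis using KD(4)[OF that(1) m(1)] mult[OF that(1) m(2)] by blast
  qed
 qed
 moreover have "insert g G \<subseteq> ?E"
 proof
  fix x assume x: "x \<in> insert g G"
  show "x \<in> ?E"
  proof (cases "x = g")
   case True
   then have "x = \<zero>$M \<oplus>$M \<one> \<odot>$M g" using g by simp
   then show ?thesis using KD(2) one by blast
  next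
   case False
   then have xG: "x \<in> G" using x by simp
   then have "x = x \<oplus>$M \<zero> \<odot>$M g" using g Gc by (simp add: smult_zeros subset_iff)
   then show ?thesis using subsetD[OF op_span_superset xG, of \<Omega> M] zero by blast
  qed
 qed
 ultimately have E: "op_span \<Omega> M (insert g G) \<subseteq> ?E" by (rule op_span_least)
 show ?case
  unfolding op_noetherian_def
 proof (intro allI impI)
  fix N assume N: "op_closed \<Omega> M N" and "N \<subseteq> op_span \<Omega> M (insert g G)"
  then have NE: "N \<subseteq> ?E" using E by blast
  note ND = op_closedD[OF N]
  have "op_closed \<Omega> M (N \<inter> ?K)" using N K unfolding op_closed_def by blast
  then obtain H where H: "finite H" "H \<subseteq> N \<inter> ?K" "N \<inter> ?K \<subseteq> op_span \<Omega> M H"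
   using insert(3)[OF Gc] unfolding op_noetherian_def by (meson inf_le2)
  show "\<exists>G. finite G & G \<subseteq> N & N \<subseteq> op_span \<Omega> M G"
  proof (cases "N \<subseteq> ?K")
   case True
   then show ?thesis using H by (intro exI[of _ H]) blast
  next
   case False
   then obtain y0 where y0: "y0 \<in> N" "y0 \<notin> ?K" by blast
   obtain m0 c0 where m0: "m0 \<in> ?K" "c0 \<in> \<Omega>" "y0 = m0 \<oplus>$M c0 \<odot>$M g" using NE y0(1) by blast
   have "c0 ~= \<zero>" using y0(2) m0 g KD(1)[OF m0(1)] by (auto simp: smult_zeros)
   then obtain d0 where d0: "d0 \<in> \<Omega>" "d0 \<otimes> c0 = \<one>" using inv[OF m0(2)] by blast
   define y where "y = d0 \<odot>$M y0"
   have y: "y \<in> N" "y = d0 \<odot>$M m0 \<oplus>$M g"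
    using ND(4)[OF d0(1) y0(1)] m0 d0 g KD(1)[OF m0(1)] c\<Omega>
    by (simp_all add: y_def smult_r_distr smult_assoc[symmetric])
   let ?S = "op_span \<Omega> M (insert y H)"
   have S: "op_closed \<Omega> M ?S" by (rule op_closed_span[OF \<Omega>]) (use y(1) H(2) ND(1) in blast)
   have yS: "y \<in> ?S" by (rule subsetD[OF op_span_superset]) simp
   have "op_span \<Omega> M H \<subseteq> ?S" by (rule op_span_least[OF S order_trans[OF subset_insertI op_span_superset]])
   then have NK: "N \<inter> ?K \<subseteq> ?S" using H(3) by blast
   have "N \<subseteq> ?S"
   proof
    fix x assume x: "x \<in> N"
    obtain m c where m: "m \<in> ?K" "c \<in> \<Omega>" "x = m \<oplus>$M c \<odot>$M g" using NE x by blast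
    have d0m: "d0 \<odot>$M m0 \<in> ?K" by (rule KD(4)[OF d0(1) m0(1)])
    have "x \<ominus>$M c \<odot>$M y = (m \<oplus>$M c \<odot>$M g) \<ominus>$M (c \<odot>$M (d0 \<odot>$M m0) \<oplus>$M c \<odot>$M g)"
     using KD(1)[OF d0m] g c\<Omega>[OF m(2)] by (simp add: m(3) y(2) smult_r_distr)
    also have "... = m \<ominus>$M c \<odot>$M (d0 \<odot>$M m0)"
     using KD(1)[OF d0m] KD(1)[OF m(1)] g c\<Omega>[OF m(2)]
     by (simp add: minus_eq_swap) (simp add: a_minus_def M.r_neg)
    finally have "x \<ominus>$M c \<odot>$M y \<in> ?K" using KD(3)[OF m(1) KD(4)[OF m(2) d0m]] by simp
    moreover have "x \<ominus>$M c \<odot>$M y \<in> N" by (rule ND(3)[OF x ND(4)[OF m(2) y(1)]])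
    ultimately have "x \<ominus>$M c \<odot>$M y \<in> ?S" using NK by blast
    then have "(x \<ominus>$M c \<odot>$M y) \<oplus>$M c \<odot>$M y \<in> ?S"
     by (rule op_closed_add[OF M.abelian_group_axioms S _ op_closedD(4)[OF S m(2) yS]])
    moreover have "(x \<ominus>$M c \<odot>$M y) \<oplus>$M c \<odot>$M y = x"
     using ND(1)[OF x] ND(1)[OF y(1)] c\<Omega>[OF m(2)] by (simp add: a_minus_def M.a_assoc M.l_neg)
    ultimately show "x \<in> ?S" by simp
   qed
   then show ?thesis using H y(1) by (intro exI[of _ "insert y H"]) auto
  qed
 qed
qed

text \<open>
  The ring is spanned by \<open>G\<close> over the algebra generated by the field \<open>\<kappa>\<close> and the commuting elements
  \<open>S\<close>. Starting from the finite-dimensional space spanned by the generators of a free module, the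
  elements of \<open>S\<close> are adjoined one by one as operators.
\<close>

theorem noetherian_free_modules_of_central_generators:
 assumes R: "ring R"
  and \<kappa>: "\<kappa> \<subseteq> carrier R" "\<one>$R \<in> \<kappa>" "!!c d. c \<in> \<kappa> ==> d \<in> \<kappa> ==> c \<ominus>$R d \<in> \<kappa>"
   "!!c d. c \<in> \<kappa> ==> d \<in> \<kappa> ==> c \<otimes>$R d \<in> \<kappa>"
   "!!c. c \<in> \<kappa> ==> c = \<zero>$R \<or> (\<exists>d\<in>\<kappa>. d \<otimes>$R c = \<one>$R)"
  and S: "finite S" "S \<subseteq> carrier R"
  and comm: "!!s a. s \<in> S ==> a \<in> \<kappa> \<union> S ==> s \<otimes>$R a = a \<otimes>$R s"
  and G: "finite G" "G \<subseteq> carrier R"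
  and gen: "\<And>N. [|N \<subseteq> carrier R; G \<subseteq> N; \<zero>$R \<in> N; !!x y. x \<in> N ==> y \<in> N ==> x \<ominus>$R y \<in> N;
    !!s x. s \<in> \<kappa> \<union> S ==> x \<in> N ==> s \<otimes>$R x \<in> N|] ==> N = carrier R"
 shows "noetherian_free_modules R"
 unfolding noetherian_free_modules_def
proof (intro allI impI)
 fix m :: nat and H assume H: "submodule H R (free_module R {..<m})"
 let ?F = "free_module R {..<m}"
 interpret R: ring R by (rule R)
 interpret F: left_module R ?F by (rule left_module_free_module[OF R])
 let ?u = "%c a x. if x = c then a else \<zero>$R"
 have u: "?u c a :. ?F" if "c < m" "a :. R" for c a
  using that by (auto simp: free_module_def)
 define B where "B = (\<lambda>(c, a). ?u c a) ` ({..<m} \<times> G)"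
 have B: "finite B" "B \<subseteq> carrier ?F" unfolding B_def using G u by auto
 have step: "op_noetherian (\<kappa> \<union> T) ?F (op_span (\<kappa> \<union> T) ?F B)" if "finite T" "T \<subseteq> S" for T
  using that
 proof (induct rule: finite_induct)
  case empty
  show ?case using F.op_noetherian_finite_dim[OF \<kappa> B] by simp
 next
  case (insert t T)
  have \<kappa>T: "\<kappa> \<union> T \<subseteq> carrier R" "\<kappa> \<union> insert t T \<subseteq> carrier R" using \<kappa>(1) S(2) insert(4) by auto
  have "op_noetherian (insert t (\<kappa> \<union> T)) ?F (op_span (insert t (\<kappa> \<union> T)) ?F (op_span (\<kappa> \<union> T) ?F B))"
  proof (rule F.op_noetherian_adjoin[OF \<kappa>T(1)])
   show "t :. R" using insert S by blast
   show "\<omega> \<otimes>$R t = t \<otimes>$R \<omega>" if "\<omega> \<in> \<kappa> \<union> T" for \<omega> using comm[of t \<omega>] that insert(4) by auto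
   show "op_closed (\<kappa> \<union> T) ?F (op_span (\<kappa> \<union> T) ?F B)" by (rule F.op_closed_span[OF \<kappa>T(1) B(2)])
   show "op_noetherian (\<kappa> \<union> T) ?F (op_span (\<kappa> \<union> T) ?F B)" using insert by blast
  qed
  moreover have "insert t (\<kappa> \<union> T) = \<kappa> \<union> insert t T" by blast
  moreover have "op_span (\<kappa> \<union> insert t T) ?F B \<subseteq> op_span (\<kappa> \<union> insert t T) ?F (op_span (\<kappa> \<union> T) ?F B)"
  proof (rule op_span_least)
   have "op_span (\<kappa> \<union> T) ?F B \<subseteq> carrier ?F"
    by (rule op_span_least[OF F.op_closed_carrier[OF \<kappa>T(1)] B(2)])
   then show "op_closed (\<kappa> \<union> insert t T) ?F (op_span (\<kappa> \<union> insert t T) ?F (op_span (\<kappa> \<union> T) ?F B))"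
    by (rule F.op_closed_span[OF \<kappa>T(2)])
   show "B \<subseteq> op_span (\<kappa> \<union> insert t T) ?F (op_span (\<kappa> \<union> T) ?F B)"
    using op_span_superset by (rule order_trans) (rule op_span_superset)
  qed
  ultimately show ?case using op_noetherian_subset by metis
 qed
 let ?\<Omega> = "\<kappa> \<union> S"
 have \<Omega>: "?\<Omega> \<subseteq> carrier R" using \<kappa>(1) S(2) by blast
 have sp: "op_closed ?\<Omega> ?F (op_span ?\<Omega> ?F B)" by (rule F.op_closed_span[OF \<Omega> B(2)])
 note spD = op_closedD[OF sp]
 have col: "?u c a \<in> op_span ?\<Omega> ?F B" if c: "c < m" and a: "a :. R" for c a
 proof -
  let ?N = "{a \<in> carrier R. ?u c a \<in> op_span ?\<Omega> ?F B}"
  have "?N = carrier R"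
  proof (rule gen)
   have uz: "?u c \<zero>$R = \<zero>$(?F)" by (auto simp: free_module_def)
   show "G \<subseteq> ?N"
   proof
    fix g assume g: "g \<in> G"
    then have "?u c g \<in> B" unfolding B_def using c by (auto intro!: image_eqI[of _ _ "(c, g)"])
    then show "g \<in> ?N" using subsetD[OF op_span_superset, of _ B "\<kappa> \<union> S" ?F] g G(2) by blast
   qed
   show "\<zero>$R \<in> ?N" using spD(2) uz by simp
   show "x \<ominus>$R y \<in> ?N" if "x \<in> ?N" "y \<in> ?N" for x y
   proof -
    have xy: "x :. R" "y :. R" using that by auto
    have "?u c (x \<ominus>$R y) \<oplus>$(?F) ?u c y = ?u c x"
     using xy by (auto simp: free_module_def a_minus_def R.a_assoc R.l_neg)
    then have "?u c (x \<ominus>$R y) = ?u c x \<ominus>$(?F) ?u c y"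
     using u[OF c xy(1)] u[OF c xy(2)] u[OF c R.minus_closed[OF xy]]
     by (metis F.M.add.inv_solve_right a_minus_def a_inv_def)
    then show ?thesis using spD(3) that by simp
   qed
   show "s \<otimes>$R x \<in> ?N" if "s \<in> ?\<Omega>" "x \<in> ?N" for s x
   proof -
    have sR: "s :. R" using that \<Omega> by blast
    have "?u c (s \<otimes>$R x) = s \<odot>$(?F) ?u c x"
     by (rule HOL.ext) (simp add: free_module_def sR)
    then show ?thesis using spD(4)[OF that(1)] that \<Omega> by auto
   qed
  qed auto
  then show ?thesis using a by blast
 qed
 have all: "carrier ?F \<subseteq> op_span ?\<Omega> ?F B"
 proof
  fix f assume f: "f :. ?F"
  then have fc: "f i :. R" "f i ~= \<zero>$R ==> i < m" for i by (auto simp: free_module_def)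
  have "(%i. if i < n then f i else \<zero>$R) \<in> op_span ?\<Omega> ?F B" if "n \<le> m" for n
   using that
  proof (induct n)
   case 0
   have "(\<lambda>i::nat. if i < 0 then f i else \<zero>$R) = \<zero>$(?F)" by (auto simp: free_module_def)
   then show ?case using spD(2) by simp
  next
   case (Suc n)
   have "(%i. if i < Suc n then f i else \<zero>$R) = (%i. if i < n then f i else \<zero>$R) \<oplus>$(?F) ?u n (f n)"
    using fc(1) by (auto simp: free_module_def less_Suc_eq)
   then show ?case
    using op_closed_add[OF F.M.abelian_group_axioms sp _ col[of n "f n"]] Suc fc(1) by simp
  qed
  from this[OF order_refl] have "(%i. if i < m then f i else \<zero>$R) \<in> op_span ?\<Omega> ?F B" .
  moreover have "(%i. if i < m then f i else \<zero>$R) = f"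
  proof
   show "(if i < m then f i else \<zero>$R) = f i" for i using fc(2)[of i] by (cases "f i = \<zero>$R") auto
  qed
  ultimately show "f \<in> op_span ?\<Omega> ?F B" by simp
 qed
 have closedH: "op_closed ?\<Omega> ?F H'" if "submodule H' R ?F" for H'
 proof -
  interpret H': submodule H' R ?F by (rule that)
  have "x \<ominus>$(?F) y \<in> H'" if "x \<in> H'" "y \<in> H'" for x y
   using H'.m_closed[OF that(1) H'.m_inv_closed[OF that(2)]] by (simp add: a_minus_def a_inv_def)
  moreover have "\<omega> \<odot>$(?F) x \<in> H'" if "\<omega> \<in> ?\<Omega>" "x \<in> H'" for \<omega> x
   by (rule H'.smult_closed[OF subsetD[OF \<Omega> that(1)] that(2)])
  moreover have "H' \<subseteq> carrier ?F" "\<zero>$(?F) \<in> H'" using H'.subset H'.one_closed by simp_all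
  ultimately show ?thesis unfolding op_closed_def by blast
 qed
 have HB: "H \<subseteq> op_span ?\<Omega> ?F B"
  using all op_closedD(1)[OF closedH[OF H]] by blast
 have "\<exists>E. finite E & E \<subseteq> H & H \<subseteq> op_span ?\<Omega> ?F E"
  using step[OF S(1) order_refl, unfolded op_noetherian_def, THEN spec, THEN mp, OF closedH[OF H], THEN mp, OF HB] .
 then obtain E where E: "finite E" "E \<subseteq> H" "H \<subseteq> op_span ?\<Omega> ?F E" by (elim exE conjE)
 show "\<exists>G. finite G & G \<subseteq> H & (\<forall>H'. submodule H' R ?F \<longrightarrow> G \<subseteq> H' \<longrightarrow> H \<subseteq> H')"
 proof (intro exI[of _ E] conjI allI impI E(1,2))
  fix H' assume "submodule H' R ?F" "E \<subseteq> H'"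
  then have "op_span ?\<Omega> ?F E \<subseteq> H'" by (intro op_span_least[OF closedH])
  then show "H \<subseteq> H'" using E(3) by blast
 qed
qed

section \<open>Hilbert's Nullstellensatz, weak form\<close>

lemma (in cring) maximal_ideal_exists:
 assumes "\<one> ~= \<zero>"
 shows "\<exists>I. maximalideal I R"
proof -
 let ?A = "{I. ideal I R & \<one> \<notin> I}"
 have "\<exists>M\<in>?A. \<forall>I\<in>?A. M \<subseteq> I \<longrightarrow> I = M"
 proof (rule subset_Zorn_nonempty)
  show "?A ~= {}" using zeroideal assms by blast
  fix C assume C: "C ~= {}" "subset.chain ?A C"
  then have "subset.chain {I. ideal I R} C" "\<forall>I\<in>C. \<one> \<notin> I" by (auto simp: subset.chain_def)
  then show "\<Union>C \<in> ?A" using chain_Union_is_ideal[of C] C(1) by auto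
 qed
 then obtain M where M: "ideal M R" "\<one> \<notin> M" "\<And>I. ideal I R ==> \<one> \<notin> I ==> M \<subseteq> I ==> I = M" by blast
 have "maximalideal M R"
 proof (rule maximalidealI[OF M(1)])
  show "carrier R ~= M" using M(2) by blast
  fix J assume J: "ideal J R" "M \<subseteq> J" "J \<subseteq> carrier R"
  then show "J = M \<or> J = carrier R" using M(3) ideal.one_imp_carrier[OF J(1)] by blast
 qed
 then show ?thesis by blast
qed

lemma (in domain) nat_pow_nonzero: "[|x :. R; x ~= \<zero>|] ==> x [^] (n::nat) ~= \<zero>"
 by (induct n) (auto simp: integral_iff)

lemma (in algebraically_closed) root_of_sum:
 assumes a: "!!i. a i :. L" and n: "n ~= 0" "a n ~= \<zero>$L"
 shows "\<exists>\<xi>\<in>carrier L. (\<Oplus>$L i\<in>{..n::nat}. a i \<otimes>$L \<xi> [^]\<^bsub>L\<^esub> i) = \<zero>$L"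
proof -
 let ?P = "%n. map a (rev [0..<n])"
 have ev: "local.eval (?P m) \<xi> = (\<Oplus>$L i\<in>{..<m}. a i \<otimes>$L \<xi> [^]\<^bsub>L\<^esub> i)" if "\<xi> :. L" for \<xi> m
 proof (induct m)
  case (Suc m)
  have "(\<Oplus>$L i\<in>{..<Suc m}. a i \<otimes>$L \<xi> [^]\<^bsub>L\<^esub> i) = a m \<otimes>$L \<xi> [^]\<^bsub>L\<^esub> m \<oplus>$L (\<Oplus>$L i\<in>{..<m}. a i \<otimes>$L \<xi> [^]\<^bsub>L\<^esub> i)"
   unfolding lessThan_Suc by (rule finsum_insert) (use a that in auto)
  then show ?case using Suc by simp
 qed simp
 have P: "?P (Suc n) :. (poly_ring L)"
  using a n by (auto simp: univ_poly_def polynomial_def)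
 have "size (roots (?P (Suc n))) = n" using roots_over_carrier[OF P] by (simp add: splitted_def)
 then have "roots (?P (Suc n)) ~= {#}" using n(1) by auto
 then obtain \<xi> where "\<xi> \<in># roots (?P (Suc n))" by blast
 then have "\<xi> :. L" "local.eval (?P (Suc n)) \<xi> = \<zero>$L"
  using roots_mem_iff_is_root[OF P] by (simp_all add: is_root_def)
 then show ?thesis using ev[of \<xi> "Suc n"] by (auto simp: lessThan_Suc_atMost)
qed

lemma (in algebraically_closed) nonroot_of_sum:
 assumes a: "!!i. a i :. L" and n: "a n ~= \<zero>$L"
 shows "\<exists>\<xi>\<in>carrier L. (\<Oplus>$L i\<in>{..n::nat}. a i \<otimes>$L \<xi> [^]\<^bsub>L\<^esub> i) ~= \<zero>$L"
proof (cases "n = 0")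
 case True
 then show ?thesis using a n by (intro bexI[of _ "\<zero>$L"]) (simp_all add: atMost_Suc)
next
 case False
 let ?b = "%i. if i = 0 then a 0 \<ominus>$L \<one>$L else a i"
 have b: "!!i. ?b i :. L" using a by simp
 obtain \<xi> where \<xi>: "\<xi> :. L" "(\<Oplus>$L i\<in>{..n}. ?b i \<otimes>$L \<xi> [^]\<^bsub>L\<^esub> i) = \<zero>$L"
  using root_of_sum[of ?b n] b False n by auto
 have split: "(\<Oplus>$L i\<in>{..n}. f i) = f 0 \<oplus>$L (\<Oplus>$L i\<in>{0<..n}. f i)" if "!!i. f i :. L" for f
 proof -
  have "{..n} = insert 0 {0<..n}" by auto
  then show ?thesis using that by (simp add: finsum_insert)
 qed
 let ?r = "\<Oplus>$L i\<in>{0<..n}. a i \<otimes>$L \<xi> [^]\<^bsub>L\<^esub> i"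
 have r: "?r :. L" using a \<xi>(1) by auto
 have "(\<Oplus>$L i\<in>{0<..n}. ?b i \<otimes>$L \<xi> [^]\<^bsub>L\<^esub> i) = ?r"
  by (rule finsum_cong'[OF HOL.refl]) (use a \<xi>(1) in auto)
 then have "(a 0 \<ominus>$L \<one>$L) \<oplus>$L ?r = \<zero>$L"
  using \<xi> split[of "%i. ?b i \<otimes>$L \<xi> [^]\<^bsub>L\<^esub> i"] b a by simp
 moreover have "(a 0 \<ominus>$L \<one>$L) \<oplus>$L ?r = (a 0 \<oplus>$L ?r) \<ominus>$L \<one>$L"
  using a r by (simp add: a_minus_def a_ac)
 ultimately have "a 0 \<oplus>$L ?r = \<one>$L" using a r by simp
 then show ?thesis
  using \<xi>(1) split[of "%i. a i \<otimes>$L \<xi> [^]\<^bsub>L\<^esub> i"] a by (intro bexI[of _ \<xi>]) auto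
qed

text \<open>
  The step for one generator \<open>x\<close> of the Nullstellensatz. If \<open>x\<close> is transcendental over \<open>C\<close>, any value
  \<open>\<xi>\<close> outside the zeros of \<open>P\<close> will do. If \<open>x\<close> is algebraic, \<open>\<xi>\<close> must be a root of a relation of least
  degree, and \<open>u\<close> collects the leading coefficient of that relation and a non-zero element of \<open>C\<close> that
  is a multiple of the value of \<open>P\<close>.
\<close>

lemma hom_extends_to_simple_extension:
 fixes C :: "('c, 's) ring_scheme" and K :: "('b, 't) ring_scheme" and k :: "('k, 'u) ring_scheme"
 assumes C: "domain C" and K: "domain K" and \<iota>: "\<iota> \<in> ring_hom C K" "inj_on \<iota> (carrier C)"
  and k: "algebraically_closed k" and x: "x :. K"
  and v: "P :. (UP C)" "UnivPoly.eval C K \<iota> x P ~= \<zero>$K"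
 shows "\<exists>u\<in>carrier C. u ~= \<zero>$C & (\<forall>\<phi>\<in>ring_hom C k. \<phi> u ~= \<zero>$k \<longrightarrow> (\<exists>\<xi>\<in>carrier k.
  (\<forall>p\<in>carrier (UP C). UnivPoly.eval C K \<iota> x p = \<zero>$K \<longrightarrow> UnivPoly.eval C k \<phi> \<xi> p = \<zero>$k) &
  UnivPoly.eval C k \<phi> \<xi> P ~= \<zero>$k))"
proof -
 interpret C: domain C by (rule C)
 interpret K: domain K by (rule K)
 interpret k: algebraically_closed k by (rule k)
 interpret U: UP_domain C "UP C" by unfold_locales simp
 interpret UK: UP_pre_univ_prop C K \<iota> "UP C"
  by (intro UP_pre_univ_prop.intro ring_hom_cringI UP_cring.intro C.cring_axioms K.cring_axioms \<iota>(1)) simp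
 define ev where "ev = UnivPoly.eval C K \<iota> x"
 have evh: "ev \<in> ring_hom (UP C) K" unfolding ev_def by (rule UK.eval_ring_hom[OF x])
 interpret E: ring_hom_cring "UP C" K ev
  by (rule ring_hom_cringI[OF U.UP_cring K.cring_axioms evh])
 have ev_const: "ev (monom (UP C) c 0) = \<iota> c" if "c :. C" for c
  unfolding ev_def by (rule UK.eval_const[OF x that])
 have \<iota>0: "\<iota> c = \<zero>$K \<longleftrightarrow> c = \<zero>$C" if "c :. C" for c
  using that \<iota>(2) ring_hom_zero[OF \<iota>(1) C.ring_axioms K.ring_axioms]
  by (metis C.zero_closed inj_on_eq_iff)
 have deg0: "ev p = \<iota> (coeff (UP C) p 0)" if "p :. (UP C)" "deg C p = 0" for p
  unfolding ev_def using that \<iota>(1) by (simp add: U.eval_on_carrier ring_hom_closed)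
 have ev_smult: "ev (c \<odot>$(UP C) p) = \<iota> c \<otimes>$K ev p" if "c :. C" "p :. (UP C)" for c p
  using that by (simp add: U.monom_mult_is_smult[symmetric] ev_const)
 have target: "UP_pre_univ_prop C k \<phi>" if "\<phi> \<in> ring_hom C k" for \<phi>
  by (intro UP_pre_univ_prop.intro ring_hom_cringI UP_cring.intro C.cring_axioms k.cring_axioms that)
 have sum_form: "UnivPoly.eval C k \<phi> \<xi> p = (\<Oplus>$k i\<in>{..deg C p}. \<phi> (coeff (UP C) p i) \<otimes>$k \<xi> [^]\<^bsub>k\<^esub> i)"
  if "p :. (UP C)" for \<phi> \<xi> p
  using that by (rule U.eval_on_carrier)
 have evh': "UnivPoly.eval C k \<phi> \<xi> \<in> ring_hom (UP C) k" if "\<phi> \<in> ring_hom C k" "\<xi> :. k" for \<phi> \<xi>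
  using UP_pre_univ_prop.eval_ring_hom[OF target[OF that(1)] that(2)] .
 have Pnz: "P ~= \<zero>$(UP C)" using v unfolding ev_def[symmetric] by auto
 show ?thesis
 proof (cases "\<forall>p\<in>carrier (UP C). ev p = \<zero>$K \<longrightarrow> p = \<zero>$(UP C)")
  case True
  let ?u = "coeff (UP C) P (deg C P)"
  have u: "?u :. C" "?u ~= \<zero>$C" using v(1) U.lcoeff_nonzero2[OF v(1) Pnz] by simp_all
  show ?thesis
  proof (intro bexI[OF _ u(1)] conjI u(2) ballI impI)
   fix \<phi> assume \<phi>: "\<phi> \<in> ring_hom C k" "\<phi> ?u ~= \<zero>$k"
   obtain \<xi> where \<xi>: "\<xi> :. k"
    "(\<Oplus>$k i\<in>{..deg C P}. \<phi> (coeff (UP C) P i) \<otimes>$k \<xi> [^]\<^bsub>k\<^esub> i) ~= \<zero>$k"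
    using k.nonroot_of_sum[of "%i. \<phi> (coeff (UP C) P i)" "deg C P"] \<phi> v(1) ring_hom_closed[OF \<phi>(1)] by auto
   show "\<exists>\<xi>\<in>carrier k. (\<forall>p\<in>carrier (UP C). UnivPoly.eval C K \<iota> x p = \<zero>$K \<longrightarrow> UnivPoly.eval C k \<phi> \<xi> p = \<zero>$k) &
     UnivPoly.eval C k \<phi> \<xi> P ~= \<zero>$k"
   proof (intro bexI[OF _ \<xi>(1)] conjI ballI impI)
    show "UnivPoly.eval C k \<phi> \<xi> P ~= \<zero>$k" using \<xi>(2) by (simp add: sum_form[OF v(1)])
    fix p assume "p :. (UP C)" "UnivPoly.eval C K \<iota> x p = \<zero>$K"
    then have "p = \<zero>$(UP C)" using True unfolding ev_def by blast
    then show "UnivPoly.eval C k \<phi> \<xi> p = \<zero>$k"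
     using ring_hom_zero[OF evh'[OF \<phi>(1) \<xi>(1)] U.UP_ring k.ring_axioms] by simp
   qed
  qed
 next
  case False
  let ?Ker = "%p. p :. (UP C) & ev p = \<zero>$K & p ~= \<zero>$(UP C)"
  from False obtain p0 where "?Ker p0" by blast
  then obtain \<mu> where \<mu>: "?Ker \<mu>" and \<mu>min: "!!p. ?Ker p ==> deg C \<mu> \<le> deg C p"
   using ex_has_least_nat[of ?Ker p0 "deg C"] by blast
  let ?Mul = "%p. p :. (UP C) & ev p ~= \<zero>$K & (\<exists>q\<in>carrier (UP C). ev p = ev q \<otimes>$K ev P)"
  have "?Mul P"
   using v E.hom_one U.UP_one_closed E.hom_closed[OF v(1)] unfolding ev_def[symmetric]
   by (intro conjI bexI[of _ "\<one>$(UP C)"]) auto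
  then obtain P0 where P0: "?Mul P0" and P0min: "!!p. ?Mul p ==> deg C P0 \<le> deg C p"
   using ex_has_least_nat[of ?Mul P "deg C"] by blast
  obtain q0 where q0: "q0 :. (UP C)" "ev P0 = ev q0 \<otimes>$K ev P" using P0 by blast
  have P0nz: "P0 ~= \<zero>$(UP C)" using P0 by auto
  have lcpow: "coeff (UP C) g (deg C g) [^]\<^bsub>C\<^esub> n :. C" "coeff (UP C) g (deg C g) [^]\<^bsub>C\<^esub> n ~= \<zero>$C"
   if "g :. (UP C)" "g ~= \<zero>$(UP C)" for g and n :: nat
   using that U.lcoeff_nonzero2[OF that] C.nat_pow_nonzero by auto
  have "deg C P0 < deg C \<mu>"
  proof (rule ccontr)
   assume nless: "\<not> deg C P0 < deg C \<mu>"
   obtain q r and n :: nat where qr: "q :. (UP C)" "r :. (UP C)"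
    "coeff (UP C) \<mu> (deg C \<mu>) [^]\<^bsub>C\<^esub> n \<odot>$(UP C) P0 = \<mu> \<otimes>$(UP C) q \<oplus>$(UP C) r"
    "r = \<zero>$(UP C) \<or> deg C r < deg C \<mu>"
    using U.long_div_theorem[of \<mu> P0] \<mu> P0 by blast
   let ?c = "coeff (UP C) \<mu> (deg C \<mu>) [^]\<^bsub>C\<^esub> n"
   have c: "?c :. C" "?c ~= \<zero>$C" using lcpow \<mu> by blast+
   have "ev (?c \<odot>$(UP C) P0) = ev r"
    unfolding qr(3) using qr \<mu> by simp
   then have evr: "ev r = \<iota> ?c \<otimes>$K ev P0" using ev_smult c P0 by simp
   have ic: "\<iota> ?c :. K" "\<iota> ?c ~= \<zero>$K" using c \<iota>0 ring_hom_closed[OF \<iota>(1)] by blast+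
   have "ev r ~= \<zero>$K" using evr ic P0 K.integral E.hom_closed by metis
   moreover have "ev r = ev (?c \<odot>$(UP C) q0) \<otimes>$K ev P"
    using evr q0 ic v(1) c by (simp add: ev_smult K.m_assoc)
   ultimately have "?Mul r" using qr(2) c q0(1) by blast
   then have "deg C P0 \<le> deg C r" "r ~= \<zero>$(UP C)" using P0min \<open>ev r ~= \<zero>$K\<close> by auto
   then show False using qr(4) nless by linarith
  qed
  have d0: "deg C P0 = 0"
  proof (rule ccontr)
   assume dpos: "deg C P0 ~= 0"
   obtain q r and n :: nat where qr: "q :. (UP C)" "r :. (UP C)"
    "coeff (UP C) P0 (deg C P0) [^]\<^bsub>C\<^esub> n \<odot>$(UP C) \<mu> = P0 \<otimes>$(UP C) q \<oplus>$(UP C) r"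
    "r = \<zero>$(UP C) \<or> deg C r < deg C P0"
    using U.long_div_theorem[of P0 \<mu>] \<mu> P0 P0nz by blast
   let ?c = "coeff (UP C) P0 (deg C P0) [^]\<^bsub>C\<^esub> n"
   have c: "?c :. C" "?c ~= \<zero>$C" using lcpow P0 P0nz by blast+
   have P0c: "P0 :. (UP C)" using P0 by blast
   have "ev (?c \<odot>$(UP C) \<mu>) = \<zero>$K" using ev_smult[OF c(1)] \<mu> c ring_hom_closed[OF \<iota>(1)] by simp
   then have sum0: "ev P0 \<otimes>$K ev q \<oplus>$K ev r = \<zero>$K" unfolding qr(3) using qr P0c by simp
   have evc: "ev P0 :. K" "ev q :. K" "ev r :. K" "ev q0 :. K" "ev P :. K"
    using E.hom_closed qr P0c q0 v(1) by blast+
   have evr: "ev r = ev (\<ominus>$(UP C) (q0 \<otimes>$(UP C) q)) \<otimes>$K ev P"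
   proof -
    have "ev r = \<ominus>$K (ev P0 \<otimes>$K ev q)"
     using sum0 evc by (metis K.add.m_comm K.m_closed K.minus_equality)
    also have "... = \<ominus>$K (ev q0 \<otimes>$K ev q) \<otimes>$K ev P"
     using evc by (simp add: q0(2) K.m_ac K.l_minus K.r_minus)
    finally show ?thesis using q0(1) qr(1) by simp
   qed
   have "ev r = \<zero>$K"
   proof (rule ccontr)
    assume nz: "ev r ~= \<zero>$K"
    then have "?Mul r" using evr qr q0(1) by blast
    then have "deg C P0 \<le> deg C r" by (rule P0min)
    moreover have "r ~= \<zero>$(UP C)" using nz by auto
    ultimately show False using qr(4) by linarith
   qed
   then have "ev q = \<zero>$K" using sum0 evc P0 K.integral by auto
   have r0: "r = \<zero>$(UP C)"
   proof (rule ccontr)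
    assume r: "r ~= \<zero>$(UP C)"
    then have "deg C \<mu> \<le> deg C r" using \<mu>min qr(2) \<open>ev r = \<zero>$K\<close> by blast
    then show False using qr(4) r \<open>deg C P0 < deg C \<mu>\<close> by linarith
   qed
   then have eq: "?c \<odot>$(UP C) \<mu> = P0 \<otimes>$(UP C) q" using qr P0c by simp
   have degc: "deg C (?c \<odot>$(UP C) \<mu>) = deg C \<mu>" using c \<mu> by simp
   have qnz: "q ~= \<zero>$(UP C)"
   proof
    assume "q = \<zero>$(UP C)"
    then have "deg C \<mu> = 0" using eq degc P0c by simp
    then show False using \<open>deg C P0 < deg C \<mu>\<close> by simp
   qed
   have "deg C \<mu> = deg C P0 + deg C q" using degc eq P0nz qnz P0c qr(1) by simp
   moreover have "deg C \<mu> \<le> deg C q" using \<mu>min qr(1) qnz \<open>ev q = \<zero>$K\<close> by blast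
   ultimately show False using dpos by simp
  qed
  let ?c = "coeff (UP C) P0 0" and ?l = "coeff (UP C) \<mu> (deg C \<mu>)"
  have P0c: "P0 :. (UP C)" and \<mu>c: "\<mu> :. (UP C)" using P0 \<mu> by blast+
  have c: "?c :. C" "?c ~= \<zero>$C"
   using P0c U.lcoeff_nonzero2[OF P0c P0nz] d0 by simp_all
  have l: "?l :. C" "?l ~= \<zero>$C" using \<mu> U.lcoeff_nonzero2[of \<mu>] by simp_all
  have \<mu>pos: "deg C \<mu> ~= 0" using \<open>deg C P0 < deg C \<mu>\<close> by simp
  show ?thesis
  proof (intro bexI[of _ "?c \<otimes>$C ?l"] conjI ballI impI)
   show "?c \<otimes>$C ?l :. C" "?c \<otimes>$C ?l ~= \<zero>$C" using c l C.integral by auto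
   fix \<phi> assume \<phi>: "\<phi> \<in> ring_hom C k" and nz: "\<phi> (?c \<otimes>$C ?l) ~= \<zero>$k"
   note \<phi>h = ring_hom_closed[OF \<phi>] ring_hom_mult[OF \<phi>]
   have \<phi>c: "\<phi> ?c ~= \<zero>$k" and \<phi>l: "\<phi> ?l ~= \<zero>$k"
    using nz c l \<phi>h by auto
   obtain \<xi> where \<xi>: "\<xi> :. k" "(\<Oplus>$k i\<in>{..deg C \<mu>}. \<phi> (coeff (UP C) \<mu> i) \<otimes>$k \<xi> [^]\<^bsub>k\<^esub> i) = \<zero>$k"
    using k.root_of_sum[of "%i. \<phi> (coeff (UP C) \<mu> i)" "deg C \<mu>"] \<phi>h(1) \<mu>c \<mu>pos \<phi>l by auto
   define e where "e = UnivPoly.eval C k \<phi> \<xi>"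
   interpret T: UP_pre_univ_prop C k \<phi> "UP C" using target[OF \<phi>] by simp
   interpret e: ring_hom_cring "UP C" k e
    unfolding e_def by (rule ring_hom_cringI[OF U.UP_cring k.cring_axioms evh'[OF \<phi> \<xi>(1)]])
   have e_smult: "e (c \<odot>$(UP C) p) = \<phi> c \<otimes>$k e p" if "c :. C" "p :. (UP C)" for c p
    using that T.eval_const[OF \<xi>(1) that(1)] unfolding e_def[symmetric]
    by (simp add: U.monom_mult_is_smult[symmetric])
   have e\<mu>: "e \<mu> = \<zero>$k" using \<xi>(2) sum_form[OF \<mu>c] by (simp add: e_def)
   have e0: "e p = \<zero>$k" if p: "p :. (UP C)" "ev p = \<zero>$K" for p
   proof -
    obtain q r and n :: nat where qr: "q :. (UP C)" "r :. (UP C)"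
     "?l [^]\<^bsub>C\<^esub> n \<odot>$(UP C) p = \<mu> \<otimes>$(UP C) q \<oplus>$(UP C) r" "r = \<zero>$(UP C) \<or> deg C r < deg C \<mu>"
     using U.long_div_theorem[OF \<mu>c p(1)] \<mu> by blast
    have ln: "?l [^]\<^bsub>C\<^esub> n :. C" using l by simp
    have "ev (?l [^]\<^bsub>C\<^esub> n \<odot>$(UP C) p) = \<zero>$K" using ev_smult[OF ln p(1)] p(2) ln ring_hom_closed[OF \<iota>(1)] by simp
    then have "ev r = \<zero>$K" unfolding qr(3) using qr \<mu> by simp
    then have "r = \<zero>$(UP C)" using \<mu>min[of r] qr by force
    then have "?l [^]\<^bsub>C\<^esub> n \<odot>$(UP C) p = \<mu> \<otimes>$(UP C) q" using qr \<mu>c by simp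
    then have "e (?l [^]\<^bsub>C\<^esub> n \<odot>$(UP C) p) = \<zero>$k" using qr(1) \<mu>c e\<mu> by simp
    then have "\<phi> (?l [^]\<^bsub>C\<^esub> n) \<otimes>$k e p = \<zero>$k" using e_smult[OF ln p(1)] by simp
    moreover have "\<phi> (?l [^]\<^bsub>C\<^esub> n) = \<phi> ?l [^]\<^bsub>k\<^esub> n" using T.hom_pow[OF l(1)] by simp
    moreover have "\<phi> ?l [^]\<^bsub>k\<^esub> n ~= \<zero>$k" using k.nat_pow_nonzero \<phi>l \<phi>h(1) l by simp
    ultimately show ?thesis using k.integral[of "\<phi> ?l [^]\<^bsub>k\<^esub> n" "e p"] \<phi>h(1) l p(1) by auto
   qed
   have "e P ~= \<zero>$k"
   proof
    assume eP: "e P = \<zero>$k"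
    have "ev (q0 \<otimes>$(UP C) P \<ominus>$(UP C) P0) = \<zero>$K"
     using q0 v(1) P0c E.hom_closed by (simp add: a_minus_def K.r_neg)
    then have "e (q0 \<otimes>$(UP C) P \<ominus>$(UP C) P0) = \<zero>$k" using q0(1) v(1) P0c by (intro e0) auto
    then have "e P0 = \<zero>$k" using eP q0(1) v(1) P0c e.hom_closed[OF P0c] by (simp add: a_minus_def)
    moreover have "e P0 = \<phi> ?c"
     using sum_form[OF P0c, of \<phi> \<xi>] \<phi>h(1)[OF c(1)] d0 by (simp add: e_def)
    ultimately show False using \<phi>c by simp
   qed
   then show "\<exists>\<xi>\<in>carrier k. (\<forall>p\<in>carrier (UP C). UnivPoly.eval C K \<iota> x p = \<zero>$K \<longrightarrow> UnivPoly.eval C k \<phi> \<xi> p = \<zero>$k) &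
     UnivPoly.eval C k \<phi> \<xi> P ~= \<zero>$k"
    using e0 \<xi>(1) unfolding ev_def e_def by (intro bexI[OF _ \<xi>(1)]) blast
  qed
 qed
qed

text \<open>
  Adjoining the generators one at a time extends the identity of \<open>k\<close> to a homomorphism from the algebra
  generated by \<open>S\<close>, which is the whole field \<open>K\<close>, to \<open>k\<close>. It is injective, and \<open>\<kappa>\<close> is a section of it.
\<close>

theorem weak_nullstellensatz:
 fixes K :: "('b, 't) ring_scheme" and k :: "('k, 'u) ring_scheme"
 assumes K: "field K" and k: "algebraically_closed k" and \<kappa>: "\<kappa> \<in> ring_hom k K"
  and S: "finite S" "S \<subseteq> carrier K" and gen: "generate_ring K (S \<union> \<kappa> ` carrier k) = carrier K"
 shows "\<kappa> ` carrier k = carrier K"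
proof -
 interpret K: field K by (rule K)
 interpret k: algebraically_closed k by (rule k)
 interpret \<kappa>: ring_hom_ring k K \<kappa>
  by (rule ring_hom_ringI2[OF k.ring_axioms K.ring_axioms \<kappa>])
 have \<kappa>inj: "inj_on \<kappa> (carrier k)"
  by (rule non_trivial_field_hom_is_inj[OF \<kappa> k.field_axioms K])
 have "\<exists>C. subring C K & \<kappa> ` carrier k \<subseteq> C & T \<subseteq> C & (\<forall>v\<in>C. v ~= \<zero>$K \<longrightarrow>
   (\<exists>\<psi>\<in>ring_hom (K\<lparr>carrier := C\<rparr>) k. (\<forall>c\<in>carrier k. \<psi> (\<kappa> c) = c) & \<psi> v ~= \<zero>$k))"
  if "finite T" "T \<subseteq> carrier K" for T
  using that
 proof (induct rule: finite_induct)
  case empty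
  let ?C = "\<kappa> ` carrier k"
  let ?\<psi> = "inv_into (carrier k) \<kappa>"
  have sub: "subring ?C K" by (rule \<kappa>.img_is_subring[OF k.carrier_is_subring])
  have inv: "?\<psi> (\<kappa> c) = c" if "c :. k" for c using \<kappa>inj that by simp
  have "?\<psi> \<in> ring_hom (K\<lparr>carrier := ?C\<rparr>) k"
  proof (rule ring_hom_memI)
   show "?\<psi> \<one>$(K\<lparr>carrier := ?C\<rparr>) = \<one>$k" using inv[OF k.one_closed] by simp
   fix x y assume "x :. (K\<lparr>carrier := ?C\<rparr>)" "y :. (K\<lparr>carrier := ?C\<rparr>)"
   then obtain a b where ab: "a :. k" "b :. k" "x = \<kappa> a" "y = \<kappa> b" by auto
   show "?\<psi> (x \<otimes>$(K\<lparr>carrier := ?C\<rparr>) y) = ?\<psi> x \<otimes>$k ?\<psi> y"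
    using ab inv[of "a \<otimes>$k b"] inv by simp
   show "?\<psi> (x \<oplus>$(K\<lparr>carrier := ?C\<rparr>) y) = ?\<psi> x \<oplus>$k ?\<psi> y"
    using ab inv[of "a \<oplus>$k b"] inv by simp
  qed (use inv in auto)
  moreover have "?\<psi> v ~= \<zero>$k" if "v \<in> ?C" "v ~= \<zero>$K" for v using that inv by auto
  ultimately show ?case using sub inv by (intro exI[of _ ?C]) blast
 next
  case (insert x T)
  then obtain C where C: "subring C K" "\<kappa> ` carrier k \<subseteq> C" "T \<subseteq> C"
   and ext: "!!v. v \<in> C ==> v ~= \<zero>$K ==>
    \<exists>\<psi>\<in>ring_hom (K\<lparr>carrier := C\<rparr>) k. (\<forall>c\<in>carrier k. \<psi> (\<kappa> c) = c) & \<psi> v ~= \<zero>$k" by auto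
  let ?C = "K\<lparr>carrier := C\<rparr>"
  have x: "x :. K" using insert by blast
  have CK: "C \<subseteq> carrier K" using subringE(1)[OF C(1)] .
  have Cd: "domain ?C" by (rule K.subring_is_domain[OF C(1)])
  interpret C: domain ?C by (rule Cd)
  have \<iota>: "(%c. c) \<in> ring_hom ?C K" using CK by (auto simp: ring_hom_def)
  interpret U: UP_domain ?C "UP ?C" by unfold_locales simp
  interpret UK: UP_pre_univ_prop ?C K "%c. c" "UP ?C"
   by (intro UP_pre_univ_prop.intro ring_hom_cringI UP_cring.intro C.cring_axioms K.cring_axioms \<iota>) simp
  define ev where "ev = UnivPoly.eval ?C K (%c. c) x"
  have evh: "ev \<in> ring_hom (UP ?C) K" unfolding ev_def by (rule UK.eval_ring_hom[OF x])
  interpret E: ring_hom_ring "UP ?C" K ev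
   by (rule ring_hom_ringI2[OF U.UP_ring K.ring_axioms evh])
  let ?D = "ev ` carrier (UP ?C)"
  have D: "subring ?D K" by (rule E.img_is_subring[OF ring.carrier_is_subring[OF U.UP_ring]])
  have ev_const: "ev (monom (UP ?C) c 0) = c" if "c \<in> C" for c
   unfolding ev_def using UK.eval_const[OF x, of c] that by simp
  have const_in: "monom (UP ?C) c 0 :. (UP ?C)" if "c \<in> C" for c using that by simp
  have CD: "C \<subseteq> ?D" using ev_const const_in by (metis image_eqI subsetI)
  have "ev (monom (UP ?C) \<one>$K 1) = x" unfolding ev_def using UK.eval_monom1[OF x] by simp
  moreover have "monom (UP ?C) \<one>$K 1 :. (UP ?C)" using U.monom_closed[OF C.one_closed] by simp
  ultimately have xD: "x \<in> ?D" by (metis image_eqI)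
  have "\<exists>\<psi>\<in>ring_hom (K\<lparr>carrier := ?D\<rparr>) k. (\<forall>c\<in>carrier k. \<psi> (\<kappa> c) = c) & \<psi> v ~= \<zero>$k"
   if v: "v \<in> ?D" "v ~= \<zero>$K" for v
  proof -
   obtain P where P: "P :. (UP ?C)" "v = ev P" using v(1) by blast
   obtain u where u: "u \<in> C" "u ~= \<zero>$K"
    and ue: "\<And>\<phi>. \<phi> \<in> ring_hom ?C k ==> \<phi> u ~= \<zero>$k ==> \<exists>\<xi>\<in>carrier k.
     (\<forall>p\<in>carrier (UP ?C). ev p = \<zero>$K \<longrightarrow> UnivPoly.eval ?C k \<phi> \<xi> p = \<zero>$k) & UnivPoly.eval ?C k \<phi> \<xi> P ~= \<zero>$k"
    using hom_extends_to_simple_extension[OF Cd K.domain_axioms \<iota> _ k x P(1)] v(2) P(2)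
    unfolding ev_def by auto
   obtain \<phi> where \<phi>: "\<phi> \<in> ring_hom ?C k" "!!c. c :. k ==> \<phi> (\<kappa> c) = c" "\<phi> u ~= \<zero>$k"
    using ext[OF u] by blast
   obtain \<xi> where \<xi>: "\<xi> :. k"
    "!!p. p :. (UP ?C) ==> ev p = \<zero>$K ==> UnivPoly.eval ?C k \<phi> \<xi> p = \<zero>$k"
    "UnivPoly.eval ?C k \<phi> \<xi> P ~= \<zero>$k" using ue[OF \<phi>(1,3)] by blast
   interpret T: UP_pre_univ_prop ?C k \<phi> "UP ?C"
    by (intro UP_pre_univ_prop.intro ring_hom_cringI UP_cring.intro C.cring_axioms k.cring_axioms \<phi>(1)) simp
   define e where "e = UnivPoly.eval ?C k \<phi> \<xi>"
   interpret e: ring_hom_ring "UP ?C" k e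
    unfolding e_def by (rule ring_hom_ringI2[OF U.UP_ring k.ring_axioms T.eval_ring_hom[OF \<xi>(1)]])
   have wd: "e p = e q" if "p :. (UP ?C)" "q :. (UP ?C)" "ev p = ev q" for p q
   proof -
    have "ev (p \<ominus>$(UP ?C) q) = \<zero>$K" using that E.hom_closed[OF that(2)] by (simp add: a_minus_def K.r_neg)
    then have "e (p \<ominus>$(UP ?C) q) = \<zero>$k" using \<xi>(2) that unfolding e_def by simp
    then have "e p \<ominus>$k e q = \<zero>$k" using that by (simp add: a_minus_def)
    then show ?thesis using k.r_right_minus_eq[OF e.hom_closed[OF that(1)] e.hom_closed[OF that(2)]] by simp
   qed
   define \<psi> where "\<psi> y = e (inv_into (carrier (UP ?C)) ev y)" for y
   have \<psi>: "\<psi> (ev p) = e p" if "p :. (UP ?C)" for p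
    unfolding \<psi>_def using that by (intro wd) (auto simp: inv_into_into f_inv_into_f)
   have "\<psi> \<in> ring_hom (K\<lparr>carrier := ?D\<rparr>) k"
   proof (rule ring_hom_memI)
    show "\<psi> \<one>$(K\<lparr>carrier := ?D\<rparr>) = \<one>$k" using \<psi>[OF U.UP_one_closed] by simp
    fix y z assume "y :. (K\<lparr>carrier := ?D\<rparr>)" "z :. (K\<lparr>carrier := ?D\<rparr>)"
    then obtain p q where pq: "p :. (UP ?C)" "q :. (UP ?C)" "y = ev p" "z = ev q" by auto
    show "\<psi> y :. k" using pq \<psi> by simp
    show "\<psi> (y \<otimes>$(K\<lparr>carrier := ?D\<rparr>) z) = \<psi> y \<otimes>$k \<psi> z"
     using pq \<psi>[OF U.UP_mult_closed[OF pq(1,2)]] \<psi> by simp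
    show "\<psi> (y \<oplus>$(K\<lparr>carrier := ?D\<rparr>) z) = \<psi> y \<oplus>$k \<psi> z"
     using pq \<psi>[OF U.UP_a_closed[OF pq(1,2)]] \<psi> by simp
   qed
   moreover have "\<psi> (\<kappa> c) = c" if c: "c :. k" for c
   proof -
    have \<kappa>c: "\<kappa> c \<in> C" using C(2) c by blast
    have "\<psi> (\<kappa> c) = e (monom (UP ?C) (\<kappa> c) 0)" using \<psi>[OF const_in[OF \<kappa>c]] ev_const[OF \<kappa>c] by simp
    also have "... = c" unfolding e_def using T.eval_const[OF \<xi>(1), of "\<kappa> c"] \<kappa>c \<phi>(2)[OF c] by simp
    finally show ?thesis .
   qed
   moreover have "\<psi> v ~= \<zero>$k" using \<psi>[OF P(1)] \<xi>(3) by (simp add: P(2) e_def)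
   ultimately show ?thesis by blast
  qed
  then show ?case using D CD C(2,3) xD by (intro exI[of _ ?D]) blast
 qed
 from this[OF S] obtain C where C: "subring C K" "\<kappa> ` carrier k \<subseteq> C" "S \<subseteq> C"
  "!!v. v \<in> C ==> v ~= \<zero>$K ==> \<exists>\<psi>\<in>ring_hom (K\<lparr>carrier := C\<rparr>) k. (\<forall>c\<in>carrier k. \<psi> (\<kappa> c) = c)" by blast
 have "S \<union> \<kappa> ` carrier k \<subseteq> carrier K" using S(2) by auto
 then have "carrier K \<subseteq> C" using K.generate_ring_min_subring1[OF _ C(1)] C(2,3) gen by blast
 then have CK: "C = carrier K" using subringE(1)[OF C(1)] by blast
 obtain \<psi> where \<psi>: "\<psi> \<in> ring_hom K k" "!!c. c :. k ==> \<psi> (\<kappa> c) = c"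
  using C(4)[of "\<one>$K"] CK by auto
 have inj: "inj_on \<psi> (carrier K)"
  by (rule non_trivial_field_hom_is_inj[OF \<psi>(1) K k.field_axioms])
 show ?thesis
 proof
  show "carrier K \<subseteq> \<kappa> ` carrier k"
  proof
   fix y assume y: "y :. K"
   then have \<psi>y: "\<psi> y :. k" by (rule ring_hom_closed[OF \<psi>(1)])
   have "\<psi> (\<kappa> (\<psi> y)) = \<psi> y" by (rule \<psi>(2)[OF \<psi>y])
   then have "\<kappa> (\<psi> y) = y" using inj y \<psi>y by (meson \<kappa>.hom_closed inj_onD)
   then show "y \<in> \<kappa> ` carrier k" using \<psi>y by (metis image_eqI)
  qed
 qed auto
qed

section \<open>Rings of fractions with central denominators\<close>

lemma ring_image:
 assumes "ring L" and carrier: "carrier A = f ` carrier L"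
  and mult: "!!x y. [|x :. L; y :. L|] ==> f x \<otimes>$A f y = f (x \<otimes>$L y)"
  and add: "!!x y. [|x :. L; y :. L|] ==> f x \<oplus>$A f y = f (x \<oplus>$L y)"
  and one: "\<one>$A = f \<one>$L" and zero: "\<zero>$A = f \<zero>$L"
 shows "ring A" and "f \<in> ring_hom L A"
proof -
 interpret L: ring L by fact
 show "ring A"
 proof (intro ringI abelian_groupI monoidI)
  fix x assume "x :. A"
  then obtain a where "a :. L" "x = f a" by (auto simp: carrier)
  then show "\<exists>y\<in>carrier A. y \<oplus>$A x = \<zero>$A"
   by (intro bexI[of _ "f (\<ominus>$L a)"]) (simp_all add: add zero carrier L.l_neg)
 qed (auto simp: carrier mult add one zero L.a_ac L.m_assoc L.l_distr L.r_distr)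
 show "f \<in> ring_hom L A" by (rule ring_hom_memI) (auto simp: carrier mult add one)
qed

text \<open>
  Denominators that are not zero divisors. Equality of fractions is then given by one
  cross-multiplication.
\<close>

locale central_denominators = R: ring A for A :: "('k, 'a) module" +
 fixes S :: "'a set"
 assumes S: "S \<subseteq> carrier A" "\<one>$A \<in> S" "!!s t. [|s \<in> S; t \<in> S|] ==> s \<otimes>$A t \<in> S"
  and S_central: "!!s a. [|s \<in> S; a :. A|] ==> s \<otimes>$A a = a \<otimes>$A s"
  and S_regular: "!!s a. [|s \<in> S; a :. A; s \<otimes>$A a = \<zero>$A|] ==> a = \<zero>$A"
begin

lemma Sc [simp]: "s \<in> S ==> s :. A"
 using S(1) by blast

lemma S_cancel:
 assumes "s \<in> S" "a :. A" "b :. A" "s \<otimes>$A a = s \<otimes>$A b"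
 shows "a = b"
proof -
 have "s \<otimes>$A (a \<ominus>$A b) = \<zero>$A"
  using assms by (simp add: a_minus_def R.r_distr R.r_minus R.r_neg)
 then show ?thesis using S_regular[OF assms(1), of "a \<ominus>$A b"] assms by simp
qed

lemma S_lcomm:
 "[|s \<in> S; a :. A; b :. A|] ==> a \<otimes>$A (s \<otimes>$A b) = s \<otimes>$A (a \<otimes>$A b)"
 using S_central[of s a] by (simp add: R.m_assoc[symmetric])

lemma loc_rel_iff:
 "((a, s), (b, t)) \<in> loc_rel A S \<longleftrightarrow>
  a :. A & b :. A & s \<in> S & t \<in> S & t \<otimes>$A a = s \<otimes>$A b"
proof
 assume "((a, s), (b, t)) \<in> loc_rel A S"
 then obtain u where u: "u \<in> S" "u \<otimes>$A (t \<otimes>$A a) = u \<otimes>$A (s \<otimes>$A b)"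
  and st: "a :. A" "b :. A" "s \<in> S" "t \<in> S" by (auto simp: loc_rel_def)
 have "t \<otimes>$A a = s \<otimes>$A b" by (rule S_cancel[OF u(1) _ _ u(2)]) (use st in auto)
 with st show "a :. A & b :. A & s \<in> S & t \<in> S & t \<otimes>$A a = s \<otimes>$A b" by simp
next
 assume "a :. A & b :. A & s \<in> S & t \<in> S & t \<otimes>$A a = s \<otimes>$A b"
 then show "((a, s), (b, t)) \<in> loc_rel A S" using S(2) by (auto simp: loc_rel_def)
qed

abbreviation fr where "fr \<equiv> loc_frac A S"

lemma frac_mem: "(b, t) \<in> fr a s \<longleftrightarrow>
  a :. A & b :. A & s \<in> S & t \<in> S & t \<otimes>$A a = s \<otimes>$A b"
 by (simp add: loc_frac_def loc_rel_iff)

lemma frac_eq_iff: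
 assumes "a :. A" "s \<in> S" "b :. A" "t \<in> S"
 shows "fr a s = fr b t \<longleftrightarrow> t \<otimes>$A a = s \<otimes>$A b"
proof
 assume "fr a s = fr b t"
 moreover have "(a, s) \<in> fr a s" using assms by (simp add: frac_mem)
 ultimately have "s \<otimes>$A b = t \<otimes>$A a" using frac_mem[of a s b t] by simp
 then show "t \<otimes>$A a = s \<otimes>$A b" by simp
next
 assume eq: "t \<otimes>$A a = s \<otimes>$A b"
 have step: "u \<otimes>$A b' = t' \<otimes>$A c"
  if c: "c :. A" "u \<in> S" "a' :. A" "s' \<in> S" "b' :. A" "t' \<in> S"
   "t' \<otimes>$A a' = s' \<otimes>$A b'" "u \<otimes>$A a' = s' \<otimes>$A c" for a' s' b' t' c u
 proof (rule S_cancel[OF c(4)])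
  have "s' \<otimes>$A (u \<otimes>$A b') = u \<otimes>$A (s' \<otimes>$A b')" by (rule S_lcomm) (use c in auto)
  also have "... = u \<otimes>$A (t' \<otimes>$A a')" by (simp only: c(7))
  also have "... = t' \<otimes>$A (u \<otimes>$A a')" by (rule S_lcomm) (use c in auto)
  also have "... = t' \<otimes>$A (s' \<otimes>$A c)" by (simp only: c(8))
  also have "... = s' \<otimes>$A (t' \<otimes>$A c)" by (rule S_lcomm) (use c in auto)
  finally show "s' \<otimes>$A (u \<otimes>$A b') = s' \<otimes>$A (t' \<otimes>$A c)" .
 qed (use c in auto)
 have "(c, u) \<in> fr a s \<longleftrightarrow> (c, u) \<in> fr b t" for c u
  unfolding frac_mem using step[OF _ _ assms eq, of c u]
   step[OF _ _ assms(3,4,1,2) eq[symmetric], of c u] assms by blast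
 then show "fr a s = fr b t" by auto
qed

lemma loc_carrier: "carrier (localization A S) = {fr a s | a s. a :. A & s \<in> S}"
 by (auto simp: localization_def quotient_def loc_frac_def)

lemma loc_cases:
 assumes "x :. (localization A S)"
 obtains a s where "a :. A" "s \<in> S" "x = fr a s"
 using assms by (auto simp: loc_carrier)

lemma Union_frac:
 assumes "a :. A" "s \<in> S"
  and "!!a' s'. [|a' :. A; s' \<in> S; s' \<otimes>$A a = s \<otimes>$A a'|] ==> F a' s' = Y"
 shows "(\<Union>(a, s)\<in>fr a s. F a s) = Y"
proof -
 have "(a, s) \<in> fr a s" using assms by (simp add: frac_mem)
 moreover have "F a' s' = Y" if "(a', s') \<in> fr a s" for a' s'
  using that assms(3)[of a' s'] by (simp add: frac_mem)
 ultimately show ?thesis by (auto intro!: UN_I[of "(a, s)"])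
qed

lemma loc_mult:
 assumes "a :. A" "s \<in> S" "b :. A" "t \<in> S"
 shows "fr a s \<otimes>$(localization A S) fr b t = fr (a \<otimes>$A b) (s \<otimes>$A t)"
proof -
 have "fr (a' \<otimes>$A b') (s' \<otimes>$A t') = fr (a \<otimes>$A b) (s \<otimes>$A t)"
  if "a' :. A" "s' \<in> S" "s' \<otimes>$A a = s \<otimes>$A a'" "b' :. A" "t' \<in> S" "t' \<otimes>$A b = t \<otimes>$A b'"
  for a' s' b' t'
 proof -
  have "(s' \<otimes>$A t') \<otimes>$A (a \<otimes>$A b) = (s' \<otimes>$A a) \<otimes>$A (t' \<otimes>$A b)"
   using assms that(1,2,4,5) by (simp add: R.m_assoc S_lcomm)
  also have "... = (s \<otimes>$A t) \<otimes>$A (a' \<otimes>$A b')"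
   unfolding that(3,6) using assms that(1,2,4,5) by (simp add: R.m_assoc S_lcomm)
  finally show ?thesis using assms that(1,2,4,5) S(3) by (simp add: frac_eq_iff)
 qed
 note key = this
 have "fr a s \<otimes>$(localization A S) fr b t = (\<Union>(a', s')\<in>fr a s. (\<Union>(b', t')\<in>fr b t. fr (a' \<otimes>$A b') (s' \<otimes>$A t')))"
  by (simp add: localization_def)
 also have "... = fr (a \<otimes>$A b) (s \<otimes>$A t)"
 proof (rule Union_frac[OF assms(1,2)])
  fix a' s' assume as: "a' :. A" "s' \<in> S" "s' \<otimes>$A a = s \<otimes>$A a'"
  show "(\<Union>(b', t')\<in>fr b t. fr (a' \<otimes>$A b') (s' \<otimes>$A t')) = fr (a \<otimes>$A b) (s \<otimes>$A t)"
   by (rule Union_frac[OF assms(3,4) key[OF as]])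
 qed
 finally show ?thesis .
qed

lemma loc_add:
 assumes "a :. A" "s \<in> S" "b :. A" "t \<in> S"
 shows "fr a s \<oplus>$(localization A S) fr b t = fr ((t \<otimes>$A a) \<oplus>$A (s \<otimes>$A b)) (s \<otimes>$A t)"
proof -
 have "fr ((t' \<otimes>$A a') \<oplus>$A (s' \<otimes>$A b')) (s' \<otimes>$A t') = fr ((t \<otimes>$A a) \<oplus>$A (s \<otimes>$A b)) (s \<otimes>$A t)"
  if "a' :. A" "s' \<in> S" "s' \<otimes>$A a = s \<otimes>$A a'" "b' :. A" "t' \<in> S" "t' \<otimes>$A b = t \<otimes>$A b'"
  for a' s' b' t'
 proof -
  have "(s \<otimes>$A t) \<otimes>$A (t' \<otimes>$A a') = t \<otimes>$A (t' \<otimes>$A (s \<otimes>$A a'))"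
   using assms that(1,2,4,5) by (simp add: R.m_assoc S_lcomm)
  also have "... = (s' \<otimes>$A t') \<otimes>$A (t \<otimes>$A a)"
   unfolding that(3)[symmetric] using assms that(1,2,4,5) by (simp add: R.m_assoc S_lcomm)
  finally have 1: "(s \<otimes>$A t) \<otimes>$A (t' \<otimes>$A a') = (s' \<otimes>$A t') \<otimes>$A (t \<otimes>$A a)" .
  have "(s \<otimes>$A t) \<otimes>$A (s' \<otimes>$A b') = s \<otimes>$A (s' \<otimes>$A (t \<otimes>$A b'))"
   using assms that(1,2,4,5) by (simp add: R.m_assoc S_lcomm)
  also have "... = (s' \<otimes>$A t') \<otimes>$A (s \<otimes>$A b)"
   unfolding that(6)[symmetric] using assms that(1,2,4,5) by (simp add: R.m_assoc S_lcomm)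
  finally have 2: "(s \<otimes>$A t) \<otimes>$A (s' \<otimes>$A b') = (s' \<otimes>$A t') \<otimes>$A (s \<otimes>$A b)" .
  show ?thesis using assms that(1,2,4,5) S(3) 1 2 by (simp add: frac_eq_iff R.r_distr)
 qed
 note key = this
 have "fr a s \<oplus>$(localization A S) fr b t = (\<Union>(a', s')\<in>fr a s. (\<Union>(b', t')\<in>fr b t. fr ((t' \<otimes>$A a') \<oplus>$A (s' \<otimes>$A b')) (s' \<otimes>$A t')))"
  by (simp add: localization_def)
 also have "... = fr ((t \<otimes>$A a) \<oplus>$A (s \<otimes>$A b)) (s \<otimes>$A t)"
 proof (rule Union_frac[OF assms(1,2)])
  fix a' s' assume as: "a' :. A" "s' \<in> S" "s' \<otimes>$A a = s \<otimes>$A a'"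
  show "(\<Union>(b', t')\<in>fr b t. fr ((t' \<otimes>$A a') \<oplus>$A (s' \<otimes>$A b')) (s' \<otimes>$A t')) = fr ((t \<otimes>$A a) \<oplus>$A (s \<otimes>$A b)) (s \<otimes>$A t)"
   by (rule Union_frac[OF assms(3,4) key[OF as]])
 qed
 finally show ?thesis .
qed

lemma loc_one: "\<one>$(localization A S) = fr \<one>$A \<one>$A" and loc_zero: "\<zero>$(localization A S) = fr \<zero>$A \<one>$A"
 by (simp_all add: localization_def)

lemma frac_mem_carrier: "a :. A ==> s \<in> S ==> fr a s :. (localization A S)"
 by (auto simp: loc_carrier)

lemma ring_localization: "ring (localization A S)"
proof (intro ringI abelian_groupI monoidI)
 note simps = loc_mult loc_add loc_one loc_zero frac_eq_iff S(2,3) frac_mem_carrier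
 fix x assume "x :. (localization A S)"
 then obtain a s where x: "a :. A" "s \<in> S" "x = fr a s" by (rule loc_cases)
 show "\<zero>$(localization A S) \<oplus>$(localization A S) x = x" "\<one>$(localization A S) \<otimes>$(localization A S) x = x"
  "x \<otimes>$(localization A S) \<one>$(localization A S) = x"
  using x by (simp_all add: simps)
 show "\<exists>y\<in>carrier (localization A S). y \<oplus>$(localization A S) x = \<zero>$(localization A S)"
  using x by (intro bexI[of _ "fr (\<ominus>$A a) s"]) (simp_all add: simps R.r_minus R.l_neg)
 fix y assume "y :. (localization A S)"
 then obtain b t where y: "b :. A" "t \<in> S" "y = fr b t" by (rule loc_cases)
 show "x \<oplus>$(localization A S) y :. (localization A S)"
  "x \<otimes>$(localization A S) y :. (localization A S)"
  using x y by (simp_all add: simps)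
 show "x \<oplus>$(localization A S) y = y \<oplus>$(localization A S) x"
  using x y S_central[of s t] by (simp add: simps R.a_comm)
 fix z assume "z :. (localization A S)"
 then obtain c u where z: "c :. A" "u \<in> S" "z = fr c u" by (rule loc_cases)
 show "x \<oplus>$(localization A S) y \<oplus>$(localization A S) z = x \<oplus>$(localization A S) (y \<oplus>$(localization A S) z)"
  using x y z by (simp add: simps R.r_distr R.m_assoc R.a_assoc S_lcomm)
 show "x \<otimes>$(localization A S) y \<otimes>$(localization A S) z = x \<otimes>$(localization A S) (y \<otimes>$(localization A S) z)"
  using x y z by (simp add: simps R.m_assoc)
 show "(x \<oplus>$(localization A S) y) \<otimes>$(localization A S) z =
   x \<otimes>$(localization A S) z \<oplus>$(localization A S) y \<otimes>$(localization A S) z"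
  using x y z by (simp add: simps R.l_distr R.r_distr R.m_assoc S_lcomm)
 show "z \<otimes>$(localization A S) (x \<oplus>$(localization A S) y) =
   z \<otimes>$(localization A S) x \<oplus>$(localization A S) z \<otimes>$(localization A S) y"
  using x y z by (simp add: simps R.l_distr R.r_distr R.m_assoc S_lcomm S_lcomm[OF y(2) z(1) x(1)]
    S_lcomm[OF x(2) z(1) y(1)])
next
 show "\<zero>$(localization A S) :. (localization A S)" "\<one>$(localization A S) :. (localization A S)"
  by (simp_all add: loc_one loc_zero frac_mem_carrier S(2))
qed

end

section \<open>Tensor products as fibres of a bilinear map\<close>

text \<open>
  A bilinear map \<open>\<beta>\<close> that is known to realize the tensor product replaces the classes of formal sums by
  fibres: if two formal sums with the same value are always equivalent, the class of a formal sum is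
  the set of all formal sums with its value.
\<close>

definition tensor_sum :: "('t, 'x) ring_scheme => ('m => 'n => 't) => ('m \<times> 'n) list => 't" where
 "tensor_sum T \<beta> xs = foldr (\<lambda>(m, n) t. \<beta> m n \<oplus>$T t) xs \<zero>$T"

locale balanced_map =
 M: left_module R M + N: left_module R N + T: abelian_group T
 for R :: "('r, 's) ring_scheme" and M :: "('r, 'm) module" and N :: "('r, 'n) module"
  and T :: "('t, 'x) ring_scheme" +
 fixes \<beta> :: "'m => 'n => 't"
 assumes closed: "[|m :. M; n :. N|] ==> \<beta> m n :. T"
  and add_left: "[|m :. M; m' :. M; n :. N|] ==> \<beta> (m \<oplus>$M m') n = \<beta> m n \<oplus>$T \<beta> m' n"
  and add_right: "[|m :. M; n :. N; n' :. N|] ==> \<beta> m (n \<oplus>$N n') = \<beta> m n \<oplus>$T \<beta> m n'"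
  and balanced: "[|r :. R; m :. M; n :. N|] ==> \<beta> (r \<odot>$M m) n = \<beta> m (r \<odot>$N n)"
begin

abbreviation "words \<equiv> {xs. set xs \<subseteq> carrier M \<times> carrier N}"

lemma sum_Nil [simp]: "tensor_sum T \<beta> [] = \<zero>$T"
 and sum_Cons [simp]: "tensor_sum T \<beta> ((m, n) # xs) = \<beta> m n \<oplus>$T tensor_sum T \<beta> xs"
 by (simp_all add: tensor_sum_def)

lemma sum_closed: "xs \<in> words ==> tensor_sum T \<beta> xs :. T"
 by (induct xs) (auto simp: closed)

lemma sum_append:
 "[|xs \<in> words; ys \<in> words|] ==> tensor_sum T \<beta> (xs @ ys) = tensor_sum T \<beta> xs \<oplus>$T tensor_sum T \<beta> ys"
proof (induct xs)
 case (Cons p xs)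
 obtain m n where "p = (m, n)" by (cases p)
 with Cons show ?case using sum_closed[of xs] sum_closed[of ys] by (simp add: closed T.a_assoc)
qed (simp add: sum_closed)

lemma zero_left: "n :. N ==> \<beta> \<zero>$M n = \<zero>$T"
 using add_left[of "\<zero>$M" "\<zero>$M" n] closed[of "\<zero>$M" n] by simp

lemma rel_sum:
 "(xs, ys) \<in> tensor_rel R M N ==> xs \<in> words & ys \<in> words & tensor_sum T \<beta> xs = tensor_sum T \<beta> ys"
proof (induct rule: tensor_rel.induct)
 case (append xs ys us vs)
 then show ?case by (auto simp: sum_append)
next
 case (comm xs ys)
 then show ?case using sum_closed[of xs] sum_closed[of ys] by (auto simp: sum_append T.a_comm)
qed (auto simp: closed add_left add_right balanced zero_left)

lemma rel_zero_right: "m :. M ==> ([(m, \<zero>$N)], []) \<in> tensor_rel R M N"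
proof -
 assume m: "m :. M"
 have "([(\<zero>$R \<odot>$M m, \<zero>$N)], [(m, \<zero>$R \<odot>$N \<zero>$N)]) \<in> tensor_rel R M N"
  by (rule tensor_rel.balanced) (use m in auto)
 then have "([(\<zero>$M, \<zero>$N)], [(m, \<zero>$N)]) \<in> tensor_rel R M N" using m by (simp add: M.smult_zeros N.smult_zeros)
 moreover have "([(\<zero>$M, \<zero>$N)], []) \<in> tensor_rel R M N" by (rule tensor_rel.zero) simp
 ultimately show ?thesis by (rule tensor_rel.trans[OF tensor_rel.sym])
qed

end

text \<open>
  The computation behind both products defined by \<open>tensor_lift2\<close>: multiplying formal sums term by term
  amounts to applying the additive maps \<open>h m n\<close> to the value of the second one.
\<close>

lemma (in balanced_map) sum_lift2:
 assumes T2: "abelian_group T2"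
  and \<beta>2: "!!m' n'. (m', n') \<in> set ys ==> \<beta>2 m' n' :. T2"
  and fg: "!!m n m' n'. (m, n) \<in> set xs ==> (m', n') \<in> set ys ==>
   f m m' :. M & g n n' :. N & \<beta> (f m m') (g n n') = h m n (\<beta>2 m' n')"
  and h: "!!m n t. (m, n) \<in> set xs ==> t :. T2 ==> h m n t :. T"
   "!!m n t t'. (m, n) \<in> set xs ==> t :. T2 ==> t' :. T2 ==>
    h m n (t \<oplus>$T2 t') = h m n t \<oplus>$T h m n t'"
 shows "[(f m m', g n n'). (m, n) \<leftarrow> xs, (m', n') \<leftarrow> ys] \<in> words &
  tensor_sum T \<beta> [(f m m', g n n'). (m, n) \<leftarrow> xs, (m', n') \<leftarrow> ys] =
   tensor_sum T (%m n. h m n (tensor_sum T2 \<beta>2 ys)) xs"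
 using fg h
proof (induct xs)
 case Nil
 show ?case by (simp add: tensor_sum_def)
next
 case (Cons p xs)
 obtain m n where p: "p = (m, n)" by (cases p)
 interpret T2: abelian_group T2 by fact
 have h0: "h m n \<zero>$T2 = \<zero>$T"
  using Cons(4)[of m n "\<zero>$T2" "\<zero>$T2"] Cons(3)[of m n "\<zero>$T2"] by (simp add: p)
 have inner: "[(f m m', g n n'). (m', n') \<leftarrow> zs] \<in> words & tensor_sum T2 \<beta>2 zs :. T2 &
   tensor_sum T \<beta> [(f m m', g n n'). (m', n') \<leftarrow> zs] = h m n (tensor_sum T2 \<beta>2 zs)"
  if "set zs \<subseteq> set ys" for zs
  using that
 proof (induct zs)
  case Nil then show ?case by (simp add: tensor_sum_def h0)
 next
  case (Cons q zs)
  obtain m' n' where q: "q = (m', n')" by (cases q)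
  have mem: "(m', n') \<in> set ys" using Cons(2) q by auto
  note fgq = \<open>!!m n m' n'. (m, n) \<in> set (p # xs) ==> (m', n') \<in> set ys ==>
   f m m' :. M & g n n' :. N & \<beta> (f m m') (g n n') = h m n (\<beta>2 m' n')\<close>[of m n, OF _ mem]
  have "h m n (\<beta>2 m' n' \<oplus>$T2 tensor_sum T2 \<beta>2 zs) = h m n (\<beta>2 m' n') \<oplus>$T h m n (tensor_sum T2 \<beta>2 zs)"
   using \<open>!!m n t t'. (m, n) \<in> set (p # xs) ==> t :. T2 ==> t' :. T2 ==>
    h m n (t \<oplus>$T2 t') = h m n t \<oplus>$T h m n t'\<close>[of m n] \<beta>2[OF mem] Cons p by auto
  then show ?case using Cons fgq \<beta>2[OF mem] p by (auto simp: q tensor_sum_def)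
 qed
 have IH: "[(f m m', g n n'). (m, n) \<leftarrow> xs, (m', n') \<leftarrow> ys] \<in> words &
  tensor_sum T \<beta> [(f m m', g n n'). (m, n) \<leftarrow> xs, (m', n') \<leftarrow> ys] =
   tensor_sum T (%m n. h m n (tensor_sum T2 \<beta>2 ys)) xs"
  by (rule Cons(1)) (use Cons(2-4) in auto)
 then show ?case
  using inner[OF subset_refl] sum_append[of "[(f m m', g n n'). (m', n') \<leftarrow> ys]"
    "[(f m m', g n n'). (m, n) \<leftarrow> xs, (m', n') \<leftarrow> ys]"]
  by (simp add: p tensor_sum_def)
qed

locale separating_balanced_map = balanced_map +
 assumes separating: "[|xs \<in> words; ys \<in> words; tensor_sum T \<beta> xs = tensor_sum T \<beta> ys|] ==> (xs, ys) \<in> tensor_rel R M N"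
begin

definition fibre where
 "fibre t = {xs \<in> words. tensor_sum T \<beta> xs = t}"

lemma class_eq_fibre:
 assumes "xs \<in> words"
 shows "tensor_class R M N xs = fibre (tensor_sum T \<beta> xs)"
proof -
 have "(xs, ys) \<in> tensor_rel R M N \<longleftrightarrow> ys \<in> words & tensor_sum T \<beta> ys = tensor_sum T \<beta> xs" for ys
  using rel_sum[of xs ys] separating[OF assms, of ys] by auto
 then show ?thesis by (auto simp only: tensor_class_def fibre_def Image_singleton_iff)
qed

lemma carrier_eq_fibres: "tensor_carrier R M N = (%xs. fibre (tensor_sum T \<beta> xs)) ` words"
proof -
 have "tensor_carrier R M N = tensor_class R M N ` words"
  by (auto simp: tensor_carrier_def quotient_def tensor_class_def)
 also have "... = (%xs. fibre (tensor_sum T \<beta> xs)) ` words"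
  by (rule image_cong[OF HOL.refl class_eq_fibre])
 finally show ?thesis .
qed

lemma Union_fibres:
 assumes "S ~= {}" "U ~= {}"
  and "!!xs ys. xs \<in> S ==> ys \<in> U ==> f xs ys \<in> words & tensor_sum T \<beta> (f xs ys) = t"
 shows "(\<Union>xs\<in>S. \<Union>ys\<in>U. tensor_class R M N (f xs ys)) = fibre t"
proof -
 have "tensor_class R M N (f xs ys) = fibre t" if "xs \<in> S" "ys \<in> U" for xs ys
  using assms(3)[OF that] class_eq_fibre by simp
 then show ?thesis using assms(1,2) by auto
qed

lemma add_fibres:
 assumes "fibre s ~= {}" "fibre t ~= {}"
 shows "tensor_add R M N (fibre s) (fibre t) = fibre (s \<oplus>$T t)"
 unfolding tensor_add_def by (rule Union_fibres[OF assms]) (auto simp: fibre_def sum_append)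

lemma lift2_fibres:
 assumes "S ~= {}" "U ~= {}"
  and "!!xs ys. xs \<in> S ==> ys \<in> U ==> [(f m m', g n n'). (m, n) \<leftarrow> xs, (m', n') \<leftarrow> ys] \<in> words &
   tensor_sum T \<beta> [(f m m', g n n'). (m, n) \<leftarrow> xs, (m', n') \<leftarrow> ys] = t"
 shows "tensor_lift2 R M N f g S U = fibre t"
 unfolding tensor_lift2_def by (rule Union_fibres[OF assms])

lemma fibre_inj: "fibre s = fibre t ==> fibre s ~= {} ==> s = t"
 by (auto simp: fibre_def)

end

section \<open>Localizing an algebra and a module at a rational point of the centre\<close>

lemma center_simps:
 "carrier (center_algebra A) = {z \<in> carrier A. \<forall>a\<in>carrier A. z \<otimes>$A a = a \<otimes>$A z}"
 "monoid.mult (center_algebra A) = monoid.mult A" "add (center_algebra A) = add A"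
 "\<one>$(center_algebra A) = \<one>$A" "\<zero>$(center_algebra A) = \<zero>$A" "smult (center_algebra A) = smult A"
 by (simp_all add: center_algebra_def)

lemma cring_center_algebra:
 assumes "ring A"
 shows "cring (center_algebra A)"
proof -
 interpret ring A by fact
 let ?C = "center_algebra A"
 have C: "z :. ?C \<longleftrightarrow> z :. A & (\<forall>a\<in>carrier A. z \<otimes>$A a = a \<otimes>$A z)" for z
  by (simp only: center_simps mem_Collect_eq)
 have Cc: "z :. A" if "z :. ?C" for z using that C by blast
 have comm: "z \<otimes>$A a = a \<otimes>$A z" if "z :. ?C" "a :. A" for z a using that C by blast
 have CI: "z :. ?C" if "z :. A" "!!a. a :. A ==> z \<otimes>$A a = a \<otimes>$A z" for z using that C by blast
 have neg: "\<ominus>$A z :. ?C" if "z :. ?C" for z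
  by (rule CI) (simp_all add: Cc[OF that] l_minus r_minus comm[OF that])
 have add: "z \<oplus>$A w :. ?C" if "z :. ?C" "w :. ?C" for z w
  by (rule CI) (simp_all only: l_distr r_distr Cc[OF that(1)] Cc[OF that(2)] comm[OF that(1)] comm[OF that(2)] a_closed)
 have mult: "z \<otimes>$A w :. ?C" if z: "z :. ?C" and w: "w :. ?C" for z w
 proof (rule CI)
  fix a assume a: "a :. A"
  have "(z \<otimes>$A w) \<otimes>$A a = (z \<otimes>$A a) \<otimes>$A w"
   using m_assoc[OF Cc[OF z] Cc[OF w] a] m_assoc[OF Cc[OF z] a Cc[OF w]] comm[OF w a] by argo
  then show "(z \<otimes>$A w) \<otimes>$A a = a \<otimes>$A (z \<otimes>$A w)"
   using comm[OF z a] m_assoc[OF a Cc[OF z] Cc[OF w]] by argo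
 qed (simp add: Cc z w)
 have one: "\<one>$A :. ?C" "\<zero>$A :. ?C" by (auto intro: CI)
 show ?thesis
 proof (intro cringI abelian_groupI comm_monoidI; unfold center_simps(2-5))
  show "\<exists>y\<in>carrier ?C. y \<oplus>$A x = \<zero>$A" if "x :. ?C" for x
   using that neg Cc l_neg by blast
  show "x \<otimes>$A y = y \<otimes>$A x" if "x :. ?C" "y :. ?C" for x y
   using comm[OF that(1) Cc[OF that(2)]] .
 qed (simp_all add: add mult one Cc a_ac m_assoc l_distr)
qed

text \<open>
  A \<open>k\<close>-rational point \<open>\<chi>\<close> of the centre with kernel \<open>\<mm>\<close>, and a module on which the centre acts through
  \<open>\<chi>\<close>. The elements outside \<open>\<mm>\<close> are regular on \<open>A\<close>, so that localization is injective.
\<close>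

locale residue_point =
 k: field k + A: ring A
 for k :: "('k, 's) ring_scheme" and A :: "('k, 'a) module" +
 fixes \<mm> :: "'a set" and \<chi> :: "'a => 'k" and V :: "('a, 'm) module"
 assumes scalar_hom: "(%c. c \<odot>$A \<one>$A) \<in> ring_hom k A"
  and scalar_mult: "[|c :. k; a :. A|] ==> c \<odot>$A a = (c \<odot>$A \<one>$A) \<otimes>$A a"
  and scalar_central: "[|c :. k; a :. A|] ==> (c \<odot>$A \<one>$A) \<otimes>$A a = a \<otimes>$A (c \<odot>$A \<one>$A)"
  and \<chi>_hom: "\<chi> \<in> ring_hom (center_algebra A) k"
  and \<chi>_scalar: "c :. k ==> \<chi> (c \<odot>$A \<one>$A) = c"
  and \<mm>_eq: "\<mm> = {z \<in> carrier (center_algebra A). \<chi> z = \<zero>$k}"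
  and regular: "[|z :. (center_algebra A); z \<notin> \<mm>; a :. A; z \<otimes>$A a = \<zero>$A|] ==> a = \<zero>$A"
  and V_module: "left_module A V"
  and V_\<chi>: "[|z :. (center_algebra A); v :. V|] ==> z \<odot>$V v = (\<chi> z \<odot>$A \<one>$A) \<odot>$V v"
begin

abbreviation Z where "Z \<equiv> center_algebra A"
definition T where "T = carrier Z - \<mm>"
abbreviation L where "L \<equiv> localization A T"
abbreviation Zm where "Zm \<equiv> center_loc A \<mm>"

sublocale Z: cring Z by (rule cring_center_algebra[OF A.ring_axioms])

sublocale V: left_module A V by (rule V_module)

lemma Zc [simp]: "z :. Z ==> z :. A"
 and Z_comm: "z :. Z ==> a :. A ==> z \<otimes>$A a = a \<otimes>$A z"
 by (auto simp: center_simps)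

lemma T_iff: "t \<in> T \<longleftrightarrow> t :. Z & \<chi> t ~= \<zero>$k"
 unfolding T_def by (subst \<mm>_eq) blast

lemma one_T [simp]: "\<one>$A \<in> T"
 using Z.one_closed ring_hom_one[OF \<chi>_hom] k.one_not_zero unfolding T_iff by (simp add: center_simps(2-6))

lemma mult_T: "s \<in> T ==> t \<in> T ==> s \<otimes>$A t \<in> T"
 using Z.m_closed[of s t] ring_hom_mult[OF \<chi>_hom, of s t] ring_hom_closed[OF \<chi>_hom] k.integral
 unfolding T_iff by (fastforce simp: center_simps(2))

sublocale LA: central_denominators A T
proof
 show "s \<otimes>$A t \<in> T" if "s \<in> T" "t \<in> T" for s t using that by (rule mult_T)
 show "a = \<zero>$A" if "s \<in> T" "a :. A" "s \<otimes>$A a = \<zero>$A" for s a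
  using regular[OF _ _ that(2,3)] that(1) unfolding T_def by blast
 show "s \<otimes>$A a = a \<otimes>$A s" if "s \<in> T" "a :. A" for s a
  using Z_comm[OF _ that(2)] that(1) unfolding T_def by blast
 show "T \<subseteq> carrier A" using Zc unfolding T_def by blast
qed (rule one_T)

sublocale LZ: central_denominators Z T
proof
 show "s \<otimes>$Z t \<in> T" if "s \<in> T" "t \<in> T" for s t using mult_T[OF that] by (simp add: center_simps(2))
 show "\<one>$Z \<in> T" by (simp add: center_simps(4))
 show "s \<otimes>$Z a = a \<otimes>$Z s" if "s \<in> T" "a :. Z" for s a using that unfolding T_def by (intro Z.m_comm) simp_all
 show "a = \<zero>$Z" if "s \<in> T" "a :. Z" "s \<otimes>$Z a = \<zero>$Z" for s a
  unfolding center_simps(5) by (rule regular[of s a]) (use that in \<open>simp_all add: T_def center_simps(2,5)\<close>)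
qed (auto simp: T_def)

lemma Zm_def: "Zm = localization Z T"
 by (simp add: center_loc_def T_def)

sublocale L: ring L by (rule LA.ring_localization)

sublocale Zm: ring Zm unfolding Zm_def by (rule LZ.ring_localization)

abbreviation fz where "fz \<equiv> loc_frac Z T"
abbreviation fa where "fa \<equiv> loc_frac A T"

lemma Zm_cases:
 assumes "w :. Zm"
 obtains z s where "z :. Z" "s \<in> T" "w = fz z s"
 using assms unfolding Zm_def by (rule LZ.loc_cases)

lemma fz_closed: "z :. Z ==> s \<in> T ==> fz z s :. Zm"
 unfolding Zm_def by (rule LZ.frac_mem_carrier)

lemma fz_eq: "[|z :. Z; s \<in> T; w :. Z; t \<in> T|] ==> fz z s = fz w t \<longleftrightarrow> t \<otimes>$A z = s \<otimes>$A w"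
 using LZ.frac_eq_iff[of z s w t] by (simp add: center_simps(2))

lemma fz_mult: "[|z :. Z; s \<in> T; w :. Z; t \<in> T|] ==> fz z s \<otimes>$Zm fz w t = fz (z \<otimes>$A w) (s \<otimes>$A t)"
 using LZ.loc_mult[of z s w t] by (simp add: Zm_def center_simps(2))

lemma fz_add: "[|z :. Z; s \<in> T; w :. Z; t \<in> T|] ==>
  fz z s \<oplus>$Zm fz w t = fz ((t \<otimes>$A z) \<oplus>$A (s \<otimes>$A w)) (s \<otimes>$A t)"
 using LZ.loc_add[of z s w t] by (simp add: Zm_def center_simps(2,3))

lemma fz_one: "\<one>$Zm = fz \<one>$A \<one>$A" and fz_zero: "\<zero>$Zm = fz \<zero>$A \<one>$A"
 using LZ.loc_one LZ.loc_zero by (simp_all add: Zm_def center_simps(4,5))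

lemma Z_ops:
 "\<one>$A :. Z" "\<zero>$A :. Z"
 "[|z :. Z; w :. Z|] ==> z \<otimes>$A w :. Z"
 "[|z :. Z; w :. Z|] ==> z \<oplus>$A w :. Z"
 using Z.one_closed Z.zero_closed Z.m_closed[of z w] Z.a_closed[of z w]
 by (simp_all add: center_simps(2-5))

lemma T_Z [simp]: "t \<in> T ==> t :. Z" by (simp add: T_def)

lemma T_A [simp]: "t \<in> T ==> t :. A" by simp

lemma \<chi>_simps:
 "z :. Z ==> \<chi> z :. k"
 "[|z :. Z; w :. Z|] ==> \<chi> (z \<otimes>$A w) = \<chi> z \<otimes>$k \<chi> w"
 "[|z :. Z; w :. Z|] ==> \<chi> (z \<oplus>$A w) = \<chi> z \<oplus>$k \<chi> w"
 "\<chi> \<one>$A = \<one>$k"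
 using ring_hom_closed[OF \<chi>_hom] ring_hom_mult[OF \<chi>_hom, of z w] ring_hom_add[OF \<chi>_hom, of z w]
  ring_hom_one[OF \<chi>_hom] by (simp_all add: center_simps(2-5))

lemma \<chi>_inv: "t \<in> T ==> inv\<^bsub>k\<^esub> (\<chi> t) :. k & inv\<^bsub>k\<^esub> (\<chi> t) \<otimes>$k \<chi> t = \<one>$k & \<chi> t \<otimes>$k inv\<^bsub>k\<^esub> (\<chi> t) = \<one>$k"
 using k.field_Units \<chi>_simps(1)[of t] unfolding T_iff by auto

text \<open>
  The residue map \<open>Z\<^sub>\<mm> \<rightarrow> k\<close> and the inclusion of \<open>Z\<^sub>\<mm>\<close> in the fractions of \<open>A\<close>, defined by a chosen
  representing fraction. They do not depend on the choice.
\<close>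

definition \<rho> :: "('a \<times> 'a) set => 'k" where
 "\<rho> w = (let p = SOME p. p \<in> w in \<chi> (fst p) \<otimes>$k inv\<^bsub>k\<^esub> (\<chi> (snd p)))"

definition \<iota>Z :: "('a \<times> 'a) set => ('a \<times> 'a) set" where
 "\<iota>Z w = (let p = SOME p. p \<in> w in fa (fst p) (snd p))"

lemma some_fz:
 assumes "z :. Z" "s \<in> T"
 shows "\<exists>z' s'. (SOME p. p \<in> fz z s) = (z', s') & z' :. Z & s' \<in> T & s' \<otimes>$A z = s \<otimes>$A z'"
proof -
 have "(z, s) \<in> fz z s" using assms by (simp add: LZ.frac_mem)
 then have "(SOME p. p \<in> fz z s) \<in> fz z s" by (rule someI[of "%p. p \<in> fz z s"])
 then show ?thesis using LZ.frac_mem[of "fst (SOME p. p \<in> fz z s)" "snd (SOME p. p \<in> fz z s)" z s]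
  by (intro exI[of _ "fst (SOME p. p \<in> fz z s)"] exI[of _ "snd (SOME p. p \<in> fz z s)"])
   (simp add: center_simps(2))
qed

lemma \<rho>_fz:
 assumes "z :. Z" "s \<in> T"
 shows "\<rho> (fz z s) = \<chi> z \<otimes>$k inv\<^bsub>k\<^esub> (\<chi> s)"
proof -
 obtain z' s' where p: "(SOME p. p \<in> fz z s) = (z', s')" "z' :. Z" "s' \<in> T" "s' \<otimes>$A z = s \<otimes>$A z'"
  using some_fz[OF assms] by blast
 have e: "\<chi> s' \<otimes>$k \<chi> z = \<chi> s \<otimes>$k \<chi> z'"
  using arg_cong[OF p(4), of \<chi>] p(2) assms(1) T_Z[OF assms(2)] T_Z[OF p(3)] by (simp add: \<chi>_simps)
 note i = \<chi>_inv[OF assms(2)] \<chi>_inv[OF p(3)]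
 have c: "\<chi> s' :. k" "\<chi> s :. k" "\<chi> z :. k" "\<chi> z' :. k"
  using p assms T_Z \<chi>_simps(1) by auto
 have "\<chi> z' \<otimes>$k inv\<^bsub>k\<^esub> (\<chi> s') = (inv\<^bsub>k\<^esub> (\<chi> s) \<otimes>$k \<chi> s) \<otimes>$k (\<chi> z' \<otimes>$k inv\<^bsub>k\<^esub> (\<chi> s'))"
  using i c by simp
 also have "... = inv\<^bsub>k\<^esub> (\<chi> s) \<otimes>$k (\<chi> s \<otimes>$k \<chi> z') \<otimes>$k inv\<^bsub>k\<^esub> (\<chi> s')"
  using conjunct1[OF i(1)] conjunct1[OF i(2)] c by (simp add: k.m_assoc)
 also have "... = inv\<^bsub>k\<^esub> (\<chi> s) \<otimes>$k \<chi> z \<otimes>$k (\<chi> s' \<otimes>$k inv\<^bsub>k\<^esub> (\<chi> s'))"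
  unfolding e[symmetric] using conjunct1[OF i(1)] conjunct1[OF i(2)] c by (simp add: k.m_ac)
 also have "... = \<chi> z \<otimes>$k inv\<^bsub>k\<^esub> (\<chi> s)"
  using i c by (simp add: k.m_comm)
 finally show ?thesis by (simp add: \<rho>_def p(1))
qed

lemma \<iota>Z_fz:
 assumes "z :. Z" "s \<in> T"
 shows "\<iota>Z (fz z s) = fa z s"
proof -
 obtain z' s' where p: "(SOME p. p \<in> fz z s) = (z', s')" "z' :. Z" "s' \<in> T" "s' \<otimes>$A z = s \<otimes>$A z'"
  using some_fz[OF assms] by blast
 have "fa z' s' = fa z s"
  using LA.frac_eq_iff[of z' s' z s] p assms Zc by simp
 then show ?thesis by (simp add: \<iota>Z_def p(1))
qed

lemma \<rho>_closed: "w :. Zm ==> \<rho> w :. k"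
 by (erule Zm_cases) (use \<chi>_inv \<chi>_simps(1) in \<open>simp add: \<rho>_fz\<close>)

lemma inv_mult: "s \<in> T ==> t \<in> T ==> inv\<^bsub>k\<^esub> (\<chi> s \<otimes>$k \<chi> t) = inv\<^bsub>k\<^esub> (\<chi> s) \<otimes>$k inv\<^bsub>k\<^esub> (\<chi> t)"
proof -
 assume st: "s \<in> T" "t \<in> T"
 note i = \<chi>_inv[OF st(1)] \<chi>_inv[OF st(2)]
 have c: "\<chi> s :. k" "\<chi> t :. k" using st T_Z \<chi>_simps(1) by auto
 have "(\<chi> s \<otimes>$k \<chi> t) \<otimes>$k (inv\<^bsub>k\<^esub> (\<chi> s) \<otimes>$k inv\<^bsub>k\<^esub> (\<chi> t)) =
   (\<chi> s \<otimes>$k inv\<^bsub>k\<^esub> (\<chi> s)) \<otimes>$k (\<chi> t \<otimes>$k inv\<^bsub>k\<^esub> (\<chi> t))"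
  using conjunct1[OF i(1)] conjunct1[OF i(2)] c st T_Z by (simp add: \<chi>_simps k.m_ac)
 also have "... = \<one>$k" using i by simp
 finally show ?thesis
  using k.comm_inv_char[of "\<chi> s \<otimes>$k \<chi> t" "inv\<^bsub>k\<^esub> (\<chi> s) \<otimes>$k inv\<^bsub>k\<^esub> (\<chi> t)"] i c st T_Z
  by (simp add: \<chi>_simps Z_ops)
qed

lemma \<rho>_hom: "\<rho> \<in> ring_hom Zm k"
proof (rule ring_hom_memI)
 show "\<rho> w :. k" if "w :. Zm" for w using that by (rule \<rho>_closed)
 fix x y assume "x :. Zm" "y :. Zm"
 then obtain z s w t where x: "z :. Z" "s \<in> T" "x = fz z s" and y: "w :. Z" "t \<in> T" "y = fz w t"
  by (meson Zm_cases)
 note i = \<chi>_inv[OF x(2)] \<chi>_inv[OF y(2)]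
 have c: "\<chi> s :. k" "\<chi> t :. k" "\<chi> z :. k" "\<chi> w :. k" using x y T_Z \<chi>_simps(1) by auto
 show "\<rho> (x \<otimes>$Zm y) = \<rho> x \<otimes>$k \<rho> y"
  using x(1,2) y(1,2) conjunct1[OF i(1)] conjunct1[OF i(2)] c
  by (simp add: x(3) y(3) fz_mult \<rho>_fz Z_ops mult_T inv_mult \<chi>_simps k.m_ac)
 have "(\<chi> t \<otimes>$k \<chi> z) \<otimes>$k (inv\<^bsub>k\<^esub> (\<chi> s) \<otimes>$k inv\<^bsub>k\<^esub> (\<chi> t)) = (\<chi> z \<otimes>$k inv\<^bsub>k\<^esub> (\<chi> s)) \<otimes>$k (\<chi> t \<otimes>$k inv\<^bsub>k\<^esub> (\<chi> t))"
  "(\<chi> s \<otimes>$k \<chi> w) \<otimes>$k (inv\<^bsub>k\<^esub> (\<chi> s) \<otimes>$k inv\<^bsub>k\<^esub> (\<chi> t)) = (\<chi> w \<otimes>$k inv\<^bsub>k\<^esub> (\<chi> t)) \<otimes>$k (\<chi> s \<otimes>$k inv\<^bsub>k\<^esub> (\<chi> s))"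
  using conjunct1[OF i(1)] conjunct1[OF i(2)] c by (simp_all add: k.m_ac)
 then show "\<rho> (x \<oplus>$Zm y) = \<rho> x \<oplus>$k \<rho> y"
  using x(1,2) y(1,2) i c
  by (simp add: x(3) y(3) fz_add \<rho>_fz Z_ops T_Z mult_T inv_mult \<chi>_simps k.l_distr)
next
 show "\<rho> \<one>$Zm = \<one>$k" using one_T Z_ops(1) by (simp add: fz_one \<rho>_fz \<chi>_simps)
qed

lemma \<iota>Z_hom: "\<iota>Z \<in> ring_hom Zm L"
proof (rule ring_hom_memI)
 show "\<iota>Z w :. L" if "w :. Zm" for w
  using that by (rule Zm_cases) (use Zc LA.frac_mem_carrier in \<open>simp add: \<iota>Z_fz\<close>)
 fix x y assume "x :. Zm" "y :. Zm"
 then obtain z s w t where x: "z :. Z" "s \<in> T" "x = fz z s" and y: "w :. Z" "t \<in> T" "y = fz w t"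
  by (meson Zm_cases)
 show "\<iota>Z (x \<otimes>$Zm y) = \<iota>Z x \<otimes>$L \<iota>Z y"
  using x(1,2) y(1,2) Zc by (simp add: x(3) y(3) fz_mult \<iota>Z_fz Z_ops mult_T LA.loc_mult)
 show "\<iota>Z (x \<oplus>$Zm y) = \<iota>Z x \<oplus>$L \<iota>Z y"
  using x(1,2) y(1,2) Zc by (simp add: x(3) y(3) fz_add \<iota>Z_fz Z_ops T_Z mult_T LA.loc_add)
next
 show "\<iota>Z \<one>$Zm = \<one>$L" using one_T Z_ops(1) by (simp add: fz_one \<iota>Z_fz LA.loc_one)
qed

lemma \<iota>Z_central:
 assumes "w :. Zm" "x :. L"
 shows "\<iota>Z w \<otimes>$L x = x \<otimes>$L \<iota>Z w"
proof -
 obtain z s where w: "z :. Z" "s \<in> T" "w = fz z s" using assms(1) by (rule Zm_cases)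
 obtain a t where x: "a :. A" "t \<in> T" "x = fa a t" using assms(2) by (rule LA.loc_cases)
 show ?thesis using w(1,2) x(1,2) Zc Z_comm[of z a] Z_comm[of s t] T_A
  by (simp add: w(3) x(3) \<iota>Z_fz LA.loc_mult)
qed

section \<open>The localized algebra\<close>

abbreviation CZ where "CZ \<equiv> center_loc_Z A \<mm>"
abbreviation AZ where "AZ \<equiv> algebra_Z A"

lemma fz_hom: "(%z. fz z \<one>$A) \<in> ring_hom Z Zm"
proof (rule ring_hom_memI)
 fix x y assume xy: "x :. Z" "y :. Z"
 then show "fz (x \<otimes>$Z y) \<one>$A = fz x \<one>$A \<otimes>$Zm fz y \<one>$A" "fz (x \<oplus>$Z y) \<one>$A = fz x \<one>$A \<oplus>$Zm fz y \<one>$A"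
  by (simp_all add: fz_mult fz_add center_simps(2,3))
qed (use one_T in \<open>simp_all add: fz_closed fz_one center_simps(4)\<close>)

lemma CZ_module: "left_module Z CZ"
 unfolding center_loc_Z_def T_def[symmetric] by (rule left_module_ring_as_module[OF Z.ring_axioms Zm.ring_axioms fz_hom])

lemma AZ_module: "left_module Z AZ"
 unfolding algebra_Z_def
 by (rule left_module_ring_as_module[OF Z.ring_axioms A.ring_axioms])
  (rule ring_hom_memI, simp_all add: center_simps(2-4))

lemma CZ_simps: "carrier CZ = carrier Zm" "add CZ = add Zm" "\<zero>$CZ = \<zero>$Zm" "monoid.mult CZ = monoid.mult Zm"
  "\<one>$CZ = \<one>$Zm" "smult CZ z w = fz z \<one>$A \<otimes>$Zm w"
 and AZ_simps: "carrier AZ = carrier A" "add AZ = add A" "\<zero>$AZ = \<zero>$A" "monoid.mult AZ = monoid.mult A"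
  "\<one>$AZ = \<one>$A" "smult AZ z a = z \<otimes>$A a"
 by (simp_all add: center_loc_Z_def algebra_Z_def ring_as_module_def T_def)

definition \<beta>A :: "('a \<times> 'a) set => 'a => ('a \<times> 'a) set" where
 "\<beta>A w a = \<iota>Z w \<otimes>$L fa a \<one>$A"

lemma \<beta>A_fz: "[|z :. Z; s \<in> T; a :. A|] ==> \<beta>A (fz z s) a = fa (z \<otimes>$A a) s"
 by (simp add: \<beta>A_def \<iota>Z_fz LA.loc_mult)

lemma fa1: "a :. A ==> fa a \<one>$A :. L"
 "[|a :. A; b :. A|] ==> fa (a \<oplus>$A b) \<one>$A = fa a \<one>$A \<oplus>$L fa b \<one>$A"
 "[|a :. A; b :. A|] ==> fa (a \<otimes>$A b) \<one>$A = fa a \<one>$A \<otimes>$L fa b \<one>$A"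
 by (simp_all add: LA.frac_mem_carrier LA.loc_add LA.loc_mult)

lemmas \<iota>Zh = ring_hom_closed[OF \<iota>Z_hom] ring_hom_mult[OF \<iota>Z_hom] ring_hom_add[OF \<iota>Z_hom]

sublocale BA: balanced_map Z CZ AZ L \<beta>A
proof (intro balanced_map.intro balanced_map_axioms.intro CZ_module AZ_module L.abelian_group_axioms)
 fix r m n assume r: "r :. Z" and m: "m :. CZ" and n: "n :. AZ"
 obtain z s where zs: "z :. Z" "s \<in> T" "m = fz z s"
  using m unfolding CZ_simps by (rule Zm_cases)
 have "r \<otimes>$A z \<otimes>$A n = z \<otimes>$A (r \<otimes>$A n)"
  using r n zs(1) Z_comm[of r z] A.m_assoc[of z r n] by (simp add: AZ_simps)
 then show "\<beta>A (r \<odot>$CZ m) n = \<beta>A m (r \<odot>$AZ n)"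
  using r n zs(1,2) by (simp add: zs(3) CZ_simps AZ_simps fz_mult \<beta>A_fz Z_ops)
qed (simp_all add: CZ_simps AZ_simps \<beta>A_def \<iota>Zh fa1 L.l_distr L.r_distr)

text \<open>
  Over a common denominator, every element of \<open>Z\<^sub>\<mm> \<otimes>\<^sub>Z A\<close> is a single fraction \<open>1/s \<otimes> a\<close>. Therefore
  \<open>z/s \<otimes> a \<mapsto> (z a)/s\<close> separates classes, and \<open>A\<^sub>\<mm>\<close> is the ring of fractions of \<open>A\<close>.
\<close>

lemma word_normal_form:
 assumes "xs \<in> BA.words"
 shows "\<exists>s\<in>T. \<exists>a\<in>carrier A. (xs, [(fz \<one>$A s, a)]) \<in> tensor_rel Z CZ AZ"
 using assms
proof (induct xs)
 case Nil
 have "([(fz \<one>$A \<one>$A, \<zero>$AZ)], []) \<in> tensor_rel Z CZ AZ"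
  by (rule BA.rel_zero_right) (simp add: CZ_simps fz_closed Z_ops one_T)
 then show ?case by (intro bexI[of _ "\<one>$A"] bexI[of _ "\<zero>$A"]) (auto simp: AZ_simps intro: tensor_rel.sym)
next
 case (Cons p xs)
 have expand: "([(fz z (s \<otimes>$A t), a)], [(fz \<one>$A (s \<otimes>$A t), z \<otimes>$A a)]) \<in> tensor_rel Z CZ AZ"
  if "z :. Z" "s \<in> T" "t \<in> T" "a :. A" for z s t a
 proof -
  have "([(z \<odot>$CZ fz \<one>$A (s \<otimes>$A t), a)], [(fz \<one>$A (s \<otimes>$A t), z \<odot>$AZ a)]) \<in> tensor_rel Z CZ AZ"
   by (rule tensor_rel.balanced) (use that in \<open>simp_all add: CZ_simps AZ_simps fz_closed Z_ops mult_T\<close>)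
  then show ?thesis using that one_T mult_T[OF that(2,3)] by (simp add: CZ_simps AZ_simps fz_mult Z_ops)
 qed
 obtain w a where p: "p = (w, a)" by (cases p)
 then have wa: "w :. Zm" "a :. A" and xs: "xs \<in> BA.words"
  using Cons(2) by (auto simp: CZ_simps AZ_simps)
 obtain z s where w: "z :. Z" "s \<in> T" "w = fz z s" using wa(1) by (rule Zm_cases)
 obtain t b where t: "t \<in> T" and b: "b :. A" and rel: "(xs, [(fz \<one>$A t, b)]) \<in> tensor_rel Z CZ AZ"
  using Cons(1)[OF xs] by blast
 let ?u = "s \<otimes>$A t"
 have u: "?u \<in> T" by (rule mult_T[OF w(2) t])
 have e1: "fz z s = fz (t \<otimes>$A z) ?u"
  using w(1,2) t u Zc T_A T_Z Z_ops by (simp add: fz_eq A.m_assoc)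
 have e2: "fz \<one>$A t = fz s ?u"
  using w(2) t u Zc T_A T_Z Z_ops Z_comm[of s t] by (simp add: fz_eq)
 have r1: "([(fz z s, a)], [(fz \<one>$A ?u, (t \<otimes>$A z) \<otimes>$A a)]) \<in> tensor_rel Z CZ AZ"
  unfolding e1 by (rule expand) (use w t wa Z_ops T_Z in auto)
 have r2: "([(fz \<one>$A t, b)], [(fz \<one>$A ?u, s \<otimes>$A b)]) \<in> tensor_rel Z CZ AZ"
  unfolding e2 by (rule expand) (use w t b T_Z in auto)
 have "([(fz z s, a)] @ xs, [(fz \<one>$A ?u, (t \<otimes>$A z) \<otimes>$A a)] @ [(fz \<one>$A ?u, s \<otimes>$A b)]) \<in> tensor_rel Z CZ AZ"
  by (rule tensor_rel.append[OF r1 tensor_rel.trans[OF rel r2]])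
 moreover have "([(fz \<one>$A ?u, ((t \<otimes>$A z) \<otimes>$A a) \<oplus>$AZ (s \<otimes>$A b))],
   [(fz \<one>$A ?u, (t \<otimes>$A z) \<otimes>$A a), (fz \<one>$A ?u, s \<otimes>$A b)]) \<in> tensor_rel Z CZ AZ"
  by (rule tensor_rel.add_right) (use w t wa b u Zc T_A in \<open>simp_all add: CZ_simps AZ_simps fz_closed Z_ops\<close>)
 ultimately have "(p # xs, [(fz \<one>$A ?u, ((t \<otimes>$A z) \<otimes>$A a) \<oplus>$A (s \<otimes>$A b))]) \<in> tensor_rel Z CZ AZ"
  using tensor_rel.trans[OF _ tensor_rel.sym] by (auto simp: p w(3) AZ_simps)
 then show ?case using u w(1,2) t wa(2) b by (intro bexI[OF _ u] bexI[of _ "t \<otimes>$A z \<otimes>$A a \<oplus>$A s \<otimes>$A b"]) auto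
qed

lemma word_sum_normal_form:
 assumes "(xs, [(fz \<one>$A s, a)]) \<in> tensor_rel Z CZ AZ" "s \<in> T" "a :. A"
 shows "tensor_sum L \<beta>A xs = fa a s"
proof -
 have "tensor_sum L \<beta>A xs = tensor_sum L \<beta>A [(fz \<one>$A s, a)]" using BA.rel_sum[OF assms(1)] by simp
 also have "... = fa a s" using assms(2,3) LA.frac_mem_carrier[of a s] by (simp add: \<beta>A_fz Z_ops)
 finally show ?thesis .
qed

sublocale FA: separating_balanced_map Z CZ AZ L \<beta>A
proof
 fix xs ys assume xs: "xs \<in> BA.words" and ys: "ys \<in> BA.words" and eq: "tensor_sum L \<beta>A xs = tensor_sum L \<beta>A ys"
 obtain s a where s: "s \<in> T" "a :. A" "(xs, [(fz \<one>$A s, a)]) \<in> tensor_rel Z CZ AZ"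
  using word_normal_form[OF xs] by blast
 obtain t b where t: "t \<in> T" "b :. A" "(ys, [(fz \<one>$A t, b)]) \<in> tensor_rel Z CZ AZ"
  using word_normal_form[OF ys] by blast
 have "fa a s = fa b t" using eq word_sum_normal_form[OF s(3,1,2)] word_sum_normal_form[OF t(3,1,2)] by simp
 then have e: "t \<otimes>$A a = s \<otimes>$A b" using LA.frac_eq_iff[OF s(2,1) t(2,1)] by simp
 let ?u = "s \<otimes>$A t"
 have u: "?u \<in> T" by (rule mult_T[OF s(1) t(1)])
 have expand: "([(fz z ?u, c)], [(fz \<one>$A ?u, z \<otimes>$A c)]) \<in> tensor_rel Z CZ AZ"
  if "z :. Z" "c :. A" for z c
 proof -
  have "([(z \<odot>$CZ fz \<one>$A ?u, c)], [(fz \<one>$A ?u, z \<odot>$AZ c)]) \<in> tensor_rel Z CZ AZ"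
   by (rule tensor_rel.balanced) (use that u in \<open>simp_all add: CZ_simps AZ_simps fz_closed Z_ops\<close>)
  then show ?thesis using that one_T u by (simp add: CZ_simps AZ_simps fz_mult Z_ops)
 qed
 have "fz \<one>$A s = fz t ?u" using s t u T_A T_Z Z_ops by (simp add: fz_eq)
 then have r1: "([(fz \<one>$A s, a)], [(fz \<one>$A ?u, t \<otimes>$A a)]) \<in> tensor_rel Z CZ AZ"
  using expand[of t a] s t T_Z by auto
 have "fz \<one>$A t = fz s ?u" using s t u T_A T_Z Z_ops Z_comm[of s t] by (simp add: fz_eq)
 then have r2: "([(fz \<one>$A t, b)], [(fz \<one>$A ?u, t \<otimes>$A a)]) \<in> tensor_rel Z CZ AZ"
  using expand[of s b] s t T_Z e by auto
 show "(xs, ys) \<in> tensor_rel Z CZ AZ"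
  by (rule tensor_rel.trans[OF tensor_rel.trans[OF s(3) r1] tensor_rel.sym[OF tensor_rel.trans[OF t(3) r2]]])
qed

abbreviation Am where "Am \<equiv> algebra_loc A \<mm>"
abbreviation \<Phi> where "\<Phi> \<equiv> FA.fibre"

lemma word_in_fibre: "[|s \<in> T; a :. A|] ==> [(fz \<one>$A s, a)] \<in> \<Phi> (fa a s)"
 using LA.frac_mem_carrier[of a s] by (simp add: FA.fibre_def CZ_simps AZ_simps fz_closed Z_ops \<beta>A_fz)

lemma fibre_nonempty: "x :. L ==> \<Phi> x ~= {}"
 using word_in_fibre by (metis LA.loc_cases empty_iff)

lemma Am_carrier: "carrier Am = \<Phi> ` carrier L"
proof -
 have "tensor_sum L \<beta>A ` BA.words = carrier L"
 proof
  show "tensor_sum L \<beta>A ` BA.words \<subseteq> carrier L" using BA.sum_closed by blast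
  show "carrier L \<subseteq> tensor_sum L \<beta>A ` BA.words"
   using fibre_nonempty by (fastforce simp: FA.fibre_def)
 qed
 then show ?thesis
  unfolding algebra_loc_def tensor_ring_def by (simp add: FA.carrier_eq_fibres image_image[symmetric])
qed

lemma tensor_sum_right_mult:
 "xs \<in> BA.words ==> y :. L ==>
  tensor_sum L (%w a. \<beta>A w a \<otimes>$L y) xs = tensor_sum L \<beta>A xs \<otimes>$L y"
proof (induct xs)
 case Nil then show ?case by (simp add: tensor_sum_def)
next
 case (Cons p xs)
 obtain w a where p: "p = (w, a)" by (cases p)
 with Cons show ?case using BA.sum_closed[of xs] BA.closed[of w a] by (simp add: tensor_sum_def L.l_distr)
qed

lemma Am_mult: "[|x :. L; y :. L|] ==> \<Phi> x \<otimes>$Am \<Phi> y = \<Phi> (x \<otimes>$L y)"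
proof -
 assume x: "x :. L" and y: "y :. L"
 have "tensor_lift2 Z CZ AZ (monoid.mult CZ) (monoid.mult AZ) (\<Phi> x) (\<Phi> y) = \<Phi> (x \<otimes>$L y)"
 proof (rule FA.lift2_fibres[OF fibre_nonempty[OF x] fibre_nonempty[OF y]])
  fix xs ys assume xs: "xs \<in> \<Phi> x" and ys: "ys \<in> \<Phi> y"
  then have W: "xs \<in> BA.words" "ys \<in> BA.words" and sums: "tensor_sum L \<beta>A xs = x" "tensor_sum L \<beta>A ys = y"
   by (auto simp: FA.fibre_def)
  have "[(m \<otimes>$CZ m', n \<otimes>$AZ n'). (m, n) \<leftarrow> xs, (m', n') \<leftarrow> ys] \<in> BA.words &
   tensor_sum L \<beta>A [(m \<otimes>$CZ m', n \<otimes>$AZ n'). (m, n) \<leftarrow> xs, (m', n') \<leftarrow> ys] =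
    tensor_sum L (%m n. \<beta>A m n \<otimes>$L tensor_sum L \<beta>A ys) xs"
  proof (rule BA.sum_lift2[OF L.abelian_group_axioms])
   show "\<beta>A m' n' :. L" if "(m', n') \<in> set ys" for m' n' using W(2) that BA.closed by auto
   fix m n assume mn: "(m, n) \<in> set xs"
   then have mn': "m :. Zm" "n :. A" using W(1) by (auto simp: CZ_simps AZ_simps)
   have b: "\<beta>A m n :. L" using mn W(1) BA.closed by auto
   show "\<beta>A m n \<otimes>$L t :. L" if "t :. L" for t using b that by simp
   show "\<beta>A m n \<otimes>$L (t \<oplus>$L t') = \<beta>A m n \<otimes>$L t \<oplus>$L \<beta>A m n \<otimes>$L t'"
    if "t :. L" "t' :. L" for t t' using b that by (simp add: L.r_distr)
   fix m' n' assume "(m', n') \<in> set ys"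
   then have mn2: "m' :. Zm" "n' :. A" using W(2) by (auto simp: CZ_simps AZ_simps)
   have "\<beta>A (m \<otimes>$Zm m') (n \<otimes>$A n') = \<iota>Z m \<otimes>$L ((\<iota>Z m' \<otimes>$L fa n \<one>$A) \<otimes>$L fa n' \<one>$A)"
    using mn' mn2 by (simp add: \<beta>A_def \<iota>Zh fa1 L.m_assoc)
   also have "\<iota>Z m' \<otimes>$L fa n \<one>$A = fa n \<one>$A \<otimes>$L \<iota>Z m'" by (rule \<iota>Z_central[OF mn2(1) fa1(1)[OF mn'(2)]])
   finally have "\<beta>A (m \<otimes>$Zm m') (n \<otimes>$A n') = \<beta>A m n \<otimes>$L \<beta>A m' n'"
    using mn' mn2 by (simp add: \<beta>A_def \<iota>Zh fa1 L.m_assoc)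
   then show "m \<otimes>$CZ m' :. CZ & n \<otimes>$AZ n' :. AZ &
     \<beta>A (m \<otimes>$CZ m') (n \<otimes>$AZ n') = \<beta>A m n \<otimes>$L \<beta>A m' n'"
    using mn' mn2 by (simp add: CZ_simps AZ_simps)
  qed
  then show "[(m \<otimes>$CZ m', n \<otimes>$AZ n'). (m, n) \<leftarrow> xs, (m', n') \<leftarrow> ys] \<in> BA.words &
   tensor_sum L \<beta>A [(m \<otimes>$CZ m', n \<otimes>$AZ n'). (m, n) \<leftarrow> xs, (m', n') \<leftarrow> ys] = x \<otimes>$L y"
   using tensor_sum_right_mult[OF W(1) y] sums by simp
 qed
 then show ?thesis by (simp add: algebra_loc_def tensor_ring_def)
qed

lemma Am_add: "[|x :. L; y :. L|] ==> \<Phi> x \<oplus>$Am \<Phi> y = \<Phi> (x \<oplus>$L y)"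
 using FA.add_fibres[OF fibre_nonempty fibre_nonempty] by (simp add: algebra_loc_def tensor_ring_def)

lemma Am_zero: "\<zero>$Am = \<Phi> \<zero>$L"
 using FA.class_eq_fibre[of "[]"] by (simp add: algebra_loc_def tensor_ring_def)

lemma Am_one: "\<one>$Am = \<Phi> \<one>$L"
proof -
 have "\<one>$Am = tensor_class Z CZ AZ [(\<one>$Zm, \<one>$A)]"
  by (simp add: algebra_loc_def tensor_ring_def CZ_simps AZ_simps)
 also have "... = \<Phi> (tensor_sum L \<beta>A [(\<one>$Zm, \<one>$A)])"
  by (rule FA.class_eq_fibre) (simp add: CZ_simps AZ_simps)
 also have "tensor_sum L \<beta>A [(\<one>$Zm, \<one>$A)] = \<one>$L"
  using one_T LA.frac_mem_carrier[of "\<one>$A" "\<one>$A"] by (simp add: fz_one \<beta>A_fz Z_ops LA.loc_one)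
 finally show ?thesis .
qed

lemmas Am_ring_facts = ring_image[OF L.ring_axioms Am_carrier Am_mult Am_add Am_one Am_zero]

sublocale Am: ring Am by (rule Am_ring_facts(1))

lemma \<Phi>_inj: "inj_on \<Phi> (carrier L)"
 by (rule inj_onI, erule FA.fibre_inj, erule fibre_nonempty)

lemma Am_cases:
 assumes "x :. Am"
 obtains a s where "a :. A" "s \<in> T" "x = \<Phi> (fa a s)"
 using assms by (auto simp: Am_carrier LA.loc_carrier)

end

section \<open>The localized module\<close>

context residue_point
begin

abbreviation mA (infixl "**" 70) where "a ** b \<equiv> a \<otimes>$A b"
abbreviation act (infixr "*." 75) where "a *. v \<equiv> a \<odot>$V v"
abbreviation scale (infixr "|>" 75) where "c |> v \<equiv> (c \<odot>$A \<one>$A) *. v"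
abbreviation J where "J \<equiv> center_loc_ideal A \<mm>"
abbreviation \<kappa> where "\<kappa> c \<equiv> fz (c \<odot>$A \<one>$A) \<one>$A"
abbreviation F where "F \<equiv> quot_algebra Zm J"
abbreviation F' where "F' \<equiv> quot_module Zm J"
abbreviation W where "W \<equiv> base_space A V"
abbreviation V' where "V' \<equiv> module_loc k A \<mm> V"

lemma scalar_simps:
 "c :. k ==> c \<odot>$A \<one>$A :. Z"
 "[|c :. k; d :. k|] ==> (c \<otimes>$k d) \<odot>$A \<one>$A = (c \<odot>$A \<one>$A) ** (d \<odot>$A \<one>$A)"
 "[|c :. k; d :. k|] ==> (c \<oplus>$k d) \<odot>$A \<one>$A = (c \<odot>$A \<one>$A) \<oplus>$A (d \<odot>$A \<one>$A)"
 "\<one>$k \<odot>$A \<one>$A = \<one>$A"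
proof -
 show "c \<odot>$A \<one>$A :. Z" if "c :. k"
  unfolding center_simps(1) using scalar_central[OF that] ring_hom_closed[OF scalar_hom that] by blast
qed (use ring_hom_mult[OF scalar_hom, of c d] ring_hom_add[OF scalar_hom, of c d] ring_hom_one[OF scalar_hom] in simp_all)

lemma scale_simps:
 assumes "c :. k" "v :. V"
 shows "c |> v :. V" "\<one>$k |> v = v"
  and "u :. V ==> c |> (v \<oplus>$V u) = c |> v \<oplus>$V c |> u"
  and "d :. k ==> (c \<oplus>$k d) |> v = c |> v \<oplus>$V d |> v"
  and "d :. k ==> (c \<otimes>$k d) |> v = c |> d |> v"
  and "a :. A ==> a *. c |> v = c |> a *. v"
 using assms by (simp_all add: scalar_simps V.smult_r_distr V.smult_l_distr V.smult_assoc)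
  (simp add: scalar_simps scalar_central V.smult_assoc[symmetric])

lemma scale_one [simp]: "v :. V ==> \<one>$k |> v = v"
 by (simp add: scalar_simps)

lemma T_acts: "t \<in> T ==> v :. V ==> t *. v = \<chi> t |> v"
 by (rule V_\<chi>) simp_all

lemma T_k: "t \<in> T ==> \<chi> t :. k" "t \<in> T ==> inv\<^bsub>k\<^esub> (\<chi> t) :. k"
 using \<chi>_inv[of t] \<chi>_simps(1) by simp_all

lemma T_cancel:
 assumes "t \<in> T" "v :. V"
 shows "inv\<^bsub>k\<^esub> (\<chi> t) |> \<chi> t |> v = v" "\<chi> t |> inv\<^bsub>k\<^esub> (\<chi> t) |> v = v"
 using \<chi>_inv[OF assms(1)] T_k[OF assms(1)] scale_simps(5)[of _ v, symmetric] scale_simps(2)[of "\<one>$k" v] assms(2)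
 by simp_all

lemma scale_zero: "c :. k ==> c |> \<zero>$V = \<zero>$V"
 by (simp add: V.smult_zeros scalar_simps)

text \<open>
  So \<open>Z\<^sub>\<mm>/\<mm>\<^sub>\<mm>\<close> is \<open>k\<close>, and its elements are the cosets of constants.
\<close>

lemma J_eq: "J = {w \<in> carrier Zm. \<rho> w = \<zero>$k}"
proof (intro Set.set_eqI iffI)
 fix w assume "w \<in> J"
 then obtain a s where w: "a \<in> \<mm>" "s \<in> T" "w = fz a s" unfolding center_loc_ideal_def T_def by blast
 then have a: "a :. Z" "\<chi> a = \<zero>$k" using \<mm>_eq by blast+
 show "w \<in> {w \<in> carrier Zm. \<rho> w = \<zero>$k}" using a w(2) T_k[OF w(2)] by (simp add: w(3) fz_closed \<rho>_fz)
next
 fix w assume "w \<in> {w \<in> carrier Zm. \<rho> w = \<zero>$k}"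
 then have w: "w :. Zm" "\<rho> w = \<zero>$k" by simp_all
 obtain z s where z: "z :. Z" "s \<in> T" "w = fz z s" using w(1) by (rule Zm_cases)
 have "\<chi> z \<otimes>$k inv\<^bsub>k\<^esub> (\<chi> s) = \<zero>$k" using w(2) z(1,2) by (simp add: z(3) \<rho>_fz)
 moreover have "inv\<^bsub>k\<^esub> (\<chi> s) ~= \<zero>$k" using \<chi>_inv[OF z(2)] T_k[OF z(2)] k.one_not_zero by (metis k.l_null)
 ultimately have "\<chi> z = \<zero>$k" using k.integral T_k[OF z(2)] \<chi>_simps(1)[OF z(1)] by blast
 then have "z \<in> \<mm>" using z(1) by (subst \<mm>_eq) simp
 then show "w \<in> J" using z(2,3) unfolding center_loc_ideal_def T_def by blast
qed

lemma ideal_J: "ideal J Zm"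
proof -
 interpret r: ring_hom_ring Zm k \<rho> by (rule ring_hom_ringI2[OF Zm.ring_axioms k.ring_axioms \<rho>_hom])
 have "J = a_kernel Zm k \<rho>" unfolding J_eq a_kernel_def' by simp
 then show ?thesis using r.kernel_is_ideal by simp
qed

lemmas coset = quot_module_coset[OF ideal_J]

lemma coset_eq:
 assumes "w :. Zm" "w' :. Zm"
 shows "J +>$Zm w = J +>$Zm w' \<longleftrightarrow> \<rho> w = \<rho> w'"
proof -
 interpret r: ring_hom_ring Zm k \<rho> by (rule ring_hom_ringI2[OF Zm.ring_axioms k.ring_axioms \<rho>_hom])
 have "\<rho> (w \<ominus>$Zm w') = \<rho> w \<ominus>$k \<rho> w'" using assms by (simp add: a_minus_def)
 moreover have "w \<ominus>$Zm w' \<in> J \<longleftrightarrow> \<rho> (w \<ominus>$Zm w') = \<zero>$k" using assms by (subst J_eq) simp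
 ultimately show ?thesis using assms by (simp add: coset(5))
qed

lemma residue_scalar [simp]: "c :. k ==> \<kappa> c :. Zm" "c :. k ==> \<rho> (\<kappa> c) = c"
 by (simp_all add: fz_closed scalar_simps \<rho>_fz \<chi>_scalar \<chi>_simps)

lemma Zm_scalar: "c :. k ==> c \<odot>$Zm \<one>$Zm = \<kappa> c"
proof -
 assume c: "c :. k"
 have "c \<odot>$Zm \<one>$Zm = (\<Union>(a, s)\<in>fz \<one>$A \<one>$A. fz (c \<odot>$A a) s)"
  by (simp add: Zm_def localization_def center_simps(4,6))
 also have "... = \<kappa> c"
 proof (rule LZ.Union_frac)
  fix a s assume a: "a :. Z" "s \<in> T" "s \<otimes>$Z \<one>$A = \<one>$A \<otimes>$Z a"
  then have "s = a" by (simp add: center_simps(2))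
  have ca: "c \<odot>$A a = (c \<odot>$A \<one>$A) ** a" using c a(1) by (intro scalar_mult) simp_all
  show "fz (c \<odot>$A a) s = \<kappa> c"
   unfolding ca using c a(1,2) scalar_central[of c a] by (simp add: fz_eq scalar_simps Z_ops \<open>s = a\<close>)
 qed (simp_all add: Z_ops)
 finally show ?thesis .
qed

definition \<omega> where "\<omega> Y = (SOME c. c :. k & Y = J +>$Zm \<kappa> c)"

lemma \<omega>_coset: "w :. Zm ==> \<omega> (J +>$Zm w) = \<rho> w"
proof -
 assume w: "w :. Zm"
 have "\<exists>c. c :. k & J +>$Zm w = J +>$Zm \<kappa> c"
  using w \<rho>_closed[OF w] by (intro exI[of _ "\<rho> w"]) (simp add: coset_eq)
 from someI_ex[OF this] have c: "\<omega> (J +>$Zm w) :. k" "J +>$Zm w = J +>$Zm \<kappa> (\<omega> (J +>$Zm w))"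
  unfolding \<omega>_def[symmetric] by blast+
 show ?thesis
  using iffD1[OF coset_eq[OF w residue_scalar(1)[OF c(1)]] c(2)] unfolding residue_scalar(2)[OF c(1)] by (rule HOL.sym)
qed

lemma residue_coset: "J +>$Zm w = J +>$Zm \<kappa> (\<rho> w)" if "w :. Zm"
 using that \<rho>_closed[OF that] by (simp add: coset_eq)

lemma F'_cases:
 assumes "Y :. F'"
 obtains c where "c :. k" "Y = J +>$Zm \<kappa> c" "\<omega> Y = c"
proof -
 obtain w where w: "w :. Zm" "Y = J +>$Zm w" using coset(1)[OF assms] by blast
 show ?thesis
  by (rule that[of "\<rho> w"]) (simp_all add: w \<rho>_closed \<omega>_coset residue_coset[symmetric])
qed

lemma F'_ops:
 "c :. k ==> J +>$Zm \<kappa> c :. F'"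
 "[|c :. k; d :. k|] ==> (J +>$Zm \<kappa> c) \<oplus>$F' (J +>$Zm \<kappa> d) = J +>$Zm \<kappa> (c \<oplus>$k d)"
 "[|w :. Zm; d :. k|] ==> w \<odot>$F' (J +>$Zm \<kappa> d) = J +>$Zm \<kappa> (\<rho> w \<otimes>$k d)"
 "c :. k ==> \<omega> (J +>$Zm \<kappa> c) = c"
 using \<rho>_closed ring_hom_add[OF \<rho>_hom, of "\<kappa> c" "\<kappa> d"] ring_hom_mult[OF \<rho>_hom, of w "\<kappa> d"]
 by (simp_all add: coset(2-4) coset_eq \<omega>_coset)

lemma F_simps: "carrier F = carrier F'" "add F = add F'" "\<zero>$F = \<zero>$F'"
  "c :. k ==> c \<odot>$F Y = \<kappa> c \<odot>$F' Y"
 by (simp_all add: quot_algebra_def quot_module_def ring_as_module_def Zm_scalar)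

lemma W_simps: "carrier W = carrier V" "add W = add V" "\<zero>$W = \<zero>$V" "c \<odot>$W v = c |> v"
 by (simp_all add: base_space_def restrict_scalars_def)

lemma F_module: "left_module k F"
proof -
 note h = ring_hom_closed[OF ideal.rcos_ring_hom[OF ideal_J]] ring_hom_mult[OF ideal.rcos_ring_hom[OF ideal_J], symmetric]
  ring_hom_add[OF ideal.rcos_ring_hom[OF ideal_J], symmetric] ring_hom_one[OF ideal.rcos_ring_hom[OF ideal_J]]
 note r = ring_hom_mult[OF \<rho>_hom] ring_hom_add[OF \<rho>_hom]
 have "(%c. J +>$Zm (c \<odot>$Zm \<one>$Zm)) \<in> ring_hom k (Zm Quot J)"
  by (rule ring_hom_memI) (simp_all add: Zm_scalar h coset_eq r scalar_simps(1,4) fz_one[symmetric])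
 then show ?thesis unfolding quot_algebra_def
  by (rule left_module_ring_as_module[OF k.ring_axioms ideal.quotient_is_ring[OF ideal_J]])
qed

lemma W_module: "left_module k W"
 unfolding base_space_def by (rule left_module_restrict_scalars[OF k.ring_axioms V_module scalar_hom])

definition \<beta>V where "\<beta>V Y v = \<omega> Y |> v"

lemma \<beta>V_coset: "c :. k ==> \<beta>V (J +>$Zm \<kappa> c) v = c |> v"
 by (simp add: \<beta>V_def F'_ops)

sublocale BV: balanced_map k F W V \<beta>V
proof (intro balanced_map.intro balanced_map_axioms.intro F_module W_module V.M.abelian_group_axioms)
 fix Y Y' v v' assume Y: "Y :. F" and v: "v :. W"
 obtain c where c: "c :. k" "Y = J +>$Zm \<kappa> c" using Y unfolding F_simps by (rule F'_cases)
 show "\<beta>V Y v :. V" using c(1) v by (simp add: c(2) \<beta>V_coset W_simps scale_simps)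
 show "\<beta>V Y (v \<oplus>$W v') = \<beta>V Y v \<oplus>$V \<beta>V Y v'" if "v' :. W"
  using c(1) v that by (simp add: c(2) \<beta>V_coset W_simps scale_simps)
 show "\<beta>V (d \<odot>$F Y) v = \<beta>V Y (d \<odot>$W v)" if "d :. k" for d
  using c(1) v that by (simp add: c(2) \<beta>V_coset W_simps F_simps F'_ops scale_simps k.m_comm[of d c])
 assume "Y' :. F"
 then obtain d where d: "d :. k" "Y' = J +>$Zm \<kappa> d" unfolding F_simps by (rule F'_cases)
 show "\<beta>V (Y \<oplus>$F Y') v = \<beta>V Y v \<oplus>$V \<beta>V Y' v"
  using c(1) d(1) v by (simp add: c(2) d(2) \<beta>V_coset W_simps F_simps F'_ops scale_simps)
qed

abbreviation F1 where "F1 \<equiv> J +>$Zm \<kappa> \<one>$k"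

text \<open>
  Every element of \<open>Z\<^sub>\<mm>/\<mm>\<^sub>\<mm> \<otimes>\<^sub>k V\<close> is \<open>1 \<otimes> v\<close>.
\<close>

lemma V_word_normal_form:
 assumes "xs \<in> BV.words"
 shows "(xs, [(F1, tensor_sum V \<beta>V xs)]) \<in> tensor_rel k F W"
 using assms
proof (induct xs)
 case Nil
 have "([(F1, \<zero>$W)], []) \<in> tensor_rel k F W" by (rule BV.rel_zero_right) (simp add: F_simps F'_ops)
 then show ?case by (auto simp: W_simps intro: tensor_rel.sym)
next
 case (Cons p xs)
 obtain Y v where p: "p = (Y, v)" by (cases p)
 then have Y: "Y :. F'" and v: "v :. V" and xs: "xs \<in> BV.words"
  using Cons(2) by (auto simp: F_simps W_simps)
 obtain c where c: "c :. k" "Y = J +>$Zm \<kappa> c" using Y by (rule F'_cases)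
 have "([(c \<odot>$F F1, v)], [(F1, c \<odot>$W v)]) \<in> tensor_rel k F W"
  by (rule tensor_rel.balanced) (simp_all add: c(1) v F_simps F'_ops W_simps)
 then have 1: "([(Y, v)], [(F1, \<beta>V Y v)]) \<in> tensor_rel k F W"
  using c(1) by (simp add: c(2) \<beta>V_coset F_simps F'_ops W_simps)
 have b: "\<beta>V Y v :. V" "tensor_sum V \<beta>V xs :. V"
  using BV.closed[of Y v] Y v BV.sum_closed[OF xs] by (simp_all add: F_simps W_simps)
 have 2: "([(Y, v)] @ xs, [(F1, \<beta>V Y v)] @ [(F1, tensor_sum V \<beta>V xs)]) \<in> tensor_rel k F W"
  by (rule tensor_rel.append[OF 1 Cons(1)[OF xs]])
 have "([(F1, \<beta>V Y v \<oplus>$W tensor_sum V \<beta>V xs)], [(F1, \<beta>V Y v), (F1, tensor_sum V \<beta>V xs)]) \<in> tensor_rel k F W"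
  by (rule tensor_rel.add_right) (simp_all add: b F_simps F'_ops W_simps)
 from tensor_rel.trans[OF 2[simplified] tensor_rel.sym[OF this]] show ?case by (simp add: p W_simps)
qed

sublocale FV: separating_balanced_map k F W V \<beta>V
proof
 fix xs ys assume xs: "xs \<in> BV.words" and ys: "ys \<in> BV.words" and eq: "tensor_sum V \<beta>V xs = tensor_sum V \<beta>V ys"
 show "(xs, ys) \<in> tensor_rel k F W"
  using tensor_rel.trans[OF V_word_normal_form[OF xs, unfolded eq] tensor_rel.sym[OF V_word_normal_form[OF ys]]] .
qed

abbreviation \<iota> where "\<iota> \<equiv> FV.fibre"

lemma V_fibre_nonempty: "v :. V ==> \<iota> v ~= {}"
proof -
 assume v: "v :. V"
 have "[(F1, v)] \<in> \<iota> v" using v by (simp add: FV.fibre_def F_simps F'_ops W_simps \<beta>V_coset scale_simps)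
 then show ?thesis by blast
qed

lemma V'_simps: "carrier V' = tensor_carrier k F W" "\<zero>$V' = tensor_class k F W []" "add V' = tensor_add k F W"
  "smult V' = tensor_lift2 k F W (smult F') (smult V)"
 by (simp_all add: module_loc_def Let_def)

lemma V'_carrier: "carrier V' = \<iota> ` carrier V"
proof -
 have "tensor_sum V \<beta>V ` BV.words = carrier V"
 proof
  show "tensor_sum V \<beta>V ` BV.words \<subseteq> carrier V" using BV.sum_closed by blast
  show "carrier V \<subseteq> tensor_sum V \<beta>V ` BV.words" using V_fibre_nonempty by (fastforce simp: FV.fibre_def)
 qed
 then show ?thesis by (simp add: V'_simps FV.carrier_eq_fibres image_image[symmetric])
qed

lemma V'_add: "[|u :. V; v :. V|] ==> \<iota> u \<oplus>$V' \<iota> v = \<iota> (u \<oplus>$V v)"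
 using FV.add_fibres[OF V_fibre_nonempty V_fibre_nonempty] by (simp add: V'_simps)

lemma V'_zero: "\<zero>$V' = \<iota> \<zero>$V"
 using FV.class_eq_fibre[of "[]"] by (simp add: V'_simps)

lemma \<iota>_inj: "[|u :. V; v :. V; \<iota> u = \<iota> v|] ==> u = v"
 using FV.fibre_inj V_fibre_nonempty by blast

text \<open>
  The fraction \<open>a/s\<close> acts on \<open>V\<^sub>\<mm> = V\<close> as \<open>a divided by \<chi>(s)\<close>.
\<close>

lemma V'_smult:
 assumes a: "a :. A" and s: "s \<in> T" and v: "v :. V"
 shows "\<Phi> (fa a s) \<odot>$V' \<iota> v = \<iota> (inv\<^bsub>k\<^esub> (\<chi> s) |> a *. v)"
proof -
 have x: "fa a s :. L" using a s by (rule LA.frac_mem_carrier)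
 let ?h = "%w a t. \<rho> w |> a *. t"
 interpret BH: balanced_map Z CZ AZ V "%w a. \<rho> w |> a *. v"
 proof (intro balanced_map.intro balanced_map_axioms.intro CZ_module AZ_module V.M.abelian_group_axioms)
  fix w w' a a' assume w: "w :. CZ" and a: "a :. AZ"
  then have c: "\<rho> w :. k" "w :. Zm" "a :. A" "a *. v :. V"
   using v \<rho>_closed by (simp_all add: CZ_simps AZ_simps)
  show "\<rho> w |> a *. v :. V" using c by (simp add: scale_simps)
  show "\<rho> w |> (a \<oplus>$AZ a') *. v = \<rho> w |> a *. v \<oplus>$V \<rho> w |> a' *. v" if "a' :. AZ"
   using c v that by (simp add: scale_simps V.smult_l_distr AZ_simps)
  show "\<rho> (w \<oplus>$CZ w') |> a *. v = \<rho> w |> a *. v \<oplus>$V \<rho> w' |> a *. v" if "w' :. CZ"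
   using c that \<rho>_closed[of w'] ring_hom_add[OF \<rho>_hom, of w w'] by (simp add: scale_simps CZ_simps)
  show "\<rho> (z \<odot>$CZ w) |> a *. v = \<rho> w |> (z \<odot>$AZ a) *. v" if z: "z :. Z" for z
  proof -
   have "\<rho> (z \<odot>$CZ w) = \<rho> w \<otimes>$k \<chi> z"
    using c z \<chi>_simps(1)[OF z] ring_hom_mult[OF \<rho>_hom, of "fz z \<one>$A" w]
    by (simp add: CZ_simps fz_closed \<rho>_fz \<chi>_simps k.m_comm[of "\<rho> w"])
   moreover have "(z ** a) *. v = \<chi> z |> a *. v" using V_\<chi>[OF z c(4)] z c v by (simp add: V.smult_assoc)
   ultimately show ?thesis using c z \<chi>_simps(1)[OF z] by (simp add: AZ_simps scale_simps)
  qed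
 qed
 have "tensor_lift2 k F W (smult F') (smult V) (\<Phi> (fa a s)) (\<iota> v) = \<iota> (inv\<^bsub>k\<^esub> (\<chi> s) |> a *. v)"
 proof (rule FV.lift2_fibres[OF fibre_nonempty[OF x] V_fibre_nonempty[OF v]])
  fix xs ys assume xs: "xs \<in> \<Phi> (fa a s)" and ys: "ys \<in> \<iota> v"
  then have U: "xs \<in> BA.words" "ys \<in> BV.words" and sums: "tensor_sum L \<beta>A xs = fa a s" "tensor_sum V \<beta>V ys = v"
   by (auto simp: FA.fibre_def FV.fibre_def)
  have mem: "m :. Zm & n :. A & \<rho> m :. k" if "(m, n) \<in> set xs" for m n
   using that U(1) \<rho>_closed[of m] by (auto simp: CZ_simps AZ_simps)
  have "[(m \<odot>$F' m', n \<odot>$V n'). (m, n) \<leftarrow> xs, (m', n') \<leftarrow> ys] \<in> BV.words &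
   tensor_sum V \<beta>V [(m \<odot>$F' m', n \<odot>$V n'). (m, n) \<leftarrow> xs, (m', n') \<leftarrow> ys] =
    tensor_sum V (%m n. ?h m n (tensor_sum V \<beta>V ys)) xs"
  proof (rule BV.sum_lift2[OF V.M.abelian_group_axioms])
   show "\<beta>V m' n' :. V" if "(m', n') \<in> set ys" for m' n' using U(2) that BV.closed by auto
   fix m n assume mn: "(m, n) \<in> set xs"
   show "\<rho> m |> n *. t :. V" if "t :. V" for t
    using mem[OF mn] that by (simp add: scale_simps)
   show "\<rho> m |> n *. (t \<oplus>$V t') = \<rho> m |> n *. t \<oplus>$V \<rho> m |> n *. t'"
    if "t :. V" "t' :. V" for t t' using mem[OF mn] that by (simp add: scale_simps V.smult_r_distr)
   fix m' n' assume "(m', n') \<in> set ys"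
   then have mn2: "m' :. F'" "n' :. V" using U(2) by (auto simp: F_simps W_simps)
   obtain c where c: "c :. k" "m' = J +>$Zm \<kappa> c" using mn2(1) by (rule F'_cases)
   show "m \<odot>$F' m' :. F & n *. n' :. W & \<beta>V (m \<odot>$F' m') (n *. n') = \<rho> m |> n *. \<beta>V m' n'"
    using mem[OF mn] c(1) mn2(2) by (simp add: c(2) F_simps W_simps F'_ops \<beta>V_coset scale_simps)
  qed
  moreover have "tensor_sum V (%m n. \<rho> m |> n *. v) xs = inv\<^bsub>k\<^esub> (\<chi> s) |> a *. v"
  proof -
   have "tensor_sum L \<beta>A xs = tensor_sum L \<beta>A [(fz \<one>$A s, a)]"
    using word_in_fibre[OF s a] sums by (simp add: FA.fibre_def)
   then have "(xs, [(fz \<one>$A s, a)]) \<in> tensor_rel Z CZ AZ"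
    by (rule FA.separating[OF U(1), rotated]) (use word_in_fibre[OF s a] in \<open>simp add: FA.fibre_def\<close>)
   from BH.rel_sum[OF this] show ?thesis
    using a v T_k[OF s] by (simp add: \<rho>_fz Z_ops s \<chi>_simps scale_simps)
  qed
  ultimately show "[(m \<odot>$F' m', n \<odot>$V n'). (m, n) \<leftarrow> xs, (m', n') \<leftarrow> ys] \<in> BV.words &
   tensor_sum V \<beta>V [(m \<odot>$F' m', n \<odot>$V n'). (m, n) \<leftarrow> xs, (m', n') \<leftarrow> ys] = inv\<^bsub>k\<^esub> (\<chi> s) |> a *. v"
   by (simp add: sums)
 qed
 then show ?thesis by (simp add: V'_simps)
qed

lemma Am_ops:
 assumes "a :. A" "s \<in> T" "b :. A" "t \<in> T"
 shows "\<Phi> (fa a s) \<oplus>$Am \<Phi> (fa b t) = \<Phi> (fa (t ** a \<oplus>$A s ** b) (s ** t))"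
  and "\<Phi> (fa a s) \<otimes>$Am \<Phi> (fa b t) = \<Phi> (fa (a ** b) (s ** t))"
  and "\<Phi> (fa a s) = \<Phi> (fa b t) \<longleftrightarrow> t ** a = s ** b"
proof -
 have L: "fa a s :. L" "fa b t :. L" using assms by (simp_all add: LA.frac_mem_carrier)
 show "\<Phi> (fa a s) \<oplus>$Am \<Phi> (fa b t) = \<Phi> (fa (t ** a \<oplus>$A s ** b) (s ** t))"
  "\<Phi> (fa a s) \<otimes>$Am \<Phi> (fa b t) = \<Phi> (fa (a ** b) (s ** t))"
  using assms by (simp_all add: Am_add[OF L] Am_mult[OF L] LA.loc_add LA.loc_mult)
 show "\<Phi> (fa a s) = \<Phi> (fa b t) \<longleftrightarrow> t ** a = s ** b"
  using inj_on_eq_iff[OF \<Phi>_inj L] LA.frac_eq_iff[OF assms] by simp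
qed

lemma Am_fraction [simp]: "a :. A ==> s \<in> T ==> \<Phi> (fa a s) :. Am"
 using LA.frac_mem_carrier by (simp add: Am_carrier)

lemma Am_unit: "\<one>$Am = \<Phi> (fa \<one>$A \<one>$A)" "\<zero>$Am = \<Phi> (fa \<zero>$A \<one>$A)"
 by (simp_all add: Am_one Am_zero LA.loc_one LA.loc_zero)

lemma V'_module: "left_module Am V'"
proof (intro left_module.intro left_module_axioms.intro abelian_groupI Am.ring_axioms)
 show "\<zero>$V' :. V'" by (simp add: V'_zero V'_carrier)
next
 fix x assume "x :. V'"
 then obtain u where u: "u :. V" "x = \<iota> u" by (auto simp: V'_carrier)
 show "\<zero>$V' \<oplus>$V' x = x" using u by (simp add: V'_zero V'_add)
 show "\<exists>y\<in>carrier V'. y \<oplus>$V' x = \<zero>$V'"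
  using u by (intro bexI[of _ "\<iota> (\<ominus>$V u)"]) (simp_all add: V'_zero V'_add V'_carrier V.M.l_neg)
 show "\<one>$Am \<odot>$V' x = x" using u by (simp add: Am_unit V'_smult \<chi>_simps scale_simps)
 fix y assume "y :. V'"
 then obtain v where v: "v :. V" "y = \<iota> v" by (auto simp: V'_carrier)
 show "x \<oplus>$V' y :. V'" "x \<oplus>$V' y = y \<oplus>$V' x"
  using u v by (simp_all add: V'_add V'_carrier V.M.a_comm)
 show "x \<oplus>$V' y \<oplus>$V' z = x \<oplus>$V' (y \<oplus>$V' z)" if "z :. V'" for z
  using that u v by (auto simp: V'_add V'_carrier V.M.a_assoc)
next
 fix a x assume "a :. Am" "x :. V'"
 then obtain c s u where c: "c :. A" "s \<in> T" "a = \<Phi> (fa c s)" and u: "u :. V" "x = \<iota> u"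
  by (auto simp: V'_carrier elim: Am_cases)
 note k = T_k[OF c(2)]
 show "a \<odot>$V' x :. V'" using c u k by (simp add: V'_smult V'_carrier scale_simps)
 show "a \<odot>$V' (x \<oplus>$V' y) = a \<odot>$V' x \<oplus>$V' a \<odot>$V' y" if "y :. V'" for y
  using that c u k by (auto simp: V'_carrier V'_smult V'_add scale_simps V.smult_r_distr)
 fix b assume "b :. Am"
 then obtain d t where d: "d :. A" "t \<in> T" "b = \<Phi> (fa d t)" by (rule Am_cases)
 note l = T_k[OF d(2)]
 have st: "s ** t \<in> T" using c(2) d(2) by (rule mult_T)
 have i: "inv\<^bsub>k\<^esub> (\<chi> (s ** t)) = inv\<^bsub>k\<^esub> (\<chi> s) \<otimes>$k inv\<^bsub>k\<^esub> (\<chi> t)"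
  using inv_mult[OF c(2) d(2)] c(2) d(2) by (simp add: \<chi>_simps)
 have e1: "(inv\<^bsub>k\<^esub> (\<chi> s) \<otimes>$k inv\<^bsub>k\<^esub> (\<chi> t)) |> (t ** c) *. u = inv\<^bsub>k\<^esub> (\<chi> s) |> c *. u"
  using c d u k l by (simp add: V.smult_assoc T_acts scale_simps(1,5,6) T_cancel)
 have e2: "(inv\<^bsub>k\<^esub> (\<chi> s) \<otimes>$k inv\<^bsub>k\<^esub> (\<chi> t)) |> (s ** d) *. u = inv\<^bsub>k\<^esub> (\<chi> t) |> d *. u"
  unfolding k.m_comm[OF k(2) l(2)]
  using c d u k l by (simp add: V.smult_assoc T_acts scale_simps(1,5,6) T_cancel)
 have kl: "inv\<^bsub>k\<^esub> (\<chi> s) \<otimes>$k inv\<^bsub>k\<^esub> (\<chi> t) :. k" using k l by simp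
 have "a \<oplus>$Am b = \<Phi> (fa (t ** c \<oplus>$A s ** d) (s ** t))" using c d by (simp add: Am_ops)
 then have "(a \<oplus>$Am b) \<odot>$V' x = \<iota> ((inv\<^bsub>k\<^esub> (\<chi> s) \<otimes>$k inv\<^bsub>k\<^esub> (\<chi> t)) |> (t ** c \<oplus>$A s ** d) *. u)"
  using c(1,2) d(1,2) u st by (simp add: V'_smult i)
 also have "(inv\<^bsub>k\<^esub> (\<chi> s) \<otimes>$k inv\<^bsub>k\<^esub> (\<chi> t)) |> (t ** c \<oplus>$A s ** d) *. u = inv\<^bsub>k\<^esub> (\<chi> s) |> c *. u \<oplus>$V inv\<^bsub>k\<^esub> (\<chi> t) |> d *. u"
  using c(1,2) d(1,2) u kl scale_simps(3)[OF kl, of "(t ** c) *. u" "(s ** d) *. u"]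
  by (simp only: V.smult_l_distr A.m_closed T_A V.smult_closed e1 e2)
 finally show "(a \<oplus>$Am b) \<odot>$V' x = a \<odot>$V' x \<oplus>$V' b \<odot>$V' x"
  using c d u k l by (simp add: V'_smult V'_add scale_simps)
 have "a \<otimes>$Am b = \<Phi> (fa (c ** d) (s ** t))" using c d by (simp add: Am_ops)
 then have "(a \<otimes>$Am b) \<odot>$V' x = \<iota> ((inv\<^bsub>k\<^esub> (\<chi> s) \<otimes>$k inv\<^bsub>k\<^esub> (\<chi> t)) |> (c ** d) *. u)"
  using c(1,2) d(1,2) u st by (simp add: V'_smult i)
 then show "(a \<otimes>$Am b) \<odot>$V' x = a \<odot>$V' (b \<odot>$V' x)"
  using c d u k l by (simp add: V'_smult scale_simps V.smult_assoc)
qed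

definition loc where "loc a = \<Phi> (fa a \<one>$A)"

lemma loc_smult: "[|a :. A; v :. V|] ==> loc a \<odot>$V' \<iota> v = \<iota> (a *. v)"
 by (simp add: loc_def V'_smult \<chi>_simps scale_simps)

lemma loc_hom: "loc \<in> ring_hom A Am"
 by (rule ring_hom_memI) (simp_all add: loc_def Am_ops Am_unit)

lemma \<iota>_bij: "bij_betw \<iota> (carrier V) (carrier V')"
 using \<iota>_inj by (auto simp: bij_betw_def V'_carrier inj_on_def)

sublocale CL: central_localization A Am loc T
proof
 show "loc \<in> ring_hom A Am" by (rule loc_hom)
 show "inj_on loc (carrier A)" by (rule inj_onI) (simp add: loc_def Am_ops)
 show "T \<subseteq> carrier A" by (rule LA.S(1))
 show "\<exists>u\<in>carrier Am. u \<otimes>$Am loc t = \<one>$Am & loc t \<otimes>$Am u = \<one>$Am" if "t \<in> T" for t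
  using that by (intro bexI[of _ "\<Phi> (fa \<one>$A t)"]) (simp_all add: loc_def Am_ops Am_unit)
 show "\<exists>t\<in>T. \<exists>a\<in>carrier A. loc t \<otimes>$Am x = loc a" if x: "x :. Am" for x
 proof -
  obtain a s where "a :. A" "s \<in> T" "x = \<Phi> (fa a s)" using x by (rule Am_cases)
  then show ?thesis by (intro bexI[of _ s] bexI[of _ a]) (simp_all add: loc_def Am_ops)
 qed
 show "s ** t \<in> T" if "s \<in> T" "t \<in> T" for s t using that by (rule mult_T)
 show "t ** a = a ** t" if "t \<in> T" "a :. A" for t a using that by (rule LA.S_central)
qed (rule one_T)

lemma ideal_loc_eq:
 assumes p: "ideal p A"
 shows "ideal_loc A \<mm> p = {\<Phi> (fa a s) | a s. a \<in> p & s \<in> T}"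
proof -
 interpret p: ideal p A by (rule p)
 have pA: "a :. A" if "a \<in> p" for a using that p.Icarr by blast
 have sum: "\<exists>a\<in>p. \<exists>s\<in>T. tensor_sum L \<beta>A xs = fa a s" if "set xs \<subseteq> carrier Zm \<times> p" for xs
  using that
 proof (induct xs)
  case Nil
  show ?case using p.zero_closed by (intro bexI[of _ "\<zero>$A"] bexI[of _ "\<one>$A"]) (simp_all add: LA.loc_zero)
 next
  case (Cons q xs)
  obtain w b where q: "q = (w, b)" by (cases q)
  then have wb: "w :. Zm" "b \<in> p" using Cons(2) by auto
  obtain z t where w: "z :. Z" "t \<in> T" "w = fz z t" using wb(1) by (rule Zm_cases)
  obtain a s where a: "a \<in> p" "s \<in> T" "tensor_sum L \<beta>A xs = fa a s" using Cons by auto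
  have 1: "z ** b \<in> p" using w(1) wb(2) by (simp add: p.I_l_closed)
  have "tensor_sum L \<beta>A (q # xs) = fa (s ** (z ** b) \<oplus>$A t ** a) (t ** s)"
   using w a wb(2) pA[OF wb(2)] pA[OF a(1)] by (simp add: q \<beta>A_fz LA.loc_add)
  moreover have "s ** (z ** b) \<oplus>$A t ** a \<in> p" using 1 a w by (simp add: p.I_l_closed)
  ultimately show ?case using mult_T[OF w(2) a(2)] by blast
 qed
 show ?thesis
 proof (intro Set.set_eqI iffI)
  fix x assume "x \<in> ideal_loc A \<mm> p"
  then obtain xs where xs: "set xs \<subseteq> carrier Zm \<times> p" "x = tensor_class Z CZ AZ xs"
   unfolding ideal_loc_def by blast
  have "xs \<in> BA.words" using xs(1) pA by (auto simp: CZ_simps AZ_simps)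
  then have "x = \<Phi> (tensor_sum L \<beta>A xs)" by (simp add: xs(2) FA.class_eq_fibre)
  moreover obtain a s where "a \<in> p" "s \<in> T" "tensor_sum L \<beta>A xs = fa a s" using sum[OF xs(1)] by blast
  ultimately show "x \<in> {\<Phi> (fa a s) | a s. a \<in> p & s \<in> T}"
   by (intro CollectI exI[of _ a] exI[of _ s]) simp
 next
  fix x assume "x \<in> {\<Phi> (fa a s) | a s. a \<in> p & s \<in> T}"
  then obtain a s where a: "a \<in> p" "s \<in> T" "x = \<Phi> (fa a s)" by blast
  have "[(fz \<one>$A s, a)] \<in> \<Phi> (fa a s)" using word_in_fibre[OF a(2) pA[OF a(1)]] .
  then have "tensor_class Z CZ AZ [(fz \<one>$A s, a)] = x"
   by (subst FA.class_eq_fibre) (auto simp: FA.fibre_def a(3))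
  moreover have "set [(fz \<one>$A s, a)] \<subseteq> carrier Zm \<times> p" using a by (simp add: fz_closed Z_ops)
  ultimately show "x \<in> ideal_loc A \<mm> p" unfolding ideal_loc_def by blast
 qed
qed

lemma annihilator_loc: "annihilator Am V' = ideal_loc A \<mm> (annihilator A V)"
proof -
 have *: "\<Phi> (fa a s) \<in> annihilator Am V' \<longleftrightarrow> a \<in> annihilator A V" if a: "a :. A" "s \<in> T" for a s
 proof -
  have "\<Phi> (fa a s) \<odot>$V' \<iota> v = \<zero>$V' \<longleftrightarrow> a *. v = \<zero>$V" if v: "v :. V" for v
  proof -
   have "\<Phi> (fa a s) \<odot>$V' \<iota> v = \<zero>$V' \<longleftrightarrow> inv\<^bsub>k\<^esub> (\<chi> s) |> a *. v = \<zero>$V"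
    using a v T_k[OF a(2)] \<iota>_inj[of "inv\<^bsub>k\<^esub> (\<chi> s) |> a *. v" "\<zero>$V"] by (auto simp: V'_smult V'_zero scale_simps)
   also have "... \<longleftrightarrow> a *. v = \<zero>$V"
    using T_cancel(2)[OF a(2), of "a *. v"] a v T_k[OF a(2)] scale_zero by force
   finally show ?thesis .
  qed
  then show ?thesis using a by (simp add: annihilator_def Am_ops V'_carrier)
 qed
 have "annihilator Am V' = {\<Phi> (fa a s) | a s. a \<in> annihilator A V & s \<in> T}"
 proof (intro Set.set_eqI iffI)
  fix x assume x: "x \<in> annihilator Am V'"
  then have "x :. Am" by (simp add: annihilator_def)
  then obtain a s where "a :. A" "s \<in> T" "x = \<Phi> (fa a s)" by (rule Am_cases)
  then show "x \<in> {\<Phi> (fa a s) | a s. a \<in> annihilator A V & s \<in> T}" using * x by blast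
 next
  fix x assume "x \<in> {\<Phi> (fa a s) | a s. a \<in> annihilator A V & s \<in> T}"
  then obtain a s where "a \<in> annihilator A V" "s \<in> T" "x = \<Phi> (fa a s)" by blast
  then show "x \<in> annihilator Am V'" using * by (auto simp: annihilator_def[of A])
 qed
 then show ?thesis by (simp add: ideal_loc_eq[OF ideal_annihilator[OF V_module]])
qed

end

lemma (in left_module) diff_acts_zero_iff:
 assumes "a :. R" "b :. R" "x :. M"
 shows "(a \<ominus>$R b) \<odot>$M x = \<zero>$M \<longleftrightarrow> a \<odot>$M x = b \<odot>$M x"
proof -
 have "a = (a \<ominus>$R b) \<oplus>$R b" using assms by (simp add: a_minus_def R.a_assoc R.l_neg)
 then have "a \<odot>$M x = (a \<ominus>$R b) \<odot>$M x \<oplus>$M b \<odot>$M x"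
  using smult_l_distr[of "a \<ominus>$R b" b x] assms by simp
 then show ?thesis
  using M.add.right_cancel[of "b \<odot>$M x" "(a \<ominus>$R b) \<odot>$M x" "\<zero>$M"] assms by auto
qed

lemma vector_scale_cancel:
 assumes "field k" "left_module k W" "c :. k" "d :. k" "u :. W" "u ~= \<zero>$W"
  and "c \<odot>$W u = d \<odot>$W u"
 shows "c = d"
proof (rule ccontr)
 interpret k: field k by fact
 interpret W: left_module k W by fact
 assume "c ~= d"
 then have x: "c \<ominus>$k d :. k" "c \<ominus>$k d ~= \<zero>$k" using assms(3,4) by simp_all
 have z: "(c \<ominus>$k d) \<odot>$W u = \<zero>$W" using assms by (simp add: W.diff_acts_zero_iff)
 have i: "inv\<^bsub>k\<^esub> (c \<ominus>$k d) :. k" "inv\<^bsub>k\<^esub> (c \<ominus>$k d) \<otimes>$k (c \<ominus>$k d) = \<one>$k"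
  using x k.field_Units by simp_all
 have "u = inv\<^bsub>k\<^esub> (c \<ominus>$k d) \<odot>$W ((c \<ominus>$k d) \<odot>$W u)"
  using W.smult_assoc[OF i(1) x(1) assms(5)] W.smult_one[OF assms(5)] by (simp add: i(2))
 then show False using assms(6) i(1) by (simp add: z W.smult_zeros)
qed

section \<open>Comparison of the five projective dimensions\<close>

text \<open>
  The vertices in \<open>D\<close> become isomorphic at \<open>\<mm>\<close>: \<open>a i\<close> and \<open>b i\<close> are inverse to each other up to
  the factor \<open>t i\<close>, which is invertible in \<open>Z\<^sub>\<mm>\<close>. The corner at \<open>r\<close> is central and its part of \<open>V\<close> is the
  line spanned by \<open>v0\<close>.
\<close>

locale morita_point = residue_point k A \<mm> \<chi> V
 for k :: "('k, 's) ring_scheme" and A :: "('k, 'a) module" and \<mm> \<chi> and V :: "('a, 'm) module" +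
 fixes D :: "'v set" and e a b t :: "'v => 'a" and r :: 'v and v0 :: 'm
 assumes D: "finite D" "r \<in> D"
  and e: "i \<in> D ==> e i :. A" "i \<in> D ==> e i \<otimes>$A e i = e i"
  and sum_e: "(\<Oplus>$A i\<in>D. e i) = \<one>$A"
  and a: "i \<in> D ==> a i :. A" "i \<in> D ==> e i \<otimes>$A a i = a i" "i \<in> D ==> a i \<otimes>$A e r = a i"
  and b: "i \<in> D ==> b i :. A" "i \<in> D ==> e r \<otimes>$A b i = b i"
  and t: "i \<in> D ==> t i \<in> carrier (center_algebra A) - \<mm>"
  and ba: "i \<in> D ==> b i \<otimes>$A a i = t i \<otimes>$A e r"
  and ab: "i \<in> D ==> a i \<otimes>$A b i = t i \<otimes>$A e i"
  and corner: "[|c :. A; e r \<otimes>$A c \<otimes>$A e r = c|] ==> \<exists>z\<in>carrier (center_algebra A). c = z \<otimes>$A e r"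
  and v0: "v0 :. V" "v0 ~= \<zero>$V" "e r \<odot>$V v0 = v0"
  and corner_V: "[|w :. V; e r \<odot>$V w = w|] ==> \<exists>c\<in>carrier k. w = (c \<odot>$A \<one>$A) \<odot>$V v0"
  and gen: "w :. V ==> \<exists>c\<in>carrier A. w = c \<odot>$V v0"
  and noeth: "noetherian_free_modules A"
begin

lemma tT: "i \<in> D ==> t i \<in> T"
 unfolding T_def by (rule t)

definition v where "v i = a i *. v0"

lemma v_closed: "i \<in> D ==> v i :. V" "i \<in> D ==> e i *. v i = v i"
 using a v0 e by (simp_all add: v_def V.smult_assoc[symmetric])

lemma b_v: "i \<in> D ==> b i *. v i = \<chi> (t i) |> v0"
proof -
 assume i: "i \<in> D"
 have "b i *. v i = (b i ** a i) *. v0" using i a b v0 by (simp add: v_def V.smult_assoc)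
 also have "... = t i *. v0" using i tT[OF i] e D v0 by (simp add: ba V.smult_assoc)
 finally show ?thesis using T_acts[OF tT[OF i] v0(1)] by simp
qed

lemma v_generates:
 assumes i: "i \<in> D" and w: "w :. V"
 shows "\<exists>c\<in>carrier A. w = c *. v i"
proof -
 obtain c where c: "c :. A" "w = c *. v0" using gen[OF w] by blast
 note k = T_k[OF tT[OF i]]
 have "v0 = ((inv\<^bsub>k\<^esub> (\<chi> (t i)) \<odot>$A \<one>$A) ** b i) *. v i"
  using i b v_closed[OF i] k T_cancel(1)[OF tT[OF i] v0(1)] by (simp add: scalar_simps V.smult_assoc b_v)
 then have "w = c *. ((inv\<^bsub>k\<^esub> (\<chi> (t i)) \<odot>$A \<one>$A) ** b i) *. v i" using c(2) by simp
 then have wc: "w = (c ** ((inv\<^bsub>k\<^esub> (\<chi> (t i)) \<odot>$A \<one>$A) ** b i)) *. v i"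
  using c(1) b(1)[OF i] v_closed[OF i] k by (simp add: scalar_simps V.smult_assoc)
 show ?thesis by (rule bexI[where P = "%c. w = c *. v i", OF wc]) (use c(1) b(1)[OF i] k in \<open>simp add: scalar_simps\<close>)
qed

text \<open>
  Transport \<open>e i w\<close> to the line at \<open>r\<close> by \<open>b i\<close> and back by \<open>a i\<close>; this multiplies it by the non-zero
  scalar \<open>\<chi> (t i)\<close>.
\<close>

lemma vertex_line:
 assumes i: "i \<in> D" and w: "w :. V"
 shows "\<exists>c\<in>carrier k. e i *. w = c |> v i"
proof -
 let ?x = "b i *. e i *. w"
 note k = T_k[OF tT[OF i]]
 have ew: "e i *. w :. V" using e(1)[OF i] w by simp
 have x: "?x :. V" "e r *. ?x = ?x" using ew b[OF i] e(1)[OF D(2)] by (simp_all add: V.smult_assoc[symmetric])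
 obtain c where c: "c :. k" "?x = c |> v0" using corner_V[OF x] by blast
 have "a i *. ?x = (a i ** b i) *. e i *. w" using a(1)[OF i] b(1)[OF i] ew by (simp add: V.smult_assoc)
 also have "... = t i *. (e i ** e i) *. w"
  using ew w e(1)[OF i] tT[OF i] by (simp add: ab[OF i] V.smult_assoc)
 also have "... = \<chi> (t i) |> e i *. w" using T_acts[OF tT[OF i] ew] e(2)[OF i] by simp
 finally have "\<chi> (t i) |> e i *. w = c |> v i"
  unfolding c(2) v_def using scale_simps(6)[OF c(1) v0(1) a(1)[OF i]] by simp
 then have "e i *. w = inv\<^bsub>k\<^esub> (\<chi> (t i)) |> c |> v i" using T_cancel(1)[OF tT[OF i] ew] by simp
 then have "e i *. w = (inv\<^bsub>k\<^esub> (\<chi> (t i)) \<otimes>$k c) |> v i"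
  using scale_simps(5)[OF k(2) v_closed(1)[OF i] c(1)] by simp
 then show ?thesis using k c(1) by blast
qed

lemma v_kill:
 assumes i: "i \<in> D" and c: "c :. A" "c *. v i = \<zero>$V"
 shows "c ** e i \<in> annihilator A V"
proof -
 have "(c ** e i) *. w = \<zero>$V" if w: "w :. V" for w
 proof -
  obtain d where d: "d :. k" "e i *. w = d |> v i" using vertex_line[OF i w] by blast
  have "(c ** e i) *. w = c *. d |> v i" using c(1) e(1)[OF i] w by (simp add: V.smult_assoc d(2))
  also have "... = d |> c *. v i" by (rule scale_simps(6)[OF d(1) v_closed(1)[OF i] c(1)])
  finally show ?thesis by (simp add: c(2) scale_zero[OF d(1)])
 qed
 then show ?thesis using c(1) e(1)[OF i] by (simp add: annihilator_def)
qed

lemma pd_quotient: "pd A V = pd A (quot_module A (annihilator A V))"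
proof (rule pd_eq_pd_quotient_annihilator[OF V_module D(1) _ e(1) sum_e v_closed])
 show "D ~= {}" using D(2) by blast
qed (use v_generates v_kill in \<open>blast+\<close>)

lemma sum_loc_e: "(\<Oplus>$Am i\<in>D. loc (e i)) = \<one>$Am"
proof -
 interpret h: ring_hom_ring A Am loc by (rule ring_hom_ringI2[OF A.ring_axioms Am.ring_axioms loc_hom])
 have "loc (\<Oplus>$A i\<in>D. e i) = (\<Oplus>$Am i\<in>D. (loc \<circ> e) i)" by (rule h.hom_finsum) (use e in blast)
 then show ?thesis by (simp add: sum_e o_def)
qed

lemma loc_closed: "c :. A ==> loc c :. Am"
 using ring_hom_closed[OF loc_hom] .

lemma \<iota>_closed: "w :. V ==> \<iota> w :. V'"
 by (simp add: V'_carrier)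

lemma pd_quotient_loc: "pd Am V' = pd Am (quot_module Am (annihilator Am V'))"
proof (rule pd_eq_pd_quotient_annihilator[OF V'_module D(1) _ _ sum_loc_e])
 show "D ~= {}" using D(2) by blast
 fix i assume i: "i \<in> D"
 show "loc (e i) :. Am" "\<iota> (v i) :. V'" "loc (e i) \<odot>$V' \<iota> (v i) = \<iota> (v i)"
  using e(1)[OF i] v_closed[OF i] by (simp_all add: loc_closed \<iota>_closed loc_smult)
 show "\<exists>c\<in>carrier Am. x = c \<odot>$V' \<iota> (v i)" if x: "x :. V'" for x
 proof -
  obtain w where w: "w :. V" "x = \<iota> w" using x by (auto simp: V'_carrier)
  obtain c where c: "c :. A" "w = c *. v i" using v_generates[OF i w(1)] by blast
  show ?thesis by (rule bexI[OF _ loc_closed[OF c(1)]]) (simp add: w(2) c v_closed[OF i] loc_smult)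
 qed
 fix x assume x: "x :. Am" "x \<odot>$V' \<iota> (v i) = \<zero>$V'"
 obtain c s where c: "c :. A" "s \<in> T" "x = \<Phi> (fa c s)" using x(1) by (rule Am_cases)
 note k = T_k[OF c(2)]
 have cv: "c *. v i :. V" using c(1) v_closed[OF i] by simp
 have "\<iota> (inv\<^bsub>k\<^esub> (\<chi> s) |> c *. v i) = \<iota> \<zero>$V" using x(2) c(1,2) v_closed[OF i] by (simp add: c(3) V'_smult V'_zero)
 then have "inv\<^bsub>k\<^esub> (\<chi> s) |> c *. v i = \<zero>$V" using \<iota>_inj scale_simps(1)[OF k(2) cv] by blast
 then have "c *. v i = \<zero>$V" using T_cancel(2)[OF c(2) cv] scale_zero[OF k(1)] by simp
 then have "c ** e i \<in> annihilator A V" by (rule v_kill[OF i c(1)])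
 moreover have "x \<otimes>$Am loc (e i) = \<Phi> (fa (c ** e i) s)" using c(1,2) e(1)[OF i] by (simp add: c(3) loc_def Am_ops)
 ultimately show "x \<otimes>$Am loc (e i) \<in> annihilator Am V'"
  using c(2) unfolding annihilator_loc ideal_loc_eq[OF ideal_annihilator[OF V_module]] by auto
qed

text \<open>
  Any \<open>s\<close> outside \<open>\<mm>\<close> is comaximal with the annihilator: \<open>1 - s/\<chi>(s)\<close> kills \<open>V\<close>.
\<close>

lemma pd_loc: "pd A V = pd Am V'"
proof -
 have "submodule (carrier V) A V" by (rule submoduleI[OF V_module]) simp_all
 moreover have "carrier V \<subseteq> H'" if H': "submodule H' A V" "{v0} \<subseteq> H'" for H'
 proof
  fix w assume "w :. V"
  then obtain c where "c :. A" "w = c *. v0" using gen by blast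
  then show "w \<in> H'" using submodule.smult_closed[OF H'(1)] H'(2) by simp
 qed
 ultimately obtain m \<epsilon> where \<epsilon>: "\<epsilon> \<in> lmod_hom A (free_module A {..<m::nat}) V"
   "\<epsilon> ` carrier (free_module A {..<m}) = carrier V"
  using finitely_generated_free_cover[OF V_module subset_refl, of "{v0}"] v0(1) by auto
 have hom: "\<iota> \<in> lmod_hom A V (restrict_scalars loc V')"
  by (rule lmod_homI) (simp_all add: restrict_scalars_def \<iota>_closed V'_add loc_smult)
 show ?thesis
 proof (rule CL.pd_localization[OF noeth V_module V'_module hom \<iota>_bij \<epsilon>])
  fix s assume s: "s \<in> T"
  note k = T_k[OF s]
  let ?z = "inv\<^bsub>k\<^esub> (\<chi> s) \<odot>$A \<one>$A"
  let ?c = "\<one>$A \<ominus>$A ?z ** s"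
  have z: "?z :. Z" using scalar_simps(1)[OF k(2)] .
  have "\<one>$Z \<ominus>$Z ?z \<otimes>$Z s :. Z" using z s by simp
  moreover have "\<ominus>$Z (?z ** s) = \<ominus>$A (?z ** s)"
  proof (rule A.minus_equality[symmetric])
   show "\<ominus>$Z (?z ** s) \<oplus>$A (?z ** s) = \<zero>$A"
    using Z.l_neg[OF Z_ops(3)[OF z T_Z[OF s]]] by (simp add: center_simps(3,5))
  qed (use z s Z.a_inv_closed[OF Z_ops(3)[OF z T_Z[OF s]]] in simp_all)
  ultimately have c: "?c :. Z" by (simp add: a_minus_def center_simps(2-4))
  have kill: "?c *. w = \<zero>$V" if w: "w :. V" for w
  proof -
   have "(?z ** s) *. w = w" using z s w by (simp add: V.smult_assoc T_acts T_cancel)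
   moreover have "\<one>$A = ?c \<oplus>$A ?z ** s" using z s by (simp add: a_minus_def A.a_assoc A.l_neg)
   ultimately have "w = ?c *. w \<oplus>$V w"
    using V.smult_l_distr[OF Zc[OF c], of "?z ** s" w] V.smult_one[OF w] z s w by simp
   then have "\<zero>$V \<oplus>$V w = ?c *. w \<oplus>$V w" using w by simp
   then show ?thesis using V.M.add.right_cancel[of w "\<zero>$V" "?c *. w"] w Zc[OF c] by simp
  qed
  show "\<exists>z\<in>carrier A. \<exists>c\<in>annihilator A V. z ** s \<oplus>$A c = \<one>$A &
    (\<forall>x\<in>carrier A. z ** x = x ** z & c ** x = x ** c)"
  proof (intro bexI conjI ballI)
   show "?z ** s \<oplus>$A ?c = \<one>$A" using Zc[OF z] s by (simp add: a_minus_def A.a_lcomm A.r_neg)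
   show "?c \<in> annihilator A V" using kill Zc[OF c] by (simp add: annihilator_def)
  qed (use Z_comm[OF z] Z_comm[OF c] Zc[OF z] in simp_all)
 qed
qed

definition \<mu> where "\<mu> w = \<Phi> (\<iota>Z w)"

lemma \<mu>_fz: "z :. Z ==> s \<in> T ==> \<mu> (fz z s) = \<Phi> (fa z s)"
 by (simp add: \<mu>_def \<iota>Z_fz)

lemma \<mu>_hom: "\<mu> \<in> ring_hom Zm Am"
 using ring_hom_one[OF \<iota>Z_hom]
 by (intro ring_hom_memI) (simp_all add: \<mu>_def \<iota>Zh Am_mult Am_add Am_one Am_carrier)

text \<open>
  If \<open>z e\<^sub>r = 0\<close>, then \<open>t\<^sub>i z e\<^sub>i = z a\<^sub>i b\<^sub>i = a\<^sub>i (z e\<^sub>r) b\<^sub>i = 0\<close> at every vertex, and \<open>t\<^sub>i\<close> is regular.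
\<close>

lemma corner_faithful:
 assumes z: "z :. Z" "z ** e r = \<zero>$A"
 shows "z = \<zero>$A"
proof -
 have ze: "z ** e i = \<zero>$A" if i: "i \<in> D" for i
 proof (rule LA.S_regular[OF tT[OF i]])
  note c = Zc[OF z(1)] a(1)[OF i] b(1)[OF i] e(1)[OF i] e(1)[OF D(2)] T_A[OF tT[OF i]]
  have "t i ** (z ** e i) = (z ** t i) ** e i" using Z_comm[OF z(1) c(6)] c by (simp add: A.m_assoc)
  also have "... = (z ** a i) ** b i" using c by (simp add: A.m_assoc ab[OF i])
  also have "... = (a i ** z) ** (e r ** b i)" using Z_comm[OF z(1) c(2)] b(2)[OF i] by simp
  also have "... = a i ** ((z ** e r) ** b i)" using c by (simp add: A.m_assoc)
  finally show "t i ** (z ** e i) = \<zero>$A" using c by (simp add: z(2))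
 qed (use z e(1)[OF i] in simp)
 have "z = z ** (\<Oplus>$A i\<in>D. e i)" using Zc[OF z(1)] by (simp add: sum_e)
 also have "... = (\<Oplus>$A i\<in>D. z ** e i)" by (rule A.finsum_rdistr[OF D(1) Zc[OF z(1)]]) (use e in blast)
 also have "... = (\<Oplus>$A i\<in>D. \<zero>$A)" by (rule A.finsum_cong'[OF HOL.refl]) (simp_all add: ze)
 finally show ?thesis by simp
qed

sublocale FC: full_corner Am Zm \<mu> "loc (e r)" D "%i. \<Phi> (fa (a i) (t i))" "%i. loc (b i)"
proof
 note er = e(1)[OF D(2)]
 show "\<mu> \<in> ring_hom Zm Am" by (rule \<mu>_hom)
 show "\<mu> z \<otimes>$Am x = x \<otimes>$Am \<mu> z" if z: "z :. Zm" and x: "x :. Am" for z x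
 proof -
  obtain y where y: "y :. L" "x = \<Phi> y" using x by (auto simp: Am_carrier)
  show ?thesis using \<iota>Z_central[OF z y(1)] z y(1) by (simp add: \<mu>_def y(2) Am_mult \<iota>Zh)
 qed
 show "loc (e r) :. Am" "loc (e r) \<otimes>$Am loc (e r) = loc (e r)"
  using er e(2)[OF D(2)] by (simp_all add: loc_closed ring_hom_mult[OF loc_hom, symmetric])
 show "finite D" by (rule D(1))
 fix i assume i: "i \<in> D"
 note c = a(1)[OF i] b(1)[OF i] tT[OF i]
 show "\<Phi> (fa (a i) (t i)) :. Am" "loc (b i) :. Am" using c by (simp_all add: loc_closed)
 show "\<Phi> (fa (a i) (t i)) \<otimes>$Am loc (e r) = \<Phi> (fa (a i) (t i))"
  using c er a(3)[OF i] by (simp add: loc_def Am_ops)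
 show "loc (e r) \<otimes>$Am loc (b i) = loc (b i)"
  using c er b(2)[OF i] by (simp add: ring_hom_mult[OF loc_hom, symmetric])
next
 have "\<Phi> (fa (a i) (t i)) \<otimes>$Am loc (b i) = loc (e i)" if i: "i \<in> D" for i
  using a(1)[OF i] b(1)[OF i] tT[OF i] e(1)[OF i] ab[OF i] by (simp add: loc_def Am_ops)
 then show "(\<Oplus>$Am i\<in>D. \<Phi> (fa (a i) (t i)) \<otimes>$Am loc (b i)) = \<one>$Am"
  unfolding sum_loc_e[symmetric] by (intro Am.finsum_cong'[OF HOL.refl]) (use e(1) loc_closed in auto)
next
 note er = e(1)[OF D(2)] e(2)[OF D(2)]
 fix x assume x: "x :. Am" "loc (e r) \<otimes>$Am x \<otimes>$Am loc (e r) = x"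
 obtain c s where c: "c :. A" "s \<in> T" "x = \<Phi> (fa c s)" using x(1) by (rule Am_cases)
 let ?c = "e r ** c ** e r"
 have "e r ** ?c ** e r = (e r ** e r) ** c ** (e r ** e r)" using er(1) c(1) by (simp only: A.m_assoc A.m_closed)
 then have "e r ** ?c ** e r = ?c" by (simp only: er(2))
 then obtain z where z: "z :. Z" "?c = z ** e r" using corner[of ?c] er(1) c(1) by auto
 have "x = \<Phi> (fa ?c s)" using x(2) er(1) c(1,2) by (simp add: c(3) loc_def Am_ops)
 also have "... = \<mu> (fz z s) \<otimes>$Am loc (e r)" unfolding z(2) using z(1) c(2) er(1) by (simp add: \<mu>_fz loc_def Am_ops)
 finally show "\<exists>z\<in>carrier Zm. x = \<mu> z \<otimes>$Am loc (e r)" using fz_closed[OF z(1) c(2)] by blast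
next
 note er = e(1)[OF D(2)]
 fix w assume w: "w :. Zm" "\<mu> w \<otimes>$Am loc (e r) = \<zero>$Am"
 obtain z s where z: "z :. Z" "s \<in> T" "w = fz z s" using w(1) by (rule Zm_cases)
 have "\<Phi> (fa (z ** e r) s) = \<Phi> (fa \<zero>$A \<one>$A)"
  using w(2) z(1,2) er by (simp add: z(3) \<mu>_fz loc_def Am_ops Am_unit(2)[symmetric])
 then have "z ** e r = \<zero>$A" using z(1,2) er by (simp add: Am_ops)
 then have "z = \<zero>$A" by (rule corner_faithful[OF z(1)])
 then show "w = \<zero>$Zm" using z(2) by (simp add: z(3) fz_zero fz_eq Z_ops)
qed

lemma scale_inj: "[|c :. k; d :. k; c |> v0 = d |> v0|] ==> c = d"
 by (rule vector_scale_cancel[OF k.field_axioms W_module, unfolded W_simps, OF _ _ v0(1,2)])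

text \<open>
  The corner of \<open>V\<^sub>\<mm>\<close> at \<open>r\<close> is the line spanned by \<open>v0\<close>, on which \<open>Z\<^sub>\<mm>\<close> acts through the residue map.
\<close>

lemma pd_center: "pd Am V' = pd Zm F'"
proof -
 let ?C = "corner_module \<mu> (loc (e r)) V'"
 define d where "d x = (SOME c. c :. k & x = \<iota> (c |> v0))" for x
 let ?f = "%x. J +>$Zm \<kappa> (d x)"
 have C: "\<exists>c\<in>carrier k. x = \<iota> (c |> v0)" if xC: "x :. ?C" for x
 proof -
  have x: "x :. V'" "loc (e r) \<odot>$V' x = x" using xC by (simp_all add: corner_module_simps)
  obtain w where w: "w :. V" "x = \<iota> w" using x(1) by (auto simp: V'_carrier)
  have "\<iota> (e r *. w) = \<iota> w" using x(2) w e(1)[OF D(2)] by (simp add: loc_smult)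
  then have "e r *. w = w" using \<iota>_inj w(1) e(1)[OF D(2)] by simp
  then show ?thesis using corner_V[OF w(1)] w(2) by blast
 qed
 have C': "\<iota> (c |> v0) :. ?C" if c: "c :. k" for c
  using scale_simps(1,6)[OF c v0(1)] e(1)[OF D(2)] v0(3) by (simp add: corner_module_simps \<iota>_closed loc_smult)
 have d: "d (\<iota> (c |> v0)) = c" if c: "c :. k" for c
 proof -
  have "\<exists>c'. c' :. k & \<iota> (c |> v0) = \<iota> (c' |> v0)" using c by blast
  from someI_ex[OF this] have "d (\<iota> (c |> v0)) :. k" "\<iota> (c |> v0) = \<iota> (d (\<iota> (c |> v0)) |> v0)"
   unfolding d_def[symmetric] by blast+
  then show ?thesis using c v0(1) scale_inj \<iota>_inj scale_simps(1) by metis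
 qed
 have hom: "?f \<in> lmod_hom Zm ?C F'"
 proof (rule lmod_homI)
  fix x assume "x :. ?C"
  then obtain c where c: "c :. k" "x = \<iota> (c |> v0)" using C by blast
  note cv = scale_simps(1)[OF c(1) v0(1)]
  show "?f x :. F'" by (simp add: c d F'_ops)
  show "?f (x \<oplus>$(?C) y) = ?f x \<oplus>$F' ?f y" if y: "y :. ?C" for y
  proof -
   obtain c' where c': "c' :. k" "y = \<iota> (c' |> v0)" using C[OF y] by blast
   have "x \<oplus>$(?C) y = \<iota> ((c \<oplus>$k c') |> v0)"
    using cv scale_simps(1)[OF c'(1) v0(1)] scale_simps(4)[OF c(1) v0(1) c'(1)]
    by (simp add: corner_module_simps c(2) c'(2) V'_add)
   then show ?thesis using c(1) c'(1) by (simp add: d F'_ops c(2) c'(2))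
  qed
  fix w assume "w :. Zm"
  then obtain z s where w: "z :. Z" "s \<in> T" "w = fz z s" by (rule Zm_cases)
  note k = T_k[OF w(2)] \<chi>_simps(1)[OF w(1)]
  have "w \<odot>$(?C) x = \<iota> (inv\<^bsub>k\<^esub> (\<chi> s) |> \<chi> z |> c |> v0)"
   using w(1,2) cv V_\<chi>[OF w(1) cv] by (simp add: corner_module_simps w(3) c(2) \<mu>_fz V'_smult)
  also have "... = \<iota> ((\<rho> w \<otimes>$k c) |> v0)"
   using w(1,2) k c(1) v0(1) cv by (simp add: w(3) \<rho>_fz scale_simps(5)[symmetric] k.m_comm[of "\<chi> z"] k.m_assoc)
  finally show "?f (w \<odot>$(?C) x) = w \<odot>$F' ?f x"
   using c(1) \<rho>_closed[OF fz_closed[OF w(1,2)]] fz_closed[OF w(1,2)] by (simp add: c(2) d F'_ops w(3))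
 qed
 have bij: "bij_betw ?f (carrier ?C) (carrier F')"
 proof (rule bij_betw_imageI[OF inj_onI])
  fix x y assume "x :. ?C" "y :. ?C" and eq: "?f x = ?f y"
  then obtain c c' where c: "c :. k" "x = \<iota> (c |> v0)" "c' :. k" "y = \<iota> (c' |> v0)" using C by metis
  have "\<omega> (?f x) = \<omega> (?f y)" using eq by simp
  then show "x = y" using c(1,3) by (simp add: c(2,4) d F'_ops)
 next
  have "Y \<in> ?f ` carrier ?C" if Y: "Y :. F'" for Y
  proof -
   obtain c where c: "c :. k" "Y = J +>$Zm \<kappa> c" using Y by (rule F'_cases)
   show ?thesis by (rule image_eqI[OF _ C'[OF c(1)]]) (simp add: c d)
  qed
  then show "?f ` carrier ?C = carrier F'" using lmod_hom_closed[OF hom] by blast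
 qed
 show ?thesis
  by (rule FC.pd_corner[OF V'_module left_module_quot_module[OF ideal_J] hom bij])
qed

theorem pd_chain:
 "pd A V = pd Am V'"
 "pd Am V' = pd A (quot_module A (annihilator A V))"
 "pd A (quot_module A (annihilator A V)) = pd Am (quot_module Am (ideal_loc A \<mm> (annihilator A V)))"
 "pd Am (quot_module Am (ideal_loc A \<mm> (annihilator A V))) = pd Zm F'"
 using pd_loc pd_quotient pd_quotient_loc pd_center by (simp_all add: annihilator_loc)

end

section \<open>Linear algebra and maximal ideals\<close>

text \<open>
  Gaussian elimination: a row with a non-zero entry \<open>m s l\<close> expresses \<open>x l\<close> by the other unknowns.
\<close>

lemma (in field) homogeneous_system:
 assumes "finite S" "finite D" "card S < card D" "!!s j. s \<in> S ==> j \<in> D ==> m s j :. R"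
 shows "\<exists>x. (\<forall>j\<in>D. x j :. R) & (\<exists>j\<in>D. x j ~= \<zero>) & (\<forall>s\<in>S. (\<Oplus>j\<in>D. m s j \<otimes> x j) = \<zero>)"
 using assms
proof (induct S arbitrary: D m rule: finite_induct)
 case empty
 then obtain j where "j \<in> D" by fastforce
 then show ?case using one_not_zero by (intro exI[of _ "%_. \<one>"]) auto
next
 case (insert s S D m)
 show ?case
 proof (cases "\<exists>j\<in>D. m s j ~= \<zero>")
  case False
  have "card S < card D" using insert(1,2,5) by simp
  then obtain x where x: "\<forall>j\<in>D. x j :. R" "\<exists>j\<in>D. x j ~= \<zero>" "\<forall>s\<in>S. (\<Oplus>j\<in>D. m s j \<otimes> x j) = \<zero>"
   using insert(3)[OF insert(4), of m] insert(6) by auto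
  have "(\<Oplus>j\<in>D. m s j \<otimes> x j) = (\<Oplus>j\<in>D. \<zero>)" by (rule finsum_cong'[OF HOL.refl]) (use False x(1) in auto)
  then show ?thesis using x by (intro exI[of _ x]) auto
 next
  case True
  then obtain l where l: "l \<in> D" "m s l ~= \<zero>" by blast
  define p where "p = inv (m s l)"
  have ml: "m s l :. R" using insert(6)[of s l] l by simp
  have p: "p :. R" "m s l \<otimes> p = \<one>" using field_Units ml l(2) by (simp_all add: p_def)
  let ?D = "D - {l}" and ?m = "%s' j. m s' j \<ominus> (m s' l \<otimes> p) \<otimes> m s j"
  have mc: "m s' j :. R" if "s' = s \<or> s' \<in> S" "j \<in> D" for s' j using insert(6) that by blast
  have "card S < card ?D" using insert(1,2,4,5) l(1) by simp
  then obtain x where x: "\<forall>j\<in>?D. x j :. R" "\<exists>j\<in>?D. x j ~= \<zero>" "\<forall>s\<in>S. (\<Oplus>j\<in>?D. ?m s j \<otimes> x j) = \<zero>"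
   using insert(3)[of ?D ?m] insert(4) mc l(1) p(1) by auto
  let ?\<Sigma> = "%s'. \<Oplus>j\<in>?D. m s' j \<otimes> x j"
  have xc: "x j :. R" if "j \<in> D" "j ~= l" for j using x(1) that by blast
  have \<Sigma>c: "?\<Sigma> s' :. R" if "s' = s \<or> s' \<in> S" for s' by (rule finsum_closed) (use mc[OF that] xc in auto)
  define y where "y j = (if j = l then \<ominus> (p \<otimes> ?\<Sigma> s) else x j)" for j
  have yc: "y j :. R" if "j \<in> D" for j using xc that p(1) \<Sigma>c[of s] by (simp add: y_def)
  have expand: "(\<Oplus>j\<in>D. m s' j \<otimes> y j) = m s' l \<otimes> \<ominus> (p \<otimes> ?\<Sigma> s) \<oplus> ?\<Sigma> s'" if s': "s' = s \<or> s' \<in> S" for s'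
  proof -
   have "(\<Oplus>j\<in>insert l ?D. m s' j \<otimes> y j) = m s' l \<otimes> y l \<oplus> (\<Oplus>j\<in>?D. m s' j \<otimes> y j)"
    by (rule finsum_insert) (use insert(4) mc[OF s'] yc l(1) in auto)
   moreover have "(\<Oplus>j\<in>?D. m s' j \<otimes> y j) = ?\<Sigma> s'"
    by (rule finsum_cong'[OF HOL.refl]) (use mc[OF s'] xc in \<open>auto simp: y_def\<close>)
   ultimately show ?thesis using l(1) by (simp add: insert_absorb y_def)
  qed
  have "(\<Oplus>j\<in>D. m s' j \<otimes> y j) = \<zero>" if s': "s' \<in> insert s S" for s'
  proof (cases "s' = s")
   case True
   have "m s l \<otimes> \<ominus> (p \<otimes> ?\<Sigma> s) = \<ominus> ((m s l \<otimes> p) \<otimes> ?\<Sigma> s)" using ml p(1) \<Sigma>c[of s] by (simp add: r_minus m_assoc)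
   then show ?thesis using True \<Sigma>c[of s] expand[of s] by (simp add: p(2) l_neg)
  next
   case False
   then have S: "s' \<in> S" using s' by simp
   let ?c = "m s' l \<otimes> p"
   have c: "?c :. R" "\<ominus> ?c :. R" using mc[of s' l] S l(1) p(1) by simp_all
   have "\<zero> = (\<Oplus>j\<in>?D. ?m s' j \<otimes> x j)" using x(3) S by simp
   also have "... = (\<Oplus>j\<in>?D. m s' j \<otimes> x j \<oplus> \<ominus> ?c \<otimes> (m s j \<otimes> x j))"
    by (rule finsum_cong'[OF HOL.refl]) (use mc[of s'] mc[of s] S xc c in \<open>auto simp: a_minus_def l_distr l_minus m_assoc[of ?c]\<close>)
   also have "... = ?\<Sigma> s' \<oplus> (\<Oplus>j\<in>?D. \<ominus> ?c \<otimes> (m s j \<otimes> x j))"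
    by (rule finsum_addf) (use mc[of s'] mc[of s] S xc c in auto)
   also have "(\<Oplus>j\<in>?D. \<ominus> ?c \<otimes> (m s j \<otimes> x j)) = \<ominus> ?c \<otimes> ?\<Sigma> s"
    by (rule finsum_rdistr[symmetric]) (use insert(4) mc[of s] xc c in auto)
   also have "\<ominus> ?c \<otimes> ?\<Sigma> s = m s' l \<otimes> \<ominus> (p \<otimes> ?\<Sigma> s)"
    using mc[of s' l] S l(1) p(1) \<Sigma>c[of s] by (simp add: r_minus l_minus m_assoc)
   finally have "?\<Sigma> s' \<oplus> m s' l \<otimes> \<ominus> (p \<otimes> ?\<Sigma> s) = \<zero>" by simp
   then show ?thesis using expand[of s'] S \<Sigma>c[of s'] \<Sigma>c[of s] mc[of s' l] l(1) p(1) by (simp add: a_comm)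
  qed
  moreover have "\<exists>j\<in>D. y j ~= \<zero>" using x(2) by (auto simp: y_def)
  ultimately show ?thesis using yc by blast
 qed
qed

lemma maximalideal_of_inverses:
 assumes "cring R" "ideal P R" "\<one>$R \<notin> P"
  and inv: "!!x. x :. R ==> x \<notin> P ==> \<exists>y\<in>carrier R. \<one>$R \<ominus>$R y \<otimes>$R x \<in> P"
 shows "maximalideal P R"
proof (rule maximalidealI[OF assms(2)])
 interpret R: cring R by fact
 show "carrier R ~= P" using assms(3) R.one_closed by blast
 fix H assume H: "ideal H R" "P \<subseteq> H" "H \<subseteq> carrier R"
 show "H = P \<or> H = carrier R"
 proof (cases "H \<subseteq> P")
  case False
  then obtain x where x: "x \<in> H" "x \<notin> P" by blast
  then obtain y where y: "y :. R" "\<one>$R \<ominus>$R y \<otimes>$R x \<in> P" using inv[of x] H(3) by blast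
  interpret H: ideal H R by fact
  have xR: "x :. R" using x H(3) by blast
  have "\<one>$R \<ominus>$R y \<otimes>$R x \<oplus>$R y \<otimes>$R x \<in> H" using y x(1) H(2) by (intro H.a_closed H.I_l_closed) auto
  moreover have "\<one>$R \<ominus>$R y \<otimes>$R x \<oplus>$R y \<otimes>$R x = \<one>$R" using y(1) xR by (simp add: a_minus_def R.a_assoc R.l_neg)
  ultimately show ?thesis using H.one_imp_carrier by simp
 qed (use H in blast)
qed

lemma maximal_quotient_is_base_field:
 assumes k: "algebraically_closed k" and B: "algebra k B" "fin_gen_algebra k B" and q: "maximalideal \<qq> B"
  and b: "b :. B"
 shows "\<exists>c\<in>carrier k. b \<ominus>$B c \<odot>$B \<one>$B \<in> \<qq>"
proof -
 interpret k: algebraically_closed k by (rule k)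
 interpret B: algebra k B by (rule B)
 interpret q: maximalideal \<qq> B by (rule q)
 let ?K = "B Quot \<qq>"
 interpret K: field ?K by (rule q.quotient_is_field) (rule B.cring_axioms)
 note h = ring_hom_closed[OF q.rcos_ring_hom] ring_hom_mult[OF q.rcos_ring_hom] ring_hom_add[OF q.rcos_ring_hom]
  ring_hom_one[OF q.rcos_ring_hom]
 have scal: "(%c. c \<odot>$B \<one>$B) \<in> ring_hom k B"
  by (rule ring_hom_memI) (simp_all add: B.smult_assoc2 B.smult_assoc1 B.smult_l_distr)
 let ?\<kappa> = "%c. \<qq> +>$B (c \<odot>$B \<one>$B)"
 have \<kappa>: "?\<kappa> \<in> ring_hom k ?K" using ring_hom_trans[OF scal q.rcos_ring_hom] by (simp add: o_def)
 obtain S where S: "finite S" "S \<subseteq> carrier B" "generate_ring B (S \<union> (%c. c \<odot>$B \<one>$B) ` carrier k) = carrier B"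
  using B(2) unfolding fin_gen_algebra_def by blast
 interpret h: ring_hom_ring B ?K "(+>$B) \<qq>"
  by (rule ring_hom_ringI2[OF B.ring_axioms K.ring_axioms q.rcos_ring_hom])
 let ?G = "S \<union> (%c. c \<odot>$B \<one>$B) ` carrier k"
 have "x :. B & \<qq> +>$B x \<in> generate_ring ?K (((+>$B) \<qq>) ` S \<union> ?\<kappa> ` carrier k)" if "x \<in> generate_ring B ?G" for x
  using that
 proof (induct rule: generate_ring.induct)
  case one then show ?case using h(4) generate_ring.one[of ?K] by simp
 next
  case (incl x)
  then show ?case using S(2) by (auto intro!: generate_ring.incl)
 next
  case (a_inv x) then show ?case by (simp add: generate_ring.a_inv)
 next
  case (eng_add x y) then show ?case by (simp add: h(3) generate_ring.eng_add)
 next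
  case (eng_mult x y) then show ?case by (simp add: h(2) generate_ring.eng_mult)
 qed
 note gen = this
 have K: "carrier ?K = (%x. \<qq> +>$B x) ` carrier B"
  unfolding FactRing_def partial_object.simps A_RCOSETS_def' by (rule UNION_singleton_eq_range)
 have "carrier ?K \<subseteq> generate_ring ?K (((+>$B) \<qq>) ` S \<union> ?\<kappa> ` carrier k)"
  unfolding K by (rule image_subsetI) (rule conjunct2[OF gen[unfolded S(3)]])
 moreover have "generate_ring ?K (((+>$B) \<qq>) ` S \<union> ?\<kappa> ` carrier k) \<subseteq> carrier ?K"
  by (rule K.generate_ring_incl) (use S(2) h(1) ring_hom_closed[OF \<kappa>] in blast)
 ultimately have "?\<kappa> ` carrier k = carrier ?K"
  by (intro weak_nullstellensatz[OF K.field_axioms k \<kappa>, of "((+>$B) \<qq>) ` S"]) (use S(1,2) h(1) in auto)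
 then obtain c where c: "c :. k" "\<qq> +>$B b = ?\<kappa> c" using h(1)[OF b] by blast
 then show ?thesis using quot_module_coset(5)[OF q.ideal_axioms b, of "c \<odot>$B \<one>$B"] by blast
qed

section \<open>Algebras with an impression whose diagonal corners agree\<close>

text \<open>
  What is used of a quiver algebra and its impression: vertex idempotents, and equality of the
  images of the diagonal corners in \<open>B\<close>.
\<close>

locale corner_impression =
 k: algebraically_closed k + A: ring A + B: domain B
 for k :: "('k, 's) ring_scheme" and A :: "('k, 'a) module" and B :: "('k, 'b) module" +
 fixes D :: "'v set" and \<tau> :: "'a => 'v \<times> 'v => 'b" and e :: "'v => 'a"
 assumes scalar_hom: "(%c. c \<odot>$A \<one>$A) \<in> ring_hom k A"
  and scalar_mult: "[|c :. k; a :. A|] ==> c \<odot>$A a = (c \<odot>$A \<one>$A) \<otimes>$A a"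
  and scalar_central: "[|c :. k; a :. A|] ==> (c \<odot>$A \<one>$A) \<otimes>$A a = a \<otimes>$A (c \<odot>$A \<one>$A)"
  and impression: "impression k A D \<tau> B"
  and e_A: "i \<in> D ==> e i :. A" and \<tau>_e: "i \<in> D ==> \<tau> (e i) = mat_entry B D i i \<one>$B"
  and corners: "[|i \<in> D; j \<in> D|] ==> tau_bar B D \<tau> i i ` corner A (e i) (e i) = tau_bar B D \<tau> j j ` corner A (e j) (e j)"
begin

abbreviation mA (infixl "**" 70) where "a ** b \<equiv> a \<otimes>$A b"

lemma pre: "algebra k B" "fin_gen_algebra k B" "finite D" "\<tau> \<in> algebra_hom k A (mat_algebra B D)" "inj_on \<tau> (carrier A)"
 using impression unfolding impression_def pre_impression_def by blast+

sublocale kB: algebra k B by (rule pre(1))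

lemma entry_closed [simp]: "[|a :. A; i \<in> D; j \<in> D|] ==> \<tau> a (i, j) :. B"
 using pre(4) unfolding algebra_hom_def ring_hom_def mat_algebra_def by (auto simp: Pi_def PiE_def)

lemma entry_mult: "[|a :. A; b :. A; i \<in> D; j \<in> D|] ==>
  \<tau> (a ** b) (i, j) = (\<Oplus>$B l\<in>D. \<tau> a (i, l) \<otimes>$B \<tau> b (l, j))"
 and entry_add: "[|a :. A; b :. A; i \<in> D; j \<in> D|] ==> \<tau> (a \<oplus>$A b) (i, j) = \<tau> a (i, j) \<oplus>$B \<tau> b (i, j)"
 and entry_scalar: "[|c :. k; i \<in> D; j \<in> D|] ==>
  \<tau> (c \<odot>$A \<one>$A) (i, j) = (if i = j then c \<odot>$B \<one>$B else \<zero>$B)"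
 and entry_one: "[|i \<in> D; j \<in> D|] ==> \<tau> \<one>$A (i, j) = (if i = j then \<one>$B else \<zero>$B)"
 using pre(4) unfolding algebra_hom_def ring_hom_def by (simp_all add: mat_algebra_def kB.smult_r_null)

lemma entry_e: "[|l \<in> D; i \<in> D; j \<in> D|] ==> \<tau> (e l) (i, j) = (if i = l & j = l then \<one>$B else \<zero>$B)"
 by (auto simp: \<tau>_e mat_entry_def)

lemma entry_zero: "[|i \<in> D; j \<in> D|] ==> \<tau> \<zero>$A (i, j) = \<zero>$B"
 using entry_add[of "\<zero>$A" "\<zero>$A" i j] entry_closed[of "\<zero>$A" i j] by simp

lemma \<tau>_extensional: "a :. A ==> \<tau> a \<in> extensional (D \<times> D)"
 using pre(4) unfolding algebra_hom_def ring_hom_def mat_algebra_def by (auto simp: PiE_def)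

lemma matrix_eqI:
 "[|a :. A; M \<in> extensional (D \<times> D); !!i j. i \<in> D ==> j \<in> D ==> \<tau> a (i, j) = M (i, j)|] ==> \<tau> a = M"
 by (rule extensionalityI[OF \<tau>_extensional]) auto

lemma entry_eqI:
 assumes "a :. A" "b :. A" "!!i j. i \<in> D ==> j \<in> D ==> \<tau> a (i, j) = \<tau> b (i, j)"
 shows "a = b"
proof (rule inj_onD[OF pre(5) _ assms(1,2)])
 show "\<tau> a = \<tau> b" by (rule matrix_eqI[OF assms(1)]) (use \<tau>_extensional[OF assms(2)] assms(3) in simp_all)
qed

lemma entry_left: "[|l \<in> D; a :. A; i \<in> D; j \<in> D|] ==> \<tau> (e l ** a) (i, j) = (if i = l then \<tau> a (l, j) else \<zero>$B)"
proof -
 assume l: "l \<in> D" "a :. A" "i \<in> D" "j \<in> D"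
 have "\<tau> (e l ** a) (i, j) = (\<Oplus>$B p\<in>D. if l = p then (if i = l then \<tau> a (p, j) else \<zero>$B) else \<zero>$B)"
  unfolding entry_mult[OF e_A[OF l(1)] l(2-4)]
  by (rule B.finsum_cong'[OF HOL.refl]) (use l in \<open>auto simp: entry_e\<close>)
 also have "... = (if i = l then \<tau> a (l, j) else \<zero>$B)"
  by (rule B.add.finprod_singleton[OF l(1) pre(3)]) (use l in auto)
 finally show ?thesis .
qed

lemma entry_right: "[|l \<in> D; a :. A; i \<in> D; j \<in> D|] ==> \<tau> (a ** e l) (i, j) = (if j = l then \<tau> a (i, l) else \<zero>$B)"
proof -
 assume l: "l \<in> D" "a :. A" "i \<in> D" "j \<in> D"
 have "\<tau> (a ** e l) (i, j) = (\<Oplus>$B p\<in>D. if l = p then (if j = l then \<tau> a (i, p) else \<zero>$B) else \<zero>$B)"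
  unfolding entry_mult[OF l(2) e_A[OF l(1)] l(3,4)]
  by (rule B.finsum_cong'[OF HOL.refl]) (use l in \<open>auto simp: entry_e\<close>)
 also have "... = (if j = l then \<tau> a (i, l) else \<zero>$B)"
  by (rule B.add.finprod_singleton[OF l(1) pre(3)]) (use l in auto)
 finally show ?thesis .
qed

lemma entry_corner: "[|l \<in> D; m \<in> D; a :. A; i \<in> D; j \<in> D|] ==>
  \<tau> (e l ** a ** e m) (i, j) = (if i = l & j = m then \<tau> a (l, m) else \<zero>$B)"
 by (simp add: entry_left entry_right e_A)

lemma entry_sum:
 "[|finite S; !!x. x \<in> S ==> h x :. A; i \<in> D; j \<in> D|] ==> \<tau> (\<Oplus>$A x\<in>S. h x) (i, j) = (\<Oplus>$B x\<in>S. \<tau> (h x) (i, j))"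
proof (induct rule: finite_induct)
 case (insert x F)
 have "(\<Oplus>$A x\<in>insert x F. h x) = h x \<oplus>$A (\<Oplus>$A x\<in>F. h x)" by (rule A.finsum_insert) (use insert in auto)
 moreover have "(\<Oplus>$B x\<in>insert x F. \<tau> (h x) (i, j)) = \<tau> (h x) (i, j) \<oplus>$B (\<Oplus>$B x\<in>F. \<tau> (h x) (i, j))"
  by (rule B.finsum_insert) (use insert in auto)
 moreover have "(\<Oplus>$A x\<in>F. h x) :. A" by (rule A.finsum_closed) (use insert in auto)
 ultimately show ?case using insert by (simp add: entry_add)
qed (simp add: entry_zero)

text \<open>
  The element \<open>z\<close> of \<open>A\<close> becomes the scalar matrix \<open>f 1\<close>.
\<close>

definition scal where
 "scal z f \<longleftrightarrow> z :. A & f :. B & (\<forall>i\<in>D. \<forall>j\<in>D. \<tau> z (i, j) = (if i = j then f else \<zero>$B))"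

lemma scal_mult_entry:
 assumes "scal z f" "a :. A" "i \<in> D" "j \<in> D"
 shows "\<tau> (z ** a) (i, j) = f \<otimes>$B \<tau> a (i, j)" and "\<tau> (a ** z) (i, j) = f \<otimes>$B \<tau> a (i, j)"
proof -
 have z: "z :. A" "f :. B" "!!i j. i \<in> D ==> j \<in> D ==> \<tau> z (i, j) = (if i = j then f else \<zero>$B)"
  using assms(1) by (simp_all add: scal_def)
 have "\<tau> (z ** a) (i, j) = (\<Oplus>$B l\<in>D. if i = l then f \<otimes>$B \<tau> a (l, j) else \<zero>$B)"
  unfolding entry_mult[OF z(1) assms(2-4)]
  by (rule B.finsum_cong'[OF HOL.refl]) (use assms(2-4) z(2) in \<open>auto simp: z(3)\<close>)
 also have "... = f \<otimes>$B \<tau> a (i, j)"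
  by (rule B.add.finprod_singleton[OF assms(3) pre(3)]) (use assms z(2) in auto)
 finally show "\<tau> (z ** a) (i, j) = f \<otimes>$B \<tau> a (i, j)" .
 have "\<tau> (a ** z) (i, j) = (\<Oplus>$B l\<in>D. if j = l then f \<otimes>$B \<tau> a (i, l) else \<zero>$B)"
  unfolding entry_mult[OF assms(2) z(1) assms(3,4)]
  by (rule B.finsum_cong'[OF HOL.refl]) (use assms(2-4) z(2) in \<open>auto simp: z(3) B.m_comm\<close>)
 also have "... = f \<otimes>$B \<tau> a (i, j)"
  by (rule B.add.finprod_singleton[OF assms(4) pre(3)]) (use assms z(2) in auto)
 finally show "\<tau> (a ** z) (i, j) = f \<otimes>$B \<tau> a (i, j)" .
qed

lemma scal_central: "scal z f ==> a :. A ==> z ** a = a ** z"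
 by (rule entry_eqI) (simp_all add: scal_mult_entry, simp_all add: scal_def)

lemma scal_center: "scal z f ==> z :. (center_algebra A)"
 unfolding center_simps using scal_central by (auto simp: scal_def)

lemma scal_unique: "scal z f ==> scal z' f ==> z = z'"
 by (rule entry_eqI) (simp_all add: scal_def)

lemma scal_ops:
 "scal z f ==> scal z' f' ==> scal (z ** z') (f \<otimes>$B f')"
 "scal z f ==> scal z' f' ==> scal (z \<oplus>$A z') (f \<oplus>$B f')"
 "c :. k ==> scal (c \<odot>$A \<one>$A) (c \<odot>$B \<one>$B)"
 "scal \<one>$A \<one>$B" "scal \<zero>$A \<zero>$B"
proof -
 assume z: "scal z f" "scal z' f'"
 then have c: "z :. A" "z' :. A" "f :. B" "f' :. B" by (simp_all add: scal_def)
 show "scal (z ** z') (f \<otimes>$B f')" using c z(2) scal_mult_entry(1)[OF z(1) c(2)] by (simp add: scal_def)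
 show "scal (z \<oplus>$A z') (f \<oplus>$B f')" using c z by (simp add: scal_def entry_add)
qed (use ring_hom_closed[OF scalar_hom] in \<open>simp_all add: scal_def entry_scalar entry_one entry_zero\<close>)

lemma scal_neg: "scal z f ==> scal (\<ominus>$A z) (\<ominus>$B f)"
proof -
 assume z: "scal z f"
 then have c: "z :. A" "f :. B" by (simp_all add: scal_def)
 have "\<tau> (\<ominus>$A z) (i, j) = \<ominus>$B \<tau> z (i, j)" if "i \<in> D" "j \<in> D" for i j
  by (rule B.minus_equality[symmetric])
   (use that c entry_add[of "\<ominus>$A z" z i j] in \<open>simp_all add: A.l_neg entry_zero\<close>)
 then show ?thesis using z c by (simp add: scal_def)
qed

text \<open>
  Take at each vertex \<open>l\<close> an element with the given diagonal entry, which exists as the corners agree, and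
  add up their parts in the corners \<open>e\<^sub>l A e\<^sub>l\<close>.
\<close>

lemma scal_exists:
 assumes a: "a :. A" and i: "i \<in> D"
 shows "\<exists>z. scal z (\<tau> a (i, i))"
proof -
 have bar: "tau_bar B D \<tau> l l (e l ** x ** e l) = \<tau> x (l, l)" if l: "l \<in> D" and x: "x :. A" for l x
  unfolding tau_bar_def
 proof (rule the_equality)
  show "\<tau> x (l, l) :. B & \<tau> (e l ** x ** e l) = mat_entry B D l l (\<tau> x (l, l))"
  proof
   show "\<tau> (e l ** x ** e l) = mat_entry B D l l (\<tau> x (l, l))"
    by (rule matrix_eqI) (use l x e_A[OF l] in \<open>auto simp: mat_entry_def entry_corner\<close>)
  qed (use l x in simp)
  fix b assume "b :. B & \<tau> (e l ** x ** e l) = mat_entry B D l l b"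
  then have "\<tau> (e l ** x ** e l) (l, l) = b" using l by (simp add: mat_entry_def)
  then show "b = \<tau> x (l, l)" using l x by (simp add: entry_corner)
 qed
 have im: "tau_bar B D \<tau> l l ` corner A (e l) (e l) = (%x. \<tau> x (l, l)) ` carrier A" if "l \<in> D" for l
  unfolding corner_def using bar[OF that] by force
 have "\<exists>g\<in>carrier A. \<tau> g (l, l) = \<tau> a (i, i)" if "l \<in> D" for l
 proof -
  have "\<tau> a (i, i) \<in> (%x. \<tau> x (l, l)) ` carrier A"
   using corners[OF i that] a unfolding im[OF i] im[OF that] by blast
  then show ?thesis by auto
 qed
 then obtain g where g: "!!l. l \<in> D ==> g l :. A" "!!l. l \<in> D ==> \<tau> (g l) (l, l) = \<tau> a (i, i)" by metis
 have gc: "e l ** g l ** e l :. A" if "l \<in> D" for l using g(1) e_A that by simp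
 have "\<tau> (\<Oplus>$A l\<in>D. e l ** g l ** e l) (p, q) = (if p = q then \<tau> a (i, i) else \<zero>$B)" if "p \<in> D" "q \<in> D" for p q
 proof -
  have "\<tau> (\<Oplus>$A l\<in>D. e l ** g l ** e l) (p, q) = (\<Oplus>$B l\<in>D. \<tau> (e l ** g l ** e l) (p, q))"
   by (rule entry_sum[OF pre(3) gc that])
  also have "... = (\<Oplus>$B l\<in>D. if p = l then (if p = q then \<tau> a (i, i) else \<zero>$B) else \<zero>$B)"
   by (rule B.finsum_cong'[OF HOL.refl]) (use a i that g in \<open>auto simp: entry_corner\<close>)
  also have "... = (if p = q then \<tau> a (i, i) else \<zero>$B)"
   by (rule B.add.finprod_singleton[OF that(1) pre(3)]) (use a i in auto)
  finally show ?thesis .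
 qed
 moreover have "(\<Oplus>$A l\<in>D. e l ** g l ** e l) :. A" by (rule A.finsum_closed) (use gc in auto)
 ultimately show ?thesis using a i by (auto simp: scal_def)
qed

lemma e_mult: "i \<in> D ==> j \<in> D ==> e i ** e j = (if i = j then e i else \<zero>$A)"
 by (rule entry_eqI) (auto simp: e_A entry_left entry_e entry_zero)

lemma sum_e: "(\<Oplus>$A i\<in>D. e i) = \<one>$A"
proof (rule entry_eqI)
 show "(\<Oplus>$A i\<in>D. e i) :. A" by (rule A.finsum_closed) (use e_A in auto)
 fix p q assume pq: "p \<in> D" "q \<in> D"
 have "\<tau> (\<Oplus>$A i\<in>D. e i) (p, q) = (\<Oplus>$B l\<in>D. \<tau> (e l) (p, q))" by (rule entry_sum[OF pre(3) e_A pq])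
 also have "... = (\<Oplus>$B l\<in>D. if p = l then (if p = q then \<one>$B else \<zero>$B) else \<zero>$B)"
  by (rule B.finsum_cong'[OF HOL.refl]) (use pq in \<open>auto simp: entry_e\<close>)
 also have "... = (if p = q then \<one>$B else \<zero>$B)" by (rule B.add.finprod_singleton[OF pq(1) pre(3)]) auto
 finally show "\<tau> (\<Oplus>$A i\<in>D. e i) (p, q) = \<tau> \<one>$A (p, q)" using pq by (simp add: entry_one)
qed simp

lemma corner_scalar:
 assumes "a :. A" "i \<in> D" "scal z (\<tau> a (i, i))"
 shows "e i ** a ** e i = z ** e i"
proof (rule entry_eqI)
 have z: "z :. A" using assms(3) by (simp add: scal_def)
 show "e i ** a ** e i :. A" "z ** e i :. A" using assms(1) z e_A[OF assms(2)] by simp_all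
 show "\<tau> (e i ** a ** e i) (p, q) = \<tau> (z ** e i) (p, q)" if "p \<in> D" "q \<in> D" for p q
  using that assms e_A[OF assms(2)] scal_mult_entry(1)[OF assms(3) e_A[OF assms(2)]]
  by (simp add: entry_corner entry_e)
qed

end


lemma (in left_module) finsum_smult:
 "[|finite S; !!i. i \<in> S ==> f i :. R; x :. M|] ==>
  (\<Oplus>$R i\<in>S. f i) \<odot>$M x = (\<Oplus>$M i\<in>S. f i \<odot>$M x)"
proof (induct rule: finite_induct)
 case (insert i S)
 have "(\<Oplus>$R i\<in>insert i S. f i) = f i \<oplus>$R (\<Oplus>$R i\<in>S. f i)" by (rule R.finsum_insert) (use insert in auto)
 moreover have "(\<Oplus>$M i\<in>insert i S. f i \<odot>$M x) = f i \<odot>$M x \<oplus>$M (\<Oplus>$M i\<in>S. f i \<odot>$M x)"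
  by (rule M.finsum_insert) (use insert in auto)
 moreover have "(\<Oplus>$R i\<in>S. f i) :. R" by (rule R.finsum_closed) (use insert in auto)
 ultimately show ?case using insert by (simp add: smult_l_distr)
qed (simp add: smult_zeros)

lemma simple_module_cyclic:
 assumes "simple_module R M" "w :. M" "w ~= \<zero>$M" "u :. M"
 shows "\<exists>a\<in>carrier R. u = a \<odot>$M w"
proof -
 interpret M: left_module R M using assms(1) by (simp add: simple_module_def)
 let ?H = "(%a. a \<odot>$M w) ` carrier R"
 have "submodule ?H R M"
 proof (rule submoduleI[OF M.left_module_axioms])
  show "\<zero>$M \<in> ?H" using assms(2) by (intro image_eqI[of _ _ "\<zero>$R"]) (simp_all add: M.smult_zeros)
  show "x \<oplus>$M y \<in> ?H" if "x \<in> ?H" "y \<in> ?H" for x y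
   using that assms(2) by (auto simp: M.smult_l_distr[symmetric])
  show "r \<odot>$M x \<in> ?H" if "r :. R" "x \<in> ?H" for r x
   using that assms(2) by (auto simp: M.smult_assoc[symmetric])
 qed (use assms(2) in auto)
 moreover have "w \<in> ?H" using assms(2) by (intro image_eqI[of _ _ "\<one>$R"]) simp_all
 ultimately have "?H = carrier M" using assms(1,3) unfolding simple_module_def by blast
 then show ?thesis using assms(4) by auto
qed

locale corner_impression_module = corner_impression k A B D \<tau> e
 for k :: "('k, 's) ring_scheme" and A :: "('k, 'a) module" and B :: "('k, 'b) module"
  and D :: "'v set" and \<tau> e +
 fixes V :: "('a, 'm) module"
 assumes simple: "simple_module A V"
begin

abbreviation act (infixr "*." 75) where "a *. v \<equiv> a \<odot>$V v"
abbreviation scale (infixr "|>" 75) where "c |> v \<equiv> (c \<odot>$A \<one>$A) *. v"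

sublocale V: left_module A V using simple by (simp add: simple_module_def)

lemma scalar_closed [simp]: "c :. k ==> c \<odot>$A \<one>$A :. A"
 using ring_hom_closed[OF scalar_hom] .

lemma base_simps: "carrier (base_space A V) = carrier V" "add (base_space A V) = add V"
  "\<zero>$(base_space A V) = \<zero>$V" "c \<odot>$(base_space A V) v = c |> v" "finsum (base_space A V) = finsum V"
 by (simp_all add: base_space_def restrict_scalars_def)
  (intro HOL.ext, simp add: finsum_def finprod_def)

lemma base_module: "left_module k (base_space A V)"
 unfolding base_space_def by (rule left_module_restrict_scalars[OF k.ring_axioms V.left_module_axioms scalar_hom])

lemmas scale_cancel = vector_scale_cancel[OF k.field_axioms base_module, unfolded base_simps]

lemma act_scale: "[|a :. A; c :. k; v :. V|] ==> a *. c |> v = c |> a *. v"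
 by (simp add: V.smult_assoc[symmetric] scalar_central)

lemma corner_acts:
 assumes "i \<in> D" "w :. V" "e i *. w = w" "a :. A" "e i *. a *. w = a *. w" "scal z (\<tau> a (i, i))"
 shows "a *. w = z *. w"
proof -
 have z: "z :. A" using assms(6) by (simp add: scal_def)
 have "a *. w = e i *. a *. e i *. w" using assms(3,5) by simp
 also have "... = (e i ** a ** e i) *. w" using assms(1,2,4) e_A by (simp add: V.smult_assoc)
 also have "... = z *. e i *. w" unfolding corner_scalar[OF assms(4,1,6)] using z assms(1,2) e_A by (simp add: V.smult_assoc)
 finally show ?thesis using assms(3) by simp
qed

abbreviation R where "R \<equiv> scalar_subring A D \<tau> B"

lemma R_carrier: "carrier R = {f. \<exists>z. scal z f}"
proof -
 have "\<tau> z = mat_scalar B D f \<longleftrightarrow> scal z f" if "z :. A" "f :. B" for z f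
 proof
  show "scal z f" if "\<tau> z = mat_scalar B D f"
   using that \<open>z :. A\<close> \<open>f :. B\<close> by (simp add: scal_def mat_scalar_def)
  assume s: "scal z f"
  show "\<tau> z = mat_scalar B D f"
   by (rule matrix_eqI[OF that(1)]) (use s in \<open>auto simp: mat_scalar_def scal_def\<close>)
 qed
 note mat = this
 show ?thesis
 proof (intro Set.set_eqI iffI)
  fix f assume "f :. R"
  then obtain z where z: "f :. B" "z :. A" "mat_scalar B D f = \<tau> z" unfolding scalar_subring_def by auto
  show "f \<in> {f. \<exists>z. scal z f}" using mat[OF z(2,1)] z(3) by auto
 next
  fix f assume "f \<in> {f. \<exists>z. scal z f}"
  then obtain z where z: "scal z f" by blast
  then have c: "z :. A" "f :. B" by (simp_all add: scal_def)
  have "mat_scalar B D f \<in> \<tau> ` carrier A" using mat[OF c] z c(1) by (intro image_eqI[of _ _ z]) simp_all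
  then show "f :. R" using c(2) by (simp add: scalar_subring_def)
 qed
qed

lemma R_cring: "cring R"
proof -
 have sub: "carrier R \<subseteq> carrier B" by (auto simp: R_carrier scal_def)
 have "subring (carrier R) B"
 proof (rule B.subringI[OF sub]; unfold R_carrier mem_Collect_eq)
  show "\<exists>z. scal z \<one>$B" using scal_ops(4) by (rule exI)
  fix f assume "\<exists>z. scal z f"
  then obtain z where z: "scal z f" ..
  show "\<exists>z. scal z (\<ominus>$B f)" using scal_neg[OF z] by (rule exI)
  fix g assume "\<exists>z. scal z g"
  then obtain y where y: "scal y g" ..
  show "\<exists>z. scal z (f \<otimes>$B g)" using scal_ops(1)[OF z y] by (rule exI)
  show "\<exists>z. scal z (f \<oplus>$B g)" using scal_ops(2)[OF z y] by (rule exI)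
 qed
 then have "subcring (carrier R) B" by (rule B.subcringI')
 then show ?thesis using B.subcring_iff[OF sub] by (simp add: scalar_subring_def)
qed

lemma R_ops: "monoid.mult R = monoid.mult B" "add R = add B" "\<one>$R = \<one>$B" "\<zero>$R = \<zero>$B"
  "f :. R ==> \<ominus>$R f = \<ominus>$B f"
proof -
 interpret R: cring R by (rule R_cring)
 show ops: "monoid.mult R = monoid.mult B" "add R = add B" "\<one>$R = \<one>$B" "\<zero>$R = \<zero>$B"
  by (simp_all add: scalar_subring_def)
 assume f: "f :. R"
 then obtain z where z: "scal z f" unfolding R_carrier by blast
 have "f :. B" "\<ominus>$B f :. R" using z scal_neg[OF z] unfolding R_carrier scal_def by blast+
 then show "\<ominus>$R f = \<ominus>$B f" using f by (intro R.minus_equality) (simp_all add: ops(2,4) B.l_neg)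
qed

text \<open>
  The elements \<open>f\<close> of \<open>R\<close> whose scalar matrix kills \<open>w\<close> form a maximal ideal \<open>P\<close>, because simplicity of
  \<open>V\<close> inverts every other \<open>f\<close> modulo \<open>P\<close>. As \<open>Max B \<rightarrow> Max R\<close> is onto, \<open>P\<close> is the trace of a maximal ideal
  of \<open>B\<close>, whose residue field is \<open>k\<close> by the Nullstellensatz. So every \<open>f\<close> is a constant modulo \<open>P\<close>, and
  \<open>e\<^sub>i A e\<^sub>i\<close>, which generates \<open>e\<^sub>i V\<close> from \<open>w\<close>, acts on it by constants.
\<close>

lemma vertex_line:
 assumes i: "i \<in> D" and w: "w :. V" "w ~= \<zero>$V" "e i *. w = w" and u: "u :. V" "e i *. u = u"
 shows "\<exists>c\<in>carrier k. u = c |> w"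
proof -
 interpret R: cring R by (rule R_cring)
 define P where "P = {f. \<exists>z. scal z f & z *. w = \<zero>$V}"
 have PR: "P \<subseteq> carrier R" by (auto simp: P_def R_carrier)
 have zA: "z :. A" if "scal z f" for z f using that by (simp add: scal_def)
 have Pmult: "f \<otimes>$B g \<in> P" if fg: "f \<in> P" "g :. R" for f g
 proof -
  obtain z where z: "scal z f" "z *. w = \<zero>$V" using fg(1) P_def by blast
  obtain y where y: "scal y g" using fg(2) R_carrier by blast
  have "(z ** y) *. w = (y ** z) *. w" using scal_central[OF z(1) zA[OF y]] by simp
  also have "... = \<zero>$V" using zA[OF z(1)] zA[OF y] w(1) z(2) by (simp add: V.smult_assoc V.smult_zeros)
  finally show ?thesis using scal_ops(1)[OF z(1) y] unfolding P_def by blast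
 qed
 have ideal: "ideal P R"
 proof (rule idealI[OF R.ring_axioms])
  show "subgroup P (add_monoid R)"
  proof (rule subgroup.intro)
   show "P \<subseteq> carrier (add_monoid R)" using PR by simp
   show "\<one>$(add_monoid R) \<in> P" using scal_ops(5) w(1) by (auto simp: P_def R_ops V.smult_zeros)
   fix f assume f: "f \<in> P"
   then obtain z where z: "scal z f" "z *. w = \<zero>$V" unfolding P_def by blast
   have "(\<ominus>$A z) *. w = (\<zero>$A \<ominus>$A z) *. w" using zA[OF z(1)] by (simp add: a_minus_def)
   also have "... = \<zero>$V" using zA[OF z(1)] w(1) z(2) by (subst V.diff_acts_zero_iff) (simp_all add: V.smult_zeros)
   finally have "\<ominus>$B f \<in> P" using scal_neg[OF z(1)] unfolding P_def by blast
   then show "inv\<^bsub>add_monoid R\<^esub> f \<in> P" using R_ops(5)[of f] f PR by (auto simp: a_inv_def)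
   fix g assume "g \<in> P"
   then obtain y where y: "scal y g" "y *. w = \<zero>$V" unfolding P_def by blast
   have "(z \<oplus>$A y) *. w = \<zero>$V" using zA[OF z(1)] zA[OF y(1)] w(1) z(2) y(2) by (simp add: V.smult_l_distr)
   then show "f \<otimes>$(add_monoid R) g \<in> P" using scal_ops(2)[OF z(1) y(1)] by (auto simp: P_def R_ops)
  qed
  fix f g assume fg: "f \<in> P" "g :. R"
  then show "f \<otimes>$R g \<in> P" using Pmult by (simp add: R_ops)
  then show "g \<otimes>$R f \<in> P" using R.m_comm[of f g] fg PR by auto
 qed
 have "maximalideal P R"
 proof (rule maximalideal_of_inverses[OF R_cring ideal])
  show "\<one>$R \<notin> P"
  proof
   assume "\<one>$R \<in> P"
   then obtain z where z: "scal z \<one>$B" "z *. w = \<zero>$V" by (auto simp: P_def R_ops)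
   then show False using scal_unique[OF z(1) scal_ops(4)] w by simp
  qed
  fix f assume f: "f :. R" "f \<notin> P"
  then obtain z where z: "scal z f" "z *. w ~= \<zero>$V" unfolding P_def R_carrier by blast
  have zw: "z *. w :. V" using zA[OF z(1)] w(1) by simp
  have ezw: "e i *. z *. w = z *. w"
   using scal_central[OF z(1) e_A[OF i]] zA[OF z(1)] e_A[OF i] w(1,3) by (metis V.smult_assoc)
  obtain a where a: "a :. A" "w = a *. z *. w" using simple_module_cyclic[OF simple zw z(2) w(1)] by blast
  obtain y where y: "scal y (\<tau> a (i, i))" using scal_exists[OF a(1) i] by blast
  have "a *. z *. w = y *. z *. w" by (rule corner_acts[OF i zw ezw a(1) _ y]) (use a(2) w(3) in simp)
  then have yz: "\<one>$A *. w = (y ** z) *. w" using a(2) zA[OF y] zA[OF z(1)] w(1) by (simp add: V.smult_assoc)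
  let ?g = "\<tau> a (i, i)"
  have g: "?g :. R" using y R_carrier by blast
  have "scal (\<one>$A \<ominus>$A y ** z) (\<one>$B \<ominus>$B ?g \<otimes>$B f)"
   unfolding a_minus_def by (rule scal_ops(2)[OF scal_ops(4) scal_neg[OF scal_ops(1)[OF y z(1)]]])
  moreover have "(\<one>$A \<ominus>$A y ** z) *. w = \<zero>$V"
   using yz zA[OF y] zA[OF z(1)] w(1) by (subst V.diff_acts_zero_iff) simp_all
  ultimately have "\<one>$B \<ominus>$B ?g \<otimes>$B f \<in> P" unfolding P_def by blast
  moreover have "\<one>$R \<ominus>$R ?g \<otimes>$R f = \<one>$B \<ominus>$B ?g \<otimes>$B f"
   using R.m_closed[OF g f(1)] by (simp add: a_minus_def R_ops)
  ultimately show "\<exists>g\<in>carrier R. \<one>$R \<ominus>$R g \<otimes>$R f \<in> P" using g by (intro bexI[of _ ?g]) simp_all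
 qed
 then have "P \<in> (\<lambda>\<qq>. \<qq> \<inter> carrier R) ` Max_spec B"
  using impression unfolding impression_def by (simp add: Max_spec_def)
 then obtain \<qq> where q: "maximalideal \<qq> B" "P = \<qq> \<inter> carrier R" by (auto simp: Max_spec_def)
 obtain a where a: "a :. A" "u = a *. w" using simple_module_cyclic[OF simple w(1,2) u(1)] by blast
 obtain z where z: "scal z (\<tau> a (i, i))" using scal_exists[OF a(1) i] by blast
 have uz: "u = z *. w" using corner_acts[OF i w(1,3) a(1) _ z] a(2) u(2) by simp
 let ?f = "\<tau> a (i, i)"
 obtain c where c: "c :. k" "?f \<ominus>$B c \<odot>$B \<one>$B \<in> \<qq>"
  using maximal_quotient_is_base_field[OF k.algebraically_closed_axioms pre(1,2) q(1), of ?f] a(1) i by auto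
 have s: "scal (z \<ominus>$A c \<odot>$A \<one>$A) (?f \<ominus>$B c \<odot>$B \<one>$B)"
  unfolding a_minus_def by (rule scal_ops(2)[OF z scal_neg[OF scal_ops(3)[OF c(1)]]])
 then have "?f \<ominus>$B c \<odot>$B \<one>$B \<in> P" using c(2) unfolding q(2) R_carrier by blast
 then have "(z \<ominus>$A c \<odot>$A \<one>$A) *. w = \<zero>$V" using scal_unique[OF _ s] unfolding P_def by blast
 then have "z *. w = c |> w" using zA[OF z] c(1) w(1) by (subst (asm) V.diff_acts_zero_iff) simp_all
 then show ?thesis using uz c(1) by blast
qed

definition support where "support = {j \<in> D. \<exists>w\<in>carrier V. e j *. w ~= \<zero>$V}"

lemma vertex_vectors:
 obtains v where "!!j. j \<in> support ==> v j :. V" "!!j. j \<in> support ==> v j ~= \<zero>$V"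
  "!!i j. i \<in> D ==> j \<in> support ==> e i *. v j = (if i = j then v j else \<zero>$V)"
proof -
 have "\<forall>j\<in>support. \<exists>w. w :. V & e j *. w ~= \<zero>$V" by (auto simp: support_def)
 then obtain w where w: "\<forall>j\<in>support. w j :. V & e j *. w j ~= \<zero>$V" by metis
 show ?thesis
 proof (rule that[of "%j. e j *. w j"])
  fix j assume j: "j \<in> support"
  then have D: "j \<in> D" by (simp add: support_def)
  show "e j *. w j :. V" "e j *. w j ~= \<zero>$V" using w j e_A[OF D] by auto
  show "e i *. e j *. w j = (if i = j then e j *. w j else \<zero>$V)" if "i \<in> D" for i
   using w j e_A[OF D] e_A[OF that] e_mult[OF that D] by (simp add: V.smult_assoc[symmetric] V.smult_zeros)
 qed
qed

lemma support_sum: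
 assumes w: "w :. V"
 shows "(\<Oplus>$V i\<in>support. e i *. w) = w"
proof -
 have "w = (\<Oplus>$A i\<in>D. e i) *. w" using w by (simp add: sum_e)
 also have "... = (\<Oplus>$V i\<in>D. e i *. w)" by (rule V.finsum_smult[OF pre(3) e_A w])
 also have "... = (\<Oplus>$V i\<in>support. e i *. w)"
  by (rule V.M.add.finprod_mono_neutral_cong_right) (use pre(3) w e_A in \<open>auto simp: support_def\<close>)
 finally show ?thesis by simp
qed

lemma finite_support: "finite support"
 using pre(3) by (simp add: support_def)

lemma vector_coefficient:
 assumes v: "!!j. j \<in> support ==> v j :. V"
  "!!i j. i \<in> D ==> j \<in> support ==> e i *. v j = (if i = j then v j else \<zero>$V)"
  and c: "!!j. j \<in> support ==> c j :. k" and i: "i \<in> support"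
 shows "e i *. (\<Oplus>$V j\<in>support. c j |> v j) = c i |> v i"
proof -
 have D: "i \<in> D" using i by (simp add: support_def)
 have "e i *. (\<Oplus>$V j\<in>support. c j |> v j) = (\<Oplus>$V j\<in>support. e i *. c j |> v j)"
  by (rule V.smult_finsum) (use finite_support e_A[OF D] v(1) c in auto)
 also have "... = (\<Oplus>$V j\<in>support. if i = j then c j |> v j else \<zero>$V)"
  by (rule V.M.finsum_cong'[OF HOL.refl]) (use e_A[OF D] v c D in \<open>auto simp: act_scale V.smult_zeros\<close>)
 also have "... = c i |> v i" by (rule V.M.add.finprod_singleton[OF i finite_support]) (use v(1) c in auto)
 finally show ?thesis .
qed

text \<open>
  One vector at each vertex of the support gives a basis, coordinates being read off by the idempotents.
\<close>

lemma kdim_le_support: "kdim k (base_space A V) \<le> enat (card support)"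
proof -
 obtain v where v: "!!j. j \<in> support ==> v j :. V" "!!j. j \<in> support ==> v j ~= \<zero>$V"
  "!!i j. i \<in> D ==> j \<in> support ==> e i *. v j = (if i = j then v j else \<zero>$V)" by (rule vertex_vectors) blast
 have sD: "i \<in> support ==> i \<in> D" for i by (simp add: support_def)
 have inj: "inj_on v support"
  using v(2) v(3)[OF sD] by (intro inj_onI) metis
 have reindex: "(\<Oplus>$V s\<in>v ` support. c s |> s) = (\<Oplus>$V j\<in>support. c (v j) |> v j)"
  if "!!j. j \<in> support ==> c (v j) :. k" for c
  by (rule V.M.finsum_reindex[OF _ inj]) (use v(1) that in auto)
 have "\<exists>!c. c \<in> v ` support \<rightarrow>\<^sub>E carrier k & w = (\<Oplus>$V s\<in>v ` support. c s |> s)" if w: "w :. V" for w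
 proof -
  have "\<exists>c\<in>carrier k. e i *. w = c |> v i" if i: "i \<in> support" for i
  proof (rule vertex_line[OF sD[OF i] v(1)[OF i] v(2)[OF i]])
   show "e i *. v i = v i" using v(3)[OF sD[OF i] i] by simp
   show "e i *. w :. V" using e_A[OF sD[OF i]] w by simp
   show "e i *. e i *. w = e i *. w" using e_A[OF sD[OF i]] e_mult[OF sD[OF i] sD[OF i]] w by (simp add: V.smult_assoc[symmetric])
  qed
  then obtain d where d: "!!i. i \<in> support ==> d i :. k" "!!i. i \<in> support ==> e i *. w = d i |> v i" by metis
  let ?c = "restrict (d \<circ> inv_into support v) (v ` support)"
  have cv: "?c (v j) = d j" if "j \<in> support" for j using inj that by simp
  show ?thesis
  proof (rule ex1I[of _ ?c])
   have "(\<Oplus>$V s\<in>v ` support. ?c s |> s) = (\<Oplus>$V j\<in>support. ?c (v j) |> v j)" by (rule reindex) (unfold cv, rule d(1))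
   also have "... = (\<Oplus>$V j\<in>support. e j *. w)"
    by (rule V.M.finsum_cong'[OF HOL.refl]) (use e_A sD w cv d(2) in auto)
   finally show "?c \<in> v ` support \<rightarrow>\<^sub>E carrier k & w = (\<Oplus>$V s\<in>v ` support. ?c s |> s)"
    using support_sum[OF w] d(1) inj by auto
  next
   fix c assume c: "c \<in> v ` support \<rightarrow>\<^sub>E carrier k & w = (\<Oplus>$V s\<in>v ` support. c s |> s)"
   have ck: "c (v j) :. k" if "j \<in> support" for j using c that by auto
   have w': "w = (\<Oplus>$V j\<in>support. c (v j) |> v j)" using c reindex[of c] ck by simp
   have "c (v j) = d j" if j: "j \<in> support" for j
   proof (rule scale_cancel[OF ck[OF j] d(1)[OF j] v(1)[OF j] v(2)[OF j]])
    show "c (v j) |> v j = d j |> v j"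
     using vector_coefficient[of v "%j. c (v j)", OF v(1) v(3) ck j] d(2)[OF j] unfolding w'[symmetric] by simp
   qed
   then show "c = ?c" by (intro extensionalityI[of c "v ` support" ?c]) (use c cv in \<open>auto simp: PiE_def\<close>)
  qed
 qed
 then have "finite_basis k (base_space A V) (v ` support)"
  using finite_support v(1) by (auto simp: finite_basis_def base_simps)
 then have "kdim k (base_space A V) \<le> enat (card (v ` support))" unfolding kdim_def by (intro Inf_lower) blast
 then show ?thesis by (simp add: card_image[OF inj])
qed

text \<open>
  Vectors at different vertices are linearly independent, since the idempotents separate them.
\<close>

lemma support_le_basis:
 assumes S: "finite_basis k (base_space A V) S"
 shows "card support \<le> card S"
proof (rule ccontr)
 assume less: "\<not> card support \<le> card S"
 obtain v where v: "!!j. j \<in> support ==> v j :. V" "!!j. j \<in> support ==> v j ~= \<zero>$V"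
  "!!i j. i \<in> D ==> j \<in> support ==> e i *. v j = (if i = j then v j else \<zero>$V)" by (rule vertex_vectors) blast
 have S': "finite S" "S \<subseteq> carrier V" using S unfolding finite_basis_def base_simps by simp_all
 have "\<exists>!c. c \<in> S \<rightarrow>\<^sub>E carrier k & w = (\<Oplus>$V s\<in>S. c s |> s)" if "w :. V" for w
  using S that unfolding finite_basis_def base_simps by simp
 from ex1_implies_ex[OF this[OF v(1)]]
 have "\<forall>j\<in>support. \<exists>c. c \<in> S \<rightarrow>\<^sub>E carrier k & v j = (\<Oplus>$V s\<in>S. c s |> s)" by blast
 from bchoice[OF this] obtain c where c: "!!j. j \<in> support ==> c j \<in> S \<rightarrow>\<^sub>E carrier k"
  "!!j. j \<in> support ==> v j = (\<Oplus>$V s\<in>S. c j s |> s)" by blast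
 have ck: "c j s :. k" if "j \<in> support" "s \<in> S" for j s using c(1)[OF that(1)] that(2) by auto
 have "\<exists>x. (\<forall>j\<in>support. x j :. k) & (\<exists>j\<in>support. x j ~= \<zero>$k) &
   (\<forall>s\<in>S. (\<Oplus>$k j\<in>support. c j s \<otimes>$k x j) = \<zero>$k)"
  by (rule k.homogeneous_system[OF S'(1) finite_support]) (use less ck in simp_all)
 then obtain x where x: "\<forall>j\<in>support. x j :. k" "\<exists>j\<in>support. x j ~= \<zero>$k"
  "\<forall>s\<in>S. (\<Oplus>$k j\<in>support. c j s \<otimes>$k x j) = \<zero>$k" by blast
 interpret W: left_module k "base_space A V" by (rule base_module)
 have "(\<Oplus>$V j\<in>support. x j |> v j) = (\<Oplus>$V j\<in>support. \<Oplus>$V s\<in>S. (c j s \<otimes>$k x j) |> s)"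
 proof (rule V.M.finsum_cong'[OF HOL.refl])
  show "(%j. \<Oplus>$V s\<in>S. (c j s \<otimes>$k x j) |> s) \<in> support \<rightarrow> carrier V"
   using x(1) ck S'(2) by (intro Pi_I V.M.finsum_closed) (auto intro!: V.smult_closed)
  fix j assume j: "j \<in> support"
  have "x j |> v j = (\<Oplus>$V s\<in>S. x j |> c j s |> s)"
   unfolding c(2)[OF j] by (rule V.smult_finsum[OF S'(1)]) (use x(1) j ck S'(2) in \<open>auto intro!: V.smult_closed\<close>)
  also have "... = (\<Oplus>$V s\<in>S. (c j s \<otimes>$k x j) |> s)"
  proof (rule V.M.finsum_cong'[OF HOL.refl])
   show "(%s. (c j s \<otimes>$k x j) |> s) \<in> S \<rightarrow> carrier V" using x(1) j ck S'(2) by (auto intro!: V.smult_closed)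
   fix s assume s: "s \<in> S"
   have "(x j \<otimes>$k c j s) |> s = x j |> c j s |> s"
    using W.smult_assoc[of "x j" "c j s" s] x(1) j ck[OF j s] S'(2) s by (auto simp: base_simps)
   then show "x j |> c j s |> s = (c j s \<otimes>$k x j) |> s" using k.m_comm[OF ck[OF j s]] x(1) j by simp
  qed
  finally show "x j |> v j = (\<Oplus>$V s\<in>S. (c j s \<otimes>$k x j) |> s)" .
 qed
 also have "... = (\<Oplus>$V s\<in>S. \<Oplus>$V j\<in>support. (c j s \<otimes>$k x j) |> s)"
  by (rule V.finsum_swap_module[OF finite_support S'(1)]) (use x(1) ck S'(2) in \<open>auto intro!: V.smult_closed\<close>)
 also have "... = (\<Oplus>$V s\<in>S. \<zero>$V)"
 proof (rule V.M.finsum_cong'[OF HOL.refl])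
  fix s assume s: "s \<in> S"
  have "(\<Oplus>$k j\<in>support. c j s \<otimes>$k x j) |> s = (\<Oplus>$V j\<in>support. (c j s \<otimes>$k x j) |> s)"
   using W.finsum_smult[OF finite_support, of "%j. c j s \<otimes>$k x j" s] x(1) ck[OF _ s] S'(2) s
   by (auto simp: base_simps)
  then show "(\<Oplus>$V j\<in>support. (c j s \<otimes>$k x j) |> s) = \<zero>$V"
   using x(3) s S'(2) W.smult_zeros(1)[of s] by (auto simp: base_simps)
 qed simp
 finally have zero: "(\<Oplus>$V j\<in>support. x j |> v j) = \<zero>$V" by simp
 have "x i = \<zero>$k" if i: "i \<in> support" for i
 proof (rule scale_cancel[OF _ _ v(1)[OF i] v(2)[OF i]])
  have "i \<in> D" using i by (simp add: support_def)
  then have "x i |> v i = \<zero>$V"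
   using vector_coefficient[of v x, OF v(1) v(3) _ i] x(1) e_A[of i] by (simp add: zero V.smult_zeros)
  then show "x i |> v i = \<zero>$k |> v i" using W.smult_zeros(1)[of "v i"] v(1)[OF i] by (simp add: base_simps)
 qed (use x(1) i in auto)
 then show False using x(2) by blast
qed

end

section \<open>Large modules\<close>

context corner_impression
begin

text \<open>
  A fibre of the impression at a point of the dense open set is simple, and every idempotent acts on it
  without being zero, so it has dimension at least \<open>card D\<close>. The large module \<open>V\<close> has dimension at most
  the size of its support.
\<close>

lemma large_module_full_support:
 assumes V: "large_module k A V" and j: "j \<in> D"
 shows "\<exists>w\<in>carrier V. e j \<odot>$V w ~= \<zero>$V"
proof -
 obtain U where U: "openin (zariski B) U" "zariski B closure_of U = Max_spec B"
  "\<And>\<qq>. \<qq> \<in> U ==> simple_module A (fiber_module B D \<tau> \<qq>)"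
  using impression unfolding impression_def pre_impression_def by blast
 have "Max_spec B ~= {}" using B.maximal_ideal_exists[OF B.one_not_zero] by (simp add: Max_spec_def)
 then have "U ~= {}" using U(2) by (metis closure_of_empty)
 then obtain \<qq> where q: "\<qq> \<in> U" by blast
 then have "maximalideal \<qq> B" using U(1) openin_zariski[OF B.cring_axioms, of U] by (auto simp: Max_spec_def)
 then interpret q: maximalideal \<qq> B .
 let ?K = "B Quot \<qq>" and ?W = "fiber_module B D \<tau> \<qq>"
 interpret K: field ?K by (rule q.quotient_is_field) (rule B.cring_axioms)
 interpret h: ring_hom_ring B ?K "(+>$B) \<qq>"
  by (rule ring_hom_ringI2[OF B.ring_axioms K.ring_axioms q.rcos_ring_hom])
 have W: "simple_module A ?W" by (rule U(3)[OF q])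
 interpret F: corner_impression_module k A B D \<tau> e ?W
  by (intro corner_impression_module.intro corner_impression_axioms corner_impression_module_axioms.intro W)
 have V': "simple_module A V" using V by (simp add: large_module_def)
 interpret V: corner_impression_module k A B D \<tau> e V
  by (intro corner_impression_module.intro corner_impression_axioms corner_impression_module_axioms.intro V')
 have "l \<in> F.support" if l: "l \<in> D" for l
 proof -
  let ?w = "\<lambda>i\<in>D. \<one>$(?K)"
  have "(e l \<odot>$(?W) ?w) l = (\<Oplus>$(?K)j\<in>D. (\<qq> +>$B \<tau> (e l) (l, j)) \<otimes>$(?K) ?w j)"
   using l by (simp add: fiber_module_def)
  also have "... = (\<Oplus>$(?K)j\<in>D. if l = j then \<one>$(?K) else \<zero>$(?K))"
   by (rule K.finsum_cong'[OF HOL.refl]) (use l h.hom_zero h.hom_one in \<open>auto simp: entry_e simp del: h.hom_zero h.hom_one\<close>)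
  also have "... = \<one>$(?K)" by (rule K.add.finprod_singleton[OF l pre(3)]) simp
  finally have "(e l \<odot>$(?W) ?w) l = \<one>$(?K)" .
  moreover have "\<zero>$(?W) l = \<zero>$(?K)" using l by (simp add: fiber_module_def)
  ultimately have "e l \<odot>$(?W) ?w ~= \<zero>$(?W)" using K.one_not_zero by metis
  moreover have "?w :. ?W" using K.one_closed by (simp add: fiber_module_def)
  ultimately show ?thesis using l by (auto simp: F.support_def)
 qed
 then have F: "F.support = D" by (auto simp: F.support_def)
 let ?X = "{enat (card S) | S. finite_basis k (base_space A ?W) S}"
 have "kdim k (base_space A ?W) \<le> enat (card V.support)"
  using large_module_max[OF V W] F.scalar_closed V.kdim_le_support by (meson order_trans)
 then have le: "Inf ?X \<le> enat (card V.support)" by (simp add: kdim_def)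
 have "?X ~= {}"
 proof
  assume "?X = {}"
  then show False using le by (simp only: Inf_enat_def) simp
 qed
 then have "Inf ?X \<in> ?X" unfolding Inf_enat_def by (metis (mono_tags, lifting) LeastI ex_in_conv)
 then obtain S where S: "finite_basis k (base_space A ?W) S" "Inf ?X = enat (card S)" by blast
 have "card D \<le> card V.support" using F.support_le_basis[OF S(1)] le unfolding S(2) F by simp
 then have "V.support = D" using pre(3) by (intro card_seteq) (auto simp: V.support_def)
 then show ?thesis using j by (auto simp: V.support_def)
qed

lemma entry_product:
 assumes "a :. A" "b :. A" "l \<in> D" "i \<in> D" "j \<in> D"
 shows "\<tau> (a ** e l ** b) (i, j) = \<tau> a (i, l) \<otimes>$B \<tau> b (l, j)"
proof -
 have "\<tau> (a ** e l ** b) (i, j) = (\<Oplus>$B p\<in>D. \<tau> (a ** e l) (i, p) \<otimes>$B \<tau> b (p, j))"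
  by (rule entry_mult) (use assms e_A in auto)
 also have "... = (\<Oplus>$B p\<in>D. if l = p then \<tau> a (i, p) \<otimes>$B \<tau> b (p, j) else \<zero>$B)"
  by (rule B.finsum_cong'[OF HOL.refl]) (use assms in \<open>auto simp: entry_right\<close>)
 also have "... = \<tau> a (i, l) \<otimes>$B \<tau> b (l, j)" by (rule B.add.finprod_singleton[OF assms(3) pre(3)]) (use assms in auto)
 finally show ?thesis .
qed

text \<open>
  The data that join the vertex \<open>i\<close> to the base vertex \<open>r\<close>; the last condition is what forces central
  elements to be scalar matrices.
\<close>

definition matched where
 "matched V r v i a b z \<longleftrightarrow> a :. A & b :. A & e i ** a = a & a ** e r = a & e r ** b = b &
   b ** a = z ** e r & a ** b = z ** e i & z :. (center_algebra A) & z \<odot>$V v r = v r & \<tau> a (i, r) ~= \<zero>$B"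

text \<open>
  By full support, simplicity moves \<open>v r\<close> to \<open>v i\<close> and back, by elements \<open>a\<close> and \<open>b\<close> of the corners between
  \<open>r\<close> and \<open>i\<close>. The products \<open>b a\<close> and \<open>a b\<close> have the same matrix entry, hence are \<open>z e\<^sub>r\<close> and \<open>z e\<^sub>i\<close> for one
  central \<open>z\<close>, which fixes \<open>v r\<close> and so lies outside \<open>\<mm>\<close>. The entry of \<open>a\<close> is non-zero, and commuting
  with \<open>a\<close> makes the diagonal entries of a central element equal. As \<open>B\<close> is a domain, central elements
  outside \<open>\<mm>\<close> are then regular.
\<close>

theorem pd_large_module:
 fixes V :: "('a, 'm) module"
 assumes V: "large_module k A V" and noeth: "noetherian_free_modules A"
  and p: "\<pp> = annihilator A V" and m: "\<mm> = \<pp> \<inter> carrier (center_algebra A)"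
 shows "\<mm> \<in> Max_spec (center_algebra A) &
     pd A V = pd (algebra_loc A \<mm>) (module_loc k A \<mm> V) &
     pd (algebra_loc A \<mm>) (module_loc k A \<mm> V) = pd A (quot_module A \<pp>) &
     pd A (quot_module A \<pp>) =
      pd (algebra_loc A \<mm>) (quot_module (algebra_loc A \<mm>) (ideal_loc A \<mm> \<pp>)) &
     pd (algebra_loc A \<mm>) (quot_module (algebra_loc A \<mm>) (ideal_loc A \<mm> \<pp>)) =
      pd (center_loc A \<mm>) (quot_module (center_loc A \<mm>) (center_loc_ideal A \<mm>))"
proof -
 have simple: "simple_module A V" using V by (simp add: large_module_def)
 interpret V: corner_impression_module k A B D \<tau> e V
  by (intro corner_impression_module.intro corner_impression_axioms corner_impression_module_axioms.intro simple)
 interpret W: left_module k "base_space A V" by (rule V.base_module)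
 note W_assoc = W.smult_assoc[unfolded V.base_simps] and W_add = W.smult_l_distr[unfolded V.base_simps]
  and W_zero = W.smult_zeros[unfolded V.base_simps]
 let ?Z = "center_algebra A"
 interpret Z: cring ?Z by (rule cring_center_algebra[OF A.ring_axioms])
 have supp: "V.support = D" using large_module_full_support[OF V] by (auto simp: V.support_def)
 obtain v where v0: "!!j. j \<in> V.support ==> v j :. V" "!!j. j \<in> V.support ==> v j ~= \<zero>$V"
  "!!i j. i \<in> D ==> j \<in> V.support ==> e i \<odot>$V v j = (if i = j then v j else \<zero>$V)" by (rule V.vertex_vectors) blast
 note v = v0[unfolded supp]
 have ev: "e i \<odot>$V v i = v i" if "i \<in> D" for i using v(3)[OF that that] by simp
 obtain w where w: "w :. V" "w ~= \<zero>$V"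
  using simple V.V.M.zero_closed unfolding simple_module_def by blast
 have "D ~= {}"
 proof
  assume "D = {}"
  then show False using V.support_sum[OF w(1)] w(2) supp by simp
 qed
 then obtain r where r: "r \<in> D" by blast
 have cyc: "\<exists>a\<in>carrier A. u = a \<odot>$V v i" if "i \<in> D" "u :. V" for i u
  by (rule simple_module_cyclic[OF simple v(1)[OF that(1)] v(2)[OF that(1)] that(2)])
 have match: "\<exists>a b z. matched V r v i a b z" if i: "i \<in> D" for i
 proof -
  obtain a' where a': "a' :. A" "v i = a' \<odot>$V v r" using cyc[OF r v(1)[OF i]] by blast
  obtain b' where b': "b' :. A" "v r = b' \<odot>$V v i" using cyc[OF i v(1)[OF r]] by blast
  note er = e_A[OF r] and ei = e_A[OF i]
  have idem: "e r ** e r = e r" "e i ** e i = e i" using e_mult r i by simp_all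
  define a where "a = e i ** a' ** e r"
  define b where "b = e r ** b' ** e i"
  have c: "a :. A" "b :. A" using a'(1) b'(1) er ei by (simp_all add: a_def b_def)
  have ea: "e i ** a = a" "a ** e r = a" "e r ** b = b" "b ** e i = b"
   using a'(1) b'(1) er ei idem A.m_assoc[of "e i" "e i" "a' ** e r"] A.m_assoc[of "e r" "e r" "b' ** e i"]
   by (simp_all add: a_def b_def A.m_assoc)
  have av: "a \<odot>$V v r = v i" "b \<odot>$V v i = v r"
   using a' b' er ei v(1)[OF r] v(1)[OF i] ev[OF r] ev[OF i] by (simp_all add: a_def b_def V.V.smult_assoc)
  have ab: "\<tau> (a ** b) (i, i) = \<tau> (b ** a) (r, r)"
   using entry_product[OF c r i i] entry_product[OF c(2,1) i r r] c r i by (simp add: ea B.m_comm)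
  obtain z where z: "scal z (\<tau> (b ** a) (r, r))" using scal_exists[of "b ** a" r] c r by auto
  then have zA: "z :. A" by (simp add: scal_def)
  have "b ** a = e r ** (b ** a) ** e r" using c er ea by (simp add: A.m_assoc[symmetric]) (simp add: A.m_assoc ea)
  also have "... = z ** e r" by (rule corner_scalar) (use c r z in auto)
  finally have ba: "b ** a = z ** e r" .
  have "a ** b = e i ** (a ** b) ** e i" using c ei ea by (simp add: A.m_assoc[symmetric]) (simp add: A.m_assoc ea)
  also have "... = z ** e i" by (rule corner_scalar) (use c i z ab in auto)
  finally have ab': "a ** b = z ** e i" .
  have "z \<odot>$V v r = (z ** e r) \<odot>$V v r" using zA er v(1)[OF r] ev[OF r] by (simp add: V.V.smult_assoc)
  also have "... = v r" unfolding ba[symmetric] using c v(1)[OF r] av by (simp add: V.V.smult_assoc)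
  finally have zv: "z \<odot>$V v r = v r" .
  have ne: "\<tau> a (i, r) ~= \<zero>$B"
  proof
   assume "\<tau> a (i, r) = \<zero>$B"
   then have "\<tau> (b ** a) (r, r) = \<zero>$B" using entry_product[OF c(2,1) i r r] c r i by (simp add: ea)
   then have "z = \<zero>$A" using scal_unique[OF _ scal_ops(5)] z by simp
   then show False using zv v(1,2)[OF r] by (simp add: V.V.smult_zeros)
  qed
  have "matched V r v i a b z"
   unfolding matched_def by (intro conjI c ea(1-3) ba ab' scal_center[OF z] zv ne)
  then show ?thesis by blast
 qed
 then obtain a b t where "!!i. i \<in> D ==> matched V r v i (a i) (b i) (t i)" by metis
 note M = this[unfolded matched_def]
 have Zmem: "z :. A & (\<forall>x\<in>carrier A. z ** x = x ** z)" if "z :. ?Z" for z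
  using that unfolding center_simps(1) mem_Collect_eq .
 have Zsub: "z :. A" "x :. A ==> z ** x = x ** z" if "z :. ?Z" for z x
  using conjunct1[OF Zmem[OF that]] bspec[OF conjunct2[OF Zmem[OF that]]] .
 have center: "scal z (\<tau> z (r, r))" if z: "z :. ?Z" for z
 proof -
  note zA = Zsub(1)[OF z]
  have off: "\<tau> z (i, j) = \<zero>$B" if "i \<in> D" "j \<in> D" "i ~= j" for i j
   using entry_right[OF that(2) zA that(1,2)] entry_left[OF that(2) zA that(1,2)] Zsub(2)[OF z e_A[OF that(2)]] that(3) by simp
  have "\<tau> z (i, i) = \<tau> z (r, r)" if i: "i \<in> D" for i
  proof -
   have ai: "a i :. A" "e i ** a i = a i" "a i ** e r = a i" "\<tau> (a i) (i, r) ~= \<zero>$B" using M[OF i] by auto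
   have "\<tau> z (i, i) \<otimes>$B \<tau> (a i) (i, r) = \<tau> (z ** e i ** a i) (i, r)"
    by (rule entry_product[symmetric]) (use zA ai i r in auto)
   also have "z ** e i ** a i = a i ** e r ** z" using Zsub(2)[OF z ai(1)] A.m_assoc[OF zA e_A[OF i] ai(1)] by (simp add: ai(2,3))
   also have "\<tau> (a i ** e r ** z) (i, r) = \<tau> (a i) (i, r) \<otimes>$B \<tau> z (r, r)"
    by (rule entry_product) (use zA ai i r in auto)
   also have "... = \<tau> z (r, r) \<otimes>$B \<tau> (a i) (i, r)" by (rule B.m_comm) (use zA ai(1) i r in simp_all)
   finally have eq: "\<tau> z (i, i) \<otimes>$B \<tau> (a i) (i, r) = \<tau> z (r, r) \<otimes>$B \<tau> (a i) (i, r)" .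
   show ?thesis by (rule iffD1[OF B.m_rcancel[OF ai(4)] eq]) (use zA ai(1) i r in simp_all)
  qed
  note diag = this
  have "\<tau> z (i, j) = (if i = j then \<tau> z (r, r) else \<zero>$B)" if "i \<in> D" "j \<in> D" for i j
   using diag[OF that(1)] off[OF that] by (cases "i = j") (simp_all only: if_True if_False HOL.refl not_False_eq_True)
  then show ?thesis unfolding scal_def using zA entry_closed[OF zA r r] by (intro conjI ballI)
 qed
 define \<chi> where "\<chi> z = (SOME c. c :. k & z \<odot>$V v r = (c \<odot>$A \<one>$A) \<odot>$V v r)" for z
 have \<chi>: "\<chi> z :. k" "z \<odot>$V v r = (\<chi> z \<odot>$A \<one>$A) \<odot>$V v r" if z: "z :. ?Z" for z
 proof -
  have "\<exists>c\<in>carrier k. z \<odot>$V v r = (c \<odot>$A \<one>$A) \<odot>$V v r"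
  proof (rule V.vertex_line[OF r v(1)[OF r] v(2)[OF r] ev[OF r]])
   show "z \<odot>$V v r :. V" using Zsub(1)[OF z] v(1)[OF r] by simp
   have "e r \<odot>$V (z \<odot>$V v r) = (z ** e r) \<odot>$V v r"
    using Zsub(1)[OF z] Zsub(2)[OF z e_A[OF r]] e_A[OF r] v(1)[OF r] by (simp add: V.V.smult_assoc[symmetric])
   then show "e r \<odot>$V (z \<odot>$V v r) = z \<odot>$V v r"
    using Zsub(1)[OF z] e_A[OF r] v(1)[OF r] ev[OF r] by (simp add: V.V.smult_assoc)
  qed
  then have "\<exists>c. c :. k & z \<odot>$V v r = (c \<odot>$A \<one>$A) \<odot>$V v r" by blast
  from someI_ex[OF this] show "\<chi> z :. k" "z \<odot>$V v r = (\<chi> z \<odot>$A \<one>$A) \<odot>$V v r"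
   unfolding \<chi>_def[symmetric] by blast+
 qed
 have \<chi>I: "\<chi> z = c" if "z :. ?Z" "c :. k" "z \<odot>$V v r = (c \<odot>$A \<one>$A) \<odot>$V v r" for z c
  by (rule V.scale_cancel[OF \<chi>(1)[OF that(1)] that(2) v(1)[OF r] v(2)[OF r]]) (use \<chi>(2)[OF that(1)] that(3) in simp)
 have sZ: "c \<odot>$A \<one>$A :. ?Z" if "c :. k" for c by (rule scal_center[OF scal_ops(3)[OF that]])
 have Vchi: "z \<odot>$V u = (\<chi> z \<odot>$A \<one>$A) \<odot>$V u" if z: "z :. ?Z" and u: "u :. V" for z u
 proof -
  obtain x where x: "x :. A" "u = x \<odot>$V v r" using cyc[OF r u] by blast
  have "z \<odot>$V u = x \<odot>$V (z \<odot>$V v r)"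
   using x Zsub(1)[OF z] Zsub(2)[OF z x(1)] v(1)[OF r] by (simp add: V.V.smult_assoc[symmetric])
  also have "... = (\<chi> z \<odot>$A \<one>$A) \<odot>$V u"
   unfolding \<chi>(2)[OF z] x(2) by (rule V.act_scale[OF x(1) \<chi>(1)[OF z] v(1)[OF r]])
  finally show ?thesis .
 qed
 have \<chi>_hom: "\<chi> \<in> ring_hom ?Z k"
 proof (rule ring_hom_memI)
  fix x y assume x: "x :. ?Z" and y: "y :. ?Z"
  note c = Zsub(1)[OF x] Zsub(1)[OF y] \<chi>(1)[OF x] \<chi>(1)[OF y] v(1)[OF r]
  show "\<chi> (x \<otimes>$(?Z) y) = \<chi> x \<otimes>$k \<chi> y"
  proof (rule \<chi>I)
   have "(x ** y) \<odot>$V v r = x \<odot>$V (y \<odot>$V v r)" using c by (simp add: V.V.smult_assoc)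
   also have "... = (\<chi> x \<odot>$A \<one>$A) \<odot>$V (y \<odot>$V v r)" by (rule Vchi[OF x]) (use c in simp)
   finally show "(x \<otimes>$(?Z) y) \<odot>$V v r = ((\<chi> x \<otimes>$k \<chi> y) \<odot>$A \<one>$A) \<odot>$V v r"
    using W_assoc[OF c(3-5)] \<chi>(2)[OF y] by (simp add: center_simps(2))
  qed (use x y c in simp_all)
  show "\<chi> (x \<oplus>$(?Z) y) = \<chi> x \<oplus>$k \<chi> y"
  proof (rule \<chi>I)
   have "(x \<oplus>$A y) \<odot>$V v r = x \<odot>$V v r \<oplus>$V y \<odot>$V v r" using c by (simp add: V.V.smult_l_distr)
   then show "(x \<oplus>$(?Z) y) \<odot>$V v r = ((\<chi> x \<oplus>$k \<chi> y) \<odot>$A \<one>$A) \<odot>$V v r"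
    unfolding W_add[OF c(3-5)] \<chi>(2)[OF x, symmetric] \<chi>(2)[OF y, symmetric] center_simps(3) .
  qed (use x y c in simp_all)
 next
  have "\<one>$k \<odot>$A \<one>$A = \<one>$A" using ring_hom_one[OF scalar_hom] .
  then show "\<chi> \<one>$(?Z) = \<one>$k" using Z.one_closed by (intro \<chi>I) (simp_all add: center_simps(4))
 qed (rule \<chi>(1))
 have m_eq: "\<mm> = {z \<in> carrier ?Z. \<chi> z = \<zero>$k}"
 proof (intro Set.set_eqI iffI)
  fix z assume "z \<in> \<mm>"
  then have z: "z :. ?Z" "z \<odot>$V v r = \<zero>$V" using v(1)[OF r] by (auto simp: m p annihilator_def)
  have "\<chi> z = \<zero>$k" by (rule \<chi>I[OF z(1)]) (use z(2) W_zero(1)[OF v(1)[OF r]] in simp_all)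
  then show "z \<in> {z \<in> carrier ?Z. \<chi> z = \<zero>$k}" using z(1) by simp
 next
  fix z assume "z \<in> {z \<in> carrier ?Z. \<chi> z = \<zero>$k}"
  then have z: "z :. ?Z" "\<chi> z = \<zero>$k" by simp_all
  have "z \<odot>$V u = \<zero>$V" if "u :. V" for u using Vchi[OF z(1) that] W_zero(1)[OF that] by (simp add: z(2))
  then show "z \<in> \<mm>" using z(1) Zsub(1)[OF z(1)] by (simp add: m p annihilator_def)
 qed
 interpret h: ring_hom_ring ?Z k \<chi> by (rule ring_hom_ringI2[OF Z.ring_axioms k.ring_axioms \<chi>_hom])
 have "maximalideal \<mm> ?Z"
 proof (rule maximalideal_of_inverses[OF Z.cring_axioms])
  have "\<mm> = a_kernel ?Z k \<chi>" unfolding m_eq a_kernel_def' by simp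
  then show "ideal \<mm> ?Z" using h.kernel_is_ideal by simp
  show "\<one>$(?Z) \<notin> \<mm>" unfolding m_eq using h.hom_one k.one_not_zero by simp
  fix x assume x: "x :. ?Z" "x \<notin> \<mm>"
  then have nz: "\<chi> x ~= \<zero>$k" by (simp add: m_eq)
  then have i: "inv\<^bsub>k\<^esub> (\<chi> x) :. k" "inv\<^bsub>k\<^esub> (\<chi> x) \<otimes>$k \<chi> x = \<one>$k"
   using k.field_Units \<chi>(1)[OF x(1)] by simp_all
  let ?y = "inv\<^bsub>k\<^esub> (\<chi> x) \<odot>$A \<one>$A"
  have y: "?y :. ?Z" "\<chi> ?y = inv\<^bsub>k\<^esub> (\<chi> x)" using sZ[OF i(1)] \<chi>I[OF sZ[OF i(1)] i(1)] by simp_all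
  have "\<chi> (\<one>$(?Z) \<ominus>$(?Z) ?y \<otimes>$(?Z) x) = \<zero>$k"
   unfolding a_minus_def using x(1) y i k.r_neg[OF k.one_closed] by simp
  then show "\<exists>y\<in>carrier ?Z. \<one>$(?Z) \<ominus>$(?Z) y \<otimes>$(?Z) x \<in> \<mm>"
   unfolding m_eq using x(1) y(1) by (intro bexI[of _ ?y]) simp_all
 qed
 then have max: "\<mm> \<in> Max_spec ?Z" by (simp add: Max_spec_def)
 have zero_scal: "z = \<zero>$A" if "scal z \<zero>$B" for z by (rule scal_unique[OF that scal_ops(5)])
 interpret M: morita_point k A \<mm> \<chi> V D e a b t r "v r"
 proof (intro morita_point.intro residue_point.intro residue_point_axioms.intro morita_point_axioms.intro)
  show "field k" "ring A" by (rule k.field_axioms, rule A.ring_axioms)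
  show "(%c. c \<odot>$A \<one>$A) \<in> ring_hom k A" by (rule scalar_hom)
  show "c \<odot>$A x = (c \<odot>$A \<one>$A) ** x" if "c :. k" "x :. A" for c x by (rule scalar_mult[OF that])
  show "(c \<odot>$A \<one>$A) ** x = x ** (c \<odot>$A \<one>$A)" if "c :. k" "x :. A" for c x by (rule scalar_central[OF that])
  show "\<chi> \<in> ring_hom ?Z k" by (rule \<chi>_hom)
  show "\<chi> (c \<odot>$A \<one>$A) = c" if "c :. k" for c by (rule \<chi>I[OF sZ[OF that] that HOL.refl])
  show "\<mm> = {z \<in> carrier ?Z. \<chi> z = \<zero>$k}" by (rule m_eq)
  show "left_module A V" by (rule V.V.left_module_axioms)
  show "z \<odot>$V u = (\<chi> z \<odot>$A \<one>$A) \<odot>$V u" if "z :. ?Z" "u :. V" for z u by (rule Vchi[OF that])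
  show "x = \<zero>$A" if z: "z :. ?Z" "z \<notin> \<mm>" and x: "x :. A" "z ** x = \<zero>$A" for z x
  proof (rule entry_eqI[OF x(1) A.zero_closed])
   fix i j assume ij: "i \<in> D" "j \<in> D"
   have "\<tau> z (r, r) ~= \<zero>$B"
   proof
    assume "\<tau> z (r, r) = \<zero>$B"
    then have "z = \<zero>$(?Z)" using zero_scal center[OF z(1)] by (simp add: center_simps(5))
    then show False using z(2) h.hom_zero Z.zero_closed by (simp add: m_eq)
   qed
   moreover have "\<tau> z (r, r) \<otimes>$B \<tau> x (i, j) = \<zero>$B"
    using scal_mult_entry(1)[OF center[OF z(1)] x(1) ij] ij by (simp add: x(2) entry_zero)
   ultimately have "\<tau> x (i, j) = \<zero>$B"
    using B.integral[of "\<tau> z (r, r)" "\<tau> x (i, j)"] Zsub(1)[OF z(1)] x(1) r ij by simp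
   then show "\<tau> x (i, j) = \<tau> \<zero>$A (i, j)" using ij by (simp add: entry_zero)
  qed
  show "finite D" "r \<in> D" "(\<Oplus>$A i\<in>D. e i) = \<one>$A" by (rule pre(3), rule r, rule sum_e)
  show "v r :. V" "v r ~= \<zero>$V" "e r \<odot>$V v r = v r" by (rule v(1)[OF r], rule v(2)[OF r], rule ev[OF r])
  show "noetherian_free_modules A" by (rule noeth)
  show "\<exists>c\<in>carrier A. u = c \<odot>$V v r" if "u :. V" for u by (rule cyc[OF r that])
  show "\<exists>c\<in>carrier k. u = (c \<odot>$A \<one>$A) \<odot>$V v r" if "u :. V" "e r \<odot>$V u = u" for u
   by (rule V.vertex_line[OF r v(1)[OF r] v(2)[OF r] ev[OF r] that])
  show "\<exists>z\<in>carrier ?Z. c = z ** e r" if c: "c :. A" "e r ** c ** e r = c" for c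
  proof -
   obtain z where z: "scal z (\<tau> c (r, r))" using scal_exists[OF c(1) r] by blast
   show ?thesis using corner_scalar[OF c(1) r z] c(2) scal_center[OF z] by (intro bexI[of _ z]) simp_all
  qed
  fix i assume i: "i \<in> D"
  show "e i :. A" "e i ** e i = e i" using e_A[OF i] e_mult[OF i i] by simp_all
  show "a i :. A" "e i ** a i = a i" "a i ** e r = a i" "b i :. A" "e r ** b i = b i"
   "b i ** a i = t i ** e r" "a i ** b i = t i ** e i" using M[OF i] by simp_all
  have tZ: "t i :. ?Z" "t i \<odot>$V v r = v r" using M[OF i] by simp_all
  have "\<chi> (t i) = \<one>$k"
   by (rule \<chi>I[OF tZ(1)]) (use tZ(2) ring_hom_one[OF scalar_hom] v(1)[OF r] in simp_all)
  then show "t i \<in> carrier ?Z - \<mm>" using tZ(1) k.one_not_zero by (simp add: m_eq)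
 qed
 show ?thesis unfolding p by (intro conjI max M.pd_chain)
qed

end

section \<open>Path algebras\<close>

locale quiver =
 k: field k + Q: fin_digraph Q for k :: "('k, 's) ring_scheme" and Q :: "('v, 'e) pre_digraph"
begin

abbreviation PA where "PA \<equiv> path_algebra k Q"
abbreviation pe where "pe \<equiv> path_elem k"

lemma path_iff: "(u, p) \<in> quiver_paths Q \<longleftrightarrow> (\<exists>v. Q.awalk u p v)"
 by (simp add: quiver_paths_def)

lemma PA_simps: "carrier PA = {f. (\<forall>x. f x :. k) & (\<forall>x. x \<notin> quiver_paths Q \<longrightarrow> f x = \<zero>$k) & finite {x. f x ~= \<zero>$k}}"
  "\<zero>$PA = (%_. \<zero>$k)" "f \<oplus>$PA g = (%x. f x \<oplus>$k g x)" "c \<odot>$PA f = (%x. c \<otimes>$k f x)"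
  "(f \<otimes>$PA g) (u, p) = (\<Oplus>$k i\<in>{..length p}. f (last (Q.awalk_verts u (take i p)), drop i p) \<otimes>$k g (u, take i p))"
 by (simp_all add: path_algebra_def)

lemma path_elem_closed: "x \<in> quiver_paths Q ==> pe x :. PA"
 by (auto simp: PA_simps path_elem_def)

lemma smult_closed: "c :. k ==> f :. PA ==> c \<odot>$PA f :. PA"
 unfolding PA_simps by (auto intro: rev_finite_subset)

lemma smult_mult:
 assumes "c :. k" "f :. PA" "g :. PA"
 shows "(c \<odot>$PA f) \<otimes>$PA g = c \<odot>$PA (f \<otimes>$PA g)" "f \<otimes>$PA (c \<odot>$PA g) = c \<odot>$PA (f \<otimes>$PA g)"
proof -
 have c: "f x :. k" "g x :. k" for x using assms(2,3) unfolding PA_simps by blast+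
 have "((c \<odot>$PA f) \<otimes>$PA g) (u, p) = (c \<odot>$PA (f \<otimes>$PA g)) (u, p) &
   (f \<otimes>$PA (c \<odot>$PA g)) (u, p) = (c \<odot>$PA (f \<otimes>$PA g)) (u, p)" for u p
 proof -
  have 1: "(c \<odot>$PA (f \<otimes>$PA g)) (u, p) = c \<otimes>$k (f \<otimes>$PA g) (u, p)" by (simp only: PA_simps(4))
  show ?thesis unfolding 1 unfolding PA_simps(4,5)
   using assms(1) c by (simp add: k.finsum_rdistr k.m_assoc k.m_lcomm)
 qed
 then show "(c \<odot>$PA f) \<otimes>$PA g = c \<odot>$PA (f \<otimes>$PA g)" "f \<otimes>$PA (c \<odot>$PA g) = c \<odot>$PA (f \<otimes>$PA g)"
  by (auto simp: fun_eq_iff)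
qed

lemma path_mult:
 assumes p: "Q.awalk u p v" and q: "Q.awalk v q w"
 shows "pe (v, q) \<otimes>$PA pe (u, p) = pe (u, p @ q)"
proof (rule HOL.ext, clarify)
 fix u' p'
 have last: "last (Q.awalk_verts u p) = v" using p by auto
 show "(pe (v, q) \<otimes>$PA pe (u, p)) (u', p') = pe (u, p @ q) (u', p')"
 proof (cases "u' = u & p' = p @ q")
  case True
  have "(pe (v, q) \<otimes>$PA pe (u, p)) (u', p') = (\<Oplus>$k i\<in>{..length p'}. if length p = i then \<one>$k else \<zero>$k)"
   unfolding PA_simps(5)
  proof (rule k.finsum_cong'[OF HOL.refl])
   fix i assume i: "i \<in> {..length p'}"
   have "take i p' = p \<longleftrightarrow> length p = i" using True i by (metis append_eq_conv_conj atMost_iff length_take min.absorb2)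
   then show "pe (v, q) (last (Q.awalk_verts u' (take i p')), drop i p') \<otimes>$k pe (u, p) (u', take i p') =
     (if length p = i then \<one>$k else \<zero>$k)"
    using True last by (auto simp: path_elem_def)
  qed simp
  also have "... = \<one>$k" by (rule k.add.finprod_singleton) (use True in auto)
  finally show ?thesis using True by (simp add: path_elem_def)
 next
  case False
  have "(pe (v, q) \<otimes>$PA pe (u, p)) (u', p') = (\<Oplus>$k i\<in>{..length p'}. \<zero>$k)"
   unfolding PA_simps(5)
  proof (rule k.finsum_cong'[OF HOL.refl])
   fix i
   have "\<not> (drop i p' = q & u' = u & take i p' = p)" using False append_take_drop_id by metis
   then show "pe (v, q) (last (Q.awalk_verts u' (take i p')), drop i p') \<otimes>$k pe (u, p) (u', take i p') = \<zero>$k"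
    by (auto simp: path_elem_def)
  qed simp
  then show ?thesis using False by (auto simp: path_elem_def)
 qed
qed

text \<open>
  Induction on the size of the support.
\<close>

lemma path_span:
 assumes zero: "\<zero>$PA \<in> N"
  and step: "!!c x f. [|c :. k; x \<in> quiver_paths Q; f :. PA; f \<in> N|] ==> (c \<odot>$PA pe x) \<oplus>$PA f \<in> N"
  and f: "f :. PA"
 shows "f \<in> N"
 using f
proof (induct "card {x. f x ~= \<zero>$k}" arbitrary: f)
 case 0
 then have "f = \<zero>$PA" by (auto simp: PA_simps)
 then show ?case using zero by simp
next
 case (Suc n f)
 have fin: "finite {x. f x ~= \<zero>$k}" and fk: "f y :. k" for y using Suc(3) unfolding PA_simps by blast+
 obtain x where x: "f x ~= \<zero>$k" using Suc(2) by (metis (mono_tags, lifting) card.empty empty_Collect_eq nat.distinct(1))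
 let ?g = "f(x := \<zero>$k)"
 have xq: "x \<in> quiver_paths Q" using x Suc(3) unfolding PA_simps by blast
 have s: "{y. ?g y ~= \<zero>$k} = {y. f y ~= \<zero>$k} - {x}" by auto
 have g: "?g :. PA" using Suc(3) fin unfolding PA_simps mem_Collect_eq s by auto
 have "n = card {y. ?g y ~= \<zero>$k}" using Suc(2) x fin unfolding s by simp
 then have "?g \<in> N" by (rule Suc(1)[OF _ g])
 then have "(f x \<odot>$PA pe x) \<oplus>$PA ?g \<in> N" by (rule step[OF fk xq g])
 moreover have "(f x \<odot>$PA pe x) \<oplus>$PA ?g = f" using fk by (auto simp: PA_simps path_elem_def fun_eq_iff)
 ultimately show ?case by simp
qed

end

section \<open>Quiver algebras\<close>

locale quiver_ideal = quiver k Q + I: ideal I "path_algebra k Q"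
 for k :: "('k, 's) ring_scheme" and Q :: "('v, 'e) pre_digraph" and I
begin

abbreviation A where "A \<equiv> quiver_algebra k Q I"
abbreviation \<pi> where "\<pi> f \<equiv> I +>$PA f"
abbreviation P where "P x \<equiv> \<pi> (pe x)"

lemma A_simps: "carrier A = carrier (PA Quot I)" "monoid.mult A = monoid.mult (PA Quot I)" "add A = add (PA Quot I)"
  "\<one>$A = \<one>$(PA Quot I)" "\<zero>$A = \<zero>$(PA Quot I)" "c \<odot>$A x = \<pi> (c \<odot>$PA \<one>$PA) \<otimes>$(PA Quot I) x"
 by (simp_all add: quiver_algebra_def quot_algebra_def ring_as_module_def)

sublocale A: ring A
 by (rule ring_image(1)[OF I.quotient_is_ring, where f = "%x. x"]) (simp_all only: A_simps image_ident)

lemma \<pi>_hom: "\<pi> \<in> ring_hom PA A"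
 using I.rcos_ring_hom unfolding ring_hom_def A_simps .

sublocale \<pi>: ring_hom_ring PA A \<pi>
 by (rule ring_hom_ringI2[OF I.ring_axioms A.ring_axioms \<pi>_hom])

lemma A_carrier: "carrier A = \<pi> ` carrier PA"
 unfolding A_simps FactRing_def partial_object.simps A_RCOSETS_def' by (rule UNION_singleton_eq_range)

lemma scalar_PA: "(%c. c \<odot>$PA \<one>$PA) \<in> ring_hom k PA"
proof (rule ring_hom_memI)
 have one: "\<one>$PA x :. k" for x using I.one_closed unfolding PA_simps by blast
 fix c d assume c: "c :. k" and d: "d :. k"
 have "(c \<odot>$PA \<one>$PA) \<otimes>$PA (d \<odot>$PA \<one>$PA) = c \<odot>$PA (d \<odot>$PA \<one>$PA)"
  using c d smult_closed[OF d I.one_closed] by (simp add: smult_mult(1))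
 then show "(c \<otimes>$k d) \<odot>$PA \<one>$PA = (c \<odot>$PA \<one>$PA) \<otimes>$PA (d \<odot>$PA \<one>$PA)"
  using c d one by (simp add: PA_simps(4) k.m_assoc)
 show "(c \<oplus>$k d) \<odot>$PA \<one>$PA = c \<odot>$PA \<one>$PA \<oplus>$PA d \<odot>$PA \<one>$PA"
  using c d one by (simp add: PA_simps(3,4) k.l_distr)
next
 have one: "\<one>$PA x :. k" for x using I.one_closed unfolding PA_simps by blast
 show "\<one>$k \<odot>$PA \<one>$PA = \<one>$PA" unfolding PA_simps(4) using one by (simp add: fun_eq_iff)
qed (rule smult_closed[OF _ I.one_closed])

lemma scalar_smult: "c :. k ==> f :. PA ==> (c \<odot>$PA \<one>$PA) \<otimes>$PA f = c \<odot>$PA f"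
  "c :. k ==> f :. PA ==> f \<otimes>$PA (c \<odot>$PA \<one>$PA) = c \<odot>$PA f"
 using smult_mult[of c "\<one>$PA" f] smult_mult[of c f "\<one>$PA"] by simp_all

lemma scalar_A: "c :. k ==> c \<odot>$A \<one>$A = \<pi> (c \<odot>$PA \<one>$PA)"
 using A.r_one[OF \<pi>.hom_closed[OF smult_closed[OF _ I.one_closed]]] unfolding A_simps(2,4,6) .

lemma scalar_hom: "(%c. c \<odot>$A \<one>$A) \<in> ring_hom k A"
proof -
 note h = ring_hom_trans[OF scalar_PA \<pi>_hom]
 show ?thesis
  by (rule ring_hom_memI)
   (use ring_hom_closed[OF h] ring_hom_mult[OF h] ring_hom_add[OF h] ring_hom_one[OF h] in \<open>simp_all add: scalar_A\<close>)
qed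

lemma scalar_mult: "c :. k ==> c \<odot>$A a = (c \<odot>$A \<one>$A) \<otimes>$A a"
 by (simp only: scalar_A) (simp only: A_simps)

lemma scalar_central: "c :. k ==> a :. A ==> (c \<odot>$A \<one>$A) \<otimes>$A a = a \<otimes>$A (c \<odot>$A \<one>$A)"
proof -
 assume c: "c :. k" and "a :. A"
 then obtain f where f: "f :. PA" "a = \<pi> f" unfolding A_carrier by blast
 note s = smult_closed[OF c I.one_closed]
 show ?thesis
  unfolding scalar_A[OF c] f(2) \<pi>.hom_mult[OF s f(1), symmetric] \<pi>.hom_mult[OF f(1) s, symmetric] scalar_smult[OF c f(1)] ..
qed

lemma P_closed: "Q.awalk u p v ==> P (u, p) :. A"
 by (rule \<pi>.hom_closed[OF path_elem_closed]) (use path_iff in blast)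

lemma P_mult: "Q.awalk u p v ==> Q.awalk v q w ==> P (v, q) \<otimes>$A P (u, p) = P (u, p @ q)"
 using \<pi>.hom_mult[OF path_elem_closed path_elem_closed, of "(v, q)" "(u, p)"] path_mult path_iff by metis

text \<open>
  A path longer than the number of vertices contains a cycle \<open>c\<close> of bounded length. In \<open>A\<close> the cycle is
  \<open>\<zeta> e\<^sub>w\<close> for a central element \<open>\<zeta>\<close>, so it can be taken out of the path as a factor. Thus finitely many short
  paths generate \<open>A\<close> over the finitely many central elements \<open>\<zeta>\<close>.
\<close>

theorem noetherian_quiver_algebra:
 fixes B :: "('k, 'b) module"
 assumes "corner_impression k A B (verts Q) \<tau> (vertex_idem k Q I)"
 shows "noetherian_free_modules A"
proof -
 interpret C: corner_impression k A B "verts Q" \<tau> "vertex_idem k Q I" by fact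
 have e: "vertex_idem k Q I = (%i. P (i, []))" by (simp add: vertex_idem_def fun_eq_iff)
 let ?n = "card (verts Q)"
 define short where "short = {(u, p). (\<exists>v. Q.awalk u p v) & length p \<le> ?n}"
 define cyc where "cyc = {(w, c). Q.awalk w c w & length c \<le> ?n}"
 have "short \<subseteq> verts Q \<times> {p. set p \<subseteq> arcs Q & length p \<le> ?n}" by (auto simp: short_def elim: Q.awalkE')
 then have fin: "finite short"
  by (rule finite_subset) (intro finite_cartesian_product Q.finite_verts finite_lists_length_le Q.finite_arcs)
 have fin': "finite cyc" by (rule finite_subset[OF _ fin]) (auto simp: short_def cyc_def)
 have "\<forall>x\<in>cyc. \<exists>z. (\<exists>f. C.scal z f) & P x = z \<otimes>$A P (fst x, [])"
 proof
  fix x assume "x \<in> cyc"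
  then obtain w c where x: "x = (w, c)" and c: "Q.awalk w c w" by (auto simp: cyc_def)
  have w: "w \<in> verts Q" "Q.awalk w [] w" using c by (auto simp: Q.awalk_Nil_iff)
  obtain z where z: "C.scal z (\<tau> (P (w, c)) (w, w))" using C.scal_exists[OF P_closed[OF c] w(1)] by blast
  have "P (w, []) \<otimes>$A P (w, c) \<otimes>$A P (w, []) = z \<otimes>$A P (w, [])"
   using C.corner_scalar[OF P_closed[OF c] w(1) z] unfolding e .
  then have "P x = z \<otimes>$A P (fst x, [])"
   unfolding P_mult[OF c w(2)] using P_mult[OF w(2) c] by (simp add: x)
  then show "\<exists>z. (\<exists>f. C.scal z f) & P x = z \<otimes>$A P (fst x, [])" using z by blast
 qed
 from bchoice[OF this] obtain \<zeta> where \<zeta>: "\<forall>x\<in>cyc. (\<exists>f. C.scal (\<zeta> x) f) & P x = \<zeta> x \<otimes>$A P (fst x, [])" by blast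
 have \<zeta>A: "\<zeta> x :. A" if "x \<in> cyc" for x using \<zeta> that by (auto simp: C.scal_def)
 have \<zeta>c: "\<zeta> x \<otimes>$A a = a \<otimes>$A \<zeta> x" if x: "x \<in> cyc" and a: "a :. A" for x a
 proof -
  obtain f where "C.scal (\<zeta> x) f" using \<zeta> x by blast
  then show ?thesis using a by (rule C.scal_central)
 qed
 let ?\<kappa> = "(%c. c \<odot>$A \<one>$A) ` carrier k"
 interpret s: ring_hom_ring k A "%c. c \<odot>$A \<one>$A" by (rule ring_hom_ringI2[OF k.ring_axioms A.ring_axioms scalar_hom])
 show ?thesis
 proof (rule noetherian_free_modules_of_central_generators[OF A.ring_axioms, of ?\<kappa> "\<zeta> ` cyc" "P ` short"])
  show "?\<kappa> \<subseteq> carrier A" using s.hom_closed by blast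
  show "\<one>$A \<in> ?\<kappa>" using s.hom_one by (intro image_eqI[of _ _ "\<one>$k"]) simp_all
  fix x y assume "x \<in> ?\<kappa>" "y \<in> ?\<kappa>"
  then obtain c d where c: "c :. k" "x = c \<odot>$A \<one>$A" and d: "d :. k" "y = d \<odot>$A \<one>$A" by blast
  have "x \<ominus>$A y = (c \<ominus>$k d) \<odot>$A \<one>$A" unfolding a_minus_def c(2) d(2) using c(1) d(1) s.hom_add s.hom_a_inv by simp
  then show "x \<ominus>$A y \<in> ?\<kappa>" using c(1) d(1) by (intro image_eqI[of _ _ "c \<ominus>$k d"]) simp_all
  show "x \<otimes>$A y \<in> ?\<kappa>" unfolding c(2) d(2) using c(1) d(1) s.hom_mult[OF c(1) d(1)] by (intro image_eqI[of _ _ "c \<otimes>$k d"]) simp_all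
 next
  fix x assume "x \<in> ?\<kappa>"
  then obtain c where c: "c :. k" "x = c \<odot>$A \<one>$A" by blast
  show "x = \<zero>$A \<or> (\<exists>d\<in>?\<kappa>. d \<otimes>$A x = \<one>$A)"
  proof (cases "c = \<zero>$k")
   case True
   then show ?thesis using s.hom_zero c(2) by simp
  next
   case False
   then have i: "inv\<^bsub>k\<^esub> c :. k" "inv\<^bsub>k\<^esub> c \<otimes>$k c = \<one>$k" using k.field_Units c(1) by simp_all
   have "(inv\<^bsub>k\<^esub> c \<odot>$A \<one>$A) \<otimes>$A x = \<one>$A" using s.hom_mult[OF i(1) c(1)] s.hom_one unfolding i(2) c(2) by simp
   then show ?thesis using i(1) by blast
  qed
 next
  show "finite (\<zeta> ` cyc)" "finite (P ` short)" using fin fin' by simp_all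
  show "\<zeta> ` cyc \<subseteq> carrier A" using \<zeta>A by blast
  show "P ` short \<subseteq> carrier A" using P_closed by (auto simp: short_def)
  fix s a assume "s \<in> \<zeta> ` cyc" "a \<in> ?\<kappa> \<union> \<zeta> ` cyc"
  then show "s \<otimes>$A a = a \<otimes>$A s" using \<zeta>c \<zeta>A s.hom_closed by blast
 next
  fix N assume N: "N \<subseteq> carrier A" "P ` short \<subseteq> N" "\<zero>$A \<in> N"
   and minus: "!!x y. x \<in> N ==> y \<in> N ==> x \<ominus>$A y \<in> N"
   and mult: "!!s x. s \<in> ?\<kappa> \<union> \<zeta> ` cyc ==> x \<in> N ==> s \<otimes>$A x \<in> N"
  have path: "P (u, p) \<in> N" if "Q.awalk u p v" for u p v
   using that
  proof (induct "length p" arbitrary: p rule: less_induct)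
   case less
   show ?case
   proof (cases "length p \<le> ?n")
    case True
    then show ?thesis using less(2) N(2) by (auto simp: short_def)
   next
    case False
    let ?p = "take ?n p" and ?p' = "drop ?n p"
    have "Q.awalk u (?p @ ?p') v" using less(2) by simp
    then obtain v1 where p1: "Q.awalk u ?p v1" "Q.awalk v1 ?p' v" unfolding Q.awalk_append_iff by blast
    have "\<not> distinct (Q.awalk_verts u ?p)"
    proof
     assume "distinct (Q.awalk_verts u ?p)"
     then have "card (set (Q.awalk_verts u ?p)) = Suc ?n"
      using False by (simp add: distinct_card Q.length_awalk_verts)
     moreover have "card (set (Q.awalk_verts u ?p)) \<le> ?n"
      by (rule card_mono[OF Q.finite_verts]) (use p1(1) in auto)
     ultimately show False by simp
    qed
    then obtain q c s w where dec: "?p = q @ c @ s" "0 < length c" "Q.awalk u q w" "Q.awalk w c w" "Q.awalk w s v1"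
     using Q.awalk_not_distinct_decomp[OF p1(1)] by blast
    have p: "p = q @ c @ s @ ?p'" using dec(1) by (metis append.assoc append_take_drop_id)
    have tail: "Q.awalk w (s @ ?p') v" using dec(5) p1(2) by auto
    have "length c \<le> ?n" using arg_cong[OF dec(1), of length] by simp
    then have c: "(w, c) \<in> cyc" using dec(4) by (simp add: cyc_def)
    have w: "Q.awalk w [] w" using dec(4) by (auto simp: Q.awalk_Nil_iff)
    note A = \<zeta>A[OF c] P_closed[OF w] P_closed[OF dec(3)] P_closed[OF tail]
    have "Q.awalk u (q @ c) w" using dec(3,4) by auto
    then have "P (u, p) = P (w, s @ ?p') \<otimes>$A P (u, q @ c)" using P_mult[OF _ tail] p by simp
    also have "P (u, q @ c) = P (w, c) \<otimes>$A P (u, q)" using P_mult[OF dec(3,4)] by simp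
    also have "P (w, c) = \<zeta> (w, c) \<otimes>$A P (w, [])" using \<zeta> c by auto
    also have "\<zeta> (w, c) \<otimes>$A P (w, []) \<otimes>$A P (u, q) = \<zeta> (w, c) \<otimes>$A P (u, q)"
     using P_mult[OF dec(3) w] A.m_assoc[OF A(1-3)] by simp
    also have "P (w, s @ ?p') \<otimes>$A (\<zeta> (w, c) \<otimes>$A P (u, q)) = \<zeta> (w, c) \<otimes>$A (P (w, s @ ?p') \<otimes>$A P (u, q))"
     using A.m_assoc[OF A(4,1,3)] A.m_assoc[OF A(1,4,3)] \<zeta>c[OF c A(4)] by simp
    also have "P (w, s @ ?p') \<otimes>$A P (u, q) = P (u, q @ s @ ?p')" by (rule P_mult[OF dec(3) tail])
    finally have Pp: "P (u, p) = \<zeta> (w, c) \<otimes>$A P (u, q @ s @ ?p')" .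
    have "P (u, q @ s @ ?p') \<in> N"
    proof (rule less(1))
     show "length (q @ s @ ?p') < length p" using arg_cong[OF p, of length] dec(2) unfolding length_append by linarith
     show "Q.awalk u (q @ s @ ?p') v" using dec(3) tail by auto
    qed
    then show ?thesis unfolding Pp using c by (intro mult) auto
   qed
  qed
  have "\<pi> f \<in> N" if f: "f :. PA" for f
  proof -
   have "f \<in> {f. \<pi> f \<in> N}"
   proof (rule path_span[OF _ _ f]; unfold mem_Collect_eq)
    show "\<pi> \<zero>$PA \<in> N" using N(3) \<pi>.hom_zero by simp
    fix c x g assume c: "c :. k" and x: "x \<in> quiver_paths Q" and g: "g :. PA" "\<pi> g \<in> N"
    have "P x \<in> N" using x path path_iff by (cases x) blast
    then have "(c \<odot>$A \<one>$A) \<otimes>$A P x \<in> N" using c by (intro mult) auto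
    moreover have "(c \<odot>$A \<one>$A) \<otimes>$A P x = \<pi> (c \<odot>$PA pe x)"
     unfolding scalar_A[OF c] \<pi>.hom_mult[OF smult_closed[OF c I.one_closed] path_elem_closed[OF x], symmetric]
      scalar_smult(1)[OF c path_elem_closed[OF x]] ..
    ultimately have cx: "\<pi> (c \<odot>$PA pe x) \<in> N" by simp
    have "\<pi> (c \<odot>$PA pe x) \<oplus>$A \<pi> g = \<pi> (c \<odot>$PA pe x) \<ominus>$A (\<zero>$A \<ominus>$A \<pi> g)"
     using cx g N(1) by (simp add: a_minus_def subset_iff)
    then show "\<pi> ((c \<odot>$PA pe x) \<oplus>$PA g) \<in> N"
     using minus[OF cx minus[OF N(3) g(2)]] \<pi>.hom_add[OF smult_closed[OF c path_elem_closed[OF x]] g(1)] by simp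
   qed
   then show ?thesis by simp
  qed
  then show "N = carrier A" using N(1) unfolding A_carrier by blast
 qed
qed

end

theorem theorem2p16:
  fixes k :: "('k, 's) ring_scheme"
    and Q :: "('v, 'e) pre_digraph"
    and I :: "('v \<times> 'e list \<Rightarrow> 'k) set"
    and A Z :: "('k, ('v \<times> 'e list \<Rightarrow> 'k) set) module"
    and B :: "('k, 'b) module"
    and \<tau> :: "('v \<times> 'e list \<Rightarrow> 'k) set \<Rightarrow> 'v \<times> 'v \<Rightarrow> 'b"
    and V :: "(('v \<times> 'e list \<Rightarrow> 'k) set, 'm) module"
    and \<pp> \<mm> :: "('v \<times> 'e list \<Rightarrow> 'k) set set"
  assumes "algebraically_closed k"
    and "\<And>n::nat. n > 0 \<Longrightarrow> [n] \<cdot>\<^bsub>k\<^esub> \<one>\<^bsub>k\<^esub> \<noteq> \<zero>\<^bsub>k\<^esub>"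
    and "fin_digraph Q"
    and "ideal I (path_algebra k Q)"
    and "A = quiver_algebra k Q I"
    and "Z = center_algebra A"
    and "impression k A (verts Q) \<tau> B"
    and "domain B"
    and "\<And>i. i \<in> verts Q \<Longrightarrow> \<tau> (vertex_idem k Q I i) = mat_entry B (verts Q) i i \<one>\<^bsub>B\<^esub>"
    and "\<And>i j. \<lbrakk>i \<in> verts Q; j \<in> verts Q\<rbrakk> \<Longrightarrow>
           tau_bar B (verts Q) \<tau> i i ` corner A (vertex_idem k Q I i) (vertex_idem k Q I i) =
           tau_bar B (verts Q) \<tau> j j ` corner A (vertex_idem k Q I j) (vertex_idem k Q I j)"
    and "large_module k A V"
    and "\<pp> = annihilator A V"
    and "\<mm> = \<pp> \<inter> carrier Z"
  shows "\<mm> \<in> Max_spec Z \<and>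
         pd A V = pd (algebra_loc A \<mm>) (module_loc k A \<mm> V) \<and>
         pd (algebra_loc A \<mm>) (module_loc k A \<mm> V) = pd A (quot_module A \<pp>) \<and>
         pd A (quot_module A \<pp>) =
           pd (algebra_loc A \<mm>) (quot_module (algebra_loc A \<mm>) (ideal_loc A \<mm> \<pp>)) \<and>
         pd (algebra_loc A \<mm>) (quot_module (algebra_loc A \<mm>) (ideal_loc A \<mm> \<pp>)) =
           pd (center_loc A \<mm>) (quot_module (center_loc A \<mm>) (center_loc_ideal A \<mm>))"
proof -
 interpret k: algebraically_closed k by fact
 interpret q: quiver_ideal k Q I
  by (intro quiver_ideal.intro quiver.intro k.field_axioms assms(3,4))
 interpret B: domain B by fact
 have C: "corner_impression k A B (verts Q) \<tau> (vertex_idem k Q I)"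
 proof (intro corner_impression.intro corner_impression_axioms.intro; (unfold assms(5))?)
  show "algebraically_closed k" "domain B" by fact+
  show "ring q.A" by (rule q.A.ring_axioms)
  show "impression k q.A (verts Q) \<tau> B" using assms(7) unfolding assms(5) .
  show "(%c. c \<odot>$(q.A) \<one>$(q.A)) \<in> ring_hom k q.A" by (rule q.scalar_hom)
  show "c \<odot>$(q.A) a = (c \<odot>$(q.A) \<one>$(q.A)) \<otimes>$(q.A) a" if "c :. k" for c a
   by (rule q.scalar_mult[OF that])
  show "(c \<odot>$(q.A) \<one>$(q.A)) \<otimes>$(q.A) a = a \<otimes>$(q.A) (c \<odot>$(q.A) \<one>$(q.A))"
   if "c :. k" "a :. q.A" for c a by (rule q.scalar_central[OF that])
  show "vertex_idem k Q I i :. q.A" if "i \<in> verts Q" for i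
   using that q.P_closed[of i "[]" i] by (simp add: vertex_idem_def q.Q.awalk_Nil_iff)
  show "\<tau> (vertex_idem k Q I i) = mat_entry B (verts Q) i i \<one>$B" if "i \<in> verts Q" for i by (rule assms(9)[OF that])
  show "tau_bar B (verts Q) \<tau> i i ` corner q.A (vertex_idem k Q I i) (vertex_idem k Q I i) =
    tau_bar B (verts Q) \<tau> j j ` corner q.A (vertex_idem k Q I j) (vertex_idem k Q I j)"
   if "i \<in> verts Q" "j \<in> verts Q" for i j using assms(10)[OF that] unfolding assms(5) .
 qed
 interpret C: corner_impression k A B "verts Q" \<tau> "vertex_idem k Q I" by (rule C)
 have "noetherian_free_modules A"
  unfolding assms(5) by (rule q.noetherian_quiver_algebra) (use C in \<open>simp only: assms(5)\<close>)
 from C.pd_large_module[OF assms(11) this assms(12) assms(13)[unfolded assms(6)]]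
 show ?thesis unfolding assms(6) .
qed

end
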